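(* Let $(X,\omega)$ be a compact Kähler manifold of complex dimension $n\ge 2$, let $\alpha>0$ be a constant, let $f\ge 0$ be a smooth function on $X$ and let $\mu$ be a smooth real function on $X$ with $\int_X\mu=0$. For $A>0$, call a real function $u$ on $X$ an $A$-solution if it solves $$\sigma_2(g')= \tfrac{n(n-1)}{2}e^{2u}(1-4\alpha e^{-u}|Du|^2)+2\alpha n(n-1)fe^{-u}|Du|^2+n(n-1)f+\tfrac{n(n-1)}{2}e^{-2u}f^2-2n\alpha\mu+2\alpha n(n-1)e^{-u}\big(\Delta f-2\,\mathrm{Re}(g^{j\bar k}f_ju_{\bar k})\big)$$ under the ellipticity condition $$\tilde g_{\bar jk}=(n-1)(e^u+fe^{-u})g_{\bar jk}+2n\alpha\big((\Delta u)g_{\bar jk}-u_{\bar jk}\big)>0$$ and the normalization condition $$\Big(\int_X e^{-\gamma u}\Big)^{1/\gamma}=A .$$ Suppose that for every $0<\delta<1$ there exists $0<A_\delta\ll1$ such that for all $0<A\le A_\delta$, $A$-solutions $u$ satisfy $$e^{-u}|Du|^2\le\delta .$$ Then there exists $0<A_0\ll1$ such that for all $0<A\le A_0$, $A$-solutions $u$ satisfy $$\frac1C\,g\le\tilde g\le C\,g ,$$ where $C$ is a constant depending on $\|u\|_{L^\infty}$, $\|Du\|_{L^\infty}$, $(X,\omega)$, $\|f\|_{C^2}$, $\|\mu\|_{C^2}$, $\alpha$ and $A$.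
   Context: Conventions: $\omega=i\,g_{\bar kj}\,dz^j\wedge d\bar z^k$. Integrals are taken with respect to $\omega^n/n!$. $\Delta u=g^{j\bar k}\partial_j\partial_{\bar k}u$, $|Du|^2=g^{j\bar k}u_ju_{\bar k}$, $u_{\bar jk}=\partial_{\bar j}\partial_ku$. The Hermitian form $g'$ is $g'_{\bar jk}=(e^u+fe^{-u})g_{\bar jk}+2n\alpha u_{\bar jk}$, with eigenvalues $\lambda'_1,\dots,\lambda'_n$ with respect to $g$; $\sigma_2(g')=\sum_{j<k}\lambda'_j\lambda'_k$. The condition $\tilde g>0$ means that the Hermitian form $\tilde g$ is positive definite at every point. The exponent is $\gamma=\frac{4}{\beta-1}=4(n-1)$, with $\beta=\frac n{n-1}$. "$\ll1$" means sufficiently small. *)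

theory Defs
  imports
    "HOL-Analysis.Analysis"
    "HOL-Computational_Algebra.Fundamental_Theorem_Algebra"
begin

section \<open>Calculus on open subsets of complex n-space\<close>

text \<open>On open subsets of a finite-dimensional space the following is the usual class of
  \<open>k\<close> times continuously differentiable maps: all iterated directional derivatives of order
  at most \<open>k\<close> exist and are continuous.\<close>

primrec Ck_on ::
  "nat \<Rightarrow> 'a::euclidean_space set \<Rightarrow> ('a \<Rightarrow> 'b::real_normed_vector) \<Rightarrow> bool" where
  "Ck_on 0 S f \<longleftrightarrow> continuous_on S f"
| "Ck_on (Suc k) S f \<longleftrightarrow>
     (\<forall>x\<in>S. f differentiable (at x)) \<and>
     (\<forall>v. Ck_on k S (\<lambda>x. frechet_derivative f (at x) v))"

definition smooth_on ::
  "'a::euclidean_space set \<Rightarrow> ('a \<Rightarrow> 'b::real_normed_vector) \<Rightarrow> bool" where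
  "smooth_on S f \<longleftrightarrow> (\<forall>k. Ck_on k S f)"

definition holomorphic_map_on ::
  "(complex^'n) set \<Rightarrow> (complex^'n \<Rightarrow> complex^'n) \<Rightarrow> bool" where
  "holomorphic_map_on V h \<longleftrightarrow>
     (\<forall>z\<in>V. \<exists>D. (h has_derivative D) (at z) \<and> (\<forall>a v. D (a *s v) = a *s D v))"

definition dz :: "'n::finite \<Rightarrow> (complex^'n \<Rightarrow> complex) \<Rightarrow> complex^'n \<Rightarrow> complex" where
  "dz j F z = (frechet_derivative F (at z) (axis j 1)
               - \<i> * frechet_derivative F (at z) (axis j \<i>)) / 2"

definition dzbar :: "'n::finite \<Rightarrow> (complex^'n \<Rightarrow> complex) \<Rightarrow> complex^'n \<Rightarrow> complex" where
  "dzbar j F z = (frechet_derivative F (at z) (axis j 1)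
               + \<i> * frechet_derivative F (at z) (axis j \<i>)) / 2"


section \<open>Hermitian forms\<close>

text \<open>A Hermitian form is stored as the matrix \<open>H\<close> with entries \<open>H $ k $ j\<close> equal to
  $H_{\bar k j}$: the first index is the conjugate one.\<close>

definition hermitian :: "complex^'n^'n \<Rightarrow> bool" where
  "hermitian H \<longleftrightarrow> (\<forall>j k. H $ k $ j = cnj (H $ j $ k))"

definition herm_form :: "complex^'n^'n \<Rightarrow> complex^'n \<Rightarrow> real" where
  "herm_form H v = Re (\<Sum>k\<in>UNIV. \<Sum>j\<in>UNIV. H $ k $ j * (v $ j) * cnj (v $ k))"

definition positive_definite :: "complex^'n^'n \<Rightarrow> bool" where
  "positive_definite H \<longleftrightarrow> hermitian H \<and> (\<forall>v. v \<noteq> 0 \<longrightarrow> 0 < herm_form H v)"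

text \<open>The eigenvalues of \<open>H\<close> with respect to \<open>G\<close>, listed with multiplicity, are the roots
  of $\det (t G - H)$. They are real when \<open>H\<close> is Hermitian and \<open>G\<close> is positive definite,
  which is why taking real parts loses nothing.\<close>

definition rel_eigenvalues :: "complex^'n^'n \<Rightarrow> complex^'n^'n \<Rightarrow> real list" where
  "rel_eigenvalues G H =
     sorted_list_of_multiset
       (image_mset Re (proots (det (\<chi> k j. [:- (H $ k $ j), G $ k $ j:]))))"

definition sigma2 :: "complex^'n^'n \<Rightarrow> complex^'n^'n \<Rightarrow> real" where
  "sigma2 G H = (let l = rel_eigenvalues G H in
     \<Sum>k<length l. \<Sum>j<k. l ! j * l ! k)"


section \<open>Compact Kaehler manifolds\<close>

text \<open>The complex dimension is \<open>CARD('n)\<close>. The complex structure is given by a holomorphic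
  atlas, which need not be maximal; a chart is a pair of its domain and its coordinate map, whose
  values outside the domain are irrelevant. Second countability follows from compactness.\<close>

type_synonym ('a, 'n) chart = "'a set \<times> ('a \<Rightarrow> complex^'n)"

definition crange :: "('a, 'n) chart \<Rightarrow> (complex^'n) set" where
  "crange c = snd c ` fst c"

definition cinv :: "('a, 'n) chart \<Rightarrow> complex^'n \<Rightarrow> 'a" where
  "cinv c = inv_into (fst c) (snd c)"

definition is_chart :: "('a::t2_space, 'n::finite) chart \<Rightarrow> bool" where
  "is_chart c \<longleftrightarrow>
     open (fst c) \<and> open (crange c) \<and> homeomorphism (fst c) (crange c) (snd c) (cinv c)"

definition complex_atlas :: "('a::t2_space, 'n::finite) chart set \<Rightarrow> bool" where
  "complex_atlas At \<longleftrightarrow>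
     (\<forall>c\<in>At. is_chart c) \<and> (\<Union>c\<in>At. fst c) = UNIV \<and>
     (\<forall>c\<in>At. \<forall>d\<in>At. holomorphic_map_on (snd c ` (fst c \<inter> fst d)) (snd d \<circ> cinv c))"

text \<open>A metric assigns to every chart \<open>c\<close> the coefficient matrix \<open>G c z\<close> at the point
  with coordinates \<open>z\<close>.\<close>

type_synonym ('a, 'n) metric = "('a, 'n) chart \<Rightarrow> complex^'n \<Rightarrow> complex^'n^'n"

text \<open>The third condition says that the coefficients in different charts define the same form
  $\omega = i g_{\bar k j} dz^j \wedge d\bar z^k$, the fourth one is $d\omega = 0$ in coordinates.\<close>

definition kaehler_metric ::
  "('a::t2_space, 'n::finite) chart set \<Rightarrow> ('a, 'n) metric \<Rightarrow> bool" where
  "kaehler_metric At G \<longleftrightarrow>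
     (\<forall>c\<in>At. \<forall>k j. smooth_on (crange c) (\<lambda>z. G c z $ k $ j)) \<and>
     (\<forall>c\<in>At. \<forall>z\<in>crange c. positive_definite (G c z)) \<and>
     (\<forall>c\<in>At. \<forall>d\<in>At. \<forall>z\<in>snd c ` (fst c \<inter> fst d). \<forall>k j.
        G c z $ k $ j =
          (\<Sum>a\<in>UNIV. \<Sum>b\<in>UNIV. G d (snd d (cinv c z)) $ b $ a
             * dz j (\<lambda>w. snd d (cinv c w) $ a) z
             * cnj (dz k (\<lambda>w. snd d (cinv c w) $ b) z))) \<and>
     (\<forall>c\<in>At. \<forall>z\<in>crange c. \<forall>j k l.
        dz l (\<lambda>w. G c w $ k $ j) z = dz j (\<lambda>w. G c w $ k $ l) z)"

definition compact_kaehler_manifold ::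
  "('a::t2_space, 'n::finite) chart set \<Rightarrow> ('a, 'n) metric \<Rightarrow> bool" where
  "compact_kaehler_manifold At G \<longleftrightarrow>
     compact (UNIV :: 'a set) \<and> complex_atlas At \<and> kaehler_metric At G"

definition smooth_fun :: "('a, 'n::finite) chart set \<Rightarrow> ('a \<Rightarrow> real) \<Rightarrow> bool" where
  "smooth_fun At u \<longleftrightarrow> (\<forall>c\<in>At. smooth_on (crange c) (u \<circ> cinv c))"

text \<open>The measure of $\omega^n/n!$. In a chart
  $\omega^n/n! = \det(g) \prod_j (i\,dz^j\wedge d\bar z^j)$ and
  $i\,dz\wedge d\bar z = 2\,dx\wedge dy$, so its density with respect to Lebesgue measure is
  $2^n \det g$; this determines the Borel measure since countably many charts cover.\<close>

definition volume ::
  "('a::t2_space, 'n::finite) chart set \<Rightarrow> ('a, 'n) metric \<Rightarrow> 'a measure" where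
  "volume At G = (THE m. sets m = sets borel \<and>
     (\<forall>c\<in>At. \<forall>E\<in>sets borel. E \<subseteq> fst c \<longrightarrow>
        emeasure m E =
          (\<integral>\<^sup>+z\<in>snd c ` E. ennreal (2 ^ CARD('n) * Re (det (G c z))) \<partial>lborel)))"


section \<open>Local expressions\<close>

definition loc :: "('a, 'n::finite) chart \<Rightarrow> ('a \<Rightarrow> real) \<Rightarrow> complex^'n \<Rightarrow> complex" where
  "loc c u z = complex_of_real (u (cinv c z))"

text \<open>\<open>ginv G c z $ j $ k\<close> is $g^{j\bar k}$.\<close>

definition ginv :: "('a, 'n::finite) metric \<Rightarrow> ('a, 'n) chart \<Rightarrow> complex^'n \<Rightarrow> complex^'n^'n" where
  "ginv G c z = matrix_inv (G c z)"

text \<open>\<open>hess c u z $ k $ j\<close> is $u_{\bar k j}$.\<close>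

definition hess :: "('a, 'n::finite) chart \<Rightarrow> ('a \<Rightarrow> real) \<Rightarrow> complex^'n \<Rightarrow> complex^'n^'n" where
  "hess c u z = (\<chi> k j. dzbar k (dz j (loc c u)) z)"

definition laplacian ::
  "('a, 'n::finite) metric \<Rightarrow> ('a, 'n) chart \<Rightarrow> ('a \<Rightarrow> real) \<Rightarrow> complex^'n \<Rightarrow> real" where
  "laplacian G c u z =
     Re (\<Sum>j\<in>UNIV. \<Sum>k\<in>UNIV. ginv G c z $ j $ k * dz j (dzbar k (loc c u)) z)"

definition grad_pair ::
  "('a, 'n::finite) metric \<Rightarrow> ('a, 'n) chart \<Rightarrow> ('a \<Rightarrow> real) \<Rightarrow> ('a \<Rightarrow> real)
     \<Rightarrow> complex^'n \<Rightarrow> complex" where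
  "grad_pair G c f u z =
     (\<Sum>j\<in>UNIV. \<Sum>k\<in>UNIV. ginv G c z $ j $ k * dz j (loc c f) z * dzbar k (loc c u) z)"

definition grad_sq ::
  "('a, 'n::finite) metric \<Rightarrow> ('a, 'n) chart \<Rightarrow> ('a \<Rightarrow> real) \<Rightarrow> complex^'n \<Rightarrow> real" where
  "grad_sq G c u z = Re (grad_pair G c u u z)"

text \<open>The (2,0) part of the covariant Hessian,
  $\nabla_j\nabla_k u = u_{jk} - \Gamma^l_{jk} u_l$ with
  $\Gamma^l_{jk} = g^{l\bar m}\partial_j g_{\bar m k}$; the (1,1) part is \<open>hess\<close>.\<close>

definition hess20 ::
  "('a, 'n::finite) metric \<Rightarrow> ('a, 'n) chart \<Rightarrow> ('a \<Rightarrow> real) \<Rightarrow> complex^'n \<Rightarrow> complex^'n^'n" where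
  "hess20 G c u z = (\<chi> j k. dz j (dz k (loc c u)) z
     - (\<Sum>l\<in>UNIV. \<Sum>m\<in>UNIV. ginv G c z $ l $ m * dz j (\<lambda>w. G c w $ m $ k) z * dz l (loc c u) z))"

definition hess_sq ::
  "('a, 'n::finite) metric \<Rightarrow> ('a, 'n) chart \<Rightarrow> ('a \<Rightarrow> real) \<Rightarrow> complex^'n \<Rightarrow> real" where
  "hess_sq G c u z =
     Re (\<Sum>j\<in>UNIV. \<Sum>k\<in>UNIV. \<Sum>a\<in>UNIV. \<Sum>b\<in>UNIV.
           ginv G c z $ j $ a * ginv G c z $ k $ b
             * hess20 G c u z $ j $ k * cnj (hess20 G c u z $ a $ b))
   + Re (\<Sum>j\<in>UNIV. \<Sum>k\<in>UNIV. \<Sum>a\<in>UNIV. \<Sum>b\<in>UNIV.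
           ginv G c z $ j $ b * ginv G c z $ a $ k
             * hess c u z $ k $ j * cnj (hess c u z $ a $ b))"


section \<open>Norms\<close>

definition sup_norm :: "('a \<Rightarrow> real) \<Rightarrow> real" where
  "sup_norm u = (SUP x. \<bar>u x\<bar>)"

definition grad_sup_norm ::
  "('a, 'n::finite) chart set \<Rightarrow> ('a, 'n) metric \<Rightarrow> ('a \<Rightarrow> real) \<Rightarrow> real" where
  "grad_sup_norm At G u = Sup {sqrt (grad_sq G c u z) | c z. c \<in> At \<and> z \<in> crange c}"

definition C2_norm ::
  "('a, 'n::finite) chart set \<Rightarrow> ('a, 'n) metric \<Rightarrow> ('a \<Rightarrow> real) \<Rightarrow> real" where
  "C2_norm At G u = sup_norm u + grad_sup_norm At G u
     + Sup {sqrt (hess_sq G c u z) | c z. c \<in> At \<and> z \<in> crange c}"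


section \<open>The equation\<close>

definition g_prime ::
  "('a, 'n::finite) metric \<Rightarrow> real \<Rightarrow> ('a \<Rightarrow> real) \<Rightarrow> ('a \<Rightarrow> real) \<Rightarrow> ('a, 'n) chart
     \<Rightarrow> complex^'n \<Rightarrow> complex^'n^'n" where
  "g_prime G \<alpha> f u c z = (let n = real CARD('n); x = cinv c z in
     \<chi> j k. complex_of_real (exp (u x) + f x * exp (- u x)) * G c z $ j $ k
            + complex_of_real (2 * n * \<alpha>) * hess c u z $ j $ k)"

definition g_tilde ::
  "('a, 'n::finite) metric \<Rightarrow> real \<Rightarrow> ('a \<Rightarrow> real) \<Rightarrow> ('a \<Rightarrow> real) \<Rightarrow> ('a, 'n) chart
     \<Rightarrow> complex^'n \<Rightarrow> complex^'n^'n" where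
  "g_tilde G \<alpha> f u c z = (let n = real CARD('n); x = cinv c z in
     \<chi> j k. complex_of_real ((n - 1) * (exp (u x) + f x * exp (- u x))) * G c z $ j $ k
            + complex_of_real (2 * n * \<alpha>)
              * (complex_of_real (laplacian G c u z) * G c z $ j $ k - hess c u z $ j $ k))"

definition equation_rhs ::
  "('a, 'n::finite) metric \<Rightarrow> real \<Rightarrow> ('a \<Rightarrow> real) \<Rightarrow> ('a \<Rightarrow> real) \<Rightarrow> ('a \<Rightarrow> real)
     \<Rightarrow> ('a, 'n) chart \<Rightarrow> complex^'n \<Rightarrow> real" where
  "equation_rhs G \<alpha> f \<mu> u c z = (let n = real CARD('n); x = cinv c z in
     n * (n - 1) / 2 * exp (2 * u x) * (1 - 4 * \<alpha> * exp (- u x) * grad_sq G c u z)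
     + 2 * \<alpha> * n * (n - 1) * f x * exp (- u x) * grad_sq G c u z
     + n * (n - 1) * f x
     + n * (n - 1) / 2 * exp (- 2 * u x) * (f x)\<^sup>2
     - 2 * n * \<alpha> * \<mu> x
     + 2 * \<alpha> * n * (n - 1) * exp (- u x)
         * (laplacian G c f z - 2 * Re (grad_pair G c f u z)))"

definition A_solution ::
  "('a::t2_space, 'n::finite) chart set \<Rightarrow> ('a, 'n) metric \<Rightarrow> real
     \<Rightarrow> ('a \<Rightarrow> real) \<Rightarrow> ('a \<Rightarrow> real) \<Rightarrow> real \<Rightarrow> ('a \<Rightarrow> real) \<Rightarrow> bool" where
  "A_solution At G \<alpha> f \<mu> A u \<longleftrightarrow>
     smooth_fun At u \<and>
     (\<forall>c\<in>At. \<forall>z\<in>crange c.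
        sigma2 (G c z) (g_prime G \<alpha> f u c z) = equation_rhs G \<alpha> f \<mu> u c z \<and>
        positive_definite (g_tilde G \<alpha> f u c z)) \<and>
     (let \<gamma> = 4 * (real CARD('n) - 1) in
        (\<integral>x. exp (- \<gamma> * u x) \<partial>volume At G) powr (1 / \<gamma>) = A)"

end

theory Submission
  imports
    Defs
    "HOL-Complex_Analysis.Cauchy_Integral_Formula"
    "HOL-Library.Numeral_Type"
begin

text \<open>Let \<open>S\<close> be the trace of $g'$ and $w = e^{-u}|Du|^2$. The function $e^{-u/2}$ has small gradient
  by hypothesis and a small integral by the normalization, so $e^{-u}$ is uniformly small for small
  \<open>A\<close>. At a maximum point $x_0$ of $S e^{Kw}$ the metric is multiplied by $\lambda = e^{u(x_0)}$; this
  makes \<open>f\<close>, \<open>\<mu>\<close> and the curvature small. In holomorphic normal coordinates diagonalizing $g'$, the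
  equation is differentiated twice. The linearized operator has the eigenvalues $\tau_m$ of
  $\tilde g$ as coefficients; the third order terms have the right sign because $\sigma_2$ is a
  Lorentzian quadratic form, and \<open>w\<close> produces
  $K e^{-u} \sum \tau_m (|u_{jm}|^2 + |u_{j \bar m}|^2)$, which dominates all other terms when \<open>K\<close> is
  large and \<open>w\<close> is small. Hence $S \le C e^{u(x_0)}$ at $x_0$, and \<open>S\<close> is bounded everywhere. Finally
  $\tau_m \le (n-1) S$, while $2\sigma_2 \le \tau_m (2S - \tau_m)$ bounds $\tau_m$ from below, the
  right-hand side of the equation being close to $\frac{n(n-1)}2 e^{2u}$.\<close>

section \<open>Hermitian linear algebra\<close>

text \<open>The obstacle is the third derivatives of u. The twice differentiated right-hand side and
  the second derivatives of w both contain them, but only in two contractions. The plain one, the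
  sum over m of u_{j m mbar}, occurs in the right-hand side. It is a derivative of S up to lower
  order, and the critical point condition DS = -K S Dw controls it at the price of a factor K. The
  one weighted by the eigenvalues of the linearized operator occurs in the derivatives of w. It
  comes from the first derivative of the equation and costs no K. Hence K can be fixed from the
  dimension and \<alpha> alone; the products of K with the size \<theta> of the gradient and of the
  rescaled data are made small afterwards, by the choice of \<theta> and then of A. The rescaling
  also explains why the final constant can be chosen before f and \<mu>: after it, the estimate at
  the maximum involves only the dimension, \<alpha>, K and \<theta>. The data f and \<mu> and the
  geometry decide only how large \<lambda> has to be, that is, how small A has to be.\<close>

definition sesq :: "complex^'n^'n \<Rightarrow> complex^'n \<Rightarrow> complex^'n \<Rightarrow> complex" where
  "sesq H v w = (\<Sum>k\<in>UNIV. \<Sum>j\<in>UNIV. H $ k $ j * (v $ j) * cnj (w $ k))"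

definition adjoint_mat :: "complex^'n^'m \<Rightarrow> complex^'m^'n" where
  "adjoint_mat M = (\<chi> i j. cnj (M $ j $ i))"

definition diag_mat :: "('n \<Rightarrow> real) \<Rightarrow> complex^'n^'n" where
  "diag_mat d = (\<chi> i j. if i = j then complex_of_real (d i) else 0)"

definition diagonalizes ::
  "complex^'n^'n \<Rightarrow> complex^'n^'n \<Rightarrow> complex^'n^'n \<Rightarrow> ('n \<Rightarrow> real) \<Rightarrow> bool" where
  "diagonalizes P G H d \<longleftrightarrow>
     adjoint_mat P ** G ** P = mat 1 \<and> adjoint_mat P ** H ** P = diag_mat d"

lemma herm_form_sesq: "herm_form H v = Re (sesq H v v)"
  by (simp add: herm_form_def sesq_def)

lemma sesq_add_left: "sesq H (v + v') w = sesq H v w + sesq H v' w"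
  by (simp add: sesq_def algebra_simps sum.distrib)

lemma sesq_add_right: "sesq H v (w + w') = sesq H v w + sesq H v w'"
  by (simp add: sesq_def algebra_simps sum.distrib)

lemma sesq_scale_left: "sesq H (a *s v) w = a * sesq H v w"
  by (simp add: sesq_def algebra_simps sum_distrib_left)

lemma sesq_scale_right: "sesq H v (a *s w) = cnj a * sesq H v w"
  by (simp add: sesq_def algebra_simps sum_distrib_left)

lemma sesq_scaleR_left: "sesq H (a *\<^sub>R v) w = of_real a * sesq H v w"
  unfolding sesq_def vector_scaleR_component
  by (simp add: algebra_simps sum_distrib_left scaleR_conv_of_real)

lemma sesq_scaleR_right: "sesq H v (a *\<^sub>R w) = of_real a * sesq H v w"
  unfolding sesq_def vector_scaleR_component
  by (simp add: algebra_simps sum_distrib_left scaleR_conv_of_real)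

lemma sesq_zero [simp]: "sesq H 0 w = 0" "sesq H v 0 = 0"
  by (simp_all add: sesq_def)

lemma sesq_cnj:
  assumes "hermitian H" shows "cnj (sesq H v w) = sesq H w v"
proof -
  have "cnj (sesq H v w) = (\<Sum>k\<in>UNIV. \<Sum>j\<in>UNIV. H $ j $ k * cnj (v $ j) * w $ k)"
    using assms unfolding sesq_def hermitian_def cnj_sum
    by (intro sum.cong refl) (metis complex_cnj_cnj complex_cnj_mult)
  also have "\<dots> = sesq H w v"
    unfolding sesq_def by (subst sum.swap) (intro sum.cong refl; simp)
  finally show ?thesis .
qed

lemma sesq_self_real:
  assumes "hermitian H" shows "sesq H v v = of_real (herm_form H v)"
  using sesq_cnj[OF assms, of v v]
  by (simp add: herm_form_sesq complex_eq_iff)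

lemma continuous_on_sesq_right [continuous_intros]: "continuous_on S (\<lambda>v. sesq H v w)"
  unfolding sesq_def by (intro continuous_intros)

lemma continuous_on_herm_form [continuous_intros]: "continuous_on S (herm_form H)"
  unfolding herm_form_def by (intro continuous_intros)

lemma adjoint_mult: "adjoint_mat (A ** B) = adjoint_mat B ** adjoint_mat A"
  by (simp add: adjoint_mat_def matrix_matrix_mult_def vec_eq_iff mult.commute)

lemma adjoint_adjoint [simp]: "adjoint_mat (adjoint_mat A) = A"
  by (simp add: adjoint_mat_def vec_eq_iff)

lemma adjoint_mat_one [simp]: "adjoint_mat (mat 1) = mat 1"
  by (simp add: adjoint_mat_def vec_eq_iff mat_def)

lemma hermitian_adjoint: "hermitian H \<longleftrightarrow> adjoint_mat H = H"
  unfolding adjoint_mat_def vec_eq_iff hermitian_def vec_lambda_beta by metis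

lemma sum_reverse4:
  "(\<Sum>k\<in>A. \<Sum>j\<in>B. \<Sum>a\<in>C. \<Sum>b\<in>D. f k j a b) = (\<Sum>b\<in>D. \<Sum>a\<in>C. \<Sum>j\<in>B. \<Sum>k\<in>A. f k j a b)"
proof -
  have "(\<Sum>k\<in>A. \<Sum>j\<in>B. \<Sum>a\<in>C. \<Sum>b\<in>D. f k j a b) = (\<Sum>k\<in>A. \<Sum>j\<in>B. \<Sum>b\<in>D. \<Sum>a\<in>C. f k j a b)"
    by (intro sum.cong refl sum.swap)
  also have "\<dots> = (\<Sum>k\<in>A. \<Sum>b\<in>D. \<Sum>j\<in>B. \<Sum>a\<in>C. f k j a b)"
    by (intro sum.cong refl sum.swap)
  also have "\<dots> = (\<Sum>k\<in>A. \<Sum>b\<in>D. \<Sum>a\<in>C. \<Sum>j\<in>B. f k j a b)"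
    by (intro sum.cong refl sum.swap)
  also have "\<dots> = (\<Sum>b\<in>D. \<Sum>k\<in>A. \<Sum>a\<in>C. \<Sum>j\<in>B. f k j a b)"
    by (rule sum.swap)
  also have "\<dots> = (\<Sum>b\<in>D. \<Sum>a\<in>C. \<Sum>k\<in>A. \<Sum>j\<in>B. f k j a b)"
    by (intro sum.cong refl sum.swap)
  also have "\<dots> = (\<Sum>b\<in>D. \<Sum>a\<in>C. \<Sum>j\<in>B. \<Sum>k\<in>A. f k j a b)"
    by (intro sum.cong refl sum.swap)
  finally show ?thesis .
qed

lemma sesq_mult_vec: "sesq H (P *v v) (P *v w) = sesq (adjoint_mat P ** H ** P) v w"
proof -
  have "sesq H (P *v v) (P *v w) = (\<Sum>k\<in>UNIV. \<Sum>j\<in>UNIV. \<Sum>a\<in>UNIV. \<Sum>b\<in>UNIV.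
      H $ k $ j * P $ j $ a * v $ a * cnj (P $ k $ b) * cnj (w $ b))"
    unfolding sesq_def matrix_vector_mult_def
    by (simp only: vec_lambda_beta cnj_sum complex_cnj_mult mult.assoc sum_product)
       (simp only: sum_distrib_left sum_distrib_right mult.assoc)
  also have "\<dots> = (\<Sum>b\<in>UNIV. \<Sum>a\<in>UNIV. \<Sum>j\<in>UNIV. \<Sum>k\<in>UNIV.
      H $ k $ j * P $ j $ a * v $ a * cnj (P $ k $ b) * cnj (w $ b))"
    by (rule sum_reverse4)
  also have "\<dots> = sesq (adjoint_mat P ** H ** P) v w"
    unfolding sesq_def matrix_matrix_mult_def adjoint_mat_def
    by (simp add: sum_distrib_right) (simp add: mult_ac)
  finally show ?thesis .
qed

lemma herm_form_mult_vec: "herm_form H (P *v v) = herm_form (adjoint_mat P ** H ** P) v"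
  by (simp add: herm_form_sesq sesq_mult_vec)

lemma matrix_vector_mul_basis_column: "P *v axis j 1 = column j (P :: complex^'n^'m)"
  by (simp add: vec_eq_iff matrix_vector_mult_def column_def axis_def mult_delta_right)

lemma sesq_column:
  fixes H P :: "complex^'n^'n"
  shows "(adjoint_mat P ** H ** P) $ i $ j = sesq H (column j P) (column i P)"
proof -
  have "sesq M (axis j 1) (axis i 1) = M $ i $ j" for M :: "complex^'n^'n"
  proof -
    have "sesq M (axis j 1) (axis i 1) = (\<Sum>k\<in>UNIV. if k = i then (\<Sum>l\<in>UNIV. if l = j then M $ k $ l else 0) else 0)"
      unfolding sesq_def by (intro sum.cong refl) (auto simp: axis_def mult_delta_left mult_delta_right)
    then show ?thesis by (simp add: mult_delta_right)
  qed
  then show ?thesis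
    using sesq_mult_vec[of H P "axis j 1" "axis i 1"] by (simp add: matrix_vector_mul_basis_column)
qed

text \<open>A zero of a form that is nonnegative along complex lines is a critical point. The value
  at \<open>v + a *s x\<close> is \<open>2 * Re (a * b)\<close> plus a term quadratic in
  \<open>a\<close>, where \<open>b = sesq F x v\<close>; a suitable multiple of
  \<open>- cnj b\<close> as \<open>a\<close> makes the linear term win unless \<open>b\<close>
  vanishes. The \<open>+ 1\<close> in \<open>c\<close> keeps the denominator positive.\<close>

lemma psd_kernel:
  fixes F :: "complex^'n^'n"
  assumes "hermitian F" and "F0": "herm_form F v = 0"
    and nn: "\<And>a. 0 \<le> herm_form F (v + a *s x)"
  shows "sesq F x v = 0"
proof -
  have *: "herm_form F (v + a *s x) = 2 * Re (a * sesq F x v) + (cmod a)\<^sup>2 * herm_form F x" for a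
  proof -
    have "sesq F v (a *s x) = cnj (a * sesq F x v)"
      by (simp add: sesq_scale_right sesq_cnj[OF assms(1)])
    moreover have "sesq F (a *s x) (a *s x) = of_real ((cmod a)\<^sup>2) * sesq F x x"
      using complex_norm_square[of a] by (simp add: sesq_scale_left sesq_scale_right mult_ac)
    ultimately show ?thesis
      using F0 by (simp add: herm_form_sesq sesq_add_left sesq_add_right sesq_scale_left)
  qed
  define b where "b = sesq F x v"
  define c where "c = \<bar>herm_form F x\<bar> + 1"
  have "c > 0" by (simp add: c_def)
  have "0 \<le> 2 * Re (- (cnj b / c) * b) + (cmod (- (cnj b / c)))\<^sup>2 * herm_form F x"
    using nn[of "- (cnj b / c)"] unfolding * b_def[symmetric] .
  also have "\<dots> \<le> - 2 * (cmod b)\<^sup>2 / c + (cmod b)\<^sup>2 / c\<^sup>2 * (c)"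
  proof -
    have re: "Re (- (cnj b / c) * b) = - (cmod b)\<^sup>2 / c"
      by (simp add: cmod_def power2_eq_square diff_divide_distrib add_divide_distrib)
    moreover have "(cmod (- (cnj b / c)))\<^sup>2 = (cmod b)\<^sup>2 / c\<^sup>2"
      by (simp add: norm_divide power_divide)
    moreover have "(cmod b)\<^sup>2 / c\<^sup>2 * herm_form F x \<le> (cmod b)\<^sup>2 / c\<^sup>2 * c"
      by (intro mult_left_mono) (auto simp: c_def)
    ultimately show ?thesis unfolding re by simp
  qed
  also have "\<dots> = - (cmod b)\<^sup>2 / c"
    using \<open>c > 0\<close> by (simp add: power2_eq_square field_simps)
  finally have "(cmod b)\<^sup>2 \<le> 0"
    using \<open>c > 0\<close> by (simp add: divide_le_0_iff zero_le_divide_iff)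
  then show ?thesis by (simp add: b_def)
qed

text \<open>Minimum over the unit sphere, then homogeneity of degree two. It bounds the unit sphere
  of \<open>G\<close>, on which a maximum is taken below.\<close>

lemma positive_definite_lower:
  fixes G :: "complex^'n^'n"
  assumes "positive_definite G"
  shows "\<exists>c>0. \<forall>v. c * (norm v)\<^sup>2 \<le> herm_form G v"
proof -
  let ?S = "sphere 0 1 :: (complex^'n) set"
  have "?S \<noteq> {}" by simp
  then obtain v0 where v0: "v0 \<in> ?S" "\<And>v. v \<in> ?S \<Longrightarrow> herm_form G v0 \<le> herm_form G v"
    using continuous_attains_inf[OF compact_sphere _ continuous_on_herm_form, of 0 1 G] by auto
  have pos: "herm_form G v0 > 0"
  proof -
    have "v0 \<noteq> 0" using v0(1) by auto
    then show ?thesis using assms by (simp add: positive_definite_def)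
  qed
  have "herm_form G v0 * (norm v)\<^sup>2 \<le> herm_form G v" for v
  proof (cases "v = 0")
    case False
    have "herm_form G v0 \<le> herm_form G ((1 / norm v) *\<^sub>R v)"
      using v0(2) False by simp
    also have "\<dots> = herm_form G v / (norm v)\<^sup>2"
      by (simp add: herm_form_sesq sesq_scaleR_left sesq_scaleR_right power2_eq_square)
    finally show ?thesis using False by (simp add: field_simps)
  qed (simp add: herm_form_def)
  with pos show ?thesis by blast
qed

text \<open>The \<open>k\<close> conditions become rows of a square matrix; as \<open>k\<close> is
  below the dimension, at least one row is left zero, so the matrix has a kernel.\<close>

lemma exists_orthogonal_vector:
  fixes G :: "complex^'n^'n" and v :: "nat \<Rightarrow> complex^'n"
  assumes "k < CARD('n)"
  shows "\<exists>x. x \<noteq> 0 \<and> (\<forall>l<k. sesq G x (v l) = 0)"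
proof -
  obtain e :: "'n \<Rightarrow> nat" where e: "bij_betw e UNIV {..<CARD('n)}"
    using ex_bij_betw_finite_nat[of "UNIV :: 'n set"] by (auto simp: atLeast0LessThan)
  define M :: "complex^'n^'n" where
    "M = (\<chi> i j. if e i < k then (\<Sum>m\<in>UNIV. G $ m $ j * cnj (v (e i) $ m)) else 0)"
  obtain i where i: "e i = k" using e assms unfolding bij_betw_def by (metis imageE lessThan_iff)
  have "row i M = 0" by (simp add: M_def row_def i vec_eq_iff)
  then have "det M = 0" by (rule det_zero_row)
  then have "\<not> invertible M" by (simp add: invertible_det_nz)
  then obtain x where x: "M *v x = 0" "x \<noteq> 0"
    using invertible_left_inverse matrix_left_invertible_ker by blast
  have "sesq G x (v l) = 0" if "l < k" for l
  proof -
    have "l < CARD('n)" using that assms by simp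
    then obtain i where i: "e i = l" using e unfolding bij_betw_def by (metis imageE lessThan_iff)
    have "(M *v x) $ i = (\<Sum>j\<in>UNIV. \<Sum>m\<in>UNIV. G $ m $ j * x $ j * cnj (v l $ m))"
      using that by (simp add: M_def matrix_vector_mult_def i sum_distrib_left mult_ac)
    also have "\<dots> = sesq G x (v l)" unfolding sesq_def by (rule sum.swap)
    finally show ?thesis using x by simp
  qed
  with x show ?thesis by blast
qed

text \<open>Rayleigh's method: each new vector maximizes \<open>H\<close> on the unit sphere of
  \<open>G\<close> inside the complement \<open>W\<close> of the earlier vectors. The second clause
  is the criticality condition for this maximum. It is stated for all \<open>x\<close> orthogonal to
  the vectors up to index \<open>i\<close>, not only for later members of the family, and therefore
  survives the extension by one vector.\<close>

lemma diagonalizing_family: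
  fixes G H :: "complex^'n^'n"
  assumes G: "positive_definite G" and H: "hermitian H" and "k \<le> CARD('n)"
  shows "\<exists>v :: nat \<Rightarrow> complex^'n.
    (\<forall>i<k. \<forall>j<k. sesq G (v j) (v i) = (if i = j then 1 else 0)) \<and>
    (\<forall>i<k. \<forall>x. (\<forall>l\<le>i. sesq G x (v l) = 0) \<longrightarrow> sesq H x (v i) = 0)"
  using \<open>k \<le> CARD('n)\<close>
proof (induction k)
  case 0 then show ?case by simp
next
  case (Suc k)
  then obtain v :: "nat \<Rightarrow> complex^'n" where
    orth: "\<And>i j. i < k \<Longrightarrow> j < k \<Longrightarrow> sesq G (v j) (v i) = (if i = j then 1 else 0)" and
    crit: "\<And>i x. i < k \<Longrightarrow> (\<forall>l\<le>i. sesq G x (v l) = 0) \<Longrightarrow> sesq H x (v i) = 0"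
    by (metis Suc_leD)
  have hG: "hermitian G" using G by (simp add: positive_definite_def)
  define W where "W = {x. \<forall>l<k. sesq G x (v l) = 0}"
  define C where "C = {x \<in> W. herm_form G x = 1}"
  have Wadd: "x + a *s y \<in> W" if "x \<in> W" "y \<in> W" for x y a
    using that by (simp add: W_def sesq_add_left sesq_scale_left)
  obtain x0 where x0: "x0 \<noteq> 0" "x0 \<in> W"
    using exists_orthogonal_vector[of k G v] Suc.prems unfolding W_def by auto
  have px0: "herm_form G x0 > 0" using G x0 by (simp add: positive_definite_def)
  have scal: "herm_form M (a *\<^sub>R x) = a\<^sup>2 * herm_form M x" for M :: "complex^'n^'n" and a x
    by (simp add: herm_form_sesq sesq_scaleR_left sesq_scaleR_right power2_eq_square)
  have Wsc: "a *\<^sub>R x \<in> W" if "x \<in> W" for a x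
    using that by (simp add: W_def sesq_scaleR_left)
  have "(1 / sqrt (herm_form G x0)) *\<^sub>R x0 \<in> C"
    using x0 px0 Wsc by (simp add: C_def scal power_divide)
  then have "C \<noteq> {}" by blast
  obtain c where c: "c > 0" "\<And>v. c * (norm v)\<^sup>2 \<le> herm_form G v"
    using positive_definite_lower[OF G] by blast
  have "closed W" unfolding W_def
    by (auto intro!: closed_Collect_all closed_Collect_imp closed_Collect_eq continuous_intros)
  moreover have "C = W \<inter> {x. herm_form G x = 1}" by (auto simp: C_def)
  ultimately have "closed C"
    by (auto intro!: closed_Int closed_Collect_eq continuous_intros)
  moreover have "bounded C"
  proof (rule boundedI)
    fix x assume "x \<in> C"
    then have "c * (norm x)\<^sup>2 \<le> 1" using c(2)[of x] by (simp add: C_def)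
    then have "(norm x)\<^sup>2 \<le> (1 / sqrt c)\<^sup>2" using c by (simp add: field_simps)
    then show "norm x \<le> 1 / sqrt c" using c(1) power2_le_imp_le by fastforce
  qed
  ultimately have "compact C" using compact_eq_bounded_closed by blast
  then obtain z where z: "z \<in> C" "\<And>x. x \<in> C \<Longrightarrow> herm_form H x \<le> herm_form H z"
    using continuous_attains_sup[of C "herm_form H"] \<open>C \<noteq> {}\<close> continuous_on_herm_form by blast
  define m where "m = herm_form H z"
  have zW: "z \<in> W" and Gz: "herm_form G z = 1" using z by (auto simp: C_def)
  \<comment> \<open>\<open>m\<close> is the maximal Rayleigh quotient on \<open>W\<close>, so
    \<open>F\<close> is nonnegative there and vanishes at \<open>z\<close>: the situation of
    \<open>psd_kernel\<close>.\<close>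
  define F :: "complex^'n^'n" where "F = (\<chi> k j. of_real m * G $ k $ j - H $ k $ j)"

  have hF: "hermitian F"
    unfolding hermitian_def
  proof (intro allI)
    fix j k
    have "G $ k $ j = cnj (G $ j $ k)" "H $ k $ j = cnj (H $ j $ k)"
      using hG H unfolding hermitian_def by blast+
    then show "F $ k $ j = cnj (F $ j $ k)" by (simp add: F_def)
  qed
  have sF: "sesq F x y = of_real m * sesq G x y - sesq H x y" for x y
    by (simp add: F_def sesq_def algebra_simps sum_subtractf sum_distrib_left)
  have Fnn: "herm_form F x \<ge> 0" if "x \<in> W" for x
  proof (cases "x = 0")
    case False
    then have px: "herm_form G x > 0" using G by (simp add: positive_definite_def)
    have "(1 / sqrt (herm_form G x)) *\<^sub>R x \<in> C"
      using that px Wsc by (simp add: C_def scal power_divide)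
    from z(2)[OF this] have "herm_form H x / herm_form G x \<le> m"
      using px by (simp add: m_def scal power_divide)
    then show ?thesis using px by (simp add: herm_form_sesq sF field_simps)
  qed (simp add: herm_form_sesq)
  have new: "sesq H x z = 0" if "x \<in> W" "sesq G x z = 0" for x
  proof -
    have "herm_form F z = 0" using Gz by (simp add: herm_form_sesq sF m_def)
    from psd_kernel[OF hF this, of x] have "sesq F x z = 0"
      using Fnn Wadd zW that(1) by blast
    with that show ?thesis by (simp add: sF)
  qed
  have zz: "sesq G z z = 1" using sesq_self_real[OF hG, of z] Gz by simp
  have zv: "sesq G z (v l) = 0" if "l < k" for l using zW that by (simp add: W_def)
  have vz: "sesq G (v l) z = 0" if "l < k" for l
    using zv[OF that] sesq_cnj[OF hG, of z "v l"] by simp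
  show ?case
  proof (intro exI[of _ "v(k := z)"] conjI allI impI)
    fix i j assume "i < Suc k" "j < Suc k"
    then show "sesq G ((v(k := z)) j) ((v(k := z)) i) = (if i = j then 1 else 0)"
      using orth zz zv vz by (auto simp: less_Suc_eq)
  next
    fix i x assume i: "i < Suc k" and *: "\<forall>l\<le>i. sesq G x ((v(k := z)) l) = 0"
    show "sesq H x ((v(k := z)) i) = 0"
    proof (cases "i = k")
      case True
      have "sesq G x (v l) = 0" if "l < k" for l using *[rule_format, of l] that True by simp
      then have "x \<in> W" by (simp add: W_def)
      moreover have "sesq G x z = 0" using * True by auto
      ultimately show ?thesis using new True by simp
    next
      case False
      have "sesq G x (v l) = 0" if "l \<le> i" for l
        using *[rule_format, of l] that i False by simp
      then show ?thesis using crit[of i x] False i by simp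
    qed
  qed
qed

lemma simultaneous_diagonalization:
  fixes G H :: "complex^'n^'n"
  assumes G: "positive_definite G" and H: "hermitian H"
  shows "\<exists>P d. diagonalizes P G H d"
proof -
  obtain v :: "nat \<Rightarrow> complex^'n" where
    orth: "\<And>i j. i < CARD('n) \<Longrightarrow> j < CARD('n) \<Longrightarrow> sesq G (v j) (v i) = (if i = j then 1 else 0)" and
    crit: "\<And>i x. i < CARD('n) \<Longrightarrow> (\<forall>l\<le>i. sesq G x (v l) = 0) \<Longrightarrow> sesq H x (v i) = 0"
    using diagonalizing_family[OF G H order_refl] by blast
  obtain e :: "'n \<Rightarrow> nat" where e: "bij_betw e UNIV {..<CARD('n)}"
    using ex_bij_betw_finite_nat[of "UNIV :: 'n set"] by (auto simp: atLeast0LessThan)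
  have el: "e i < CARD('n)" for i using e by (auto simp: bij_betw_def)
  have einj: "e i = e j \<longleftrightarrow> i = j" for i j using e by (auto simp: bij_betw_def inj_on_def)
  define P where "P = (\<chi> a j. v (e j) $ a)"
  have col: "column j P = v (e j)" for j by (simp add: P_def column_def vec_eq_iff)
  \<comment> \<open>Criticality of the earlier of the two vectors gives one order of the arguments,
    Hermitian symmetry the other.\<close>
  have H0: "sesq H (v (e j)) (v (e i)) = 0" if "i \<noteq> j" for i j
  proof -
    have *: "sesq H (v (e j)) (v (e i)) = 0" if "e i < e j" for i j
    proof (rule crit[OF el], intro allI impI)
      fix l assume "l \<le> e i"
      then show "sesq G (v (e j)) (v l) = 0"
        using that orth[of l "e j"] el[of j] by (auto simp: )
    qed
    from that einj consider "e i < e j" | "e j < e i" by (metis nat_neq_iff)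
    then show ?thesis
    proof cases
      case 2 then show ?thesis using *[of j i] sesq_cnj[OF H, of "v (e i)" "v (e j)"] by simp
    qed (rule *)
  qed
  have "adjoint_mat P ** G ** P = mat 1"
    unfolding vec_eq_iff sesq_column col mat_def using orth el by (simp add: einj)
  moreover have "adjoint_mat P ** H ** P = diag_mat (\<lambda>i. herm_form H (v (e i)))"
    unfolding vec_eq_iff sesq_column col diag_mat_def using H0 sesq_self_real[OF H] by simp
  ultimately show ?thesis unfolding diagonalizes_def by blast
qed

lemma diagonalizes_inverse:
  fixes G H P :: "complex^'n^'n"
  assumes "diagonalizes P G H d"
  shows "invertible P" "invertible G" "matrix_inv G = P ** adjoint_mat P"
    "(P ** adjoint_mat P) ** G = mat 1" "(adjoint_mat P ** G) ** P = mat 1"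
    "P ** (adjoint_mat P ** G) = mat 1"
proof -
  show 1: "(adjoint_mat P ** G) ** P = mat 1" using assms by (simp add: diagonalizes_def)
  then show 2: "P ** (adjoint_mat P ** G) = mat 1" using matrix_left_right_inverse by blast
  from 1 2 show "invertible P" unfolding invertible_def by blast
  show 3: "(P ** adjoint_mat P) ** G = mat 1" using 2 by (simp add: matrix_mul_assoc)
  then have 4: "G ** (P ** adjoint_mat P) = mat 1" using matrix_left_right_inverse by blast
  from 3 4 show iG: "invertible G" unfolding invertible_def by blast
  have "matrix_inv G ** G = mat 1"
    using someI_ex[OF iG[unfolded invertible_def]] by (simp add: matrix_inv_def)
  then have "matrix_inv G ** G ** (P ** adjoint_mat P) = P ** adjoint_mat P" by simp
  then show "matrix_inv G = P ** adjoint_mat P"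
    by (metis 4 matrix_mul_assoc matrix_mul_rid)
qed

section \<open>Relative eigenvalues, traces and the second elementary symmetric function\<close>

lemma trace_mult_commute:
  fixes A B :: "complex^'n^'n" shows "trace (A ** B) = trace (B ** A)"
  by (simp add: trace_def matrix_matrix_mult_def mult.commute) (rule sum.swap)

lemma diagonalizes_trace:
  fixes G H P :: "complex^'n^'n"
  assumes "diagonalizes P G H d"
  shows "trace (matrix_inv G ** H) = of_real (\<Sum>i\<in>UNIV. d i)"
    "trace (matrix_inv G ** H ** (matrix_inv G ** H)) = of_real (\<Sum>i\<in>UNIV. (d i)\<^sup>2)"
proof -
  note inv = diagonalizes_inverse[OF assms]
  have d: "adjoint_mat P ** H ** P = diag_mat d" using assms by (simp add: diagonalizes_def)
  have "trace (matrix_inv G ** H) = trace (P ** (adjoint_mat P ** H))"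
    by (simp add: inv(3) matrix_mul_assoc)
  also have "\<dots> = trace (diag_mat d :: complex^'n^'n)"
    by (subst trace_mult_commute) (simp add: d)
  finally show "trace (matrix_inv G ** H) = of_real (\<Sum>i\<in>UNIV. d i)"
    by (simp add: trace_def diag_mat_def)
  have "trace (matrix_inv G ** H ** (matrix_inv G ** H)) = trace (P ** (adjoint_mat P ** H ** P ** (adjoint_mat P ** H)))"
    by (simp add: inv(3) matrix_mul_assoc)
  also have "\<dots> = trace (adjoint_mat P ** H ** P ** (adjoint_mat P ** H ** P))"
    by (subst trace_mult_commute) (simp add: matrix_mul_assoc)
  also have "\<dots> = trace (diag_mat d ** diag_mat d :: complex^'n^'n)"
    by (simp add: d)
  also have "diag_mat d ** diag_mat d = (diag_mat (\<lambda>i. (d i)\<^sup>2) :: complex^'n^'n)"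
    by (auto simp: vec_eq_iff diag_mat_def matrix_matrix_mult_def power2_eq_square mult_delta_left)
  finally show "trace (matrix_inv G ** H ** (matrix_inv G ** H)) = of_real (\<Sum>i\<in>UNIV. (d i)\<^sup>2)"
    by (simp add: trace_def diag_mat_def)
qed

text \<open>Complex matrices seen over the polynomial ring, where the pencil t G - H can be
  multiplied by a change of basis.\<close>

definition lift_mat :: "complex^'n^'n \<Rightarrow> complex poly^'n^'n" where
  "lift_mat A = (\<chi> i j. [:A $ i $ j:])"

lemma pCons_0_sum: "[:sum f A:] = (\<Sum>i\<in>A. [:f i:])"
proof (induction A rule: infinite_finite_induct)
  case (insert x F)
  have "[:f x + sum f F:] = [:f x:] + [:sum f F:]" by simp
  with insert show ?case by (metis sum.insert)
qed auto

lemma lift_mat_mult: "lift_mat (A ** B) = lift_mat A ** lift_mat B"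
  by (simp add: lift_mat_def matrix_matrix_mult_def vec_eq_iff pCons_0_sum) (simp add: mult.commute)

lemma lift_mat_one [simp]: "lift_mat (mat 1) = mat 1"
  by (simp add: lift_mat_def mat_def vec_eq_iff one_pCons)

text \<open>Over the polynomial ring, conjugation by the lifted \<open>P\<close> turns t G - H into
  the diagonal matrix with entries t - d_i. The lifts of \<open>P\<close> and of its adjoint are
  invertible, so their determinants are units, that is, nonzero constants, and multiplying by them
  changes no root and no multiplicity.\<close>

lemma proots_char_poly:
  fixes G H P :: "complex^'n^'n"
  assumes "diagonalizes P G H d"
  shows "proots (det (\<chi> k j. [:- (H $ k $ j), G $ k $ j:])) =
         image_mset (\<lambda>i. complex_of_real (d i)) (mset_set UNIV)"
proof -
  define M where "M = (\<chi> k j. [:- (H $ k $ j), G $ k $ j:])"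
  define D :: "complex poly^'n^'n" where "D = (\<chi> i j. if i = j then [:- complex_of_real (d i), 1:] else 0)"
  have M: "M = (\<chi> i j. [:0,1:] * lift_mat G $ i $ j - lift_mat H $ i $ j)"
    by (simp add: M_def lift_mat_def vec_eq_iff)
  have conj: "A ** (\<chi> i j. c * X $ i $ j - Y $ i $ j) ** B =
      (\<chi> i j. c * (A ** X ** B) $ i $ j - (A ** Y ** B) $ i $ j)"
    for A B X Y :: "complex poly^'n^'n" and c
    by (simp add: matrix_matrix_mult_def vec_eq_iff algebra_simps sum_subtractf sum_distrib_left sum_distrib_right)
  have "lift_mat (adjoint_mat P) ** M ** lift_mat P =
      (\<chi> i j. [:0,1:] * lift_mat (adjoint_mat P ** G ** P) $ i $ j - lift_mat (adjoint_mat P ** H ** P) $ i $ j)"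
    unfolding M conj lift_mat_mult ..
  also have "\<dots> = D"
    using assms by (simp add: diagonalizes_def D_def vec_eq_iff lift_mat_def diag_mat_def mat_def)
  finally have "det (lift_mat (adjoint_mat P)) * det M * det (lift_mat P) = det D"
    by (metis det_mul)
  also have "det D = (\<Prod>i\<in>UNIV. [:- complex_of_real (d i), 1:])"
    by (subst det_diagonal) (auto simp: D_def)
  finally have eq: "det (lift_mat (adjoint_mat P)) * det M * det (lift_mat P) = (\<Prod>i\<in>UNIV. [:- complex_of_real (d i), 1:])" .
  have unit: "\<exists>c. c \<noteq> 0 \<and> det (lift_mat A) = [:c:]" if A: "invertible A" for A :: "complex^'n^'n"
  proof -
    obtain B where "A ** B = mat 1" using A unfolding invertible_def by blast
    then have "lift_mat A ** lift_mat B = mat 1" by (metis lift_mat_mult lift_mat_one)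
    then have "det (lift_mat A) * det (lift_mat B) = 1" by (metis det_mul det_I)
    then have "is_unit (det (lift_mat A))" by (metis dvd_triv_left)
    then show ?thesis unfolding is_unit_poly_iff by (auto simp: dvd_field_iff)
  qed
  note inv = diagonalizes_inverse[OF assms]
  obtain a where a: "a \<noteq> 0" "det (lift_mat P) = [:a:]" using unit[OF inv(1)] by blast
  have "invertible (adjoint_mat P)"
    using inv(1) unfolding invertible_def by (metis adjoint_mat_one adjoint_mult)
  then obtain b where b: "b \<noteq> 0" "det (lift_mat (adjoint_mat P)) = [:b:]" using unit by blast
  have "proots (det M) = proots (smult (a * b) (det M))" using a b by simp
  also have "smult (a * b) (det M) = (\<Prod>i\<in>UNIV. [:- complex_of_real (d i), 1:])"
    using eq by (simp add: a b mult.commute)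
  also have "proots \<dots> = (\<Sum>i\<in>UNIV. {#complex_of_real (d i)#})"
    by (subst proots_prod) auto
  also have "\<dots> = image_mset (\<lambda>i. complex_of_real (d i)) (mset_set UNIV)"
  proof -
    have "finite A \<Longrightarrow> (\<Sum>i\<in>A. {#complex_of_real (d i)#}) = image_mset (\<lambda>i. complex_of_real (d i)) (mset_set A)" for A :: "'n set"
      by (induction A rule: finite_induct) auto
    then show ?thesis by simp
  qed
  finally show ?thesis by (simp add: M_def)
qed

text \<open>Newton's identity for the second elementary symmetric function, in the indexing that
  \<open>sigma2\<close> uses.\<close>

lemma sum_pairs_list:
  fixes l :: "real list"
  shows "(\<Sum>k<length l. \<Sum>j<k. l ! j * l ! k) = ((sum_list l)\<^sup>2 - sum_list (map (\<lambda>x. x\<^sup>2) l)) / 2"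
proof (induction l rule: rev_induct)
  case (snoc x l)
  have "(\<Sum>k<length (l @ [x]). \<Sum>j<k. (l @ [x]) ! j * (l @ [x]) ! k)
     = (\<Sum>k<length l. \<Sum>j<k. (l @ [x]) ! j * (l @ [x]) ! k) + (\<Sum>j<length l. (l @ [x]) ! j * x)"
    by simp
  also have "(\<Sum>k<length l. \<Sum>j<k. (l @ [x]) ! j * (l @ [x]) ! k) = (\<Sum>k<length l. \<Sum>j<k. l ! j * l ! k)"
    by (intro sum.cong refl) (auto simp: nth_append)
  also have "(\<Sum>j<length l. (l @ [x]) ! j * x) = sum_list l * x"
    by (simp add: nth_append sum_list_sum_nth atLeast0LessThan sum_distrib_right)
  finally show ?case using snoc by (simp add: power2_eq_square field_simps)
qed simp

lemma sigma2_diagonalizes: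
  fixes G H P :: "complex^'n^'n"
  assumes "diagonalizes P G H d"
  shows "sigma2 G H = ((\<Sum>i\<in>UNIV. d i)\<^sup>2 - (\<Sum>i\<in>UNIV. (d i)\<^sup>2)) / 2"
proof -
  define l where "l = rel_eigenvalues G H"
  have ml: "mset l = image_mset d (mset_set UNIV)"
    unfolding l_def rel_eigenvalues_def proots_char_poly[OF assms]
    by (simp add: multiset.map_comp o_def)
  have "sum_list l = (\<Sum>i\<in>UNIV. d i)"
    by (metis ml sum_mset_sum_list sum_unfold_sum_mset)
  moreover have "sum_list (map (\<lambda>x. x\<^sup>2) l) = (\<Sum>i\<in>UNIV. (d i)\<^sup>2)"
    by (metis (no_types, lifting) image_mset.compositionality comp_def ml mset_map
        sum_mset_sum_list sum_unfold_sum_mset multiset.map_cong)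
  moreover have "sigma2 G H = (\<Sum>k<length l. \<Sum>j<k. l ! j * l ! k)"
    by (simp add: sigma2_def l_def Let_def)
  ultimately show ?thesis by (simp add: sum_pairs_list)
qed

text \<open>This replaces the roots of a characteristic polynomial by an expression in matrix
  entries, which can be differentiated and pulled back along coordinate changes.\<close>

lemma sigma2_trace:
  fixes G H :: "complex^'n^'n"
  assumes "positive_definite G" "hermitian H"
  shows "complex_of_real (2 * sigma2 G H) = (trace (matrix_inv G ** H))\<^sup>2
     - trace (matrix_inv G ** H ** (matrix_inv G ** H))"
proof -
  obtain P d where "diagonalizes P G H d" using simultaneous_diagonalization[OF assms] by blast
  from sigma2_diagonalizes[OF this] diagonalizes_trace[OF this] show ?thesis
    by (simp only: of_real_diff[symmetric] of_real_power[symmetric]) simp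
qed

text \<open>Cauchy-Schwarz between the norm of \<open>v\<close> given by \<open>G\<close> and the
  dual norm of \<open>a\<close>. In a unitary frame \<open>P\<close> for \<open>G\<close> both norms
  become standard, because the inverse of \<open>G\<close> is \<open>P\<close> times its
  adjoint.\<close>

lemma covector_pairing_bound:
  fixes G :: "complex^'n^'n" and a v :: "complex^'n"
  assumes "positive_definite G"
  shows "(cmod (\<Sum>j\<in>UNIV. a $ j * v $ j))\<^sup>2
    \<le> Re (\<Sum>j\<in>UNIV. \<Sum>k\<in>UNIV. matrix_inv G $ j $ k * a $ j * cnj (a $ k)) * herm_form G v"
proof -
  have "hermitian G" using assms by (simp add: positive_definite_def)
  then obtain P d where D: "diagonalizes P G G d"
    using simultaneous_diagonalization[OF assms] by blast
  note inv = diagonalizes_inverse[OF D]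
  define y where "y = adjoint_mat P *v (G *v v)"
  define b where "b = a v* P"
  have v: "v = P *v y" unfolding y_def
    by (metis inv(6) matrix_vector_mul_assoc matrix_vector_mul_lid)
  have hv: "herm_form G v = (\<Sum>i\<in>UNIV. (cmod (y $ i))\<^sup>2)"
  proof -
    have "herm_form G v = herm_form (mat 1) y"
      unfolding v herm_form_mult_vec using inv(5) by simp
    also have "\<dots> = (\<Sum>i\<in>UNIV. (cmod (y $ i))\<^sup>2)"
      by (simp add: herm_form_def mat_def if_distrib if_distribR cmod_def power2_eq_square cong: if_cong)
    finally show ?thesis .
  qed
  have pv: "(\<Sum>j\<in>UNIV. a $ j * v $ j) = (\<Sum>i\<in>UNIV. b $ i * y $ i)"
    unfolding v b_def matrix_vector_mult_def vector_matrix_mult_def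
    by (simp add: sum_distrib_left sum_distrib_right mult_ac) (subst sum.swap, simp add: mult_ac)
  have "(\<Sum>j\<in>UNIV. \<Sum>k\<in>UNIV. matrix_inv G $ j $ k * a $ j * cnj (a $ k))
      = (\<Sum>j\<in>UNIV. \<Sum>k\<in>UNIV. \<Sum>i\<in>UNIV. (P $ j $ i * a $ j) * cnj (P $ k $ i * a $ k))"
    by (simp add: inv(3) matrix_matrix_mult_def adjoint_mat_def sum_distrib_right sum_distrib_left mult_ac)
  also have "\<dots> = (\<Sum>i\<in>UNIV. \<Sum>j\<in>UNIV. \<Sum>k\<in>UNIV. (P $ j $ i * a $ j) * cnj (P $ k $ i * a $ k))"
    by (subst (2) sum.swap, subst sum.swap, rule refl)
  also have "\<dots> = (\<Sum>i\<in>UNIV. b $ i * cnj (b $ i))"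
    by (simp only: b_def vector_matrix_mult_def vec_lambda_beta cnj_sum sum_product)
       (simp add: mult.commute)
  finally have pb: "Re (\<Sum>j\<in>UNIV. \<Sum>k\<in>UNIV. matrix_inv G $ j $ k * a $ j * cnj (a $ k))
     = (\<Sum>i\<in>UNIV. (cmod (b $ i))\<^sup>2)"
    by (simp add: cmod_def power2_eq_square)
  have "cmod (\<Sum>i\<in>UNIV. b $ i * y $ i) \<le> (\<Sum>i\<in>UNIV. cmod (b $ i) * cmod (y $ i))"
    by (rule order_trans[OF norm_sum]) (simp add: norm_mult)
  then have "(cmod (\<Sum>i\<in>UNIV. b $ i * y $ i))\<^sup>2 \<le> (\<Sum>i\<in>UNIV. cmod (b $ i) * cmod (y $ i))\<^sup>2"
    by (intro power_mono) auto
  also have "\<dots> \<le> (\<Sum>i\<in>UNIV. (cmod (b $ i))\<^sup>2) * (\<Sum>i\<in>UNIV. (cmod (y $ i))\<^sup>2)"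
    by (rule Cauchy_Schwarz_ineq_sum)
  finally show ?thesis unfolding pv pb hv .
qed

section \<open>Smooth functions\<close>

text \<open>\<open>Ck_on\<close> quantifies over points of \<open>S\<close> only, but its
  derivatives look at full neighbourhoods; openness of \<open>S\<close> is what makes them agree for
  functions that agree on \<open>S\<close>.\<close>

lemma Ck_on_cong_imp:
  assumes "open S" "\<And>x. x \<in> S \<Longrightarrow> f x = g x" "Ck_on k S f"
  shows "Ck_on k S g"
  using assms(2,3)
proof (induction k arbitrary: f g)
  case 0 then show ?case using continuous_on_cong by (metis Ck_on.simps(1))
next
  case (Suc k)
  have d: "f differentiable (at x)" if "x \<in> S" for x using Suc.prems that by simp
  have e: "frechet_derivative f (at x) = frechet_derivative g (at x)" if "x \<in> S" for x
    using frechet_derivative_transform_within_open[OF d[OF that] assms(1) that] Suc.prems(1) by blast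
  have "g differentiable (at x)" if "x \<in> S" for x
    using d[OF that] has_derivative_transform_within_open[OF _ assms(1) that] Suc.prems(1)
    unfolding differentiable_def by blast
  moreover have "Ck_on k S (\<lambda>x. frechet_derivative g (at x) v)" for v
    by (rule Suc.IH[of "\<lambda>x. frechet_derivative f (at x) v"]) (use e Suc.prems in auto)
  ultimately show ?case by simp
qed

lemma smooth_on_cong:
  assumes "open S" "\<And>x. x \<in> S \<Longrightarrow> f x = g x"
  shows "smooth_on S f \<longleftrightarrow> smooth_on S g"
  using Ck_on_cong_imp[OF assms(1), of f g] Ck_on_cong_imp[OF assms(1), of g f] assms(2)
  unfolding smooth_on_def by metis

lemma Ck_on_SucD: "Ck_on (Suc k) S f \<Longrightarrow> Ck_on k S f"
proof (induction k arbitrary: f)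
  case 0 then show ?case
    by (auto intro!: continuous_at_imp_continuous_on differentiable_imp_continuous_within)
qed auto

lemma smooth_on_differentiable: "smooth_on S f \<Longrightarrow> x \<in> S \<Longrightarrow> f differentiable (at x)"
  unfolding smooth_on_def by (metis Ck_on.simps(2))

lemma smooth_on_frechet: "smooth_on S f \<Longrightarrow> smooth_on S (\<lambda>x. frechet_derivative f (at x) v)"
  unfolding smooth_on_def by (metis Ck_on.simps(2))

lemma smooth_on_continuous: "smooth_on S f \<Longrightarrow> continuous_on S f"
  unfolding smooth_on_def by (metis Ck_on.simps(1))

lemma frechet_derivative_eqI:
  "(f has_derivative f') (at x) \<Longrightarrow> frechet_derivative f (at x) = f'"
  using frechet_derivative_at by metis

lemma frechet_derivative_worksI: "f differentiable (at x) \<Longrightarrow> (f has_derivative frechet_derivative f (at x)) (at x)"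
  by (simp add: frechet_derivative_works)

text \<open>The following induction principle reduces smoothness to a single differentiation step,
  in which smoothness of lower order of the function itself is available.\<close>

lemma Ck_on_const [simp]: "Ck_on k S (\<lambda>x. c)"
  by (induction k arbitrary: c) auto

lemma Ck_on_add:
  assumes "open S"
  shows "Ck_on k S f \<Longrightarrow> Ck_on k S g \<Longrightarrow> Ck_on k S (\<lambda>x. f x + g x)"
proof (induction k arbitrary: f g)
  case 0 then show ?case by (auto intro: continuous_intros)
next
  case (Suc k)
  have "Ck_on k S (\<lambda>x. frechet_derivative (\<lambda>x. f x + g x) (at x) v)" for v
  proof (rule Ck_on_cong_imp[OF assms])
    show "Ck_on k S (\<lambda>x. frechet_derivative f (at x) v + frechet_derivative g (at x) v)"
      by (rule Suc.IH) (use Suc.prems in auto)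
    show "frechet_derivative f (at x) v + frechet_derivative g (at x) v =
        frechet_derivative (\<lambda>x. f x + g x) (at x) v" if "x \<in> S" for x
      by (subst frechet_derivative_eqI[OF has_derivative_add[OF frechet_derivative_worksI frechet_derivative_worksI]])
        (use Suc.prems that in auto)
  qed
  then show ?case using Suc.prems by auto
qed

lemma Ck_on_bounded_linear:
  assumes "open S" "bounded_linear L"
  shows "Ck_on k S f \<Longrightarrow> Ck_on k S (\<lambda>x. L (f x))"
proof (induction k arbitrary: f)
  case 0 then show ?case by (auto intro: bounded_linear.continuous_on[OF assms(2)])
next
  case (Suc k)
  have hd: "((\<lambda>x. L (f x)) has_derivative (\<lambda>v. L (frechet_derivative f (at x) v))) (at x)" if "x \<in> S" for x
    by (rule bounded_linear.has_derivative[OF assms(2) frechet_derivative_worksI])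
      (use Suc.prems that in auto)
  have "Ck_on k S (\<lambda>x. frechet_derivative (\<lambda>x. L (f x)) (at x) v)" for v
  proof (rule Ck_on_cong_imp[OF assms(1)])
    show "Ck_on k S (\<lambda>x. L (frechet_derivative f (at x) v))"
      by (rule Suc.IH) (use Suc.prems in auto)
    show "L (frechet_derivative f (at x) v) = frechet_derivative (\<lambda>x. L (f x)) (at x) v" if "x \<in> S" for x
      by (subst frechet_derivative_eqI[OF hd[OF that]]) simp
  qed
  then show ?case using hd by (auto simp: differentiable_def)
qed

lemma Ck_on_bilinear:
  assumes "open S" "bounded_bilinear B"
  shows "Ck_on k S f \<Longrightarrow> Ck_on k S g \<Longrightarrow> Ck_on k S (\<lambda>x. B (f x) (g x))"
proof (induction k arbitrary: f g)
  case 0 then show ?case by (auto intro: bounded_bilinear.continuous_on[OF assms(2)])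
next
  case (Suc k)
  have hd: "((\<lambda>x. B (f x) (g x)) has_derivative
      (\<lambda>v. B (f x) (frechet_derivative g (at x) v) + B (frechet_derivative f (at x) v) (g x))) (at x)"
    if "x \<in> S" for x
    by (rule bounded_bilinear.FDERIV[OF assms(2) frechet_derivative_worksI frechet_derivative_worksI])
      (use Suc.prems that in auto)
  have "Ck_on k S (\<lambda>x. frechet_derivative (\<lambda>x. B (f x) (g x)) (at x) v)" for v
  proof (rule Ck_on_cong_imp[OF assms(1)])
    show "Ck_on k S (\<lambda>x. B (f x) (frechet_derivative g (at x) v) + B (frechet_derivative f (at x) v) (g x))"
      by (intro Ck_on_add assms Suc.IH Ck_on_SucD[OF Suc.prems(1)] Ck_on_SucD[OF Suc.prems(2)]) (use Suc.prems in auto)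
    show "B (f x) (frechet_derivative g (at x) v) + B (frechet_derivative f (at x) v) (g x)
        = frechet_derivative (\<lambda>x. B (f x) (g x)) (at x) v" if "x \<in> S" for x
      by (subst frechet_derivative_eqI[OF hd[OF that]]) simp
  qed
  then show ?case using hd by (auto simp: differentiable_def)
qed

lemma Ck_on_sum:
  assumes "open S" "\<And>i. i \<in> I \<Longrightarrow> Ck_on k S (f i)"
  shows "Ck_on k S (\<lambda>x. \<Sum>i\<in>I. f i x)"
  using assms(2)
  by (induction I rule: infinite_finite_induct) (auto intro!: Ck_on_add assms(1))

text \<open>The derivative of the composition applies a point-dependent linear map to a
  point-dependent vector. Expanding that vector in the basis turns it into a finite sum of
  coordinate functions times compositions with a function of lower order, to which the induction
  hypothesis applies.\<close>

lemma Ck_on_compose: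
  fixes h :: "'a::euclidean_space \<Rightarrow> 'b::euclidean_space" and F :: "'b \<Rightarrow> 'c::real_normed_vector"
  assumes "open S" "open V" and hV: "\<And>x. x \<in> S \<Longrightarrow> h x \<in> V"
  shows "Ck_on k S h \<Longrightarrow> Ck_on k V F \<Longrightarrow> Ck_on k S (\<lambda>x. F (h x))"
proof (induction k arbitrary: F)
  case 0 then show ?case using hV by (auto intro: continuous_on_compose2)
next
  case (Suc k)
  have hd: "((\<lambda>x. F (h x)) has_derivative
      (\<lambda>v. frechet_derivative F (at (h x)) (frechet_derivative h (at x) v))) (at x)" if "x \<in> S" for x
    by (rule has_derivative_compose[OF frechet_derivative_worksI frechet_derivative_worksI])
      (use Suc.prems that hV in auto)
  have "Ck_on k S (\<lambda>x. frechet_derivative (\<lambda>x. F (h x)) (at x) v)" for v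
  proof (rule Ck_on_cong_imp[OF assms(1)])
    show "Ck_on k S (\<lambda>x. \<Sum>b\<in>Basis. (frechet_derivative h (at x) v \<bullet> b) *\<^sub>R frechet_derivative F (at (h x)) b)"
      by (intro Ck_on_sum Ck_on_bilinear[OF _ bounded_bilinear_scaleR] assms Suc.IH
            Ck_on_bounded_linear[OF _ bounded_linear_inner_left] Ck_on_SucD[OF Suc.prems(1)])
         (use Suc.prems in auto)
    show "(\<Sum>b\<in>Basis. (frechet_derivative h (at x) v \<bullet> b) *\<^sub>R frechet_derivative F (at (h x)) b)
        = frechet_derivative (\<lambda>x. F (h x)) (at x) v" if x: "x \<in> S" for x
    proof -
      have "linear (frechet_derivative F (at (h x)))"
        using Suc.prems x hV by (auto intro!: linear_frechet_derivative)
      then have "frechet_derivative F (at (h x)) (\<Sum>b\<in>Basis. (frechet_derivative h (at x) v \<bullet> b) *\<^sub>R b)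
         = (\<Sum>b\<in>Basis. (frechet_derivative h (at x) v \<bullet> b) *\<^sub>R frechet_derivative F (at (h x)) b)"
        by (simp add: linear_sum linear_cmul)
      then show ?thesis
        by (subst frechet_derivative_eqI[OF hd[OF x]]) (simp add: euclidean_representation)
    qed
  qed
  then show ?case using hd by (auto simp: differentiable_def)
qed

lemma Ck_on_exp: "Ck_on k UNIV (exp :: complex \<Rightarrow> complex)"
proof (induction k)
  case 0 then show ?case by (auto intro: continuous_intros)
next
  case (Suc k)
  have hd: "(exp has_derivative (\<lambda>v. exp x * v)) (at x)" for x :: complex
    using DERIV_exp[of x] by (simp add: has_field_derivative_def)
  have "frechet_derivative exp (at x) v = exp x * v" for x v :: complex
    by (simp add: frechet_derivative_eqI[OF hd])
  then show ?case
    using Suc hd by (auto simp: differentiable_def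
        intro!: Ck_on_bounded_linear[OF _ bounded_linear_mult_left])
qed

lemma Ck_on_inverse: "Ck_on k (- {0}) (inverse :: complex \<Rightarrow> complex)"
proof (induction k)
  case 0 then show ?case by (auto intro: continuous_intros)
next
  case (Suc k)
  have hd: "(inverse has_derivative ((*) (- (inverse x * inverse x)))) (at x)" if "x \<noteq> 0" for x :: complex
    using DERIV_inverse[OF that] by (simp add: has_field_derivative_def power2_eq_square numeral_2_eq_2)
  have "Ck_on k (-{0}) (\<lambda>x. frechet_derivative inverse (at x) v)" for v :: complex
  proof (rule Ck_on_cong_imp[rotated 2])
    show "Ck_on k (-{0}) (\<lambda>x::complex. - v * (inverse x * inverse x))"
      by (intro Ck_on_bounded_linear[OF _ bounded_linear_mult_right] Ck_on_bilinear[OF _ bounded_bilinear_mult] Suc) auto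
    show "- v * (inverse x * inverse x) = frechet_derivative inverse (at x) v" if "x \<in> -{0}" for x :: complex
      using that by (simp add: frechet_derivative_eqI[OF hd[of x]])
  qed auto
  then show ?case using hd by (auto simp: differentiable_def)
qed

section \<open>Closure properties of smooth functions\<close>

lemma smooth_on_const [simp]: "smooth_on S (\<lambda>x. c)"
  by (simp add: smooth_on_def)

lemma smooth_on_add: "open S \<Longrightarrow> smooth_on S f \<Longrightarrow> smooth_on S g \<Longrightarrow> smooth_on S (\<lambda>x. f x + g x)"
  by (simp add: smooth_on_def Ck_on_add)

lemma smooth_on_bounded_linear:
  "open S \<Longrightarrow> bounded_linear L \<Longrightarrow> smooth_on S f \<Longrightarrow> smooth_on S (\<lambda>x. L (f x))"
  by (simp add: smooth_on_def Ck_on_bounded_linear)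

lemma smooth_on_bilinear:
  "open S \<Longrightarrow> bounded_bilinear B \<Longrightarrow> smooth_on S f \<Longrightarrow> smooth_on S g \<Longrightarrow> smooth_on S (\<lambda>x. B (f x) (g x))"
  by (simp add: smooth_on_def Ck_on_bilinear)

lemma smooth_on_sum:
  "open S \<Longrightarrow> (\<And>i. i \<in> I \<Longrightarrow> smooth_on S (f i)) \<Longrightarrow> smooth_on S (\<lambda>x. \<Sum>i\<in>I. f i x)"
  by (simp add: smooth_on_def Ck_on_sum)

lemma smooth_on_compose:
  fixes h :: "'a::euclidean_space \<Rightarrow> 'b::euclidean_space" and F :: "'b \<Rightarrow> 'c::real_normed_vector"
  assumes "open S" "open V" "\<And>x. x \<in> S \<Longrightarrow> h x \<in> V" "smooth_on S h" "smooth_on V F"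
  shows "smooth_on S (\<lambda>x. F (h x))"
  using Ck_on_compose[of S V h _ F] assms unfolding smooth_on_def by blast

lemma smooth_on_mult:
  fixes f g :: "'a::euclidean_space \<Rightarrow> 'b::real_normed_algebra"
  shows "open S \<Longrightarrow> smooth_on S f \<Longrightarrow> smooth_on S g \<Longrightarrow> smooth_on S (\<lambda>x. f x * g x)"
  by (rule smooth_on_bilinear[OF _ bounded_bilinear_mult])

lemma smooth_on_minus: "open S \<Longrightarrow> smooth_on S f \<Longrightarrow> smooth_on S (\<lambda>x. - f x)"
  by (rule smooth_on_bounded_linear[OF _ bounded_linear_minus[OF bounded_linear_ident]])

lemma smooth_on_diff: "open S \<Longrightarrow> smooth_on S f \<Longrightarrow> smooth_on S g \<Longrightarrow> smooth_on S (\<lambda>x. f x - g x)"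
  using smooth_on_add[of S f "\<lambda>x. - g x"] smooth_on_minus by force

lemma smooth_on_prod:
  fixes f :: "'i \<Rightarrow> 'a::euclidean_space \<Rightarrow> complex"
  shows "open S \<Longrightarrow> (\<And>i. i \<in> I \<Longrightarrow> smooth_on S (f i)) \<Longrightarrow> smooth_on S (\<lambda>x. \<Prod>i\<in>I. f i x)"
  by (induction I rule: infinite_finite_induct) (auto intro!: smooth_on_mult)

lemma smooth_on_power:
  fixes f :: "'a::euclidean_space \<Rightarrow> complex"
  shows "open S \<Longrightarrow> smooth_on S f \<Longrightarrow> smooth_on S (\<lambda>x. f x ^ k)"
  by (induction k) (auto intro!: smooth_on_mult)

lemma smooth_on_cnj: "open S \<Longrightarrow> smooth_on S f \<Longrightarrow> smooth_on S (\<lambda>x. cnj (f x))"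
  by (rule smooth_on_bounded_linear[OF _ bounded_linear_cnj])

lemma smooth_on_Re: "open S \<Longrightarrow> smooth_on S f \<Longrightarrow> smooth_on S (\<lambda>x. Re (f x))"
  by (rule smooth_on_bounded_linear[OF _ bounded_linear_Re])

lemma smooth_on_of_real: "open S \<Longrightarrow> smooth_on S f \<Longrightarrow> smooth_on S (\<lambda>x. complex_of_real (f x))"
  by (rule smooth_on_bounded_linear[OF _ bounded_linear_of_real])

lemma smooth_on_exp:
  fixes f :: "'a::euclidean_space \<Rightarrow> complex"
  shows "open S \<Longrightarrow> smooth_on S f \<Longrightarrow> smooth_on S (\<lambda>x. exp (f x))"
  by (rule smooth_on_compose[of S UNIV]) (auto simp: smooth_on_def Ck_on_exp)

lemma smooth_on_inverse:
  fixes f :: "'a::euclidean_space \<Rightarrow> complex"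
  shows "open S \<Longrightarrow> smooth_on S f \<Longrightarrow> (\<And>x. x \<in> S \<Longrightarrow> f x \<noteq> 0) \<Longrightarrow> smooth_on S (\<lambda>x. inverse (f x))"
  by (rule smooth_on_compose[of S "-{0}"]) (auto simp: smooth_on_def Ck_on_inverse)

lemma smooth_on_linear:
  fixes L :: "'a::euclidean_space \<Rightarrow> 'b::real_normed_vector"
  assumes "open S" "bounded_linear L" shows "smooth_on S L"
proof -
  have "frechet_derivative L (at x) = L" for x
    by (rule frechet_derivative_eqI) (rule bounded_linear_imp_has_derivative[OF assms(2)])
  then have "Ck_on k S L" for k
    by (cases k) (auto intro: bounded_linear.continuous_on[OF assms(2) continuous_on_id]
        bounded_linear_imp_differentiable assms)
  then show ?thesis by (simp add: smooth_on_def)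
qed

lemma smooth_on_vec:
  fixes f :: "'a::euclidean_space \<Rightarrow> complex^'n"
  assumes "open S" "\<And>i. smooth_on S (\<lambda>x. f x $ i)"
  shows "smooth_on S f"
proof -
  have "smooth_on S (\<lambda>x. \<Sum>i\<in>UNIV. axis i (f x $ i))"
  proof (intro smooth_on_sum assms)
    fix i :: 'n
    have "bounded_linear (axis i :: complex \<Rightarrow> complex^'n)"
      by (intro linear_conv_bounded_linear[THEN iffD1] linearI) (auto simp: axis_def vec_eq_iff)
    then show "smooth_on S (\<lambda>x. axis i (f x $ i) :: complex^'n)"
      using smooth_on_bounded_linear[OF assms(1) _ assms(2)] by blast
  qed
  moreover have "(\<Sum>i\<in>UNIV. axis i (f x $ i)) = f x" for x
    by (simp add: vec_eq_iff axis_def)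
  ultimately show ?thesis by simp
qed

lemmas smooth_intros = smooth_on_add smooth_on_mult smooth_on_minus smooth_on_diff
  smooth_on_sum smooth_on_prod smooth_on_power smooth_on_cnj smooth_on_exp smooth_on_of_real

subsection \<open>Symmetry of second derivatives\<close>

text \<open>The mean value theorem is applied once in each direction. The second difference on the
  left is symmetric in \<open>u\<close> and \<open>v\<close>, while the derivative on the right
  depends on their order; comparing the two orders proves that directional derivatives
  commute.\<close>

lemma second_difference_mvt:
  fixes f :: "'a::euclidean_space \<Rightarrow> real"
  assumes f: "\<And>y. y \<in> S \<Longrightarrow> f differentiable (at y)"
    and fu: "\<And>y. y \<in> S \<Longrightarrow> (\<lambda>y. frechet_derivative f (at y) u) differentiable (at y)"
    and h: "h > 0" and box: "\<And>s t. 0 \<le> s \<Longrightarrow> s \<le> h \<Longrightarrow> 0 \<le> t \<Longrightarrow> t \<le> h \<Longrightarrow> x + s *\<^sub>R u + t *\<^sub>R v \<in> S"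
  shows "\<exists>s t. 0 \<le> s \<and> s \<le> h \<and> 0 \<le> t \<and> t \<le> h \<and>
     f (x + h *\<^sub>R u + h *\<^sub>R v) - f (x + h *\<^sub>R u) - f (x + h *\<^sub>R v) + f x =
     h * h * frechet_derivative (\<lambda>y. frechet_derivative f (at y) u) (at (x + s *\<^sub>R u + t *\<^sub>R v)) v"
proof -
  define F where "F y = frechet_derivative f (at y) u" for y
  define p where "p s = f (x + s *\<^sub>R u + h *\<^sub>R v) - f (x + s *\<^sub>R u)" for s
  have line: "((\<lambda>s. f (a + s *\<^sub>R w)) has_real_derivative frechet_derivative f (at (a + s *\<^sub>R w)) w) (at s)"
    if "a + s *\<^sub>R w \<in> S" "\<And>y. y \<in> S \<Longrightarrow> f differentiable (at y)" for a s w and f :: "'a \<Rightarrow> real"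
  proof -
    have "((\<lambda>s. a + s *\<^sub>R w) has_derivative (\<lambda>t. t *\<^sub>R w)) (at s)"
      by (auto intro!: derivative_eq_intros)
    from has_derivative_compose[OF this frechet_derivative_worksI[OF that(2)[OF that(1)]]]
    have 1: "((\<lambda>s. f (a + s *\<^sub>R w)) has_derivative (\<lambda>t. frechet_derivative f (at (a + s *\<^sub>R w)) (t *\<^sub>R w))) (at s)" .
    have "linear (frechet_derivative f (at (a + s *\<^sub>R w)))"
      using that by (auto intro!: linear_frechet_derivative)
    then have "frechet_derivative f (at (a + s *\<^sub>R w)) (t *\<^sub>R w) = frechet_derivative f (at (a + s *\<^sub>R w)) w * t" for t
      by (simp add: linear_cmul)
    with 1 show ?thesis by (simp add: has_field_derivative_def)
  qed
  have dp: "(p has_real_derivative (F (x + s *\<^sub>R u + h *\<^sub>R v) - F (x + s *\<^sub>R u))) (at s)" if "0 \<le> s" "s \<le> h" for s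
  proof -
    have "((\<lambda>s. f ((x + h *\<^sub>R v) + s *\<^sub>R u)) has_real_derivative F ((x + h *\<^sub>R v) + s *\<^sub>R u)) (at s)"
      unfolding F_def using box[of s h] that h by (intro line f) (auto simp: algebra_simps)
    moreover have "((\<lambda>s. f (x + s *\<^sub>R u)) has_real_derivative F (x + s *\<^sub>R u)) (at s)"
      unfolding F_def using box[of s 0] that h by (intro line f) (auto simp: algebra_simps)
    ultimately show ?thesis unfolding p_def by (auto intro!: derivative_eq_intros simp: algebra_simps)
  qed
  obtain s where s: "0 < s" "s < h" "p h - p 0 = (h - 0) * (F (x + s *\<^sub>R u + h *\<^sub>R v) - F (x + s *\<^sub>R u))"
    using MVT2[of 0 h p "\<lambda>s. F (x + s *\<^sub>R u + h *\<^sub>R v) - F (x + s *\<^sub>R u)"] dp h by auto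
  have dq: "((\<lambda>t. F (x + s *\<^sub>R u + t *\<^sub>R v)) has_real_derivative frechet_derivative F (at (x + s *\<^sub>R u + t *\<^sub>R v)) v) (at t)"
    if "0 \<le> t" "t \<le> h" for t
    using box[of s t] that s fu unfolding F_def by (intro line) auto
  obtain t where t: "0 < t" "t < h" "F (x + s *\<^sub>R u + h *\<^sub>R v) - F (x + s *\<^sub>R u + 0 *\<^sub>R v) =
      (h - 0) * frechet_derivative F (at (x + s *\<^sub>R u + t *\<^sub>R v)) v"
    using MVT2[of 0 h "\<lambda>t. F (x + s *\<^sub>R u + t *\<^sub>R v)"
        "\<lambda>t. frechet_derivative F (at (x + s *\<^sub>R u + t *\<^sub>R v)) v", OF h dq] that
    by (metis (no_types, lifting))
  have "f (x + h *\<^sub>R u + h *\<^sub>R v) - f (x + h *\<^sub>R u) - f (x + h *\<^sub>R v) + f x = p h - p 0"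
    by (simp add: p_def)
  also have "\<dots> = h * h * frechet_derivative F (at (x + s *\<^sub>R u + t *\<^sub>R v)) v"
    using s(3) t(3) by simp
  finally show ?thesis using s t unfolding F_def by (intro exI[of _ s] exI[of _ t]) auto
qed

lemma frechet_commute_real:
  fixes f :: "'a::euclidean_space \<Rightarrow> real"
  assumes "open S" "smooth_on S f" "x \<in> S"
  shows "frechet_derivative (\<lambda>y. frechet_derivative f (at y) u) (at x) v =
         frechet_derivative (\<lambda>y. frechet_derivative f (at y) v) (at x) u"
proof (rule ccontr)
  define P where "P y = frechet_derivative (\<lambda>y. frechet_derivative f (at y) u) (at y) v" for y
  define Q where "Q y = frechet_derivative (\<lambda>y. frechet_derivative f (at y) v) (at y) u" for y
  assume "\<not> ?thesis"
  then have ne: "P x \<noteq> Q x" by (simp add: P_def Q_def)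
  \<comment> \<open>Near \<open>x\<close> both \<open>P\<close> and \<open>Q\<close> move by less
    than half of their distance at \<open>x\<close>, so they cannot take a common value there; the
    second difference produces one.\<close>
  define e where "e = \<bar>P x - Q x\<bar> / 2"
  have e: "e > 0" using ne by (simp add: e_def)
  have "continuous_on S P" "continuous_on S Q"
    unfolding P_def Q_def
    using smooth_on_continuous[OF smooth_on_frechet[OF smooth_on_frechet[OF assms(2)]]] by blast+
  then have cont: "isCont P x" "isCont Q x"
    using assms(1,3) by (simp_all add: continuous_on_eq_continuous_at)
  have cd: "\<exists>d>0. \<forall>y. dist y x < d \<longrightarrow> dist (h y) (h x) < e" if "isCont h x" for h :: "'a \<Rightarrow> real"
    using that e unfolding continuous_at_eps_delta by blast
  obtain d1 where d1: "d1 > 0" "\<And>y. dist y x < d1 \<Longrightarrow> dist (P y) (P x) < e"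
    using cd[OF cont(1)] by blast
  obtain d2 where d2: "d2 > 0" "\<And>y. dist y x < d2 \<Longrightarrow> dist (Q y) (Q x) < e"
    using cd[OF cont(2)] by blast
  note d = d1(1) d2(1) d1(2) d2(2)
  obtain r where r: "r > 0" "ball x r \<subseteq> S" using assms openE by blast
  define m where "m = min r (min d1 d2)"
  \<comment> \<open>This keeps the whole parallelogram spanned by \<open>h *\<^sub>R u\<close> and
    \<open>h *\<^sub>R v\<close> within distance \<open>m\<close> of \<open>x\<close>; the
    \<open>+ 1\<close> covers the case in which both directions are zero.\<close>
  define h where "h = m / (2 * (norm u + norm v + 1))"
  have m: "m > 0" using r d by (simp add: m_def)
  have np: "norm u + norm v + 1 > 0" by (simp add: add_nonneg_pos)
  have h: "h > 0" using m np by (simp add: h_def)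
  have near: "dist (x + s *\<^sub>R u + t *\<^sub>R v) x < m" if "0 \<le> s" "s \<le> h" "0 \<le> t" "t \<le> h" for s t
  proof -
    have "dist (x + s *\<^sub>R u + t *\<^sub>R v) x \<le> norm (s *\<^sub>R u) + norm (t *\<^sub>R v)"
      using norm_triangle_ineq[of "s *\<^sub>R u" "t *\<^sub>R v"] by (simp add: dist_norm add.assoc)
    also have "\<dots> \<le> h * norm u + h * norm v"
      using that by (intro add_mono) (auto intro: mult_right_mono)
    also have "\<dots> \<le> h * (norm u + norm v + 1)" using h by (simp add: algebra_simps)
    also have "\<dots> = m / 2" using np by (simp add: h_def field_simps)
    also have "\<dots> < m" using m by simp
    finally show ?thesis .
  qed
  have inS: "x + s *\<^sub>R u + t *\<^sub>R v \<in> S" if "0 \<le> s" "s \<le> h" "0 \<le> t" "t \<le> h" for s t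
    using near[OF that] r by (auto simp: m_def dist_commute)
  have inS': "x + s *\<^sub>R v + t *\<^sub>R u \<in> S" if "0 \<le> s" "s \<le> h" "0 \<le> t" "t \<le> h" for s t
    using inS[OF that(3,4,1,2)] by (simp add: algebra_simps)
  have df: "\<And>y. y \<in> S \<Longrightarrow> f differentiable (at y)"
    "\<And>y w. y \<in> S \<Longrightarrow> (\<lambda>y. frechet_derivative f (at y) w) differentiable (at y)"
    using smooth_on_differentiable smooth_on_frechet assms by blast+
  obtain s t where st: "0 \<le> s" "s \<le> h" "0 \<le> t" "t \<le> h"
     "f (x + h *\<^sub>R u + h *\<^sub>R v) - f (x + h *\<^sub>R u) - f (x + h *\<^sub>R v) + f x =
     h * h * P (x + s *\<^sub>R u + t *\<^sub>R v)"
    using second_difference_mvt[of S f u h x v] df h inS unfolding P_def by blast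
  obtain s' t' where st': "0 \<le> s'" "s' \<le> h" "0 \<le> t'" "t' \<le> h"
     "f (x + h *\<^sub>R v + h *\<^sub>R u) - f (x + h *\<^sub>R v) - f (x + h *\<^sub>R u) + f x =
     h * h * Q (x + s' *\<^sub>R v + t' *\<^sub>R u)"
    using second_difference_mvt[of S f v h x u] df h inS' unfolding Q_def by blast
  have "h * h * P (x + s *\<^sub>R u + t *\<^sub>R v) = h * h * Q (x + s' *\<^sub>R v + t' *\<^sub>R u)"
    using st(5) st'(5) by (simp add: algebra_simps)
  then have "P (x + s *\<^sub>R u + t *\<^sub>R v) = Q (x + s' *\<^sub>R v + t' *\<^sub>R u)" using h by simp
  moreover have "dist (P (x + s *\<^sub>R u + t *\<^sub>R v)) (P x) < e"
    using near[OF st(1-4)] d(3) by (simp add: m_def)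
  moreover have "dist (Q (x + s' *\<^sub>R v + t' *\<^sub>R u)) (Q x) < e"
    using near[OF st'(3,4,1,2)] d(4) by (simp add: m_def algebra_simps)
  moreover have "\<bar>P x - Q x\<bar> = 2 * e" by (simp add: e_def)
  ultimately show False unfolding dist_real_def by (smt (verit))
qed

lemma frechet_derivative_linear_comp:
  assumes "bounded_linear L" "f differentiable (at x)"
  shows "frechet_derivative (\<lambda>y. L (f y)) (at x) v = L (frechet_derivative f (at x) v)"
  by (subst frechet_derivative_eqI[OF bounded_linear.has_derivative[OF assms(1) frechet_derivative_worksI[OF assms(2)]]]) simp

lemma frechet_derivative_cong_open:
  assumes "open S" "x \<in> S" "\<And>y. y \<in> S \<Longrightarrow> f y = g y"
  shows "frechet_derivative f (at x) = frechet_derivative g (at x)"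
proof -
  have "(f has_derivative D) (at x) \<longleftrightarrow> (g has_derivative D) (at x)" for D
    using has_derivative_transform_within_open[OF _ assms(1,2), of f D UNIV g]
      has_derivative_transform_within_open[OF _ assms(1,2), of g D UNIV f] assms(3) by auto
  then show ?thesis by (simp add: frechet_derivative_def)
qed

lemma frechet_commute:
  fixes f :: "'a::euclidean_space \<Rightarrow> complex"
  assumes S: "open S" and f: "smooth_on S f" and x: "x \<in> S"
  shows "frechet_derivative (\<lambda>y. frechet_derivative f (at y) u) (at x) v =
         frechet_derivative (\<lambda>y. frechet_derivative f (at y) v) (at x) u"
proof -
  have *: "L (frechet_derivative (\<lambda>y. frechet_derivative f (at y) u) (at x) v) =
         L (frechet_derivative (\<lambda>y. frechet_derivative f (at y) v) (at x) u)"
    if L: "bounded_linear L" for L :: "complex \<Rightarrow> real"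
  proof -
    have 1: "L (frechet_derivative (\<lambda>y. frechet_derivative f (at y) u) (at x) v) =
      frechet_derivative (\<lambda>y. frechet_derivative (\<lambda>z. L (f z)) (at y) u) (at x) v" for u v
    proof -
      have "L (frechet_derivative (\<lambda>y. frechet_derivative f (at y) u) (at x) v) =
        frechet_derivative (\<lambda>y. L (frechet_derivative f (at y) u)) (at x) v"
        using frechet_derivative_linear_comp[OF L smooth_on_differentiable[OF smooth_on_frechet[OF f] x]] by simp
      also have "\<dots> = frechet_derivative (\<lambda>y. frechet_derivative (\<lambda>z. L (f z)) (at y) u) (at x) v"
        by (subst frechet_derivative_cong_open[OF S x])
          (use frechet_derivative_linear_comp[OF L smooth_on_differentiable[OF f]] in auto)
      finally show ?thesis .
    qed
    show ?thesis unfolding 1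
      by (rule frechet_commute_real[OF S smooth_on_bounded_linear[OF S L f] x])
  qed
  show ?thesis
    using *[OF bounded_linear_Re] *[OF bounded_linear_Im] by (simp add: complex_eq_iff)
qed

section \<open>Wirtinger derivatives\<close>

text \<open>Only the diagonal entries of the complex Hessian get an abbreviation: in a frame that
  diagonalizes $g'$ the linearized operator is a combination of these.\<close>

definition ddbar :: "'n::finite \<Rightarrow> (complex^'n \<Rightarrow> complex) \<Rightarrow> complex^'n \<Rightarrow> complex" where
  "ddbar m F z = dz m (dzbar m F) z"

lemma frechet_add:
  "f differentiable (at x) \<Longrightarrow> g differentiable (at x) \<Longrightarrow>
   frechet_derivative (\<lambda>x. f x + g x) (at x) v = frechet_derivative f (at x) v + frechet_derivative g (at x) v"
  by (subst frechet_derivative_eqI[OF has_derivative_add[OF frechet_derivative_worksI frechet_derivative_worksI]]) auto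

lemma frechet_mult:
  fixes f g :: "'a::real_normed_vector \<Rightarrow> complex"
  shows "f differentiable (at x) \<Longrightarrow> g differentiable (at x) \<Longrightarrow>
   frechet_derivative (\<lambda>x. f x * g x) (at x) v = f x * frechet_derivative g (at x) v + frechet_derivative f (at x) v * g x"
  by (subst frechet_derivative_eqI[OF has_derivative_mult[OF frechet_derivative_worksI frechet_derivative_worksI]]) auto

lemma frechet_exp:
  fixes f :: "'a::real_normed_vector \<Rightarrow> complex"
  assumes "f differentiable (at x)"
  shows "(\<lambda>x. exp (f x)) differentiable (at x)"
   "frechet_derivative (\<lambda>x. exp (f x)) (at x) v = exp (f x) * frechet_derivative f (at x) v"
proof -
  have "(exp has_derivative ((*) (exp (f x)))) (at (f x))"
    using DERIV_exp[of "f x"] by (simp add: has_field_derivative_def)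
  from has_derivative_compose[OF frechet_derivative_worksI[OF assms] this]
  have *: "((\<lambda>x. exp (f x)) has_derivative (\<lambda>v. exp (f x) * frechet_derivative f (at x) v)) (at x)" .
  then show "(\<lambda>x. exp (f x)) differentiable (at x)"
    "frechet_derivative (\<lambda>x. exp (f x)) (at x) v = exp (f x) * frechet_derivative f (at x) v"
    by (auto simp: differentiable_def frechet_derivative_eqI[OF *])
qed

lemma dz_const [simp]: "dz j (\<lambda>w. c) z = 0" "dzbar j (\<lambda>w. c) z = 0"
  by (simp_all add: dz_def dzbar_def)

lemma dz_add0:
  assumes "F differentiable (at z)" "G differentiable (at z)"
  shows "dz j (\<lambda>w. F w + G w) z = dz j F z + dz j G z"
    "dzbar j (\<lambda>w. F w + G w) z = dzbar j F z + dzbar j G z"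
  by (simp_all add: dz_def dzbar_def frechet_add assms field_simps)

lemma dz_mult0:
  assumes "F differentiable (at z)" "G differentiable (at z)"
  shows "dz j (\<lambda>w. F w * G w) z = F z * dz j G z + dz j F z * G z"
    "dzbar j (\<lambda>w. F w * G w) z = F z * dzbar j G z + dzbar j F z * G z"
  by (simp_all add: dz_def dzbar_def frechet_mult assms field_simps)

lemma dz_exp0:
  assumes "F differentiable (at z)"
  shows "dz j (\<lambda>w. exp (F w)) z = exp (F z) * dz j F z"
    "dzbar j (\<lambda>w. exp (F w)) z = exp (F z) * dzbar j F z"
  by (simp_all add: dz_def dzbar_def frechet_exp assms field_simps)

lemma dz_cnj0:
  assumes "F differentiable (at z)"
  shows "dz j (\<lambda>w. cnj (F w)) z = cnj (dzbar j F z)"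
    "dzbar j (\<lambda>w. cnj (F w)) z = cnj (dz j F z)"
  by (simp_all add: dz_def dzbar_def frechet_derivative_linear_comp[OF bounded_linear_cnj assms])

text \<open>The open set is fixed once so that smoothness on it can be discharged by simplification
  when long products are differentiated.\<close>

locale open_domain =
  fixes W :: "(complex^'n::finite) set"
  assumes open_W [simp]: "open W"
begin

abbreviation "sm \<equiv> smooth_on W"

lemma smD: "sm F \<Longrightarrow> z \<in> W \<Longrightarrow> F differentiable (at z)"
  by (rule smooth_on_differentiable)

lemmas sm_intros [simp, intro] = smooth_on_const[of W] smooth_intros[OF open_W]

lemma dz_cong: "z \<in> W \<Longrightarrow> (\<And>w. w \<in> W \<Longrightarrow> F w = G w) \<Longrightarrow> dz j F z = dz j G z"
  and dzbar_cong: "z \<in> W \<Longrightarrow> (\<And>w. w \<in> W \<Longrightarrow> F w = G w) \<Longrightarrow> dzbar j F z = dzbar j G z"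
  using frechet_derivative_cong_open[OF open_W, of z F G] by (simp_all add: dz_def dzbar_def)

lemma sm_cong: "(\<And>w. w \<in> W \<Longrightarrow> F w = G w) \<Longrightarrow> sm F \<longleftrightarrow> sm G"
  by (rule smooth_on_cong[OF open_W])

lemma sm_dz [simp, intro]: "sm F \<Longrightarrow> sm (dz j F)"
proof -
  assume F: "sm F"
  have "sm (\<lambda>z. (1/2) * (frechet_derivative F (at z) (axis j 1)
               + (- \<i>) * frechet_derivative F (at z) (axis j \<i>)))"
    by (intro sm_intros smooth_on_frechet F)
  moreover have "dz j F = (\<lambda>z. (1/2) * (frechet_derivative F (at z) (axis j 1)
               + (- \<i>) * frechet_derivative F (at z) (axis j \<i>)))"
    by (rule ext) (simp add: dz_def)
  ultimately show ?thesis by simp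
qed

lemma sm_dzbar [simp, intro]: "sm F \<Longrightarrow> sm (dzbar j F)"
proof -
  assume F: "sm F"
  have "sm (\<lambda>z. (1/2) * (frechet_derivative F (at z) (axis j 1)
               + \<i> * frechet_derivative F (at z) (axis j \<i>)))"
    by (intro sm_intros smooth_on_frechet F)
  moreover have "dzbar j F = (\<lambda>z. (1/2) * (frechet_derivative F (at z) (axis j 1)
               + \<i> * frechet_derivative F (at z) (axis j \<i>)))"
    by (rule ext) (simp add: dzbar_def)
  ultimately show ?thesis by simp
qed

lemma d_add: "sm F \<Longrightarrow> sm G \<Longrightarrow> z \<in> W \<Longrightarrow> dz j (\<lambda>w. F w + G w) z = dz j F z + dz j G z"
    "sm F \<Longrightarrow> sm G \<Longrightarrow> z \<in> W \<Longrightarrow> dzbar j (\<lambda>w. F w + G w) z = dzbar j F z + dzbar j G z"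
  by (intro dz_add0 smD; assumption)+

lemma d_mult: "sm F \<Longrightarrow> sm G \<Longrightarrow> z \<in> W \<Longrightarrow> dz j (\<lambda>w. F w * G w) z = F z * dz j G z + dz j F z * G z"
    "sm F \<Longrightarrow> sm G \<Longrightarrow> z \<in> W \<Longrightarrow> dzbar j (\<lambda>w. F w * G w) z = F z * dzbar j G z + dzbar j F z * G z"
  by (intro dz_mult0 smD; assumption)+

lemma d_cmult: "sm F \<Longrightarrow> z \<in> W \<Longrightarrow> dz j (\<lambda>w. c * F w) z = c * dz j F z"
    "sm F \<Longrightarrow> z \<in> W \<Longrightarrow> dzbar j (\<lambda>w. c * F w) z = c * dzbar j F z"
  by (simp_all add: d_mult)

lemma d_minus: "sm F \<Longrightarrow> z \<in> W \<Longrightarrow> dz j (\<lambda>w. - F w) z = - dz j F z"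
    "sm F \<Longrightarrow> z \<in> W \<Longrightarrow> dzbar j (\<lambda>w. - F w) z = - dzbar j F z"
  using d_cmult[of F z j "-1"] by simp_all

lemma d_diff: "sm F \<Longrightarrow> sm G \<Longrightarrow> z \<in> W \<Longrightarrow> dz j (\<lambda>w. F w - G w) z = dz j F z - dz j G z"
    "sm F \<Longrightarrow> sm G \<Longrightarrow> z \<in> W \<Longrightarrow> dzbar j (\<lambda>w. F w - G w) z = dzbar j F z - dzbar j G z"
  using d_add[of F "\<lambda>w. - G w" z j] by (simp_all add: d_minus)

lemma d_sum: "(\<And>i. i \<in> I \<Longrightarrow> sm (F i)) \<Longrightarrow> z \<in> W \<Longrightarrow> dz j (\<lambda>w. \<Sum>i\<in>I. F i w) z = (\<Sum>i\<in>I. dz j (F i) z)"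
    "(\<And>i. i \<in> I \<Longrightarrow> sm (F i)) \<Longrightarrow> z \<in> W \<Longrightarrow> dzbar j (\<lambda>w. \<Sum>i\<in>I. F i w) z = (\<Sum>i\<in>I. dzbar j (F i) z)"
  by (induction I rule: infinite_finite_induct) (auto simp: d_add)

lemma d_exp: "sm F \<Longrightarrow> z \<in> W \<Longrightarrow> dz j (\<lambda>w. exp (F w)) z = exp (F z) * dz j F z"
    "sm F \<Longrightarrow> z \<in> W \<Longrightarrow> dzbar j (\<lambda>w. exp (F w)) z = exp (F z) * dzbar j F z"
  by (intro dz_exp0 smD; assumption)+

lemma d_cnj: "sm F \<Longrightarrow> z \<in> W \<Longrightarrow> dz j (\<lambda>w. cnj (F w)) z = cnj (dzbar j F z)"
    "sm F \<Longrightarrow> z \<in> W \<Longrightarrow> dzbar j (\<lambda>w. cnj (F w)) z = cnj (dz j F z)"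
  by (intro dz_cnj0 smD; assumption)+

lemma d_real: "sm F \<Longrightarrow> (\<And>w. w \<in> W \<Longrightarrow> cnj (F w) = F w) \<Longrightarrow> z \<in> W \<Longrightarrow> dzbar j F z = cnj (dz j F z)"
  by (metis d_cnj(2) dzbar_cong)

text \<open>Both Wirtinger operators are complex combinations of two directional derivatives, so they
  commute because directional derivatives do.\<close>

lemma wirtinger_commute:
  assumes "sm F" "z \<in> W"
  defines "D \<equiv> \<lambda>s j F z. (frechet_derivative F (at z) (axis j 1)
               + s * \<i> * frechet_derivative F (at z) (axis j \<i>)) / 2"
  shows "D s i (D t j F) z = D t j (D s i F) z"
proof -
  have *: "frechet_derivative (D t j F) (at z) v =
     (frechet_derivative (\<lambda>y. frechet_derivative F (at y) (axis j 1)) (at z) v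
       + t * \<i> * frechet_derivative (\<lambda>y. frechet_derivative F (at y) (axis j \<i>)) (at z) v) / 2" for t j v
  proof -
    let ?A = "\<lambda>y. frechet_derivative F (at y) (axis j 1)"
    let ?B = "\<lambda>y. frechet_derivative F (at y) (axis j \<i>)"
    have A: "?A differentiable (at z)" and B: "?B differentiable (at z)"
      by (auto intro!: smD smooth_on_frechet assms)
    have "((\<lambda>y. (?A y + t * \<i> * ?B y) / 2) has_derivative
       (\<lambda>v. (frechet_derivative ?A (at z) v + t * \<i> * frechet_derivative ?B (at z) v) / 2)) (at z)"
      using frechet_derivative_worksI[OF A] frechet_derivative_worksI[OF B]
      by (auto intro!: derivative_eq_intros)
    then show ?thesis
      unfolding D_def by (subst frechet_derivative_eqI) auto
  qed
  have DE: "D s j F z = (frechet_derivative F (at z) (axis j 1)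
               + s * \<i> * frechet_derivative F (at z) (axis j \<i>)) / 2" for s j F z
    by (simp add: D_def)
  note c = frechet_commute[OF open_W assms(1,2)]
  show ?thesis
    unfolding DE[of s i "D t j F"] DE[of t j "D s i F"] *
    using c[of "axis i 1" "axis j 1"] c[of "axis i 1" "axis j \<i>"]
      c[of "axis i \<i>" "axis j 1"] c[of "axis i \<i>" "axis j \<i>"]
    by (simp add: field_simps)
qed

lemma d_commute:
  assumes "sm F" "z \<in> W"
  shows "dz i (dz j F) z = dz j (dz i F) z" "dzbar i (dzbar j F) z = dzbar j (dzbar i F) z"
    "dzbar i (dz j F) z = dz j (dzbar i F) z"
proof -
  have 1: "dz j F z = (frechet_derivative F (at z) (axis j 1)
               + (-1) * \<i> * frechet_derivative F (at z) (axis j \<i>)) / 2"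
    and 2: "dzbar j F z = (frechet_derivative F (at z) (axis j 1)
               + 1 * \<i> * frechet_derivative F (at z) (axis j \<i>)) / 2" for j F z
    by (simp_all add: dz_def dzbar_def)
  note w = wirtinger_commute[OF assms]
  have e: "dz j F = (\<lambda>z. (frechet_derivative F (at z) (axis j 1)
               + (-1) * \<i> * frechet_derivative F (at z) (axis j \<i>)) / 2)"
     "dzbar j F = (\<lambda>z. (frechet_derivative F (at z) (axis j 1)
               + 1 * \<i> * frechet_derivative F (at z) (axis j \<i>)) / 2)" for j F
    using 1 2 by (auto intro!: ext)
  show "dz i (dz j F) z = dz j (dz i F) z" unfolding e by (rule w)
  show "dzbar i (dzbar j F) z = dzbar j (dzbar i F) z" unfolding e by (rule w)
  show "dzbar i (dz j F) z = dz j (dzbar i F) z" unfolding e by (rule w)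
qed

lemma ddbar_alt: "sm F \<Longrightarrow> z \<in> W \<Longrightarrow> ddbar m F z = dzbar m (dz m F) z"
  by (simp add: ddbar_def d_commute)

lemma ddbar_cong: "z \<in> W \<Longrightarrow> (\<And>w. w \<in> W \<Longrightarrow> F w = G w) \<Longrightarrow> ddbar m F z = ddbar m G z"
  unfolding ddbar_def by (rule dz_cong) (auto intro: dzbar_cong)

lemma ddbar_add: "sm F \<Longrightarrow> sm G \<Longrightarrow> z \<in> W \<Longrightarrow> ddbar m (\<lambda>w. F w + G w) z = ddbar m F z + ddbar m G z"
  unfolding ddbar_def by (subst dz_cong[OF _ d_add(2)]) (auto simp: d_add)

lemma ddbar_mult: "sm F \<Longrightarrow> sm G \<Longrightarrow> z \<in> W \<Longrightarrow>
  ddbar m (\<lambda>w. F w * G w) z = F z * ddbar m G z + dz m F z * dzbar m G z + dzbar m F z * dz m G z + ddbar m F z * G z"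
  unfolding ddbar_def by (subst dz_cong[OF _ d_mult(2)]) (auto simp: d_add d_mult)

lemma ddbar_const [simp]: "ddbar m (\<lambda>w. c) z = 0"
proof -
  have "dzbar m (\<lambda>w. c) = (\<lambda>z. 0)" by (rule ext) simp
  then show ?thesis by (simp add: ddbar_def)
qed

lemma ddbar_cmult: "sm F \<Longrightarrow> z \<in> W \<Longrightarrow> ddbar m (\<lambda>w. c * F w) z = c * ddbar m F z"
  by (simp add: ddbar_mult)

lemma ddbar_minus: "sm F \<Longrightarrow> z \<in> W \<Longrightarrow> ddbar m (\<lambda>w. - F w) z = - ddbar m F z"
  using ddbar_cmult[of F z m "-1"] by simp

lemma ddbar_diff: "sm F \<Longrightarrow> sm G \<Longrightarrow> z \<in> W \<Longrightarrow> ddbar m (\<lambda>w. F w - G w) z = ddbar m F z - ddbar m G z"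
  using ddbar_add[of F "\<lambda>w. - G w" z m] by (simp add: ddbar_minus)

lemma ddbar_sum: "(\<And>i. i \<in> I \<Longrightarrow> sm (F i)) \<Longrightarrow> z \<in> W \<Longrightarrow> ddbar m (\<lambda>w. \<Sum>i\<in>I. F i w) z = (\<Sum>i\<in>I. ddbar m (F i) z)"
  by (induction I rule: infinite_finite_induct) (auto simp: ddbar_add)

lemma ddbar_exp: "sm F \<Longrightarrow> z \<in> W \<Longrightarrow> ddbar m (\<lambda>w. exp (F w)) z = exp (F z) * (ddbar m F z + dz m F z * dzbar m F z)"
  unfolding ddbar_def by (subst dz_cong[OF _ d_exp(2)]) (auto simp: d_mult d_exp algebra_simps)

lemma ddbar_cnj: "sm F \<Longrightarrow> z \<in> W \<Longrightarrow> ddbar m (\<lambda>w. cnj (F w)) z = cnj (ddbar m F z)"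
  unfolding ddbar_def
  by (subst dz_cong[OF _ d_cnj(2)]) (auto simp: d_cnj ddbar_def[symmetric] ddbar_alt)

lemma d_ddbar_commute:
  assumes "sm F" "z \<in> W"
  shows "dz j (ddbar m F) z = ddbar m (dz j F) z" "dzbar j (ddbar m F) z = ddbar m (dzbar j F) z"
proof -
  have b: "ddbar m F = dz m (dzbar m F)" by (rule ext) (simp add: ddbar_def)
  have "dz j (dz m (dzbar m F)) z = dz m (dz j (dzbar m F)) z" by (simp add: d_commute assms)
  also have "\<dots> = dz m (dzbar m (dz j F)) z"
    by (rule dz_cong) (auto simp: d_commute assms)
  finally show "dz j (ddbar m F) z = ddbar m (dz j F) z" by (simp add: b ddbar_def)
  have "dzbar j (dz m (dzbar m F)) z = dz m (dzbar j (dzbar m F)) z" by (simp add: d_commute assms)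
  also have "\<dots> = dz m (dzbar m (dzbar j F)) z"
    by (rule dz_cong) (auto simp: d_commute assms)
  finally show "dzbar j (ddbar m F) z = ddbar m (dzbar j F) z" by (simp add: b ddbar_def)
qed

text \<open>The symmetry of the fourth derivatives of u: it converts the twice differentiated
  equation, summed over all directions, into the linearized operator applied to the trace.\<close>

lemma ddbar_ddbar_commute:
  assumes "sm F" "z \<in> W"
  shows "ddbar j (ddbar m F) z = ddbar m (ddbar j F) z"
proof -
  have "ddbar j (ddbar m F) z = dz j (ddbar m (dzbar j F)) z"
    unfolding ddbar_def[of j "ddbar m F"] by (rule dz_cong) (auto simp: d_ddbar_commute assms)
  also have "\<dots> = ddbar m (dz j (dzbar j F)) z" by (simp add: d_ddbar_commute assms)
  also have "\<dots> = ddbar m (ddbar j F) z" by (rule ddbar_cong) (auto simp: assms ddbar_def)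
  finally show ?thesis .
qed

end

section \<open>The second derivative test at a local maximum\<close>

lemma second_derivative_nonpos:
  fixes g :: "real \<Rightarrow> real"
  assumes "e > 0" and d1: "\<And>t. \<bar>t\<bar> < e \<Longrightarrow> (g has_real_derivative g' t) (at t)"
    and d2: "(g' has_real_derivative c) (at 0)"
    and max: "\<And>t. \<bar>t\<bar> < e \<Longrightarrow> g t \<le> g 0"
  shows "g' 0 = 0 \<and> c \<le> 0"
proof
  show g0: "g' 0 = 0"
    by (rule DERIV_local_max[OF d1[of 0] \<open>e > 0\<close>]) (use assms in auto)
  show "c \<le> 0"
  proof (rule ccontr)
    assume "\<not> c \<le> 0"
    then obtain d where d: "d > 0" "\<And>h. 0 < h \<Longrightarrow> h < d \<Longrightarrow> g' 0 < g' (0 + h)"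
      using DERIV_pos_inc_right[OF d2] by auto
    define h where "h = min d e / 2"
    have h: "0 < h" "h < d" "h < e" using d \<open>e > 0\<close> by (auto simp: h_def)
    obtain z where z: "0 < z" "z < h" "g h - g 0 = (h - 0) * g' z"
      using MVT2[of 0 h g g'] h d1 by auto
    have "g' z > 0" using d(2)[of z] z h g0 by auto
    then have "g h > g 0" using z h by (metis diff_gt_0_iff_gt diff_zero mult_pos_pos)
    with max[of h] h show False by auto
  qed
qed

lemma frechet_local_max:
  fixes f :: "'a::euclidean_space \<Rightarrow> real"
  assumes "open S" "smooth_on S f" "x \<in> S" and max: "\<And>y. y \<in> S \<Longrightarrow> f y \<le> f x"
  shows "frechet_derivative f (at x) v = 0"
    "frechet_derivative (\<lambda>y. frechet_derivative f (at y) v) (at x) v \<le> 0"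
proof -
  obtain r where r: "r > 0" "ball x r \<subseteq> S" using assms openE by blast
  define e where "e = r / (norm v + 1)"
  have np: "norm v + 1 > 0" by (simp add: add_nonneg_pos)
  have e: "e > 0" using r np by (simp add: e_def)
  have inS: "x + t *\<^sub>R v \<in> S" if "\<bar>t\<bar> < e" for t
  proof -
    have "\<bar>t\<bar> * norm v \<le> \<bar>t\<bar> * (norm v + 1)" by (simp add: mult_left_mono)
    also have "\<dots> < r" using that np by (simp add: e_def field_simps)
    finally show ?thesis using r by (auto simp: dist_norm subset_iff)
  qed
  have line: "((\<lambda>s. f (x + s *\<^sub>R v)) has_real_derivative frechet_derivative f (at (x + s *\<^sub>R v)) v) (at s)"
    if "\<bar>s\<bar> < e" "smooth_on S f" for s and f :: "'a \<Rightarrow> real"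
  proof -
    have "((\<lambda>s. x + s *\<^sub>R v) has_derivative (\<lambda>t. t *\<^sub>R v)) (at s)"
      by (auto intro!: derivative_eq_intros)
    from has_derivative_compose[OF this frechet_derivative_worksI[OF smooth_on_differentiable[OF that(2) inS[OF that(1)]]]]
    have 1: "((\<lambda>s. f (x + s *\<^sub>R v)) has_derivative (\<lambda>t. frechet_derivative f (at (x + s *\<^sub>R v)) (t *\<^sub>R v))) (at s)" .
    have "linear (frechet_derivative f (at (x + s *\<^sub>R v)))"
      using that inS by (auto intro!: linear_frechet_derivative smooth_on_differentiable)
    then have "frechet_derivative f (at (x + s *\<^sub>R v)) (t *\<^sub>R v) = frechet_derivative f (at (x + s *\<^sub>R v)) v * t" for t
      by (simp add: linear_cmul)
    with 1 show ?thesis by (simp add: has_field_derivative_def)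
  qed
  have "frechet_derivative f (at (x + 0 *\<^sub>R v)) v = 0 \<and>
    frechet_derivative (\<lambda>y. frechet_derivative f (at y) v) (at (x + 0 *\<^sub>R v)) v \<le> 0"
  proof (rule second_derivative_nonpos[OF e, of "\<lambda>s. f (x + s *\<^sub>R v)"])
    show "((\<lambda>s. frechet_derivative f (at (x + s *\<^sub>R v)) v) has_real_derivative
      frechet_derivative (\<lambda>y. frechet_derivative f (at y) v) (at (x + 0 *\<^sub>R v)) v) (at 0)"
      by (rule line[of 0 "\<lambda>y. frechet_derivative f (at y) v"]) (auto intro!: e smooth_on_frechet assms)
  qed (use inS max in \<open>auto intro!: line assms\<close>)
  then show "frechet_derivative f (at x) v = 0"
    "frechet_derivative (\<lambda>y. frechet_derivative f (at y) v) (at x) v \<le> 0" by simp_all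
qed

context open_domain
begin

text \<open>The real part of \<open>ddbar m F p\<close> is a quarter of the sum of the second
  directional derivatives along \<open>axis m 1\<close> and \<open>axis m \<i>\<close>; the mixed
  derivatives of a real function enter with a factor i and drop out.\<close>

lemma local_max_wirtinger:
  assumes F: "sm F" and real: "\<And>w. w \<in> W \<Longrightarrow> cnj (F w) = F w" and p: "p \<in> W"
    and max: "\<And>w. w \<in> W \<Longrightarrow> Re (F w) \<le> Re (F p)"
  shows "dz m F p = 0" "dzbar m F p = 0" "Re (ddbar m F p) \<le> 0"
proof -
  define f where "f w = Re (F w)" for w
  have f: "smooth_on W f" unfolding f_def by (rule smooth_on_Re[OF open_W F])
  have Ff: "F w = complex_of_real (f w)" if "w \<in> W" for w
    using real[OF that] by (simp add: f_def complex_eq_iff)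
  have D: "frechet_derivative F (at w) v = complex_of_real (frechet_derivative f (at w) v)" if "w \<in> W" for w v
    using frechet_derivative_cong_open[OF open_W that Ff]
      frechet_derivative_linear_comp[OF bounded_linear_of_real smooth_on_differentiable[OF f that]] by simp
  have D2: "frechet_derivative (\<lambda>y. frechet_derivative F (at y) u) (at w) v =
      complex_of_real (frechet_derivative (\<lambda>y. frechet_derivative f (at y) u) (at w) v)" if "w \<in> W" for w u v
    using frechet_derivative_cong_open[OF open_W that D]
      frechet_derivative_linear_comp[OF bounded_linear_of_real smooth_on_differentiable[OF smooth_on_frechet[OF f] that]]
    by simp
  have mx: "\<And>w. w \<in> W \<Longrightarrow> f w \<le> f p" using max by (simp add: f_def)
  have z: "frechet_derivative f (at p) v = 0"
    "frechet_derivative (\<lambda>y. frechet_derivative f (at y) v) (at p) v \<le> 0" for v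
    using frechet_local_max[OF open_W f p] mx by blast+
  show "dz m F p = 0" "dzbar m F p = 0" by (simp_all add: dz_def dzbar_def D p z)
  let ?A = "\<lambda>y. frechet_derivative F (at y) (axis m 1)"
  let ?B = "\<lambda>y. frechet_derivative F (at y) (axis m \<i>)"
  have A: "?A differentiable (at p)" and B: "?B differentiable (at p)"
    by (auto intro!: smD smooth_on_frechet F p)
  have "((\<lambda>y. (?A y + \<i> * ?B y) / 2) has_derivative
     (\<lambda>v. (frechet_derivative ?A (at p) v + \<i> * frechet_derivative ?B (at p) v) / 2)) (at p)"
    using frechet_derivative_worksI[OF A] frechet_derivative_worksI[OF B]
    by (auto intro!: derivative_eq_intros)
  moreover have "dzbar m F = (\<lambda>y. (?A y + \<i> * ?B y) / 2)" by (rule ext) (simp add: dzbar_def)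
  ultimately have *: "frechet_derivative (dzbar m F) (at p) v =
     (frechet_derivative ?A (at p) v + \<i> * frechet_derivative ?B (at p) v) / 2" for v
    by (simp add: frechet_derivative_eqI)
  have "Re (ddbar m F p) = (frechet_derivative (\<lambda>y. frechet_derivative f (at y) (axis m 1)) (at p) (axis m 1)
     + frechet_derivative (\<lambda>y. frechet_derivative f (at y) (axis m \<i>)) (at p) (axis m \<i>)) / 4"
    unfolding ddbar_def dz_def * D2[OF p] by simp
  then show "Re (ddbar m F p) \<le> 0" using z(2)[of "axis m 1"] z(2)[of "axis m \<i>"] by simp
qed

lemma sm_det:
  fixes M :: "complex^'n \<Rightarrow> complex^'m^'m"
  assumes "\<And>i j. sm (\<lambda>w. M w $ i $ j)"
  shows "sm (\<lambda>w. det (M w))"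
  unfolding det_def by (intro sm_intros assms)

text \<open>Cramer's rule: an entry of the inverse is a quotient of determinants, hence smooth where
  the denominator does not vanish.\<close>

lemma sm_matrix_inv:
  fixes M :: "complex^'n \<Rightarrow> complex^'m^'m"
  assumes M: "\<And>i j. sm (\<lambda>w. M w $ i $ j)" and inv: "\<And>w. w \<in> W \<Longrightarrow> invertible (M w)"
  shows "sm (\<lambda>w. matrix_inv (M w) $ i $ j)"
proof -
  define N where "N w = (\<chi> a b. if b = i then (axis j 1 :: complex^'m) $ a else M w $ a $ b)" for w
  have eq: "matrix_inv (M w) $ i $ j = det (N w) * inverse (det (M w))" if "w \<in> W" for w
  proof -
    have I: "M w ** matrix_inv (M w) = mat 1"
      using someI_ex[OF inv[OF that, unfolded invertible_def]] by (simp add: matrix_inv_def)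
    have "M w *v (matrix_inv (M w) *v axis j 1) = axis j 1"
      by (simp add: matrix_vector_mul_assoc I)
    moreover have "det (M w) \<noteq> 0" using inv[OF that] invertible_det_nz by blast
    ultimately have "matrix_inv (M w) *v axis j 1 = (\<chi> k. det (\<chi> a b. if b = k then (axis j 1 :: complex^'m) $ a else M w $ a $ b) / det (M w))"
      using cramer by blast
    then have "(matrix_inv (M w) *v axis j 1) $ i = det (N w) / det (M w)"
      by (simp add: N_def)
    then show ?thesis
      by (simp add: matrix_vector_mult_def axis_def mult_delta_right divide_inverse)
  qed
  have N: "sm (\<lambda>w. N w $ a $ b)" for a b unfolding N_def using M by (cases "b = i") auto
  have "sm (\<lambda>w. det (N w) * inverse (det (M w)))"
    using inv invertible_det_nz by (intro sm_intros smooth_on_inverse sm_det N M) auto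
  then show ?thesis using sm_cong[OF eq] by simp
qed

end

section \<open>The maximum principle in holomorphic normal coordinates\<close>

text \<open>Here \<open>gi j k\<close> is $g^{j\bar k}$, \<open>\<kappa>\<close> is $2n\alpha$, \<open>q\<close> is $\Delta f$, and \<open>a\<close> lists the eigenvalues
  of $g'$ at \<open>p\<close>; the condition $u(p)=0$ is achieved by rescaling. The constant \<open>K\<close> is the weight
  of the test function $S e^{Kw}$ with $w = e^{-u}|Du|^2$.\<close>

locale normal_coords = open_domain W for W :: "(complex^'n::finite) set" +
  fixes p :: "complex^'n" and g gi :: "'n \<Rightarrow> 'n \<Rightarrow> complex^'n \<Rightarrow> complex"
    and u f q mu :: "complex^'n \<Rightarrow> complex" and \<kappa> K :: real and a :: "'n \<Rightarrow> real"
  assumes p [simp]: "p \<in> W"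
    and sm_g [simp]: "\<And>k j. sm (g k j)" and sm_gi [simp]: "\<And>k j. sm (gi k j)"
    and sm_u [simp]: "sm u" and sm_f [simp]: "sm f" and sm_q [simp]: "sm q" and sm_mu [simp]: "sm mu"
    and gi_g: "\<And>w j l. w \<in> W \<Longrightarrow> (\<Sum>k\<in>UNIV. gi j k w * g k l w) = (if j = l then 1 else 0)"
    and g_herm: "\<And>w k j. w \<in> W \<Longrightarrow> cnj (g k j w) = g j k w"
    and g_p: "\<And>k j. g k j p = (if k = j then 1 else 0)"
    and dg_p: "\<And>m k j. dz m (g k j) p = 0"
    and real: "\<And>w. w \<in> W \<Longrightarrow> cnj (u w) = u w" "\<And>w. w \<in> W \<Longrightarrow> cnj (f w) = f w"
      "\<And>w. w \<in> W \<Longrightarrow> cnj (q w) = q w" "\<And>w. w \<in> W \<Longrightarrow> cnj (mu w) = mu w"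
    and u_p: "u p = 0"
    and q_lap: "\<And>w. w \<in> W \<Longrightarrow> q w = (\<Sum>j\<in>UNIV. \<Sum>k\<in>UNIV. gi j k w * dz j (dzbar k f) w)"
    and kappa: "\<kappa> > 0" and K: "K > 0"
    and a: "\<And>k j. (exp (u p) + f p * exp (- u p)) * g k j p + of_real \<kappa> * dzbar k (dz j u) p
        = (if k = j then complex_of_real (a k) else 0)"
begin

definition "E w = exp (u w) + f w * exp (- u w)"
definition "E' w = exp (u w) - f w * exp (- u w)"
definition "A k j w = E w * g k j w + of_real \<kappa> * dzbar k (dz j u) w"
definition "Cm j l w = (\<Sum>k\<in>UNIV. gi j k w * A k l w)"
definition "S w = (\<Sum>j\<in>UNIV. Cm j j w)"
definition "N w = (\<Sum>j\<in>UNIV. \<Sum>l\<in>UNIV. Cm j l w * Cm l j w)"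
definition "P w = (\<Sum>j\<in>UNIV. \<Sum>k\<in>UNIV. gi j k w * dz j u w * dzbar k u w)"
definition "Q w = (\<Sum>j\<in>UNIV. \<Sum>k\<in>UNIV. gi j k w * dz j f w * dzbar k u w)"
definition "R w = Q w + cnj (Q w) - q w"
definition "n1 = complex_of_real (real CARD('n) - 1)"
definition "nn = complex_of_real (real CARD('n))"
text \<open>The right-hand side of the equation after completing a square: e^{2u} + 2f + e^{-2u} f^2
  is the square of \<open>E\<close>, and the two terms with |Du|^2 combine into
  \<open>E' w * P w\<close>.\<close>

definition "psi w = nn * n1 / 2 * (E w * E w)
    - of_real \<kappa> * n1 * (E' w * P w + exp (- u w) * R w) - of_real \<kappa> * mu w"
definition "ww w = exp (- u w) * P w"

definition "U j = dz j u p"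
definition "V j m = dz m (dz j u) p"
definition "h m = Re (ddbar m u p)"
definition "t3 m j = ddbar m (dz j u) p"
text \<open>Up to sign these are curvature components at \<open>p\<close>, because the first
  derivatives of the metric vanish there.\<close>

definition "rho m j k = ddbar m (gi j k) p"
definition "B m k l = dz m (A k l) p"
definition "s = (\<Sum>j\<in>UNIV. a j)"
definition "tau j = s - a j"
definition "f0 = Re (f p)"

lemma sm_defs [simp]: "sm E" "sm E'" "sm (A k j)" "sm (Cm k j)" "sm S" "sm N" "sm P" "sm Q" "sm R" "sm psi" "sm ww"
proof -
  show E: "sm E" unfolding E_def[abs_def] by auto
  show E': "sm E'" unfolding E'_def[abs_def] by auto
  have A: "sm (A k j)" for k j unfolding A_def[abs_def] using E by auto
  then show "sm (A k j)" .
  have C: "sm (Cm k j)" for k j unfolding Cm_def[abs_def] using A by auto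
  then show "sm (Cm k j)" .
  show "sm S" unfolding S_def[abs_def] using C by auto
  show "sm N" unfolding N_def[abs_def] using C by auto
  show P: "sm P" unfolding P_def[abs_def] by auto
  show Q: "sm Q" unfolding Q_def[abs_def] by auto
  show R: "sm R" unfolding R_def[abs_def] using Q by auto
  have half: "psi = (\<lambda>w. (nn * n1 / 2) * (E w * E w)
    - of_real \<kappa> * n1 * (E' w * P w + exp (- u w) * R w) - of_real \<kappa> * mu w)"
    by (rule ext) (simp add: psi_def)
  show "sm psi" unfolding half using E E' P R by (intro sm_intros) auto
  show "sm ww" unfolding ww_def[abs_def] using P by auto
qed

lemma dbar_g_p: "dzbar m (g k j) p = 0"
proof -
  have "dzbar m (g k j) p = dzbar m (\<lambda>w. cnj (g j k w)) p"
    by (rule dzbar_cong) (auto simp: g_herm)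
  then show ?thesis by (simp add: d_cnj dg_p)
qed

lemma gi_p: "gi k j p = (if k = j then 1 else 0)"
  using gi_g[OF p, of k j] by (simp add: g_p mult_delta_right)

lemma dgi_p: "dz m (gi k j) p = 0" "dzbar m (gi k j) p = 0"
proof -
  have "dz m (\<lambda>w. \<Sum>l\<in>UNIV. gi k l w * g l j w) p = dz m (\<lambda>w. if k = j then 1 else 0) p"
    by (rule dz_cong) (auto simp: gi_g)
  then show "dz m (gi k j) p = 0"
    by (simp add: d_sum d_mult dg_p g_p mult_delta_right)
  have "dzbar m (\<lambda>w. \<Sum>l\<in>UNIV. gi k l w * g l j w) p = dzbar m (\<lambda>w. if k = j then 1 else 0) p"
    by (rule dzbar_cong) (auto simp: gi_g)
  then show "dzbar m (gi k j) p = 0"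
    by (simp add: d_sum d_mult dbar_g_p g_p mult_delta_right)
qed

lemma rho_g: "ddbar m (g k j) p = - rho m k j"
proof -
  have "ddbar m (\<lambda>w. \<Sum>l\<in>UNIV. gi k l w * g l j w) p = ddbar m (\<lambda>w. if k = j then 1 else 0) p"
    by (rule ddbar_cong) (auto simp: gi_g)
  then have "ddbar m (g k j) p + ddbar m (gi k j) p = 0"
    by (simp add: ddbar_sum ddbar_mult dgi_p gi_p g_p mult_delta_right mult_delta_left sum.distrib)
  then show ?thesis by (simp add: rho_def add_eq_0_iff)
qed

lemma A_p: "A k j p = (if k = j then complex_of_real (a k) else 0)"
  using a[of k j] by (simp add: A_def E_def)

lemma Cm_p: "Cm k j p = (if k = j then complex_of_real (a k) else 0)"
  by (simp add: Cm_def gi_p A_p mult_delta_left)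

lemma S_p: "S p = of_real s"
  by (simp add: S_def Cm_p s_def)

lemma real_fns:
  assumes "w \<in> W"
  shows "cnj (E w) = E w" "cnj (E' w) = E' w" "cnj (dz j u w) = dzbar j u w" "cnj (dzbar j u w) = dz j u w"
    "cnj (dz j f w) = dzbar j f w" "cnj (dzbar j f w) = dz j f w"
    "cnj (dzbar k (dz j u) w) = dzbar j (dz k u) w"
    "cnj (A k j w) = A j k w"
proof -
  show 1: "cnj (E w) = E w" "cnj (E' w) = E' w"
    using real assms by (simp_all add: E_def E'_def exp_cnj)
  show 2: "cnj (dz j u w) = dzbar j u w" "cnj (dzbar j u w) = dz j u w"
     "cnj (dz j f w) = dzbar j f w" "cnj (dzbar j f w) = dz j f w"
    using d_real[OF sm_u real(1) assms, of j] d_real[OF sm_f real(2) assms, of j] by simp_all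
  show 3: "cnj (dzbar k (dz j u) w) = dzbar j (dz k u) w" for k j
  proof -
    have "cnj (dzbar k (dz j u) w) = dz k (\<lambda>w. cnj (dz j u w)) w" using assms by (simp add: d_cnj)
    also have "\<dots> = dz k (dzbar j u) w"
      by (rule dz_cong[OF assms]) (simp add: d_real[OF sm_u real(1)])
    finally show ?thesis using assms by (simp add: d_commute)
  qed
  show "cnj (A k j w) = A j k w" using 1 3 g_herm assms by (simp add: A_def)
qed

lemma h_p: "dzbar k (dz j u) p = (if k = j then of_real (h k) else 0)"
proof (cases "k = j")
  case True
  have "cnj (dzbar j (dz j u) p) = dzbar j (dz j u) p" by (simp add: real_fns)
  then show ?thesis using True by (simp add: h_def ddbar_alt complex_eq_iff)
next
  case False
  then show ?thesis using a[of k j] kappa by (simp add: g_p)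
qed

lemma h_p': "dz k (dzbar j u) p = (if k = j then of_real (h k) else 0)"
  using h_p[of j k] by (auto simp: d_commute)

lemma ddbar_u: "ddbar m u p = of_real (h m)"
  using h_p[of m m] by (simp add: ddbar_alt)

lemma f_p: "f p = of_real f0"
  using real(2)[OF p] by (simp add: f0_def complex_eq_iff)

lemma E_p: "E p = of_real (1 + f0)" and E'_p: "E' p = of_real (1 - f0)"
  by (simp_all add: E_def E'_def u_p f_p)

lemma a_h: "a m = (1 + f0) + \<kappa> * h m"
proof -
  have "complex_of_real (a m) = of_real ((1 + f0) + \<kappa> * h m)"
    using A_p[of m m] by (simp add: A_def E_p g_p h_p)
  then show ?thesis using of_real_eq_iff by blast
qed

lemma dz_A_cnj: "dzbar m (A k l) p = cnj (B m l k)"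
proof -
  have "dzbar m (A k l) p = dzbar m (\<lambda>w. cnj (A l k w)) p"
    by (rule dzbar_cong) (auto simp: real_fns)
  then show ?thesis by (simp add: d_cnj B_def)
qed

lemma dz_Cm: "dz m (Cm j l) p = B m j l" "dzbar m (Cm j l) p = cnj (B m l j)"
  unfolding Cm_def[abs_def]
  by (simp_all add: d_sum d_mult dgi_p gi_p mult_delta_left B_def[symmetric] dz_A_cnj)

lemma ddbar_Cm: "ddbar m (Cm j l) p = ddbar m (A j l) p + rho m j l * of_real (a l)"
  unfolding Cm_def[abs_def]
  by (simp add: ddbar_sum ddbar_mult dgi_p gi_p A_p mult_delta_left mult_delta_right sum.distrib rho_def)

lemma dz_S: "dz m S p = (\<Sum>j\<in>UNIV. B m j j)" "dzbar m S p = cnj (dz m S p)"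
  unfolding S_def[abs_def] by (simp_all add: d_sum dz_Cm)

lemma ddbar_S: "ddbar m S p = (\<Sum>j\<in>UNIV. ddbar m (Cm j j) p)"
  unfolding S_def[abs_def] by (simp add: ddbar_sum)

lemma ddbar_A: "ddbar m (A j j) p = ddbar m E p - of_real (1 + f0) * rho m j j + of_real \<kappa> * ddbar m (ddbar j u) p"
proof -
  have "ddbar m (dzbar j (dz j u)) p = ddbar m (ddbar j u) p"
    by (rule ddbar_cong) (auto simp: ddbar_alt)
  then show ?thesis
    unfolding A_def[abs_def]
    by (simp add: ddbar_add ddbar_mult ddbar_cmult dg_p dbar_g_p g_p E_p rho_g)
qed

lemma dz_N: "dz m N p = 2 * (\<Sum>j\<in>UNIV. of_real (a j) * B m j j)"
  unfolding N_def[abs_def]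
  by (simp add: d_sum d_mult Cm_p dz_Cm mult_delta_left mult_delta_right sum.distrib sum_distrib_left mult_ac)

lemma ddbar_N: "ddbar m N p = 2 * (\<Sum>j\<in>UNIV. of_real (a j) * ddbar m (Cm j j) p)
   + 2 * (\<Sum>j\<in>UNIV. \<Sum>l\<in>UNIV. of_real ((cmod (B m j l))\<^sup>2))"
proof -
  have "ddbar m N p = (\<Sum>j\<in>UNIV. \<Sum>l\<in>UNIV. Cm j l p * ddbar m (Cm l j) p
     + B m j l * cnj (B m j l) + cnj (B m l j) * B m l j + ddbar m (Cm j l) p * Cm l j p)"
    unfolding N_def[abs_def] by (simp add: ddbar_sum ddbar_mult dz_Cm)
  also have "\<dots> = (\<Sum>j\<in>UNIV. \<Sum>l\<in>UNIV. Cm j l p * ddbar m (Cm l j) p)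
     + (\<Sum>j\<in>UNIV. \<Sum>l\<in>UNIV. B m j l * cnj (B m j l)) + (\<Sum>j\<in>UNIV. \<Sum>l\<in>UNIV. B m l j * cnj (B m l j))
     + (\<Sum>j\<in>UNIV. \<Sum>l\<in>UNIV. ddbar m (Cm j l) p * Cm l j p)"
    by (simp add: sum.distrib mult.commute)
  also have "(\<Sum>j\<in>UNIV. \<Sum>l\<in>UNIV. B m l j * cnj (B m l j)) = (\<Sum>j\<in>UNIV. \<Sum>l\<in>UNIV. B m j l * cnj (B m j l))"
    by (rule sum.swap)
  finally show ?thesis
    unfolding complex_norm_square
    by (simp add: Cm_p mult_delta_left mult_delta_right mult_ac)
qed

end

section \<open>The equation differentiated once and twice in normal coordinates\<close>

locale normal_equation = normal_coords W p g gi u f q mu \<kappa> K a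
  for W :: "(complex^'n::finite) set" and p g gi u f q mu \<kappa> K a +
  assumes eq: "\<And>w. w \<in> W \<Longrightarrow> S w * S w - N w = 2 * psi w"
begin

lemma first_order_equation: "(\<Sum>j\<in>UNIV. of_real (tau j) * B m j j) = dz m psi p"
proof -
  have "dz m (\<lambda>w. S w * S w - N w) p = dz m (\<lambda>w. 2 * psi w) p"
    by (rule dz_cong) (auto simp: eq)
  then have "2 * (of_real s * (\<Sum>j\<in>UNIV. B m j j)) - 2 * (\<Sum>j\<in>UNIV. of_real (a j) * B m j j) = 2 * dz m psi p"
    by (simp add: d_diff d_mult d_cmult dz_N dz_S S_p)
  then have "of_real s * (\<Sum>j\<in>UNIV. B m j j) - (\<Sum>j\<in>UNIV. of_real (a j) * B m j j) = dz m psi p"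
    by algebra
  then show ?thesis by (simp add: tau_def left_diff_distrib sum_subtractf sum_distrib_left)
qed

text \<open>Differentiating twice adds the quadratic form itself, evaluated on the first derivatives
  \<open>B m\<close> of $g'$. These are the third order terms in u whose sign is settled by the
  Lorentzian signature.\<close>

lemma second_order_equation:
  "(\<Sum>j\<in>UNIV. of_real (tau j) * ddbar m (Cm j j) p) = ddbar m psi p
     + (\<Sum>j\<in>UNIV. \<Sum>l\<in>UNIV. of_real ((cmod (B m j l))\<^sup>2)) - of_real ((cmod (dz m S p))\<^sup>2)"
proof -
  have "ddbar m (\<lambda>w. S w * S w - N w) p = ddbar m (\<lambda>w. 2 * psi w) p"
    by (rule ddbar_cong) (auto simp: eq)
  then have "2 * (of_real s * (\<Sum>j\<in>UNIV. ddbar m (Cm j j) p)) + 2 * (dz m S p * cnj (dz m S p))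
    - (2 * (\<Sum>j\<in>UNIV. of_real (a j) * ddbar m (Cm j j) p)
   + 2 * (\<Sum>j\<in>UNIV. \<Sum>l\<in>UNIV. of_real ((cmod (B m j l))\<^sup>2))) = 2 * ddbar m psi p"
    by (simp add: ddbar_diff ddbar_mult ddbar_cmult ddbar_N ddbar_S S_p dz_S(2) mult_ac)
  then have "of_real s * (\<Sum>j\<in>UNIV. ddbar m (Cm j j) p) + dz m S p * cnj (dz m S p)
    - ((\<Sum>j\<in>UNIV. of_real (a j) * ddbar m (Cm j j) p)
   + (\<Sum>j\<in>UNIV. \<Sum>l\<in>UNIV. of_real ((cmod (B m j l))\<^sup>2))) = ddbar m psi p"
    by algebra
  then show ?thesis
    unfolding complex_norm_square[of "dz m S p"]
    by (simp add: tau_def left_diff_distrib sum_subtractf sum_distrib_left algebra_simps)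
qed

text \<open>\<open>D k j\<close> differentiates the j-th diagonal entry of the endomorphism in
  direction k. The operator applied to \<open>S\<close> weights it by \<open>tau k\<close>, the
  equation summed over directions by \<open>tau j\<close>. Its fourth order part \<open>Y\<close> is
  symmetric and cannot tell the two weightings apart, so they differ only by derivatives of
  \<open>E\<close> and by curvature.\<close>

lemma linearized_S:
  "(\<Sum>k\<in>UNIV. of_real (tau k) * ddbar k S p) =
     (\<Sum>m\<in>UNIV. ddbar m psi p)
     + (\<Sum>m\<in>UNIV. (\<Sum>j\<in>UNIV. \<Sum>l\<in>UNIV. of_real ((cmod (B m j l))\<^sup>2)) - of_real ((cmod (dz m S p))\<^sup>2))
     + of_real (real CARD('n)) * (\<Sum>k\<in>UNIV. of_real (tau k) * ddbar k E p)
     - of_real (\<Sum>k\<in>UNIV. tau k) * (\<Sum>k\<in>UNIV. ddbar k E p)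
     + (\<Sum>k\<in>UNIV. \<Sum>j\<in>UNIV. of_real (tau k * (\<kappa> * h j)) * rho k j j)
     - (\<Sum>k\<in>UNIV. \<Sum>j\<in>UNIV. of_real (tau j * (\<kappa> * h j)) * rho k j j)"
proof -
  define D where "D k j = ddbar k (Cm j j) p" for k j
  define Y where "Y k j = ddbar k (ddbar j u) p" for k j
  have Y: "Y k j = Y j k" for k j by (simp add: Y_def ddbar_ddbar_commute)
  \<comment> \<open>The curvature term of \<open>ddbar_Cm\<close> carries \<open>a j\<close> and
    that of \<open>ddbar_A\<close> carries \<open>1 + f0\<close>; by \<open>a_h\<close> their
    difference is \<open>\<kappa> * h j\<close>.\<close>
  have D: "D k j = ddbar k E p + of_real (\<kappa> * h j) * rho k j j + of_real \<kappa> * Y k j" for k j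
    by (simp add: D_def ddbar_Cm ddbar_A Y_def a_h algebra_simps)
  have 1: "(\<Sum>k\<in>UNIV. of_real (tau k) * ddbar k S p) = (\<Sum>k\<in>UNIV. \<Sum>j\<in>UNIV. of_real (tau k) * D k j)"
    by (simp add: ddbar_S D_def sum_distrib_left)
  have 2: "\<dots> = of_real (real CARD('n)) * (\<Sum>k\<in>UNIV. of_real (tau k) * ddbar k E p)
     + (\<Sum>k\<in>UNIV. \<Sum>j\<in>UNIV. of_real (tau k * (\<kappa> * h j)) * rho k j j)
     + (\<Sum>k\<in>UNIV. \<Sum>j\<in>UNIV. of_real (tau k) * (of_real \<kappa> * Y k j))"
    unfolding D by (simp add: ring_distribs sum.distrib sum_distrib_left mult_ac)
  have 3: "(\<Sum>k\<in>UNIV. \<Sum>j\<in>UNIV. of_real (tau j) * D k j) =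
     of_real (\<Sum>k\<in>UNIV. tau k) * (\<Sum>k\<in>UNIV. ddbar k E p)
     + (\<Sum>k\<in>UNIV. \<Sum>j\<in>UNIV. of_real (tau j * (\<kappa> * h j)) * rho k j j)
     + (\<Sum>k\<in>UNIV. \<Sum>j\<in>UNIV. of_real (tau j) * (of_real \<kappa> * Y k j))"
    unfolding D by (simp add: ring_distribs sum.distrib sum_distrib_left sum_distrib_right mult_ac)
  have 4: "(\<Sum>k\<in>UNIV. \<Sum>j\<in>UNIV. of_real (tau j) * (of_real \<kappa> * Y k j))
      = (\<Sum>k\<in>UNIV. \<Sum>j\<in>UNIV. of_real (tau k) * (of_real \<kappa> * Y k j))"
    by (subst sum.swap) (simp add: Y)
  have 5: "(\<Sum>k\<in>UNIV. \<Sum>j\<in>UNIV. of_real (tau j) * D k j) = (\<Sum>m\<in>UNIV. ddbar m psi p)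
     + (\<Sum>m\<in>UNIV. (\<Sum>j\<in>UNIV. \<Sum>l\<in>UNIV. of_real ((cmod (B m j l))\<^sup>2)) - of_real ((cmod (dz m S p))\<^sup>2))"
    unfolding D_def second_order_equation by (simp add: sum.distrib sum_subtractf)
  show ?thesis using 1 2 3 4 5 by (simp add: algebra_simps)
qed

lemma B_diag: "B m k k = dz m E p + of_real \<kappa> * t3 k m"
proof -
  have "dz m (dzbar k (dz k u)) p = dz m (ddbar k u) p"
    by (rule dz_cong) (auto simp: ddbar_alt)
  then have "dz m (dzbar k (dz k u)) p = t3 k m" by (simp add: t3_def d_ddbar_commute)
  then show ?thesis
    unfolding B_def A_def[abs_def] by (simp add: d_add d_mult d_cmult dg_p g_p)
qed

text \<open>The plain contraction of the third derivatives is a first derivative of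
  \<open>S\<close>, which is known at a maximum of the test function.\<close>

lemma t3_trace: "of_real \<kappa> * (\<Sum>k\<in>UNIV. t3 k m) = dz m S p - nn * dz m E p"
  by (simp add: dz_S B_diag sum.distrib sum_distrib_left nn_def)

text \<open>The contraction weighted by \<open>tau\<close> is read off from the once differentiated
  equation.\<close>

lemma t3_tau: "of_real \<kappa> * (\<Sum>k\<in>UNIV. of_real (tau k) * t3 k m) = dz m psi p - of_real (\<Sum>k\<in>UNIV. tau k) * dz m E p"
  unfolding first_order_equation[symmetric]
  by (simp add: B_diag sum.distrib sum_distrib_left sum_distrib_right algebra_simps)

lemma sum_tau: "(\<Sum>k\<in>UNIV. tau k) = (real CARD('n) - 1) * s"
  by (simp add: tau_def sum_subtractf s_def[symmetric] algebra_simps)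

lemma tau_a: "(\<Sum>k\<in>UNIV. tau k * a k) = 2 * Re (psi p)"
proof -
  have "N p = of_real (\<Sum>k\<in>UNIV. a k * a k)"
    by (simp add: N_def Cm_p mult_delta_left mult_delta_right)
  then have "complex_of_real (s * s - (\<Sum>k\<in>UNIV. a k * a k)) = 2 * psi p"
    using eq[OF p] by (simp add: S_p)
  then have "Re (complex_of_real (s * s - (\<Sum>k\<in>UNIV. a k * a k))) = Re (2 * psi p)" by simp
  then have "s * s - (\<Sum>k\<in>UNIV. a k * a k) = 2 * Re (psi p)" by simp
  moreover have "(\<Sum>k\<in>UNIV. tau k * a k) = s * s - (\<Sum>k\<in>UNIV. a k * a k)"
    by (simp add: tau_def left_diff_distrib sum_subtractf sum_distrib_left[symmetric]) (simp add: s_def)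
  ultimately show ?thesis by simp
qed

definition "Fj j = dz j f p"
definition "FF j m = dz m (dz j f) p"
definition "FH k j = dzbar k (dz j f) p"
definition "Pm m = dz m P p"
definition "wm m = dz m ww p"

lemma conj_jets: "dzbar j u p = cnj (U j)" "dzbar m (dzbar j u) p = cnj (V j m)"
  "ddbar m (dzbar j u) p = cnj (t3 m j)" "dzbar j f p = cnj (Fj j)"
proof -
  show "dzbar j u p = cnj (U j)" "dzbar j f p = cnj (Fj j)" by (simp_all add: U_def Fj_def real_fns)
  have "dzbar m (dzbar j u) p = dzbar m (\<lambda>w. cnj (dz j u w)) p"
    by (rule dzbar_cong) (simp_all add: real_fns)
  then show "dzbar m (dzbar j u) p = cnj (V j m)" by (simp add: V_def d_cnj)
  have "ddbar m (dzbar j u) p = ddbar m (\<lambda>w. cnj (dz j u w)) p"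
    by (rule ddbar_cong) (simp_all add: real_fns)
  then show "ddbar m (dzbar j u) p = cnj (t3 m j)" by (simp add: t3_def ddbar_cnj)
qed

lemma sum_if_const: "(\<Sum>k\<in>I. if b then X k else (0::complex)) = (if b then sum X I else 0)"
  by simp

lemma dz_P: "dz m P p = (\<Sum>j\<in>UNIV. V j m * cnj (U j)) + U m * of_real (h m)"
    "dzbar m P p = cnj (dz m P p)"
  unfolding P_def[abs_def]
  by (simp_all add: d_sum d_mult dgi_p gi_p mult_delta_left mult_delta_right sum.distrib conj_jets h_p h_p'
      V_def[symmetric] U_def[symmetric] mult.commute sum_if_const)

lemma ddbar_P: "ddbar m P p = (\<Sum>j\<in>UNIV. t3 m j * cnj (U j) + cnj (t3 m j * cnj (U j)) + V j m * cnj (V j m))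
    + of_real ((h m)\<^sup>2) + (\<Sum>j\<in>UNIV. \<Sum>k\<in>UNIV. rho m j k * U j * cnj (U k))"
  unfolding P_def[abs_def]
  by (simp add: ddbar_sum ddbar_mult d_mult dgi_p gi_p mult_delta_left mult_delta_right sum.distrib conj_jets h_p h_p'
      V_def[symmetric] U_def[symmetric] t3_def[symmetric] rho_def[symmetric] power2_eq_square mult_ac distrib_left)

lemma dz_Q: "dz m Q p = (\<Sum>j\<in>UNIV. FF j m * cnj (U j)) + Fj m * of_real (h m)"
    "dzbar m Q p = (\<Sum>j\<in>UNIV. FH m j * cnj (U j)) + (\<Sum>j\<in>UNIV. Fj j * cnj (V j m))"
  unfolding Q_def[abs_def]
  by (simp_all add: d_sum d_mult dgi_p gi_p mult_delta_left mult_delta_right sum.distrib conj_jets h_p h_p'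
      FF_def[symmetric] FH_def[symmetric] Fj_def[symmetric] U_def[symmetric] mult.commute)

lemma ddbar_Q: "ddbar m Q p = (\<Sum>j\<in>UNIV. Fj j * cnj (t3 m j)) + (\<Sum>j\<in>UNIV. FF j m * cnj (V j m))
    + (\<Sum>j\<in>UNIV. ddbar m (dz j f) p * cnj (U j)) + FH m m * of_real (h m)
    + (\<Sum>j\<in>UNIV. \<Sum>k\<in>UNIV. rho m j k * Fj j * cnj (U k))"
  unfolding Q_def[abs_def]
  by (simp add: ddbar_sum ddbar_mult d_mult dgi_p gi_p mult_delta_left mult_delta_right sum.distrib conj_jets h_p h_p'
      FF_def[symmetric] FH_def[symmetric] Fj_def[symmetric] U_def[symmetric] t3_def[symmetric] rho_def[symmetric] mult_ac distrib_left)

text \<open>The third derivatives of f also occur only in a contracted form, which is the gradient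
  of its Laplacian as the first derivatives of the metric vanish at \<open>p\<close>. This is why
  the Laplacian \<open>q\<close> is treated as a datum with jets of its own.\<close>

lemma dz_q: "(\<Sum>m\<in>UNIV. ddbar m (dz j f) p) = dz j q p"
proof -
  have "dz j q p = dz j (\<lambda>w. \<Sum>m\<in>UNIV. \<Sum>k\<in>UNIV. gi m k w * dz m (dzbar k f) w) p"
    by (rule dz_cong) (auto simp: q_lap)
  also have "\<dots> = (\<Sum>m\<in>UNIV. dz j (dz m (dzbar m f)) p)"
    by (simp add: d_sum d_mult dgi_p gi_p mult_delta_left)
  also have "\<dots> = (\<Sum>m\<in>UNIV. ddbar m (dz j f) p)"
  proof (intro sum.cong refl)
    fix m
    have "dz m (dzbar m f) = ddbar m f" by (rule ext) (simp add: ddbar_def)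
    then show "dz j (dz m (dzbar m f)) p = ddbar m (dz j f) p" by (simp add: d_ddbar_commute)
  qed
  finally show ?thesis by simp
qed

lemma dz_R: "dz m R p = dz m Q p + cnj (dzbar m Q p) - dz m q p" "dzbar m R p = cnj (dz m R p)"
    "ddbar m R p = ddbar m Q p + cnj (ddbar m Q p) - ddbar m q p"
  unfolding R_def[abs_def]
  by (simp_all add: d_add d_diff d_cnj ddbar_add ddbar_diff ddbar_cnj d_real[OF sm_q real(3)])

lemma dz_E: "dz m E p = of_real (1 - f0) * U m + Fj m" "dzbar m E p = cnj (dz m E p)"
   "ddbar m E p = of_real (1 - f0) * of_real (h m) + of_real (1 + f0) * (U m * cnj (U m)) + ddbar m f p
      - (Fj m * cnj (U m) + U m * cnj (Fj m))"
  unfolding E_def[abs_def]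
  by (simp_all add: d_add d_mult d_exp d_minus ddbar_add ddbar_mult ddbar_exp ddbar_minus u_p f_p conj_jets
     U_def[symmetric] Fj_def[symmetric] ddbar_u algebra_simps)

lemma dz_E': "dz m E' p = of_real (1 + f0) * U m - Fj m" "dzbar m E' p = cnj (dz m E' p)"
   "ddbar m E' p = of_real (1 + f0) * of_real (h m) + of_real (1 - f0) * (U m * cnj (U m)) - ddbar m f p
      + (Fj m * cnj (U m) + U m * cnj (Fj m))"
  unfolding E'_def[abs_def]
  by (simp_all add: d_diff d_mult d_exp d_minus ddbar_diff ddbar_mult ddbar_exp ddbar_minus u_p f_p conj_jets
     U_def[symmetric] Fj_def[symmetric] ddbar_u algebra_simps)

lemma P_p: "P p = of_real (\<Sum>j\<in>UNIV. (cmod (U j))\<^sup>2)"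
  by (simp add: P_def gi_p mult_delta_left conj_jets U_def[symmetric] complex_norm_square del: of_real_power)

lemma Q_p: "Q p = (\<Sum>j\<in>UNIV. Fj j * cnj (U j))"
  by (simp add: Q_def gi_p mult_delta_left conj_jets Fj_def[symmetric])

lemma psi_p: "psi p = nn * n1 / 2 * (of_real (1 + f0) * of_real (1 + f0))
    - of_real \<kappa> * n1 * (of_real (1 - f0) * P p + R p) - of_real \<kappa> * mu p"
  by (simp add: psi_def E_p E'_p u_p)

lemma dz_psi: "dz m psi p = nn * n1 * (of_real (1 + f0) * dz m E p)
    - (of_real \<kappa> * n1) * (dz m E' p * P p + of_real (1 - f0) * dz m P p - U m * R p + dz m R p)
    - of_real \<kappa> * dz m mu p" (is ?A)
  and ddbar_psi: "ddbar m psi p = nn * n1 * (of_real (1 + f0) * ddbar m E p + dz m E p * cnj (dz m E p))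
    - (of_real \<kappa> * n1) * (dz m E' p * cnj (dz m P p) + cnj (dz m E' p) * dz m P p
         + of_real (1 - f0) * ddbar m P p + P p * ddbar m E' p
         + ddbar m R p - U m * cnj (dz m R p) - cnj (U m) * dz m R p
         + R p * (- of_real (h m) + U m * cnj (U m)))
    - of_real \<kappa> * ddbar m mu p" (is ?B)
proof -
  define c1 where "c1 = nn * n1 / 2"
  define c2 where "c2 = complex_of_real \<kappa> * n1"
  have psi: "psi = (\<lambda>w. c1 * (E w * E w) - c2 * (E' w * P w + exp (- u w) * R w) - of_real \<kappa> * mu w)"
    by (rule ext) (simp add: psi_def c1_def c2_def)
  have c: "nn * n1 = 2 * c1" "of_real \<kappa> * n1 = c2" by (simp_all add: c1_def c2_def)
  show ?A unfolding psi c
    by (simp add: d_add d_diff d_mult d_exp d_minus u_p E_p E'_p U_def[symmetric])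
  show ?B unfolding psi c
    by (simp add: ddbar_add ddbar_diff ddbar_mult ddbar_exp ddbar_minus d_minus d_exp u_p E_p E'_p U_def[symmetric]
      conj_jets dz_E(2) dz_E'(2) dz_P(2) dz_R(2) ddbar_u) (simp add: algebra_simps)
qed

lemma dz_ww: "wm m = Pm m - U m * P p" "dzbar m ww p = cnj (wm m)"
   "ddbar m ww p = ddbar m P p - (U m * cnj (Pm m) + cnj (U m) * Pm m)
      + P p * (- of_real (h m) + U m * cnj (U m))"
  unfolding wm_def Pm_def ww_def[abs_def]
  by (simp_all add: d_mult d_exp d_minus ddbar_mult ddbar_exp ddbar_minus u_p U_def[symmetric]
      conj_jets dz_P(2) ddbar_u P_p algebra_simps)

end

section \<open>Bounds of the form constant times scale\<close>

lemma rb_add: "norm a \<le> A * y \<Longrightarrow> norm b \<le> B * y \<Longrightarrow> norm (a + b) \<le> (A + B) * (y::real)"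
  for a b :: complex
  using norm_triangle_ineq[of a b] by (simp add: distrib_right)

lemma rb_diff: "norm a \<le> A * y \<Longrightarrow> norm b \<le> B * y \<Longrightarrow> norm (a - b) \<le> (A + B) * (y::real)"
  for a b :: complex
  using norm_triangle_ineq4[of a b] by (simp add: distrib_right)

lemma rb_sum:
  fixes f :: "'n::finite \<Rightarrow> complex"
  assumes "\<And>i. norm (f i) \<le> A * y"
  shows "norm (\<Sum>i\<in>UNIV. f i) \<le> (real CARD('n) * A) * (y::real)"
  using sum_norm_bound[of UNIV f "A * y"] assms by (simp add: mult.assoc)

text \<open>Constants multiply, while the product of the two scales may be replaced by any larger
  scale. In this way the constants stay free of \<theta>, of the trace and of the second
  derivatives, all of which live in the scales.\<close>

lemma rb_mult:
  fixes a b :: complex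
  assumes "norm a \<le> A * y1" "norm b \<le> B * y2" "y1 * y2 \<le> y" "0 \<le> A" "0 \<le> B"
  shows "norm (a * b) \<le> (A * B) * (y::real)"
proof -
  have "norm (a * b) \<le> (A * y1) * (B * y2)"
    unfolding norm_mult using assms norm_ge_zero by (intro mult_mono) (auto intro: order_trans[OF norm_ge_zero])
  also have "\<dots> = (A * B) * (y1 * y2)" by simp
  also have "\<dots> \<le> (A * B) * y" using assms by (intro mult_left_mono) auto
  finally show ?thesis .
qed

lemma rb_weak: "norm (a::complex) \<le> A * y1 \<Longrightarrow> y1 \<le> y \<Longrightarrow> 0 \<le> A \<Longrightarrow> norm a \<le> A * (y::real)"
  by (meson mult_left_mono order_trans)

lemma rb_cnj: "norm a \<le> A * (y::real) \<Longrightarrow> norm (cnj a) \<le> A * y"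
  by simp

text \<open>The reversed Cauchy-Schwarz inequality for the Lorentzian form
  $(\sum b)^2 - \sum b^2$, in the time-like direction \<open>a\<close>.\<close>

lemma lorentz_real:
  fixes a b :: "'n::finite \<Rightarrow> real"
  defines "s \<equiv> \<Sum>k\<in>UNIV. a k"
  assumes pos: "s\<^sup>2 - (\<Sum>k\<in>UNIV. (a k)\<^sup>2) > 0"
  shows "((\<Sum>k\<in>UNIV. b k)\<^sup>2 - (\<Sum>k\<in>UNIV. (b k)\<^sup>2)) * (s\<^sup>2 - (\<Sum>k\<in>UNIV. (a k)\<^sup>2))
    \<le> (\<Sum>k\<in>UNIV. (s - a k) * b k)\<^sup>2"
proof -
  have "(\<Sum>k\<in>UNIV. (a k)\<^sup>2) \<ge> 0" by (simp add: sum_nonneg)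
  then have s: "s \<noteq> 0" using pos by auto
  \<comment> \<open>\<open>t\<close> is chosen so that \<open>c = b - t a\<close> has trace zero. On
    such vectors the form is negative definite, and the inequality reduces to the nonnegativity of
    \<open>r\<^sup>2 + w * q\<close>.\<close>
  define t where "t = (\<Sum>k\<in>UNIV. b k) / s"
  define c where "c k = b k - t * a k" for k
  define q where "q = s\<^sup>2 - (\<Sum>k\<in>UNIV. (a k)\<^sup>2)"
  define r where "r = (\<Sum>k\<in>UNIV. a k * c k)"
  define w where "w = (\<Sum>k\<in>UNIV. (c k)\<^sup>2)"
  have sb: "(\<Sum>k\<in>UNIV. b k) = t * s" using s by (simp add: t_def)
  have b: "b k = c k + t * a k" for k by (simp add: c_def)
  have "(\<Sum>k\<in>UNIV. (b k)\<^sup>2) = (\<Sum>k\<in>UNIV. (c k)\<^sup>2 + 2 * t * (a k * c k) + t\<^sup>2 * (a k)\<^sup>2)"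
    unfolding b by (intro sum.cong refl) (simp add: power2_eq_square algebra_simps)
  also have "\<dots> = w + 2 * t * r + t\<^sup>2 * (s\<^sup>2 - q)"
    by (simp add: sum.distrib sum_distrib_left w_def r_def q_def)
  finally have 1: "(\<Sum>k\<in>UNIV. b k)\<^sup>2 - (\<Sum>k\<in>UNIV. (b k)\<^sup>2) = t\<^sup>2 * q - 2 * t * r - w"
    unfolding sb by (simp add: power2_eq_square algebra_simps)
  have "(\<Sum>k\<in>UNIV. a k * b k) = r + t * (s\<^sup>2 - q)"
    unfolding b by (simp add: ring_distribs sum.distrib r_def q_def sum_distrib_left power2_eq_square mult_ac)
  moreover have "(\<Sum>k\<in>UNIV. (s - a k) * b k) = s * (\<Sum>k\<in>UNIV. b k) - (\<Sum>k\<in>UNIV. a k * b k)"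
    by (simp add: left_diff_distrib sum_subtractf sum_distrib_left)
  ultimately have 2: "(\<Sum>k\<in>UNIV. (s - a k) * b k) = t * q - r"
    unfolding sb by (simp add: power2_eq_square algebra_simps)
  have "(t * q - r)\<^sup>2 - (t\<^sup>2 * q - 2 * t * r - w) * q = r\<^sup>2 + w * q"
    by (simp add: power2_eq_square algebra_simps)
  moreover have "w \<ge> 0" "q > 0" using pos by (auto simp: w_def q_def sum_nonneg)
  ultimately have "(t\<^sup>2 * q - 2 * t * r - w) * q \<le> (t * q - r)\<^sup>2"
    by (smt (verit) mult_nonneg_nonneg zero_le_power2)
  then show ?thesis unfolding 1 2 q_def[symmetric] .
qed

lemma lorentz_complex:
  fixes a :: "'n::finite \<Rightarrow> real" and b :: "'n \<Rightarrow> complex"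
  defines "s \<equiv> \<Sum>k\<in>UNIV. a k"
  assumes pos: "s\<^sup>2 - (\<Sum>k\<in>UNIV. (a k)\<^sup>2) > 0"
  shows "((cmod (\<Sum>k\<in>UNIV. b k))\<^sup>2 - (\<Sum>k\<in>UNIV. (cmod (b k))\<^sup>2)) * (s\<^sup>2 - (\<Sum>k\<in>UNIV. (a k)\<^sup>2))
    \<le> (cmod (\<Sum>k\<in>UNIV. of_real (s - a k) * b k))\<^sup>2"
  using lorentz_real[of a "\<lambda>k. Re (b k)"] lorentz_real[of a "\<lambda>k. Im (b k)"] pos
  unfolding s_def[symmetric] cmod_power2
  by (simp add: sum.distrib algebra_simps)

text \<open>The following constants are what the triangle inequality yields in the estimates below.
  They depend only on the dimension and on $\kappa = 2n\alpha$.\<close>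

definition "c_h n \<kappa> = (n + 2) / (\<kappa>::real)"
definition "c_psi n \<kappa> = n * n * (2 * 2) + \<kappa> * n * (3 * n + (n + c_h n \<kappa>) + (2 * n + 1) + (3 * n + c_h n \<kappa> + 1)) + \<kappa>"
definition "c_w n \<kappa> = n + c_h n \<kappa> + n"
definition "c_1 n \<kappa> = (c_w n \<kappa> + n * 2) / \<kappa>"
definition "c_2 n \<kappa> = (c_psi n \<kappa> + n * 2) / \<kappa>"
definition "c_3 n \<kappa> = n * c_1 n \<kappa> + n * c_1 n \<kappa> + 1 + n * (c_h n \<kappa> * c_h n \<kappa>) + n * (n * n)"
definition "c_4 n \<kappa> = n * c_1 n \<kappa> + n * n + n + n * c_h n \<kappa> + n * (n * n)"
definition "c_6 n \<kappa> = n * n * (n * (2 * (c_h n \<kappa> + 5) + 4))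
   + \<kappa> * n * (n * (6 * (n + c_h n \<kappa>) + 6 * (n + c_h n \<kappa>) + n * (2 * c_h n \<kappa> + 6)
       + 2 * (3 * n + c_h n \<kappa> + 1) + 2 * (3 * n + c_h n \<kappa> + 1) + (2 * n + 1) * (c_h n \<kappa> + 1))
     + c_3 n \<kappa> + (c_4 n \<kappa> + c_4 n \<kappa> + n)) + \<kappa> * n"
definition "c_8 n \<kappa> = n * n * 2 + \<kappa> * n * (n + (2 * n + 1)) + \<kappa>"

definition "c_7 n \<kappa> = 2 * n * (c_psi n \<kappa>)\<^sup>2 + 2 * (n * n * (c_h n \<kappa> + 5)) + 2 * (n * n * (\<kappa> * c_h n \<kappa>))"
definition "c_9 n \<kappa> = 4 * n * c_2 n \<kappa> + n * (n * n) + 2 * (n + 1) * n + 2 * n * c_8 n \<kappa> / \<kappa>"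
definition "c_10 n = 3 * n * (n * n :: real)"

text \<open>\<theta> is a single smallness parameter for the gradient of u and, at \<open>p\<close>,
  for the jets of f, of its Laplacian and of \<mu> and for the curvature. The third condition on it
  keeps \<open>psi\<close> above one half at \<open>p\<close>. The case \<open>s < 1\<close> is
  disposed of in \<open>scaled_trace_bound\<close>.\<close>

locale normal_bounds = normal_equation W p g gi u f q mu \<kappa> K a
  for W :: "(complex^'n::finite) set" and p g gi u f q mu \<kappa> K a +
  fixes \<theta> nr :: real
  assumes nr: "nr = real CARD('n)"
    and theta: "0 < \<theta>" "\<theta> \<le> 1" "\<theta> * (\<kappa> * nr * (3 * nr + 2)) \<le> 1 / 2"
    and n2: "CARD('n) \<ge> 2"
    and bU: "\<And>j. cmod (U j) \<le> \<theta>"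
    and f0: "0 \<le> f0" "f0 \<le> \<theta>"
    and bF: "\<And>j. cmod (Fj j) \<le> \<theta>" "\<And>j m. cmod (FF j m) \<le> \<theta>" "\<And>j m. cmod (FH j m) \<le> \<theta>"
      "\<And>m. cmod (ddbar m f p) \<le> \<theta>"
    and bq: "cmod (q p) \<le> \<theta>" "\<And>m. cmod (dz m q p) \<le> \<theta>" "\<And>m. cmod (ddbar m q p) \<le> \<theta>"
    and bmu: "cmod (mu p) \<le> \<theta>" "\<And>m. cmod (dz m mu p) \<le> \<theta>" "\<And>m. cmod (ddbar m mu p) \<le> \<theta>"
    and brho: "\<And>m j k. cmod (rho m j k) \<le> \<theta>"
    and tau: "\<And>m. tau m > 0"
    and max: "\<And>w. w \<in> W \<Longrightarrow> Re (S w * exp (of_real K * ww w)) \<le> Re (S p * exp (of_real K * ww p))"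
      "\<And>w. w \<in> W \<Longrightarrow> cnj (S w) = S w" "\<And>w. w \<in> W \<Longrightarrow> cnj (ww w) = ww w"
    and s1: "1 \<le> s"
begin

abbreviation "ch \<equiv> c_h nr \<kappa>"
text \<open>\<open>X\<close> is the squared size of the second derivatives of pure type. The mixed
  ones are controlled by \<open>s\<close>, so all second derivatives are at most a constant times
  \<open>Z\<close>.\<close>

definition "X = (\<Sum>j\<in>UNIV. \<Sum>m\<in>UNIV. (cmod (V j m))\<^sup>2)"
definition "x = sqrt X"
definition "Z = x + s"
text \<open>The scale of the twice differentiated right-hand side: the first summand comes from the
  plain contraction of the third derivatives, the other two from products of second derivatives. The
  next definition, \<open>T\<close>, is the good term that w contributes.\<close>

definition "Y = K * \<theta> * s * Z + X + s\<^sup>2"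
definition "T = (\<Sum>m\<in>UNIV. tau m * ((\<Sum>j\<in>UNIV. (cmod (V j m))\<^sup>2) + (h m)\<^sup>2))"

lemma n_ge: "nr \<ge> 2" "nr \<ge> 1" "nr \<ge> 0" using n2 by (auto simp: nr)

lemma rb_sumn:
  fixes F :: "'n \<Rightarrow> complex"
  shows "(\<And>i. norm (F i) \<le> A0 * y) \<Longrightarrow> norm (\<Sum>i\<in>UNIV. F i) \<le> (nr * A0) * y"
  unfolding nr by (rule rb_sum)

lemma X_nonneg: "X \<ge> 0" unfolding X_def by (intro sum_nonneg) auto

lemma x_nonneg: "x \<ge> 0" and x2: "x\<^sup>2 = X" using X_nonneg by (auto simp: x_def)

lemma Z_ge: "x \<le> Z" "s \<le> Z" "1 \<le> Z" "0 \<le> Z" using x_nonneg s1 by (auto simp: Z_def)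

lemma bV: "cmod (V j m) \<le> x"
proof -
  have "(cmod (V j m))\<^sup>2 \<le> (\<Sum>m\<in>UNIV. (cmod (V j m))\<^sup>2)" by (intro member_le_sum) auto
  also have "\<dots> \<le> X" unfolding X_def by (rule member_le_sum[of j UNIV "\<lambda>j. \<Sum>m\<in>UNIV. (cmod (V j m))\<^sup>2"]) (auto intro: sum_nonneg)
  finally show ?thesis unfolding x2[symmetric] using x_nonneg power2_le_imp_le by blast
qed

lemma ch_nonneg: "ch \<ge> 0" using kappa n_ge by (simp add: c_h_def)

text \<open>Ellipticity lets the trace control every eigenvalue: all \<open>a m\<close> are below
  \<open>s\<close>, so each one is at least \<open>s\<close> minus \<open>n - 1\<close> times
  \<open>s\<close>.\<close>

lemma bh: "\<bar>h m\<bar> \<le> ch * s"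
proof -
  have "a m < s" using tau[of m] by (simp add: tau_def)
  have "a m = s - (\<Sum>k\<in>UNIV - {m}. a k)" unfolding s_def by (simp add: sum_diff1)
  moreover have "(\<Sum>k\<in>UNIV - {m}. a k) \<le> (\<Sum>k\<in>UNIV - {m}. s)"
    using tau by (intro sum_mono) (simp add: tau_def less_imp_le)
  moreover have "(\<Sum>k\<in>UNIV - {m}. s) = (nr - 1) * s" using n2 by (simp add: nr card_Diff_subset of_nat_diff)
  ultimately have "- (nr * s) \<le> a m" using s1 by (simp add: algebra_simps)
  moreover have "a m \<le> nr * s" using \<open>a m < s\<close> n_ge s1 mult_right_mono[of 1 nr s] by linarith
  ultimately have "\<bar>a m\<bar> \<le> nr * s" by simp
  then have "\<kappa> * \<bar>h m\<bar> \<le> nr * s + 2"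
  proof -
    have "\<bar>\<kappa> * h m\<bar> = \<bar>a m - (1 + f0)\<bar>" by (simp add: a_h)
    also have "\<dots> \<le> nr * s + 2" using \<open>\<bar>a m\<bar> \<le> nr * s\<close> f0 theta by linarith
    finally show ?thesis using kappa by (simp add: abs_mult)
  qed
  also have "\<dots> \<le> (nr + 2) * s" using s1 by (simp add: algebra_simps)
  finally show ?thesis using kappa by (simp add: c_h_def field_simps)
qed

lemma bh': "cmod (of_real (h m)) \<le> ch * s" using bh by simp

lemma scales: "\<theta> * \<theta> \<le> \<theta>" "\<theta> \<le> \<theta> * Z" "\<theta> * s \<le> \<theta> * Z" "\<theta> * x \<le> \<theta> * Z" "\<theta> * (\<theta> * Z) \<le> \<theta> * Z" "\<theta> * Z \<le> Z"
  "\<theta> * s \<le> s" "0 \<le> \<theta>" "\<theta> \<le> s" "1 * \<theta> \<le> \<theta>" "1 * s \<le> s" "1 \<le> s"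
proof -
  show "\<theta> * \<theta> \<le> \<theta>" using theta by (simp add: mult_left_le)
  show "\<theta> \<le> \<theta> * Z" using theta Z_ge by (simp add: mult_le_cancel_left1)
  show "\<theta> * s \<le> \<theta> * Z" "\<theta> * x \<le> \<theta> * Z" using theta Z_ge by (auto intro: mult_left_mono)
  show "\<theta> * (\<theta> * Z) \<le> \<theta> * Z" "\<theta> * Z \<le> Z" "\<theta> * s \<le> s" using theta Z_ge s1 by (auto intro!: mult_left_le_one_le)
qed (use theta s1 in auto)

lemma Yscales: "1 \<le> Y" "s \<le> Y" "x \<le> Y" "Z \<le> 2 * Y" "\<theta> \<le> Y" "\<theta> * Z \<le> 2 * Y" "\<theta> * x \<le> Y" "\<theta> * s \<le> Y"
  "X \<le> Y" "s * s \<le> Y" "K * \<theta> * s * Z + 1 \<le> Y" "0 \<le> K * \<theta> * s * Z" "\<theta> * (K * \<theta> * s * Z + 1) \<le> Y" "0 \<le> Y"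
proof -
  show 0: "0 \<le> K * \<theta> * s * Z" using K theta s1 Z_ge by simp
  have ss: "s \<le> s\<^sup>2" "1 \<le> s\<^sup>2" using s1 by (auto simp: power2_eq_square mult_le_cancel_left1 intro: order_trans[of _ s])
  show 1: "1 \<le> Y" "s \<le> Y" using ss 0 X_nonneg by (auto simp: Y_def)
  have "x \<le> x\<^sup>2 + 1" using zero_le_power2[of "x - 1"] x_nonneg by (simp add: power2_eq_square algebra_simps)
  then show 2: "x \<le> Y" using ss 0 by (simp add: Y_def x2)
  show 3: "Z \<le> 2 * Y" using 1 2 by (simp add: Z_def)
  show "\<theta> \<le> Y" using 1 theta by simp
  show "\<theta> * Z \<le> 2 * Y" using 3 scales(6) by simp
  show "\<theta> * x \<le> Y" using 2 mult_left_le_one_le[of x \<theta>] theta x_nonneg by simp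
  show "\<theta> * s \<le> Y" using 1 scales(7) by simp
  show "X \<le> Y" using 0 by (simp add: Y_def)
  show "s * s \<le> Y" using 0 X_nonneg by (simp add: Y_def power2_eq_square)
  show 4: "K * \<theta> * s * Z + 1 \<le> Y" using ss X_nonneg by (simp add: Y_def)
  have "\<theta> * (K * \<theta> * s * Z + 1) \<le> 1 * (K * \<theta> * s * Z + 1)" by (rule mult_right_mono) (use theta 0 in auto)
  then show "\<theta> * (K * \<theta> * s * Z + 1) \<le> Y" using 4 by simp
  show "0 \<le> Y" using 1 by simp
qed

lemma bU': "cmod (U j) \<le> 1 * \<theta>" "cmod (cnj (U j)) \<le> 1 * \<theta>" using bU by auto
lemma bV': "cmod (V j m) \<le> 1 * x" "cmod (cnj (V j m)) \<le> 1 * x" using bV by auto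
lemma bF': "cmod (Fj j) \<le> 1 * \<theta>" "cmod (cnj (Fj j)) \<le> 1 * \<theta>" "cmod (FF j m) \<le> 1 * \<theta>"
  "cmod (FH j m) \<le> 1 * \<theta>" "cmod (ddbar m f p) \<le> 1 * \<theta>" using bF by auto
lemma bf0: "cmod (of_real (1 - f0)) \<le> 1 * 1" "cmod (of_real (1 + f0)) \<le> 2 * 1"
  unfolding norm_of_real using f0 theta by auto
lemma bUU: "cmod (U m * cnj (U m)) \<le> 1 * \<theta>"
  using rb_mult[OF bU'(1) bU'(2) scales(1)] by simp
lemma bnn: "cmod nn \<le> nr" "cmod n1 \<le> nr" "cmod n1 = nr - 1"
proof -
  show "cmod nn \<le> nr" by (simp add: nn_def nr)
  show "cmod n1 = nr - 1" unfolding n1_def norm_of_real using n_ge by (simp add: nr)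
  then show "cmod n1 \<le> nr" by simp
qed

lemma bE1: "cmod (dz m E p) \<le> 2 * \<theta>"
proof -
  have "cmod (of_real (1 - f0) * U m) \<le> (1 * 1) * \<theta>" by (rule rb_mult[OF bf0(1) bU'(1)]) auto
  from rb_add[OF this bF'(1)[of m]] show ?thesis by (simp add: dz_E(1))
qed

lemma bE'1: "cmod (dz m E' p) \<le> 3 * \<theta>"
proof -
  have "cmod (of_real (1 + f0) * U m) \<le> (2 * 1) * \<theta>" by (rule rb_mult[OF bf0(2) bU'(1)]) auto
  from rb_diff[OF this bF'(1)[of m]] show ?thesis by (simp add: dz_E'(1))
qed

lemma bFU: "cmod (Fj m * cnj (U m) + U m * cnj (Fj m)) \<le> 2 * \<theta>"
  using rb_add[OF rb_mult[OF bF'(1)[of m] bU'(2)[of m] scales(1)] rb_mult[OF bU'(1)[of m] bF'(2)[of m] scales(1)]] by simp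

lemma bE2: "cmod (ddbar m E p) \<le> (ch + 5) * s"
proof -
  have 1: "cmod (of_real (1 - f0) * of_real (h m)) \<le> (1 * ch) * s"
    by (rule rb_mult[OF bf0(1) bh']) (use ch_nonneg in auto)
  have 2: "cmod (of_real (1 + f0) * (U m * cnj (U m))) \<le> (2 * 1) * s"
    by (rule rb_mult[OF bf0(2) bUU]) (use scales in auto)
  have 3: "cmod (ddbar m f p) \<le> 1 * s" by (rule rb_weak[OF bF'(5)]) (use scales in auto)
  have 4: "cmod (Fj m * cnj (U m) + U m * cnj (Fj m)) \<le> 2 * s" by (rule rb_weak[OF bFU]) (use scales in auto)
  show ?thesis using rb_diff[OF rb_add[OF rb_add[OF 1 2] 3] 4] by (simp add: dz_E(3) add_ac)
qed

lemma bE'2: "cmod (ddbar m E' p) \<le> (2 * ch + 6) * s"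
proof -
  have 1: "cmod (of_real (1 + f0) * of_real (h m)) \<le> (2 * ch) * s"
    by (rule rb_mult[OF bf0(2) bh']) (use ch_nonneg in auto)
  have 2: "cmod (of_real (1 - f0) * (U m * cnj (U m))) \<le> (1 * 1) * s"
    by (rule rb_mult[OF bf0(1) bUU]) (use scales in auto)
  have 3: "cmod (ddbar m f p) \<le> 1 * s" by (rule rb_weak[OF bF'(5)]) (use scales in auto)
  have 4: "cmod (Fj m * cnj (U m) + U m * cnj (Fj m)) \<le> 2 * s" by (rule rb_weak[OF bFU]) (use scales in auto)
  have "cmod (ddbar m E' p) \<le> (2 * ch + 1 * 1 + 1 + 2) * s"
    using rb_add[OF rb_diff[OF rb_add[OF 1 2] 3] 4] by (simp only: dz_E'(3))
  also have "\<dots> \<le> (2 * ch + 6) * s" using s1 by (intro mult_right_mono) auto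
  finally show ?thesis .
qed

lemma P_real: "P p = of_real (Re (P p))" "Re (P p) \<ge> 0" "Re (P p) \<le> nr * \<theta>"
proof -
  show "P p = of_real (Re (P p))" by (simp add: P_p)
  show "Re (P p) \<ge> 0" by (simp add: P_p sum_nonneg)
  have "(cmod (U j))\<^sup>2 \<le> \<theta>" for j
    using power_mono[OF bU, of j 2] scales(1) by (simp add: power2_eq_square)
  then have "(\<Sum>j\<in>UNIV. (cmod (U j))\<^sup>2) \<le> (\<Sum>j::'n\<in>UNIV. \<theta>)" by (intro sum_mono) auto
  then show "Re (P p) \<le> nr * \<theta>" by (simp add: P_p nr)
qed

lemma bP: "cmod (P p) \<le> nr * \<theta>"
  using P_real by (metis abs_of_nonneg norm_of_real)

lemma bP1: "cmod (Pm m) \<le> (nr + ch) * (\<theta> * Z)"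
proof -
  have "cmod (V j m * cnj (U j)) \<le> (1 * 1) * (\<theta> * Z)" for j
    by (rule rb_mult[OF bV'(1) bU'(2)]) (use scales in \<open>auto simp: mult.commute\<close>)
  from rb_sumn[OF this] have 1: "cmod (\<Sum>j\<in>UNIV. V j m * cnj (U j)) \<le> (nr * (1 * 1)) * (\<theta> * Z)" .
  have 2: "cmod (U m * of_real (h m)) \<le> (1 * ch) * (\<theta> * Z)"
    by (rule rb_mult[OF bU'(1) bh']) (use scales ch_nonneg in auto)
  show ?thesis using rb_add[OF 1 2] by (simp add: Pm_def dz_P)
qed

lemma bR: "cmod (R p) \<le> (2 * nr + 1) * \<theta>"
proof -
  have "cmod (Fj j * cnj (U j)) \<le> (1 * 1) * \<theta>" for j
    by (rule rb_mult[OF bF'(1) bU'(2) scales(1)]) auto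
  from rb_sumn[OF this] have 1: "cmod (Q p) \<le> (nr * (1 * 1)) * \<theta>" by (simp add: Q_p)
  have 2: "cmod (q p) \<le> 1 * \<theta>" using bq by simp
  show ?thesis using rb_diff[OF rb_add[OF 1 rb_cnj[OF 1]] 2] by (simp add: R_def)
qed

lemma bR1: "cmod (dz m R p) \<le> (3 * nr + ch + 1) * (\<theta> * Z)"
proof -
  have t: "cmod (c * d) \<le> (1 * 1) * (\<theta> * Z)" if "cmod c \<le> 1 * \<theta>" "cmod d \<le> 1 * \<theta>" for c d
    by (rule rb_mult[OF that]) (use scales in auto)
  have "cmod (FF j m * cnj (U j)) \<le> (1 * 1) * (\<theta> * Z)" for j by (rule t[OF bF'(3) bU'(2)])
  from rb_sumn[OF this] have 1: "cmod (\<Sum>j\<in>UNIV. FF j m * cnj (U j)) \<le> (nr * (1 * 1)) * (\<theta> * Z)" .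
  have 2: "cmod (Fj m * of_real (h m)) \<le> (1 * ch) * (\<theta> * Z)"
    by (rule rb_mult[OF bF'(1) bh']) (use scales ch_nonneg in auto)
  have "cmod (FH m j * cnj (U j)) \<le> (1 * 1) * (\<theta> * Z)" for j by (rule t[OF bF'(4) bU'(2)])
  from rb_sumn[OF this] have 3: "cmod (\<Sum>j\<in>UNIV. FH m j * cnj (U j)) \<le> (nr * (1 * 1)) * (\<theta> * Z)" .
  have "cmod (Fj j * cnj (V j m)) \<le> (1 * 1) * (\<theta> * Z)" for j
    by (rule rb_mult[OF bF'(1) bV'(2)]) (use scales in auto)
  from rb_sumn[OF this] have 4: "cmod (\<Sum>j\<in>UNIV. Fj j * cnj (V j m)) \<le> (nr * (1 * 1)) * (\<theta> * Z)" .
  have 5: "cmod (dz m q p) \<le> 1 * (\<theta> * Z)"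
    by (rule rb_weak[of _ _ \<theta>]) (use bq scales in auto)
  show ?thesis using rb_diff[OF rb_add[OF rb_add[OF 1 2] rb_cnj[OF rb_add[OF 3 4]]] 5]
    by (simp add: dz_R(1) dz_Q algebra_simps)
qed

lemma bpsi1: "cmod (dz m psi p) \<le> c_psi nr \<kappa> * (\<theta> * Z)"
proof -
  have "cmod (of_real (1 + f0) * dz m E p) \<le> (2 * 2) * (\<theta> * Z)"
    by (rule rb_mult[OF bf0(2) bE1]) (use scales in auto)
  then have 1: "cmod ((nn * n1) * (of_real (1 + f0) * dz m E p)) \<le> ((nr * nr) * (2 * 2)) * (\<theta> * Z)"
    using bnn n_ge by (intro rb_mult[of "nn * n1" "nr * nr" 1 _ "2 * 2" "\<theta> * Z" "\<theta> * Z"])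
      (auto simp: norm_mult intro!: mult_mono)
  have 2: "cmod (dz m E' p * P p) \<le> (3 * nr) * (\<theta> * Z)"
    by (rule rb_mult[OF bE'1 bP]) (use scales n_ge in auto)
  have 3: "cmod (of_real (1 - f0) * dz m P p) \<le> (1 * (nr + ch)) * (\<theta> * Z)"
    by (rule rb_mult[OF bf0(1) bP1[unfolded Pm_def]]) (use n_ge ch_nonneg in auto)
  have 4: "cmod (U m * R p) \<le> (1 * (2 * nr + 1)) * (\<theta> * Z)"
    by (rule rb_mult[OF bU'(1) bR]) (use scales n_ge in auto)
  note 5 = rb_add[OF rb_diff[OF rb_add[OF 2 3] 4] bR1]
  have 6: "cmod ((of_real \<kappa> * n1) * (dz m E' p * P p + of_real (1 - f0) * dz m P p - U m * R p + dz m R p))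
     \<le> ((\<kappa> * nr) * (3 * nr + 1 * (nr + ch) + 1 * (2 * nr + 1) + (3 * nr + ch + 1))) * (\<theta> * Z)"
    by (rule rb_mult[OF _ 5, of _ _ 1]) (use n_ge kappa ch_nonneg bnn in \<open>auto simp: norm_mult\<close>)
  have 7: "cmod (of_real \<kappa> * dz m mu p) \<le> (\<kappa> * 1) * (\<theta> * Z)"
    by (rule rb_mult[of _ _ 1 _ _ \<theta>]) (use scales bmu kappa in auto)
  show ?thesis using rb_diff[OF rb_diff[OF 1 6] 7]
    by (simp add: dz_psi c_psi_def mult.assoc)
qed

lemma bw1: "cmod (wm m) \<le> c_w nr \<kappa> * (\<theta> * Z)"
proof -
  have "cmod (U m * P p) \<le> (1 * nr) * (\<theta> * Z)"
    by (rule rb_mult[OF bU'(1) bP]) (use scales n_ge in auto)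
  from rb_diff[OF bP1 this] show ?thesis by (simp add: dz_ww(1) c_w_def)
qed

lemma c_nonneg: "c_psi nr \<kappa> \<ge> 0" "c_w nr \<kappa> \<ge> 0" "c_1 nr \<kappa> \<ge> 0" "c_2 nr \<kappa> \<ge> 0" "c_3 nr \<kappa> \<ge> 0"
  "c_4 nr \<kappa> \<ge> 0" "c_6 nr \<kappa> \<ge> 0" "c_8 nr \<kappa> \<ge> 0"
proof -
  note k = kappa[THEN less_imp_le] n_ge(3)
  show 1: "c_psi nr \<kappa> \<ge> 0" "c_w nr \<kappa> \<ge> 0"
    unfolding c_psi_def c_w_def using ch_nonneg k by (auto intro!: add_nonneg_nonneg mult_nonneg_nonneg)
  then show 2: "c_1 nr \<kappa> \<ge> 0" "c_2 nr \<kappa> \<ge> 0"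
    unfolding c_1_def c_2_def using k by (auto intro!: add_nonneg_nonneg divide_nonneg_nonneg)
  then show 3: "c_3 nr \<kappa> \<ge> 0" "c_4 nr \<kappa> \<ge> 0"
    unfolding c_3_def c_4_def using ch_nonneg k by (auto intro!: add_nonneg_nonneg mult_nonneg_nonneg)
  then show "c_6 nr \<kappa> \<ge> 0" "c_8 nr \<kappa> \<ge> 0"
    unfolding c_6_def c_8_def using ch_nonneg k by (auto intro!: add_nonneg_nonneg mult_nonneg_nonneg)
qed

section \<open>Third derivatives at the maximum point\<close>

lemma ww_p: "ww p = P p" by (simp add: ww_def u_p)

text \<open>The factor exp (K w) is real and positive at \<open>p\<close> and divides out.
  Substituting the first order condition into the second order one turns the cross terms into minus
  twice the square term, which leaves a single negative square of the gradient of w.\<close>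

lemma max_first: "dz m S p = - (of_real (K * s) * wm m)"
  and max_second: "Re (ddbar m S p) + s * K * Re (ddbar m ww p) - K\<^sup>2 * s * (cmod (wm m))\<^sup>2 \<le> 0"
proof -
  define \<Phi> where "\<Phi> w = S w * exp (of_real K * ww w)" for w
  have smP: "sm \<Phi>" unfolding \<Phi>_def[abs_def] by auto
  have re: "cnj (\<Phi> w) = \<Phi> w" if "w \<in> W" for w
    using max(2,3)[OF that] by (simp add: \<Phi>_def exp_cnj)
  define e where "e = exp (K * Re (P p))"
  have e: "exp (of_real K * ww p) = of_real e" "e > 0"
    using P_real(1) by (simp_all add: e_def ww_p exp_of_real[symmetric])
  note lm = local_max_wirtinger[OF smP re p, of m] 
  have mx: "\<And>w. w \<in> W \<Longrightarrow> Re (\<Phi> w) \<le> Re (\<Phi> p)"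
    using max(1) by (simp only: \<Phi>_def)
  have d: "dz m \<Phi> p = 0" and dd: "Re (ddbar m \<Phi> p) \<le> 0"
    using lm(1,3)[OF _ mx] by auto
  have "of_real e * (dz m S p + of_real (K * s) * wm m) = 0"
    using d unfolding \<Phi>_def[abs_def]
    by (simp add: d_mult d_exp d_cmult e S_p wm_def algebra_simps)
  then show 1: "dz m S p = - (of_real (K * s) * wm m)" using e(2) by (simp add: add_eq_0_iff)
  have "ddbar m \<Phi> p = of_real e * (ddbar m S p + of_real (s * K) * ddbar m ww p
     + of_real (s * K * K) * (wm m * cnj (wm m)) + of_real K * (dz m S p * cnj (wm m) + cnj (dz m S p) * wm m))"
    unfolding \<Phi>_def[abs_def]
    by (simp add: ddbar_mult ddbar_exp d_exp d_cmult ddbar_cmult e S_p dz_S(2) dz_ww(2) wm_def[symmetric] algebra_simps)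
  also have "\<dots> = of_real e * (ddbar m S p + of_real (s * K) * ddbar m ww p - of_real (s * K * K) * (wm m * cnj (wm m)))"
    unfolding 1 by (simp add: algebra_simps)
  also have "\<dots> = of_real e * (ddbar m S p + of_real (s * K) * ddbar m ww p - of_real (K\<^sup>2 * s * (cmod (wm m))\<^sup>2))"
    unfolding complex_norm_square[symmetric] by (simp add: power2_eq_square mult_ac)
  finally have "Re (ddbar m \<Phi> p) = e * (Re (ddbar m S p) + s * K * Re (ddbar m ww p) - K\<^sup>2 * s * (cmod (wm m))\<^sup>2)"
    by (simp only: Re_complex_of_real Re_divide times_complex.sel minus_complex.sel plus_complex.sel Im_complex_of_real mult_zero_left diff_zero)
  then show "Re (ddbar m S p) + s * K * Re (ddbar m ww p) - K\<^sup>2 * s * (cmod (wm m))\<^sup>2 \<le> 0"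
    using dd e(2) by (simp add: mult_le_0_iff)
qed

abbreviation "y1 \<equiv> K * \<theta> * s * Z + 1"

text \<open>By \<open>max_first\<close> the derivative of \<open>S\<close> is \<open>K * s\<close>
  times that of w, and the latter is small of order \<open>\<theta> * Z\<close>. This is the origin
  of \<open>y1\<close> and the only way in which \<open>K\<close> enters the third
  derivatives.\<close>

lemma bT1: "cmod (\<Sum>k\<in>UNIV. t3 k m) \<le> c_1 nr \<kappa> * y1"
proof -
  have "cmod (of_real (K * s) * wm m) \<le> (1 * c_w nr \<kappa>) * (K * \<theta> * s * Z)"
    by (rule rb_mult[OF _ bw1, of _ _ "K * s"]) (use K s1 c_nonneg in \<open>auto simp: mult_ac norm_mult\<close>)
  then have 1: "cmod (dz m S p) \<le> c_w nr \<kappa> * y1"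
    unfolding max_first norm_minus_cancel using c_nonneg mult_left_mono[of "K * \<theta> * s * Z" y1 "c_w nr \<kappa>"] by simp
  have 2: "cmod (nn * dz m E p) \<le> (nr * 2) * y1"
    by (rule rb_mult[of _ _ 1 _ _ \<theta>]) (use bnn bE1 n_ge Yscales theta in auto)
  have "\<kappa> * cmod (\<Sum>k\<in>UNIV. t3 k m) = cmod (dz m S p - nn * dz m E p)"
    unfolding t3_trace[symmetric] using kappa by (simp add: norm_mult)
  also have "\<dots> \<le> (c_w nr \<kappa> + nr * 2) * y1" by (rule rb_diff[OF 1 2])
  finally show ?thesis using kappa by (simp add: c_1_def field_simps)
qed

lemma sum_tau': "(\<Sum>k\<in>UNIV. tau k) = (nr - 1) * s" "0 \<le> (\<Sum>k\<in>UNIV. tau k)" "(\<Sum>k\<in>UNIV. tau k) \<le> nr * s"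
  unfolding sum_tau nr[symmetric] using n_ge s1 by (auto simp: algebra_simps)

text \<open>This bound contains no \<open>K\<close>, so the estimate for w derived from it can be
  multiplied by \<open>K\<close> without producing a further power of it.\<close>

lemma bT2: "cmod (\<Sum>k\<in>UNIV. of_real (tau k) * t3 k m) \<le> c_2 nr \<kappa> * (\<theta> * Z)"
proof -
  have 2: "cmod (of_real (\<Sum>k\<in>UNIV. tau k) * dz m E p) \<le> (nr * 2) * (\<theta> * Z)"
  proof (rule rb_mult[OF _ bE1, of _ _ s])
    show "cmod (of_real (\<Sum>k\<in>UNIV. tau k)) \<le> nr * s"
      unfolding norm_of_real using sum_tau'(2,3) by linarith
  qed (use n_ge scales in \<open>auto simp: mult.commute\<close>)
  have "\<kappa> * cmod (\<Sum>k\<in>UNIV. of_real (tau k) * t3 k m) = cmod (dz m psi p - of_real (\<Sum>k\<in>UNIV. tau k) * dz m E p)"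
    unfolding t3_tau[symmetric] using kappa by (simp add: norm_mult)
  also have "\<dots> \<le> (c_psi nr \<kappa> + nr * 2) * (\<theta> * Z)" by (rule rb_diff[OF bpsi1 2])
  finally show ?thesis using kappa by (simp add: c_2_def field_simps)
qed

lemma brho': "cmod (\<Sum>j\<in>UNIV. \<Sum>k\<in>UNIV. rho m j k * G j * cnj (U k)) \<le> (nr * nr) * \<theta>"
  if "\<And>j. cmod (G j) \<le> 1 * \<theta>"
proof -
  have "cmod (rho m j k * G j * cnj (U k)) \<le> (1 * 1 * 1) * \<theta>" for j k
    by (rule rb_mult[OF rb_mult[OF _ that, of _ _ \<theta>] bU'(2)]) (use brho scales in auto)
  from rb_sumn[OF rb_sumn[OF this]] show ?thesis by (simp add: mult.assoc)
qed

lemma bPP: "cmod (\<Sum>m\<in>UNIV. ddbar m P p) \<le> c_3 nr \<kappa> * Y"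
proof -
  \<comment> \<open>The sum over \<open>m\<close> is carried out inside, so that third derivatives
    appear only in their plain contraction.\<close>
  have eq: "(\<Sum>m\<in>UNIV. ddbar m P p) = (\<Sum>j\<in>UNIV. (\<Sum>m\<in>UNIV. t3 m j) * cnj (U j))
     + cnj (\<Sum>j\<in>UNIV. (\<Sum>m\<in>UNIV. t3 m j) * cnj (U j)) + of_real X
     + (\<Sum>m\<in>UNIV. of_real (h m) * of_real (h m)) + (\<Sum>m\<in>UNIV. \<Sum>j\<in>UNIV. \<Sum>k\<in>UNIV. rho m j k * U j * cnj (U k))"
  proof -
    have a: "(\<Sum>m\<in>UNIV. \<Sum>j\<in>UNIV. V j m * cnj (V j m)) = of_real X"
      unfolding X_def complex_norm_square[symmetric] of_real_sum by (rule sum.swap)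
    have b: "(\<Sum>m\<in>UNIV. \<Sum>j\<in>UNIV. t3 m j * cnj (U j)) = (\<Sum>j\<in>UNIV. (\<Sum>m\<in>UNIV. t3 m j) * cnj (U j))"
      unfolding sum_distrib_right by (rule sum.swap)
    show ?thesis
      unfolding ddbar_P a[symmetric] b[symmetric] by (simp add: sum.distrib power2_eq_square)
  qed
  have "cmod ((\<Sum>m\<in>UNIV. t3 m j) * cnj (U j)) \<le> (c_1 nr \<kappa> * 1) * Y" for j
    by (rule rb_mult[OF bT1 bU'(2)]) (use c_nonneg Yscales in \<open>auto simp: mult.commute\<close>)
  from rb_sumn[OF this] have 1: "cmod (\<Sum>j\<in>UNIV. (\<Sum>m\<in>UNIV. t3 m j) * cnj (U j)) \<le> (nr * (c_1 nr \<kappa> * 1)) * Y" .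
  have 2: "cmod (of_real X) \<le> 1 * Y" using X_nonneg Yscales by simp
  have "cmod (of_real (h m) * of_real (h m)) \<le> (ch * ch) * Y" for m
    by (rule rb_mult[OF bh' bh']) (use Yscales ch_nonneg in auto)
  from rb_sumn[OF this] have 3: "cmod (\<Sum>m\<in>UNIV. of_real (h m) * of_real (h m)) \<le> (nr * (ch * ch)) * Y" .
  have "cmod (\<Sum>j\<in>UNIV. \<Sum>k\<in>UNIV. rho m j k * U j * cnj (U k)) \<le> (nr * nr) * Y" for m
    by (rule rb_weak[OF brho'[OF bU'(1)]]) (use n_ge Yscales in auto)
  from rb_sumn[OF this] have 4: "cmod (\<Sum>m\<in>UNIV. \<Sum>j\<in>UNIV. \<Sum>k\<in>UNIV. rho m j k * U j * cnj (U k)) \<le> (nr * (nr * nr)) * Y" .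
  show ?thesis unfolding eq
    using rb_add[OF rb_add[OF rb_add[OF rb_add[OF 1 rb_cnj[OF 1]] 2] 3] 4] by (simp add: c_3_def)
qed

lemma bQQ: "cmod (\<Sum>m\<in>UNIV. ddbar m Q p) \<le> c_4 nr \<kappa> * Y"
proof -
  \<comment> \<open>The same regrouping, with the third derivatives of f replaced by the gradient of
    \<open>q\<close>.\<close>
  have eq: "(\<Sum>m\<in>UNIV. ddbar m Q p) = (\<Sum>j\<in>UNIV. Fj j * cnj (\<Sum>m\<in>UNIV. t3 m j))
     + (\<Sum>m\<in>UNIV. \<Sum>j\<in>UNIV. FF j m * cnj (V j m)) + (\<Sum>j\<in>UNIV. dz j q p * cnj (U j))
     + (\<Sum>m\<in>UNIV. FH m m * of_real (h m)) + (\<Sum>m\<in>UNIV. \<Sum>j\<in>UNIV. \<Sum>k\<in>UNIV. rho m j k * Fj j * cnj (U k))"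
  proof -
    have a: "(\<Sum>m\<in>UNIV. \<Sum>j\<in>UNIV. ddbar m (dz j f) p * cnj (U j)) = (\<Sum>j\<in>UNIV. dz j q p * cnj (U j))"
      unfolding dz_q[symmetric] sum_distrib_right by (rule sum.swap)
    have b: "(\<Sum>m\<in>UNIV. \<Sum>j\<in>UNIV. Fj j * cnj (t3 m j)) = (\<Sum>j\<in>UNIV. Fj j * cnj (\<Sum>m\<in>UNIV. t3 m j))"
      unfolding sum_distrib_left cnj_sum by (rule sum.swap)
    show ?thesis
      unfolding ddbar_Q a[symmetric] b[symmetric] by (simp add: sum.distrib)
  qed
  have "cmod (Fj j * cnj (\<Sum>m\<in>UNIV. t3 m j)) \<le> (1 * c_1 nr \<kappa>) * Y" for j
    by (rule rb_mult[OF bF'(1) rb_cnj[OF bT1]]) (use c_nonneg Yscales in auto)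
  from rb_sumn[OF this] have 1: "cmod (\<Sum>j\<in>UNIV. Fj j * cnj (\<Sum>m\<in>UNIV. t3 m j)) \<le> (nr * (1 * c_1 nr \<kappa>)) * Y" .
  have "cmod (FF j m * cnj (V j m)) \<le> (1 * 1) * Y" for j m
    by (rule rb_mult[OF bF'(3) bV'(2)]) (use Yscales in auto)
  from rb_sumn[OF rb_sumn[OF this]] have 2: "cmod (\<Sum>m\<in>UNIV. \<Sum>j\<in>UNIV. FF j m * cnj (V j m)) \<le> (nr * (nr * (1 * 1))) * Y" .
  have "cmod (dz j q p * cnj (U j)) \<le> (1 * 1) * Y" for j
    by (rule rb_mult[OF _ bU'(2), of _ _ \<theta>]) (use bq scales(1) Yscales in auto)
  from rb_sumn[OF this] have 3: "cmod (\<Sum>j\<in>UNIV. dz j q p * cnj (U j)) \<le> (nr * (1 * 1)) * Y" .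
  have "cmod (FH m m * of_real (h m)) \<le> (1 * ch) * Y" for m
    by (rule rb_mult[OF bF'(4) bh']) (use Yscales ch_nonneg in auto)
  from rb_sumn[OF this] have 4: "cmod (\<Sum>m\<in>UNIV. FH m m * of_real (h m)) \<le> (nr * (1 * ch)) * Y" .
  have "cmod (\<Sum>j\<in>UNIV. \<Sum>k\<in>UNIV. rho m j k * Fj j * cnj (U k)) \<le> (nr * nr) * Y" for m
    by (rule rb_weak[OF brho'[OF bF'(1)]]) (use n_ge Yscales in auto)
  from rb_sumn[OF this] have 5: "cmod (\<Sum>m\<in>UNIV. \<Sum>j\<in>UNIV. \<Sum>k\<in>UNIV. rho m j k * Fj j * cnj (U k)) \<le> (nr * (nr * nr)) * Y" .
  show ?thesis unfolding eq
    using rb_add[OF rb_add[OF rb_add[OF rb_add[OF 1 2] 3] 4] 5] by (simp add: c_4_def)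
qed

lemma bRR: "cmod (\<Sum>m\<in>UNIV. ddbar m R p) \<le> (c_4 nr \<kappa> + c_4 nr \<kappa> + nr) * Y"
proof -
  have "cmod (ddbar m q p) \<le> 1 * Y" for m by (rule rb_weak[of _ _ \<theta>]) (use bq Yscales in auto)
  from rb_sumn[OF this] have 1: "cmod (\<Sum>m\<in>UNIV. ddbar m q p) \<le> (nr * 1) * Y" .
  show ?thesis using rb_diff[OF rb_add[OF bQQ rb_cnj[OF bQQ]] 1]
    by (simp add: dz_R(3) sum.distrib sum_subtractf)
qed

lemma bpsi2: "cmod (\<Sum>m\<in>UNIV. ddbar m psi p) \<le> c_6 nr \<kappa> * Y"
proof -
  define X1 where "X1 m = of_real (1 + f0) * ddbar m E p + dz m E p * cnj (dz m E p)" for m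
  \<comment> \<open>\<open>X1\<close> and \<open>X2\<close> gather the terms without third
    derivatives of u; they can be bounded for each \<open>m\<close>, whereas the derivatives of
    \<open>P\<close> and \<open>R\<close> are bounded only after summation over
    \<open>m\<close>.\<close>
  define X2 where "X2 m = dz m E' p * cnj (dz m P p) + cnj (dz m E' p) * dz m P p
         + P p * ddbar m E' p - U m * cnj (dz m R p) - cnj (U m) * dz m R p
         + R p * (- of_real (h m) + U m * cnj (U m))" for m
  have eq: "(\<Sum>m\<in>UNIV. ddbar m psi p) = (nn * n1) * (\<Sum>m\<in>UNIV. X1 m)
     - (of_real \<kappa> * n1) * ((\<Sum>m\<in>UNIV. X2 m) + of_real (1 - f0) * (\<Sum>m\<in>UNIV. ddbar m P p) + (\<Sum>m\<in>UNIV. ddbar m R p))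
     - (\<Sum>m\<in>UNIV. of_real \<kappa> * ddbar m mu p)"
  proof -
    have "ddbar m psi p = (nn * n1) * X1 m - (of_real \<kappa> * n1) * (X2 m + of_real (1 - f0) * ddbar m P p + ddbar m R p)
       - of_real \<kappa> * ddbar m mu p" for m
      unfolding ddbar_psi X1_def X2_def by (simp add: algebra_simps)
    then show ?thesis
      by (simp add: sum.distrib sum_subtractf sum_distrib_left[symmetric])
  qed
  have ns: "nr \<ge> 0" "\<kappa> \<ge> 0" "ch \<ge> 0" using n_ge kappa ch_nonneg by auto
  have a1: "cmod (of_real (1 + f0) * ddbar m E p) \<le> (2 * (ch + 5)) * Y" for m
    by (rule rb_mult[OF bf0(2) bE2]) (use ns Yscales in auto)
  have a2: "cmod (dz m E p * cnj (dz m E p)) \<le> (2 * 2) * Y" for m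
    by (rule rb_mult[OF bE1 rb_cnj[OF bE1]]) (use scales(1) Yscales in auto)
  have "cmod (X1 m) \<le> (2 * (ch + 5) + 4) * Y" for m
    using rb_add[OF a1 a2] by (simp add: X1_def)
  from rb_sumn[OF this] have 1: "cmod (\<Sum>m\<in>UNIV. X1 m) \<le> (nr * (2 * (ch + 5) + 4)) * Y" .
  have b0: "\<theta> * (\<theta> * Z) \<le> 2 * Y" using scales Yscales by linarith
  have wk: "cmod c \<le> A0 * Y" if "cmod c \<le> B0 * (2 * Y)" "A0 = 2 * B0" for c A0 B0 using that by simp
  have "cmod (dz m E' p * cnj (dz m P p)) \<le> (3 * (nr + ch)) * (2 * Y)" for m
    by (rule rb_mult[OF bE'1 rb_cnj[OF bP1[unfolded Pm_def]]]) (use ns b0 in auto)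
  then have b1: "cmod (dz m E' p * cnj (dz m P p)) \<le> (6 * (nr + ch)) * Y" for m by (rule wk) simp
  have "cmod (cnj (dz m E' p) * dz m P p) \<le> (3 * (nr + ch)) * (2 * Y)" for m
    by (rule rb_mult[OF rb_cnj[OF bE'1] bP1[unfolded Pm_def]]) (use ns b0 in auto)
  then have b2: "cmod (cnj (dz m E' p) * dz m P p) \<le> (6 * (nr + ch)) * Y" for m by (rule wk) simp
  have b3: "cmod (P p * ddbar m E' p) \<le> (nr * (2 * ch + 6)) * Y" for m
    by (rule rb_mult[OF bP bE'2]) (use ns Yscales in auto)
  have "cmod (U m * cnj (dz m R p)) \<le> (1 * (3 * nr + ch + 1)) * (2 * Y)" for m
    by (rule rb_mult[OF bU'(1) rb_cnj[OF bR1]]) (use ns b0 in auto)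
  then have b4: "cmod (U m * cnj (dz m R p)) \<le> (2 * (3 * nr + ch + 1)) * Y" for m by (rule wk) simp
  have "cmod (cnj (U m) * dz m R p) \<le> (1 * (3 * nr + ch + 1)) * (2 * Y)" for m
    by (rule rb_mult[OF bU'(2) bR1]) (use ns b0 in auto)
  then have b5: "cmod (cnj (U m) * dz m R p) \<le> (2 * (3 * nr + ch + 1)) * Y" for m by (rule wk) simp
  have "cmod (- of_real (h m) + U m * cnj (U m)) \<le> (ch + 1) * s" for m
    by (rule rb_add) (use bh' rb_weak[OF bUU] scales in auto)
  then have b6: "cmod (R p * (- of_real (h m) + U m * cnj (U m))) \<le> ((2 * nr + 1) * (ch + 1)) * Y" for m
    by (rule rb_mult[OF bR]) (use ns Yscales in auto)
  have "cmod (X2 m) \<le> (6 * (nr + ch) + 6 * (nr + ch) + nr * (2 * ch + 6)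
       + 2 * (3 * nr + ch + 1) + 2 * (3 * nr + ch + 1) + (2 * nr + 1) * (ch + 1)) * Y" for m
    using rb_add[OF rb_diff[OF rb_diff[OF rb_add[OF rb_add[OF b1 b2] b3] b4] b5] b6] by (simp only: X2_def)
  note 2 = rb_sumn[OF this]
  have 3: "cmod (of_real (1 - f0) * (\<Sum>m\<in>UNIV. ddbar m P p)) \<le> (1 * c_3 nr \<kappa>) * Y"
    by (rule rb_mult[OF bf0(1) bPP]) (use c_nonneg in auto)
  note 4 = rb_add[OF rb_add[OF 2 3] bRR]
  have nk: "cmod (nn * n1) \<le> (nr * nr) * 1" "cmod (of_real \<kappa> * n1) \<le> (\<kappa> * nr) * 1"
    using bnn ns n_ge(2) by (auto simp: norm_mult intro!: mult_mono)
  have 5: "cmod ((nn * n1) * (\<Sum>m\<in>UNIV. X1 m)) \<le> ((nr * nr) * (nr * (2 * (ch + 5) + 4))) * Y"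
    by (rule rb_mult[OF nk(1) 1]) (use ns in auto)
  note 6 = rb_mult[OF nk(2) 4, of Y]
  have "cmod (of_real \<kappa> * ddbar m mu p) \<le> (\<kappa> * 1) * Y" for m
    by (rule rb_mult[of _ _ 1 _ _ \<theta>]) (use bmu ns Yscales in auto)
  from rb_sumn[OF this] have 7: "cmod (\<Sum>m\<in>UNIV. of_real \<kappa> * ddbar m mu p) \<le> (nr * (\<kappa> * 1)) * Y" .
  have le: "0 \<le> \<kappa> * nr" "0 \<le> nr * (6 * (nr + ch) + 6 * (nr + ch) + nr * (2 * ch + 6) + 2 * (3 * nr + ch + 1) +
     2 * (3 * nr + ch + 1) + (2 * nr + 1) * (ch + 1)) + 1 * c_3 nr \<kappa> + (c_4 nr \<kappa> + c_4 nr \<kappa> + nr)"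
    using ns c_nonneg by (auto intro!: add_nonneg_nonneg mult_nonneg_nonneg)
  have 8: "1 * Y \<le> Y" by simp
  show ?thesis unfolding eq
    using rb_diff[OF rb_diff[OF 5 6[OF 8 le]] 7] by (simp add: c_6_def mult_ac)
qed

text \<open>The common scale of the final inequality. The summand \<open>X / s\<close> is what
  \<open>T\<close> retains of \<open>X\<close>, since each \<open>tau\<close> is at least a multiple
  of \<open>1 / s\<close>; the product \<open>s * t\<close> is \<open>X + s\<^sup>2\<close>.\<close>

definition "t = X / s + s"

lemma t_scales: "s \<le> t" "1 \<le> t" "0 \<le> t" "Z \<le> 2 * t" "Z\<^sup>2 \<le> 2 * (s * t)" "Y \<le> s * ((2 * (K * \<theta>) + 1) * t)"
   "\<theta> * Z \<le> 2 * t"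
proof -
  have s0: "s > 0" using s1 by simp
  have "X / s \<ge> 0" using X_nonneg s0 by simp
  then show 1: "s \<le> t" "1 \<le> t" "0 \<le> t" using s1 by (auto simp: t_def)
  have st: "s * t = X + s\<^sup>2" using s0 by (simp add: t_def power2_eq_square field_simps)
  have "Z\<^sup>2 + (x - s)\<^sup>2 = 2 * (x\<^sup>2 + s\<^sup>2)" by (simp add: Z_def power2_eq_square algebra_simps)
  then show 2: "Z\<^sup>2 \<le> 2 * (s * t)" unfolding st x2 using zero_le_power2[of "x - s"] by linarith
  have "2 * (s * x) \<le> X + s\<^sup>2"
    using zero_le_power2[of "x - s"] by (simp add: x2[symmetric] power2_eq_square algebra_simps)
  then have "s * (2 * x) \<le> s * t" using st by (simp add: mult_ac)
  then have "2 * x \<le> t" using s0 by (simp add: mult_le_cancel_left_pos)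
  then show 3: "Z \<le> 2 * t" using 1 by (simp add: Z_def)
  then show "\<theta> * Z \<le> 2 * t" using scales(6) by simp
  have "K * \<theta> * s * Z \<le> K * \<theta> * s * (2 * t)" using 3 K theta s0 by (intro mult_left_mono) auto
  moreover have "Y = K * \<theta> * s * Z + s * t" by (simp add: Y_def st)
  moreover have "s * ((2 * (K * \<theta>) + 1) * t) = K * \<theta> * s * (2 * t) + s * t" by (simp add: algebra_simps)
  ultimately show "Y \<le> s * ((2 * (K * \<theta>) + 1) * t)" by linarith
qed

text \<open>The leading term is at least n (n - 1) / 2, hence at least 1 in dimension two or more.
  The third condition on \<theta> bounds the remaining terms by one half in total.\<close>

lemma psi_bounds: "1 / 2 \<le> Re (psi p)" "Re (psi p) \<le> c_8 nr \<kappa>"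
proof -
  have eq: "Re (psi p) = nr * (nr - 1) / 2 * ((1 + f0) * (1 + f0))
     - \<kappa> * (nr - 1) * ((1 - f0) * Re (P p) + Re (R p)) - \<kappa> * Re (mu p)"
    unfolding psi_p nn_def n1_def nr[symmetric] using P_real(1) by (simp add: complex_eq_iff)
  have f: "0 \<le> f0" "f0 \<le> 1" using f0 theta by auto
  have "\<bar>Re (R p)\<bar> \<le> (2 * nr + 1) * \<theta>" using abs_Re_le_cmod[of "R p"] bR by linarith
  moreover have "0 \<le> (1 - f0) * Re (P p)" "(1 - f0) * Re (P p) \<le> nr * \<theta>"
    using P_real f mult_left_le_one_le[of "Re (P p)" "1 - f0"] by auto
  ultimately have 1: "\<bar>(1 - f0) * Re (P p) + Re (R p)\<bar> \<le> (3 * nr + 1) * \<theta>" 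
    by (simp add: algebra_simps abs_le_iff)
  have 2: "\<bar>\<kappa> * (nr - 1) * ((1 - f0) * Re (P p) + Re (R p))\<bar> \<le> (\<kappa> * nr) * ((3 * nr + 1) * \<theta>)"
    unfolding abs_mult using 1 kappa n_ge by (intro mult_mono) auto
  have 3: "\<bar>\<kappa> * Re (mu p)\<bar> \<le> \<kappa> * \<theta>"
    using abs_Re_le_cmod[of "mu p"] bmu(1) kappa by (simp add: abs_mult)
  have ff: "1 \<le> (1 + f0) * (1 + f0)" "(1 + f0) * (1 + f0) \<le> 4"
    using f mult_mono[of 1 "1 + f0" 1 "1 + f0"] mult_mono[of "1 + f0" 2 "1 + f0" 2] by auto
  have nn: "1 \<le> nr * (nr - 1) / 2" using n_ge mult_mono[of 2 nr 1 "nr - 1"] by auto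
  have a: "1 \<le> nr * (nr - 1) / 2 * ((1 + f0) * (1 + f0))"
    using mult_mono[OF nn ff(1)] nn by auto
  have "nr * (nr - 1) / 2 * ((1 + f0) * (1 + f0)) \<le> nr * (nr - 1) / 2 * 4"
    using ff nn by (intro mult_left_mono) auto
  also have "\<dots> \<le> nr * nr * 2" using n_ge by (simp add: algebra_simps)
  finally have b: "nr * (nr - 1) / 2 * ((1 + f0) * (1 + f0)) \<le> nr * nr * 2" .
  have "\<kappa> * \<theta> \<le> \<kappa> * \<theta> * nr" using mult_left_mono[of 1 nr "\<kappa> * \<theta>"] kappa theta n_ge by simp
  then have c: "(\<kappa> * nr) * ((3 * nr + 1) * \<theta>) + \<kappa> * \<theta> \<le> 1 / 2"
    using theta(3) by (simp add: algebra_simps)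
  show "1 / 2 \<le> Re (psi p)" unfolding eq using a c 2 3 by linarith
  have "\<theta> * (\<kappa> * nr * (3 * nr + 1)) \<le> 1 * (\<kappa> * nr * (3 * nr + 1))"
    by (rule mult_right_mono) (use theta kappa n_ge in auto)
  moreover have "\<kappa> * \<theta> \<le> \<kappa>" using theta kappa by simp
  ultimately show "Re (psi p) \<le> c_8 nr \<kappa>" unfolding eq c_8_def using b 2 3 
    by (simp add: algebra_simps abs_le_iff)
qed

lemma Q_a: "s\<^sup>2 - (\<Sum>k\<in>UNIV. (a k)\<^sup>2) = 2 * Re (psi p)"
  unfolding tau_a[symmetric]
  by (simp add: tau_def left_diff_distrib sum_subtractf power2_eq_square sum_distrib_left[symmetric]) (simp add: s_def)

lemma tau_lower: "1 / (2 * s) \<le> tau m"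
proof -
  have sm: "(\<Sum>k\<in>UNIV - {m}. a k) = tau m" unfolding tau_def s_def by (simp add: sum_diff1)
  have "(\<Sum>k\<in>UNIV. (a k)\<^sup>2) = (a m)\<^sup>2 + (\<Sum>k\<in>UNIV - {m}. (a k)\<^sup>2)" by (simp add: sum.remove)
  moreover have "(\<Sum>k\<in>UNIV - {m}. (a k)\<^sup>2) \<ge> 0" by (intro sum_nonneg) auto
  ultimately have "2 * Re (psi p) \<le> s\<^sup>2 - (a m)\<^sup>2" using Q_a by linarith
  also have "\<dots> = tau m * (s + a m)" by (simp add: tau_def power2_eq_square algebra_simps)
  also have "\<dots> \<le> tau m * (2 * s)" using tau[of m] by (intro mult_left_mono) (auto simp: tau_def)
  finally have "1 \<le> tau m * (2 * s)" using psi_bounds by linarith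
  then show ?thesis using s1 by (simp add: field_simps)
qed

text \<open>\<open>X\<close> is weighted by the lower bound for \<open>tau\<close>. For the summand
  \<open>s\<close>, consider the weighted sum \<open>H\<close> of the \<open>h m\<close>: \<kappa>
  \<open>H\<close> equals \<open>2 * Re (psi p)\<close> minus at least \<open>(nr - 1) * s\<close>,
  so it is negative of order \<open>s\<close> once \<open>s\<close> exceeds a multiple of the bound
  for \<open>psi\<close>. Cauchy-Schwarz with the weights \<open>tau\<close>, whose total is also of
  order \<open>s\<close>, passes from \<open>H\<close> to the weighted squares.\<close>

lemma T_lower:
  assumes "4 * c_8 nr \<kappa> \<le> s"
  shows "min (1 / 2) (1 / (4 * \<kappa>\<^sup>2)) * t \<le> T"
proof -
  have s0: "s > 0" using s1 by simp
  have Xs: "X = (\<Sum>m\<in>UNIV. \<Sum>j\<in>UNIV. (cmod (V j m))\<^sup>2)" unfolding X_def by (rule sum.swap)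
  have eqT: "T = (\<Sum>m\<in>UNIV. tau m * (\<Sum>j\<in>UNIV. (cmod (V j m))\<^sup>2)) + (\<Sum>m\<in>UNIV. tau m * (h m)\<^sup>2)"
    by (simp add: T_def distrib_left sum.distrib)
  have "(\<Sum>m\<in>UNIV. (1 / (2 * s)) * (\<Sum>j\<in>UNIV. (cmod (V j m))\<^sup>2)) \<le> (\<Sum>m\<in>UNIV. tau m * (\<Sum>j\<in>UNIV. (cmod (V j m))\<^sup>2))"
    using tau_lower by (intro sum_mono mult_right_mono) (auto intro: sum_nonneg)
  moreover have "(\<Sum>m\<in>UNIV. (1 / (2 * s)) * (\<Sum>j\<in>UNIV. (cmod (V j m))\<^sup>2)) = (1 / 2) * (X / s)"
    unfolding Xs by (simp add: sum_divide_distrib mult.commute)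
  ultimately have 1: "(1 / 2) * (X / s) \<le> (\<Sum>m\<in>UNIV. tau m * (\<Sum>j\<in>UNIV. (cmod (V j m))\<^sup>2))" by simp
  define H where "H = (\<Sum>m\<in>UNIV. tau m * h m)"
  have "H\<^sup>2 = (\<Sum>m\<in>UNIV. sqrt (tau m) * (sqrt (tau m) * h m))\<^sup>2"
    unfolding H_def using tau by (simp add: mult.assoc[symmetric] less_imp_le)
  also have "\<dots> \<le> (\<Sum>m\<in>UNIV. (sqrt (tau m))\<^sup>2) * (\<Sum>m\<in>UNIV. (sqrt (tau m) * h m)\<^sup>2)"
    by (rule Cauchy_Schwarz_ineq_sum)
  also have "\<dots> = ((nr - 1) * s) * (\<Sum>m\<in>UNIV. tau m * (h m)\<^sup>2)"
    using tau by (simp add: power_mult_distrib less_imp_le sum_tau'(1)[symmetric])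
  finally have CS: "H\<^sup>2 \<le> ((nr - 1) * s) * (\<Sum>m\<in>UNIV. tau m * (h m)\<^sup>2)" .
  have "\<kappa> * H = (\<Sum>m\<in>UNIV. tau m * a m) - (1 + f0) * (\<Sum>m\<in>UNIV. tau m)"
    unfolding H_def a_h by (simp add: algebra_simps sum.distrib sum_distrib_left)
  then have kH: "\<kappa> * H = 2 * Re (psi p) - (1 + f0) * ((nr - 1) * s)" unfolding tau_a sum_tau' .
  have ns: "s \<le> (nr - 1) * s" using n_ge s0 by simp
  have "(nr - 1) * s \<le> (1 + f0) * ((nr - 1) * s)" using mult_right_mono[of 1 "1 + f0" "(nr - 1) * s"] f0 ns s0 by simp
  \<comment> \<open>Here \<open>2 * Re (psi p)\<close> is absorbed: it is at most
    \<open>2 * c_8 nr \<kappa>\<close>, hence at most \<open>s / 2\<close>.\<close>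
  then have "(nr - 1) * s / 2 \<le> - (\<kappa> * H)" using kH psi_bounds assms ns by linarith
  then have "((nr - 1) * s / 2)\<^sup>2 \<le> (- (\<kappa> * H))\<^sup>2" using ns s0 by (intro power_mono) auto
  also have "\<dots> = \<kappa>\<^sup>2 * H\<^sup>2" by (simp add: power_mult_distrib)
  also have "\<dots> \<le> \<kappa>\<^sup>2 * (((nr - 1) * s) * (\<Sum>m\<in>UNIV. tau m * (h m)\<^sup>2))"
    using CS by (intro mult_left_mono) auto
  finally have "((nr - 1) * s) * ((nr - 1) * s) \<le> ((nr - 1) * s) * (4 * \<kappa>\<^sup>2 * (\<Sum>m\<in>UNIV. tau m * (h m)\<^sup>2))"
    by (simp add: power2_eq_square field_simps)
  then have "(nr - 1) * s \<le> 4 * \<kappa>\<^sup>2 * (\<Sum>m\<in>UNIV. tau m * (h m)\<^sup>2)"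
    using ns s0 by (simp add: mult_le_cancel_left_pos)
  then have "s \<le> 4 * \<kappa>\<^sup>2 * (\<Sum>m\<in>UNIV. tau m * (h m)\<^sup>2)" using ns by linarith
  then have 2: "(1 / (4 * \<kappa>\<^sup>2)) * s \<le> (\<Sum>m\<in>UNIV. tau m * (h m)\<^sup>2)" using kappa by (simp add: field_simps)
  have "min (1 / 2) (1 / (4 * \<kappa>\<^sup>2)) * t = min (1 / 2) (1 / (4 * \<kappa>\<^sup>2)) * (X / s) + min (1 / 2) (1 / (4 * \<kappa>\<^sup>2)) * s"
    by (simp add: t_def distrib_left)
  also have "\<dots> \<le> (1 / 2) * (X / s) + (1 / (4 * \<kappa>\<^sup>2)) * s"
    using s0 X_nonneg by (intro add_mono mult_right_mono) auto
  finally show ?thesis using 1 2 eqT by linarith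
qed

text \<open>The Lorentzian inequality is applied to the diagonal entries \<open>B m k k\<close>,
  whose sum weighted by \<open>tau\<close> is the derivative of \<open>psi\<close>. The form is at
  least 1 on \<open>a\<close>, so dividing by it does no harm, and the off-diagonal entries enter
  the left-hand side with a favourable sign.\<close>

lemma gradient_terms: "(cmod (dz m S p))\<^sup>2 - (\<Sum>j\<in>UNIV. \<Sum>l\<in>UNIV. (cmod (B m j l))\<^sup>2) \<le> 2 * (c_psi nr \<kappa>)\<^sup>2 * (s * t)"
proof -
  have q: "s\<^sup>2 - (\<Sum>k\<in>UNIV. (a k)\<^sup>2) \<ge> 1" using Q_a psi_bounds by linarith
  have "((cmod (\<Sum>k\<in>UNIV. B m k k))\<^sup>2 - (\<Sum>k\<in>UNIV. (cmod (B m k k))\<^sup>2)) * (s\<^sup>2 - (\<Sum>k\<in>UNIV. (a k)\<^sup>2))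
     \<le> (cmod (\<Sum>k\<in>UNIV. of_real (s - a k) * B m k k))\<^sup>2"
    using lorentz_complex[of a "\<lambda>k. B m k k"] q unfolding s_def[symmetric] by simp
  then have 1: "((cmod (dz m S p))\<^sup>2 - (\<Sum>k\<in>UNIV. (cmod (B m k k))\<^sup>2)) * (s\<^sup>2 - (\<Sum>k\<in>UNIV. (a k)\<^sup>2))
     \<le> (cmod (dz m psi p))\<^sup>2"
    unfolding dz_S(1) first_order_equation[symmetric] tau_def .
  have 2: "(cmod (dz m psi p))\<^sup>2 \<le> 2 * (c_psi nr \<kappa>)\<^sup>2 * (s * t)"
  proof -
    have "(cmod (dz m psi p))\<^sup>2 \<le> (c_psi nr \<kappa> * Z)\<^sup>2"
      using bpsi1[of m] scales(6) c_nonneg(1) by (intro power_mono) (auto intro: order_trans mult_left_mono)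
    also have "\<dots> = (c_psi nr \<kappa>)\<^sup>2 * Z\<^sup>2" by (simp add: power_mult_distrib)
    also have "\<dots> \<le> (c_psi nr \<kappa>)\<^sup>2 * (2 * (s * t))" using t_scales(5) by (intro mult_left_mono) auto
    finally show ?thesis by simp
  qed
  have "(\<Sum>k\<in>UNIV. (cmod (B m k k))\<^sup>2) \<le> (\<Sum>j\<in>UNIV. \<Sum>l\<in>UNIV. (cmod (B m j l))\<^sup>2)"
    by (intro sum_mono member_le_sum) auto
  moreover have "(cmod (dz m S p))\<^sup>2 - (\<Sum>k\<in>UNIV. (cmod (B m k k))\<^sup>2) \<le> 2 * (c_psi nr \<kappa>)\<^sup>2 * (s * t)"
  proof (cases "(cmod (dz m S p))\<^sup>2 - (\<Sum>k\<in>UNIV. (cmod (B m k k))\<^sup>2) \<le> 0")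
    case True
    then show ?thesis using 2 zero_le_power2[of "cmod (dz m psi p)"] by linarith
  next
    case False
    then have "(cmod (dz m S p))\<^sup>2 - (\<Sum>k\<in>UNIV. (cmod (B m k k))\<^sup>2) \<le> ((cmod (dz m S p))\<^sup>2 - (\<Sum>k\<in>UNIV. (cmod (B m k k))\<^sup>2)) * (s\<^sup>2 - (\<Sum>k\<in>UNIV. (a k)\<^sup>2))"
      using q by (simp add: mult_le_cancel_left1)
    then show ?thesis using 1 2 by linarith
  qed
  ultimately show ?thesis by linarith
qed

lemma tau_sum_bound:
  assumes "\<And>m. cmod (G m) \<le> A0 * y" "0 \<le> A0 * y"
  shows "cmod (\<Sum>m\<in>UNIV. of_real (tau m) * G m) \<le> nr * A0 * (s * y)"
proof -
  have "cmod (\<Sum>m\<in>UNIV. of_real (tau m) * G m) \<le> (\<Sum>m\<in>UNIV. tau m * (A0 * y))"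
    using assms tau by (intro sum_norm_le) (auto simp: norm_mult less_imp_le intro!: mult_left_mono)
  also have "\<dots> = (\<Sum>m\<in>UNIV. tau m) * (A0 * y)" by (simp add: sum_distrib_right)
  also have "\<dots> \<le> (nr * s) * (A0 * y)" using sum_tau' assms by (intro mult_right_mono) auto
  finally show ?thesis by (simp add: mult_ac)
qed

text \<open>Each error term of \<open>linearized_S\<close> is brought to the scale
  \<open>s * t\<close>. \<open>K\<close> occurs only through the right-hand side of the equation,
  and there only in the product of \<open>K\<close> with \<theta>, which can be made small after
  \<open>K\<close> is fixed.\<close>

lemma L_S: "- (s * (c_7 nr \<kappa> + c_6 nr \<kappa> * (2 * (K * \<theta>) + 1)) * t) \<le> (\<Sum>k\<in>UNIV. tau k * Re (ddbar k S p))"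
proof -
  have ss: "s * s \<le> s * t" using t_scales s1 by (intro mult_left_mono) auto
  have 1: "- (s * c_6 nr \<kappa> * (2 * (K * \<theta>) + 1) * t) \<le> Re (\<Sum>m\<in>UNIV. ddbar m psi p)"
  proof -
    have "\<bar>Re (\<Sum>m\<in>UNIV. ddbar m psi p)\<bar> \<le> c_6 nr \<kappa> * Y" using bpsi2 abs_Re_le_cmod order_trans by blast
    also have "\<dots> \<le> c_6 nr \<kappa> * (s * ((2 * (K * \<theta>) + 1) * t))" using t_scales c_nonneg by (intro mult_left_mono) auto
    finally show ?thesis by (simp add: mult_ac abs_le_iff)
  qed
  define g2 where "g2 m = (\<Sum>j\<in>UNIV. \<Sum>l\<in>UNIV. (cmod (B m j l))\<^sup>2) - (cmod (dz m S p))\<^sup>2" for m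
  have "- (2 * (c_psi nr \<kappa>)\<^sup>2 * (s * t)) \<le> g2 m" for m
    using gradient_terms[of m] unfolding g2_def by linarith
  then have "(\<Sum>m::'n\<in>UNIV. - (2 * (c_psi nr \<kappa>)\<^sup>2 * (s * t))) \<le> (\<Sum>m\<in>UNIV. g2 m)"
    by (intro sum_mono)
  then have 2: "- (nr * (2 * (c_psi nr \<kappa>)\<^sup>2 * (s * t))) \<le> (\<Sum>m\<in>UNIV. g2 m)" by (simp add: nr)
  have 3: "cmod (\<Sum>k\<in>UNIV. of_real (tau k) * ddbar k E p) \<le> nr * (ch + 5) * (s * s)"
    using bE2 ch_nonneg s1 by (intro tau_sum_bound) auto
  have n3: "cmod (of_real nr * (\<Sum>k\<in>UNIV. of_real (tau k) * ddbar k E p)) \<le> (nr * nr * (ch + 5)) * (s * s)"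
    using mult_left_mono[OF 3, of nr] n_ge by (simp add: norm_mult mult_ac)
  have 4: "cmod (of_real (\<Sum>k\<in>UNIV. tau k) * (\<Sum>k\<in>UNIV. ddbar k E p)) \<le> (nr * nr * (ch + 5)) * (s * s)"
  proof -
    have "cmod (of_real (\<Sum>k\<in>UNIV. tau k)) \<le> nr * s"
      unfolding norm_of_real using sum_tau'(2,3) by linarith
    from rb_mult[OF this rb_sumn[OF bE2], of "s * s"] show ?thesis using n_ge ch_nonneg by (simp add: mult_ac)
  qed
  have re: "- b \<le> Re c" "Re c \<le> b" if "cmod c \<le> b" for b c
    using that abs_Re_le_cmod[of c] by linarith+
  have kh: "cmod (of_real (\<kappa> * h j)) \<le> (\<kappa> * ch) * s" for j
    unfolding norm_of_real abs_mult using bh[of j] kappa by simp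
  have kr: "cmod (of_real (\<kappa> * h j) * rho k j j) \<le> (\<kappa> * ch) * s" for j k
    using rb_mult[OF kh[of j], of "rho k j j" 1 1 s] brho[of k j j] theta kappa ch_nonneg by simp
  have 5: "cmod (\<Sum>k\<in>UNIV. \<Sum>j\<in>UNIV. of_real (tau k * (\<kappa> * h j)) * rho k j j) \<le> (nr * nr * (\<kappa> * ch)) * (s * s)"
  proof -
    have "(\<Sum>k\<in>UNIV. \<Sum>j\<in>UNIV. of_real (tau k * (\<kappa> * h j)) * rho k j j)
       = (\<Sum>k\<in>UNIV. of_real (tau k) * (\<Sum>j\<in>UNIV. of_real (\<kappa> * h j) * rho k j j))"
      by (simp add: sum_distrib_left mult_ac)
    moreover have "cmod \<dots> \<le> nr * (nr * (\<kappa> * ch)) * (s * s)"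
      using rb_sumn[OF kr] n_ge kappa ch_nonneg s1 by (intro tau_sum_bound) auto
    ultimately show ?thesis by (simp add: mult_ac)
  qed
  have 6: "cmod (\<Sum>k\<in>UNIV. \<Sum>j\<in>UNIV. of_real (tau j * (\<kappa> * h j)) * rho k j j) \<le> (nr * nr * (\<kappa> * ch)) * (s * s)"
  proof -
    have "(\<Sum>k\<in>UNIV. \<Sum>j\<in>UNIV. of_real (tau j * (\<kappa> * h j)) * rho k j j)
       = (\<Sum>j\<in>UNIV. of_real (tau j) * (\<Sum>k\<in>UNIV. of_real (\<kappa> * h j) * rho k j j))"
      by (subst sum.swap) (simp add: sum_distrib_left mult_ac)
    moreover have "cmod \<dots> \<le> nr * (nr * (\<kappa> * ch)) * (s * s)"
      using rb_sumn[OF kr] n_ge kappa ch_nonneg s1 by (intro tau_sum_bound) auto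
    ultimately show ?thesis by (simp add: mult_ac)
  qed
  have "(\<Sum>k\<in>UNIV. tau k * Re (ddbar k S p)) = Re (\<Sum>k\<in>UNIV. of_real (tau k) * ddbar k S p)" by simp
  also have "\<dots> = Re (\<Sum>m\<in>UNIV. ddbar m psi p) + (\<Sum>m\<in>UNIV. g2 m)
     + Re (of_real nr * (\<Sum>k\<in>UNIV. of_real (tau k) * ddbar k E p))
     - Re (of_real (\<Sum>k\<in>UNIV. tau k) * (\<Sum>k\<in>UNIV. ddbar k E p))
     + Re (\<Sum>k\<in>UNIV. \<Sum>j\<in>UNIV. of_real (tau k * (\<kappa> * h j)) * rho k j j)
     - Re (\<Sum>k\<in>UNIV. \<Sum>j\<in>UNIV. of_real (tau j * (\<kappa> * h j)) * rho k j j)"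
  proof -
    have g: "(\<Sum>m\<in>UNIV. (\<Sum>j\<in>UNIV. \<Sum>l\<in>UNIV. of_real ((cmod (B m j l))\<^sup>2)) - of_real ((cmod (dz m S p))\<^sup>2))
      = complex_of_real (\<Sum>m\<in>UNIV. g2 m)"
      by (simp add: g2_def)
    show ?thesis unfolding linearized_S g nr[symmetric]
      by (simp only: plus_complex.sel minus_complex.sel Re_complex_of_real)
  qed
  finally have "(\<Sum>k\<in>UNIV. tau k * Re (ddbar k S p)) \<ge>
     - (s * c_6 nr \<kappa> * (2 * (K * \<theta>) + 1) * t) - nr * (2 * (c_psi nr \<kappa>)\<^sup>2 * (s * t))
      - (nr * nr * (ch + 5)) * (s * s) - (nr * nr * (ch + 5)) * (s * s)
      - (nr * nr * (\<kappa> * ch)) * (s * s) - (nr * nr * (\<kappa> * ch)) * (s * s)"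
    using 1 2 re[OF n3] re[OF 4] re[OF 5] re[OF 6] by linarith
  moreover have "(nr * nr * (ch + 5)) * (s * s) \<le> (nr * nr * (ch + 5)) * (s * t)"
    "(nr * nr * (\<kappa> * ch)) * (s * s) \<le> (nr * nr * (\<kappa> * ch)) * (s * t)"
    using ss n_ge ch_nonneg kappa by (auto intro!: mult_left_mono)
  moreover have "s * (c_7 nr \<kappa> + c_6 nr \<kappa> * (2 * (K * \<theta>) + 1)) * t = s * c_6 nr \<kappa> * (2 * (K * \<theta>) + 1) * t
      + nr * (2 * (c_psi nr \<kappa>)\<^sup>2 * (s * t)) + 2 * ((nr * nr * (ch + 5)) * (s * t)) + 2 * ((nr * nr * (\<kappa> * ch)) * (s * t))"
    unfolding c_7_def by (simp add: algebra_simps)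
  ultimately show ?thesis by linarith
qed

text \<open>By the relation between \<open>a\<close> and \<open>h\<close> the sum is
  \<open>2 * Re (psi p)\<close> minus a nonnegative multiple of the trace of \<open>tau\<close>. The
  upper bound is the direction needed for the term -|Du|^2 u_{m mbar} in the second derivatives of
  w.\<close>

lemma tau_h: "\<kappa> * (\<Sum>m\<in>UNIV. tau m * h m) \<le> 2 * c_8 nr \<kappa>"
proof -
  have "\<kappa> * (\<Sum>m\<in>UNIV. tau m * h m) = (\<Sum>m\<in>UNIV. tau m * a m) - (1 + f0) * (\<Sum>m\<in>UNIV. tau m)"
    unfolding a_h by (simp add: algebra_simps sum.distrib sum_distrib_left)
  moreover have "0 \<le> (1 + f0) * (\<Sum>m\<in>UNIV. tau m)" using sum_tau' f0 by auto
  ultimately show ?thesis unfolding tau_a using psi_bounds by linarith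
qed

definition "v m = (\<Sum>j\<in>UNIV. (cmod (V j m))\<^sup>2) + (h m)\<^sup>2"

lemma T_v: "T = (\<Sum>m\<in>UNIV. tau m * v m)" by (simp add: T_def v_def)

lemma tau_v: "(\<Sum>m\<in>UNIV. tau m * (v m + b)) \<le> T + nr * b * t" if "b \<ge> 0"
proof -
  have "(\<Sum>m\<in>UNIV. tau m * (v m + b)) = T + (\<Sum>m\<in>UNIV. tau m) * b"
    by (simp add: T_v distrib_left sum.distrib sum_distrib_right)
  also have "(\<Sum>m\<in>UNIV. tau m) * b \<le> (nr * s) * b" using sum_tau' that by (intro mult_right_mono) auto
  also have "\<dots> \<le> (nr * t) * b" using t_scales n_ge that by (intro mult_right_mono mult_left_mono) auto
  finally show ?thesis by (simp add: mult_ac)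
qed

lemma Pm_sum: "cmod (Pm m) \<le> \<theta> * ((\<Sum>j\<in>UNIV. cmod (V j m)) + \<bar>h m\<bar>)"
proof -
  have "cmod (Pm m) \<le> cmod (\<Sum>j\<in>UNIV. V j m * cnj (U j)) + cmod (U m * of_real (h m))"
    unfolding Pm_def dz_P(1) by (rule norm_triangle_ineq)
  also have "cmod (\<Sum>j\<in>UNIV. V j m * cnj (U j)) \<le> (\<Sum>j\<in>UNIV. cmod (V j m) * \<theta>)"
    by (intro sum_norm_le) (auto simp: norm_mult bU intro!: mult_left_mono)
  also have "cmod (U m * of_real (h m)) \<le> \<theta> * \<bar>h m\<bar>" by (simp add: norm_mult bU mult_right_mono)
  finally show ?thesis by (simp add: sum_distrib_left algebra_simps)
qed

lemma le_square_plus_one: "y \<le> y\<^sup>2 + 1" for y :: real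
  using zero_le_power2[of "y - 1 / 2"] by (simp add: power2_eq_square algebra_simps)

lemma Pm_v: "cmod (Pm m) \<le> \<theta> * (v m + (nr + 1))"
proof -
  have "(\<Sum>j\<in>UNIV. cmod (V j m)) \<le> (\<Sum>j\<in>UNIV. (cmod (V j m))\<^sup>2 + 1)"
    by (intro sum_mono le_square_plus_one)
  then have "(\<Sum>j\<in>UNIV. cmod (V j m)) \<le> (\<Sum>j\<in>UNIV. (cmod (V j m))\<^sup>2) + nr" by (simp add: sum.distrib nr)
  moreover have "\<bar>h m\<bar> \<le> (h m)\<^sup>2 + 1" using le_square_plus_one[of "\<bar>h m\<bar>"] by simp
  ultimately have "(\<Sum>j\<in>UNIV. cmod (V j m)) + \<bar>h m\<bar> \<le> v m + (nr + 1)" by (simp add: v_def)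
  then have "\<theta> * ((\<Sum>j\<in>UNIV. cmod (V j m)) + \<bar>h m\<bar>) \<le> \<theta> * (v m + (nr + 1))" using theta by (intro mult_left_mono) auto
  then show ?thesis using Pm_sum[of m] by linarith
qed

lemma v_nonneg: "0 \<le> v m" by (simp add: v_def sum_nonneg)

lemma T_nonneg: "0 \<le> T" unfolding T_v using tau v_nonneg by (intro sum_nonneg mult_nonneg_nonneg) (auto simp: less_imp_le)

text \<open>The second derivatives of |Du|^2 contain the squares \<open>v m\<close>, which add up to
  \<open>T\<close>. The third derivatives appear weighted by \<open>tau\<close> and are covered by
  \<open>bT2\<close>. The product of the gradients of u and of |Du|^2 is at most \<theta> times
  \<open>v m\<close> plus a constant, so it costs a small fraction of \<open>T\<close>; curvature
  and the remaining terms are of order \<open>\<theta> * t\<close>.\<close>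

lemma L_ww: "(1 - 2 * \<theta>) * T - c_9 nr \<kappa> * \<theta> * t \<le> (\<Sum>m\<in>UNIV. tau m * Re (ddbar m ww p))"
proof -
  define r where "r m = (\<Sum>j\<in>UNIV. \<Sum>k\<in>UNIV. rho m j k * U j * cnj (U k))" for m
  define G where "G m = (\<Sum>j\<in>UNIV. t3 m j * cnj (U j))" for m
  have eq: "Re (ddbar m ww p) = 2 * Re (G m) + v m + Re (r m) - 2 * Re (U m * cnj (Pm m))
      + Re (P p) * (- h m + (cmod (U m))\<^sup>2)" for m
  proof -
    have a: "Re (\<Sum>j\<in>UNIV. t3 m j * cnj (U j) + cnj (t3 m j * cnj (U j)) + V j m * cnj (V j m))
       = 2 * Re (G m) + (\<Sum>j\<in>UNIV. (cmod (V j m))\<^sup>2)"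
      unfolding complex_norm_square[symmetric] by (simp add: G_def sum.distrib)
    have b: "Re (P p * (- of_real (h m) + U m * cnj (U m))) = Re (P p) * (- h m + (cmod (U m))\<^sup>2)"
      unfolding complex_norm_square[symmetric] by (subst P_real(1)) simp
    show ?thesis unfolding dz_ww(3) ddbar_P plus_complex.sel minus_complex.sel a b r_def v_def by simp
  qed
  have "(\<Sum>m\<in>UNIV. tau m * Re (G m)) = Re (\<Sum>j\<in>UNIV. (\<Sum>m\<in>UNIV. of_real (tau m) * t3 m j) * cnj (U j))"
  proof -
    have "(\<Sum>m\<in>UNIV. of_real (tau m) * G m) = (\<Sum>j\<in>UNIV. (\<Sum>m\<in>UNIV. of_real (tau m) * t3 m j) * cnj (U j))"
      unfolding G_def sum_distrib_left sum_distrib_right by (subst sum.swap) (simp add: mult_ac)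
    moreover have "(\<Sum>m\<in>UNIV. tau m * Re (G m)) = Re (\<Sum>m\<in>UNIV. of_real (tau m) * G m)" by simp
    ultimately show ?thesis by simp
  qed
  moreover have "cmod (\<Sum>j\<in>UNIV. (\<Sum>m\<in>UNIV. of_real (tau m) * t3 m j) * cnj (U j)) \<le> (nr * (c_2 nr \<kappa> * 1)) * (2 * (\<theta> * t))"
  proof (rule rb_sumn)
    fix j
    have "\<theta> * Z * \<theta> \<le> 2 * t * \<theta>" using t_scales(7) theta by (intro mult_right_mono) auto
    then show "cmod ((\<Sum>m\<in>UNIV. of_real (tau m) * t3 m j) * cnj (U j)) \<le> (c_2 nr \<kappa> * 1) * (2 * (\<theta> * t))"
      by (intro rb_mult[OF bT2 bU'(2)]) (use c_nonneg in \<open>auto simp: mult_ac\<close>)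
  qed
  ultimately have 1: "- (2 * (nr * c_2 nr \<kappa> * (\<theta> * t))) \<le> (\<Sum>m\<in>UNIV. tau m * Re (G m))"
    using abs_Re_le_cmod[of "\<Sum>j\<in>UNIV. (\<Sum>m\<in>UNIV. of_real (tau m) * t3 m j) * cnj (U j)"] by (simp add: abs_le_iff)
  have 2: "- (nr * (nr * nr) * (\<theta> * t)) \<le> (\<Sum>m\<in>UNIV. tau m * Re (r m))"
  proof -
    have "cmod (r m) \<le> (nr * nr) * \<theta>" for m unfolding r_def by (rule brho'[OF bU'(1)])
    then have "cmod (\<Sum>m\<in>UNIV. of_real (tau m) * r m) \<le> nr * (nr * nr) * (s * \<theta>)"
      using n_ge theta by (intro tau_sum_bound) auto
    also have "\<dots> \<le> nr * (nr * nr) * (\<theta> * t)"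
      using n_ge theta t_scales by (intro mult_left_mono) (auto simp: mult.commute)
    finally show ?thesis using abs_Re_le_cmod[of "\<Sum>m\<in>UNIV. of_real (tau m) * r m"] by (simp add: abs_le_iff)
  qed
  have 3: "(\<Sum>m\<in>UNIV. tau m * (2 * Re (U m * cnj (Pm m)))) \<le> 2 * \<theta> * T + 2 * (nr + 1) * nr * (\<theta> * t)"
  proof -
    have "tau m * (2 * Re (U m * cnj (Pm m))) \<le> 2 * \<theta> * (tau m * (v m + (nr + 1)))" for m
    proof -
      have vn: "0 \<le> v m + (nr + 1)" using v_nonneg[of m] n_ge by simp
      have "Re (U m * cnj (Pm m)) \<le> cmod (U m * cnj (Pm m))" by (rule complex_Re_le_cmod)
      also have "\<dots> \<le> \<theta> * (\<theta> * (v m + (nr + 1)))"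
        unfolding norm_mult complex_mod_cnj using bU[of m] Pm_v[of m] theta by (intro mult_mono) auto
      also have "\<dots> = (\<theta> * \<theta>) * (v m + (nr + 1))" by simp
      also have "\<dots> \<le> \<theta> * (v m + (nr + 1))" using scales(1) vn by (intro mult_right_mono) auto
      finally have "tau m * (2 * Re (U m * cnj (Pm m))) \<le> tau m * (2 * (\<theta> * (v m + (nr + 1))))"
        using tau[of m] by (intro mult_left_mono) auto
      then show ?thesis by (simp add: mult_ac)
    qed
    then have "(\<Sum>m\<in>UNIV. tau m * (2 * Re (U m * cnj (Pm m)))) \<le> 2 * \<theta> * (\<Sum>m\<in>UNIV. tau m * (v m + (nr + 1)))"
      unfolding sum_distrib_left by (intro sum_mono)
    also have "\<dots> \<le> 2 * \<theta> * (T + nr * (nr + 1) * t)"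
      using tau_v[of "nr + 1"] theta n_ge by (intro mult_left_mono) auto
    finally show ?thesis by (simp add: algebra_simps)
  qed
  have 4: "- (2 * nr * c_8 nr \<kappa> / \<kappa> * (\<theta> * t)) \<le> (\<Sum>m\<in>UNIV. tau m * (Re (P p) * (- h m + (cmod (U m))\<^sup>2)))"
  proof -
    have "(\<Sum>m\<in>UNIV. tau m * (Re (P p) * (- h m))) \<le> (\<Sum>m\<in>UNIV. tau m * (Re (P p) * (- h m + (cmod (U m))\<^sup>2)))"
      using tau P_real by (intro sum_mono mult_left_mono) (auto simp: less_imp_le)
    moreover have "(\<Sum>m\<in>UNIV. tau m * (Re (P p) * (- h m))) = - (Re (P p) * (\<Sum>m\<in>UNIV. tau m * h m))"
      by (simp add: sum_distrib_left sum_negf mult_ac)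
    moreover have "Re (P p) * (\<Sum>m\<in>UNIV. tau m * h m) \<le> (nr * \<theta>) * (2 * c_8 nr \<kappa> / \<kappa>)"
    proof -
      have "(\<Sum>m\<in>UNIV. tau m * h m) \<le> 2 * c_8 nr \<kappa> / \<kappa>" using tau_h kappa by (simp add: field_simps)
      then have "Re (P p) * (\<Sum>m\<in>UNIV. tau m * h m) \<le> Re (P p) * (2 * c_8 nr \<kappa> / \<kappa>)"
        using P_real by (intro mult_left_mono)
      also have "\<dots> \<le> (nr * \<theta>) * (2 * c_8 nr \<kappa> / \<kappa>)"
        using P_real c_nonneg kappa by (intro mult_right_mono) auto
      finally show ?thesis .
    qed
    moreover have "(nr * \<theta>) * (2 * c_8 nr \<kappa> / \<kappa>) \<le> (nr * \<theta>) * (2 * c_8 nr \<kappa> / \<kappa>) * t"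
      using mult_left_mono[of 1 t "(nr * \<theta>) * (2 * c_8 nr \<kappa> / \<kappa>)"] t_scales n_ge theta c_nonneg kappa by simp
    ultimately show ?thesis by (simp add: mult_ac)
  qed
  have "(\<Sum>m\<in>UNIV. tau m * Re (ddbar m ww p)) = 2 * (\<Sum>m\<in>UNIV. tau m * Re (G m)) + T + (\<Sum>m\<in>UNIV. tau m * Re (r m))
     - (\<Sum>m\<in>UNIV. tau m * (2 * Re (U m * cnj (Pm m)))) + (\<Sum>m\<in>UNIV. tau m * (Re (P p) * (- h m + (cmod (U m))\<^sup>2)))"
    unfolding eq T_v by (simp only: distrib_left right_diff_distrib sum.distrib sum_subtractf sum_distrib_left mult.left_commute[of "tau _" 2])
  moreover have "c_9 nr \<kappa> * \<theta> * t = 2 * (2 * (nr * c_2 nr \<kappa> * (\<theta> * t))) + nr * (nr * nr) * (\<theta> * t)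
     + 2 * (nr + 1) * nr * (\<theta> * t) + 2 * nr * c_8 nr \<kappa> / \<kappa> * (\<theta> * t)"
    unfolding c_9_def by (simp add: algebra_simps)
  moreover have "(1 - 2 * \<theta>) * T = T - 2 * \<theta> * T" by (simp add: algebra_simps)
  ultimately show ?thesis using 1 2 3 4 by linarith
qed

text \<open>This is the negative square left over in \<open>max_second\<close>. The first
  derivatives of w are \<theta> times sums of second derivatives of u, so their squares are again
  bounded by the density \<open>v m\<close> of \<open>T\<close> with a small factor.\<close>

lemma W2: "(\<Sum>m\<in>UNIV. tau m * (cmod (wm m))\<^sup>2) \<le> c_10 nr * \<theta> * (T + t)"
proof -
  have w: "(cmod (wm m))\<^sup>2 \<le> (3 * nr * \<theta>) * (v m + nr)" for m
  proof -
    define A where "A = (\<Sum>j\<in>UNIV. cmod (V j m))"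
    have "cmod (wm m) \<le> cmod (Pm m) + cmod (U m * P p)" unfolding dz_ww(1) by (rule norm_triangle_ineq4)
    also have "cmod (U m * P p) \<le> \<theta> * nr"
      using rb_mult[OF bU'(1) bP scales(1), of m] n_ge by (simp add: mult.commute)
    finally have "cmod (wm m) \<le> \<theta> * (A + \<bar>h m\<bar> + nr)" using Pm_sum[of m] by (simp add: A_def algebra_simps)
    then have "(cmod (wm m))\<^sup>2 \<le> (\<theta> * (A + \<bar>h m\<bar> + nr))\<^sup>2" by (intro power_mono) auto
    also have "\<dots> = (\<theta> * \<theta>) * (A + \<bar>h m\<bar> + nr)\<^sup>2" by (simp add: power2_eq_square)
    also have "\<dots> \<le> \<theta> * (A + \<bar>h m\<bar> + nr)\<^sup>2" using scales(1) by (intro mult_right_mono) auto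
    also have "(A + \<bar>h m\<bar> + nr)\<^sup>2 \<le> 3 * (A\<^sup>2 + (h m)\<^sup>2 + nr\<^sup>2)"
      using zero_le_power2[of "A - \<bar>h m\<bar>"] zero_le_power2[of "A - nr"] zero_le_power2[of "\<bar>h m\<bar> - nr"]
      by (simp add: power2_eq_square algebra_simps abs_mult_self_eq)
    also have "A\<^sup>2 \<le> nr * (\<Sum>j\<in>UNIV. (cmod (V j m))\<^sup>2)"
      using Cauchy_Schwarz_ineq_sum[of "\<lambda>j. 1" "\<lambda>j. cmod (V j m)" UNIV] by (simp add: A_def nr)
    also have "(h m)\<^sup>2 \<le> nr * (h m)\<^sup>2" using n_ge mult_right_mono[of 1 nr "(h m)\<^sup>2"] by simp
    finally have "(cmod (wm m))\<^sup>2 \<le> \<theta> * (3 * (nr * (\<Sum>j\<in>UNIV. (cmod (V j m))\<^sup>2) + nr * (h m)\<^sup>2 + nr\<^sup>2))"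
      using theta by (simp add: mult_left_mono)
    then show ?thesis by (simp add: v_def power2_eq_square algebra_simps)
  qed
  have "(\<Sum>m\<in>UNIV. tau m * (cmod (wm m))\<^sup>2) \<le> (\<Sum>m\<in>UNIV. tau m * ((3 * nr * \<theta>) * (v m + nr)))"
    using w tau by (intro sum_mono mult_left_mono) (auto simp: less_imp_le)
  also have "\<dots> = (3 * nr * \<theta>) * (\<Sum>m\<in>UNIV. tau m * (v m + nr))" by (simp add: sum_distrib_left mult_ac)
  also have "\<dots> \<le> (3 * nr * \<theta>) * (T + nr * nr * t)" using tau_v[of nr] n_ge theta by (intro mult_left_mono) auto
  also have "\<dots> \<le> (3 * nr * \<theta>) * (nr * nr * (T + t))"
  proof (intro mult_left_mono)
    have "1 \<le> nr * nr" using n_ge mult_mono[of 1 nr 1 nr] by simp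
    then show "T + nr * nr * t \<le> nr * nr * (T + t)" using T_nonneg by (simp add: distrib_left mult_le_cancel_right1)
  qed (use n_ge theta in auto)
  finally show ?thesis by (simp add: c_10_def mult_ac)
qed

text \<open>The equation, differentiated twice, bounds $\sum \tau_m S_{m\bar m}$ from below up to the term
  \<open>t\<close>; the good term $K T$ produced by \<open>w\<close> absorbs it because \<open>T\<close> controls \<open>t\<close> once \<open>s\<close> is
  large.\<close>

lemma trace_bound:
  assumes Kc: "K * min (1 / 2) (1 / (4 * \<kappa>\<^sup>2)) = 2 * (c_7 nr \<kappa> + c_6 nr \<kappa> + 1)"
    and th: "\<theta> \<le> 1 / 8" "K * c_10 nr * \<theta> \<le> 1 / 4"
      "\<theta> * (2 * c_6 nr \<kappa> * K + K * c_9 nr \<kappa> + K\<^sup>2 * c_10 nr) \<le> 1 / 2"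
  shows "s < 4 * c_8 nr \<kappa>"
proof (rule ccontr)
  assume "\<not> ?thesis"
  \<comment> \<open>The negated claim is exactly the hypothesis of \<open>T_lower\<close>.\<close>
  then have T: "min (1 / 2) (1 / (4 * \<kappa>\<^sup>2)) * t \<le> T" by (intro T_lower) simp
  have s0: "s > 0" using s1 by simp
  have "(\<Sum>m\<in>UNIV. tau m * (Re (ddbar m S p) + s * K * Re (ddbar m ww p) - K\<^sup>2 * s * (cmod (wm m))\<^sup>2)) \<le> 0"
    using max_second tau by (intro sum_nonpos) (auto simp: mult_le_0_iff less_imp_le)
  then have "(\<Sum>m\<in>UNIV. tau m * Re (ddbar m S p)) + s * K * (\<Sum>m\<in>UNIV. tau m * Re (ddbar m ww p))
     - K\<^sup>2 * s * (\<Sum>m\<in>UNIV. tau m * (cmod (wm m))\<^sup>2) \<le> 0"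
    by (simp add: distrib_left right_diff_distrib sum.distrib sum_subtractf sum_distrib_left mult_ac)
  moreover have "s * K * ((1 - 2 * \<theta>) * T - c_9 nr \<kappa> * \<theta> * t) \<le> s * K * (\<Sum>m\<in>UNIV. tau m * Re (ddbar m ww p))"
    using L_ww s0 K by (intro mult_left_mono) auto
  moreover have "K\<^sup>2 * s * (\<Sum>m\<in>UNIV. tau m * (cmod (wm m))\<^sup>2) \<le> K\<^sup>2 * s * (c_10 nr * \<theta> * (T + t))"
    using W2 s0 by (intro mult_left_mono) auto
  moreover note L_S
  ultimately have "- (s * (c_7 nr \<kappa> + c_6 nr \<kappa> * (2 * (K * \<theta>) + 1)) * t) + s * K * ((1 - 2 * \<theta>) * T - c_9 nr \<kappa> * \<theta> * t)
      - K\<^sup>2 * s * (c_10 nr * \<theta> * (T + t)) \<le> 0" by linarith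
  then have "s * (K * T * (1 - 2 * \<theta> - K * c_10 nr * \<theta>)
       - (c_7 nr \<kappa> + c_6 nr \<kappa>) * t - \<theta> * (2 * c_6 nr \<kappa> * K + K * c_9 nr \<kappa> + K\<^sup>2 * c_10 nr) * t) \<le> 0"
    by (simp add: algebra_simps power2_eq_square)
  then have 1: "K * T * (1 - 2 * \<theta> - K * c_10 nr * \<theta>)
       - (c_7 nr \<kappa> + c_6 nr \<kappa>) * t - \<theta> * (2 * c_6 nr \<kappa> * K + K * c_9 nr \<kappa> + K\<^sup>2 * c_10 nr) * t \<le> 0"
    using s0 by (simp add: mult_le_0_iff)
  \<comment> \<open>At most half of the good term is spent on errors proportional to
    \<open>T\<close>. By the choice of \<open>K\<close> the other half exceeds the fixed coefficient
    of \<open>t\<close> by one, and the terms with a factor \<theta> use only one half of that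
    surplus.\<close>
  have "K * T * (1 / 2) \<le> K * T * (1 - 2 * \<theta> - K * c_10 nr * \<theta>)"
    using th K T_nonneg by (intro mult_left_mono) auto
  moreover have "K * (min (1 / 2) (1 / (4 * \<kappa>\<^sup>2)) * t) \<le> K * T" using T K by (intro mult_left_mono) auto
  then have "2 * (c_7 nr \<kappa> + c_6 nr \<kappa> + 1) * t \<le> K * T" unfolding Kc[symmetric] by (simp add: mult.assoc)
  moreover have "\<theta> * (2 * c_6 nr \<kappa> * K + K * c_9 nr \<kappa> + K\<^sup>2 * c_10 nr) * t \<le> (1 / 2) * t"
    using th t_scales by (intro mult_right_mono) auto
  ultimately have "(c_7 nr \<kappa> + c_6 nr \<kappa> + 1) * t - (c_7 nr \<kappa> + c_6 nr \<kappa>) * t - (1 / 2) * t \<le> 0" using 1 by linarith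
  then have "t \<le> 0" by (simp add: algebra_simps)
  then show False using t_scales by simp
qed

end

section \<open>Holomorphic maps\<close>

definition jac :: "(complex^'n::finite \<Rightarrow> complex^'n) \<Rightarrow> complex^'n \<Rightarrow> complex^'n^'n" where
  "jac h w = (\<chi> a j. dz j (\<lambda>x. h x $ a) w)"

lemma axis_ii: "axis j \<i> = \<i> *s axis j (1::complex)"
  by (simp add: vec_eq_iff axis_def)

lemma norm_smult_axis: "norm (c *s axis j (1::complex) :: complex^'n::finite) = cmod c"
proof -
  have "(\<Sum>i\<in>UNIV. (norm ((c *s axis j (1::complex) :: complex^'n) $ i))\<^sup>2) = (\<Sum>i\<in>UNIV. if i = j then (cmod c)\<^sup>2 else 0)"
    by (intro sum.cong refl) (auto simp: axis_def)
  then show ?thesis by (simp add: norm_vec_def L2_set_def)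
qed

lemma real_linear_wirtinger:
  fixes F :: "complex^'n::finite \<Rightarrow> complex"
  assumes "F differentiable (at z)"
  shows "frechet_derivative F (at z) y = (\<Sum>a\<in>UNIV. dz a F z * y $ a + dzbar a F z * cnj (y $ a))"
proof -
  let ?L = "frechet_derivative F (at z)"
  have L: "linear ?L" using assms by (rule linear_frechet_derivative)
  have "y = (\<Sum>a\<in>UNIV. Re (y $ a) *\<^sub>R axis a 1 + Im (y $ a) *\<^sub>R axis a \<i>)"
    by (simp add: vec_eq_iff axis_def complex_eq_iff if_distrib[of Re] if_distrib[of Im] if_distrib[of "(*) _"] cong: if_cong)
  then have "?L y = ?L (\<Sum>a\<in>UNIV. Re (y $ a) *\<^sub>R axis a 1 + Im (y $ a) *\<^sub>R axis a \<i>)" by simp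
  also have "\<dots> = (\<Sum>a\<in>UNIV. Re (y $ a) *\<^sub>R ?L (axis a 1) + Im (y $ a) *\<^sub>R ?L (axis a \<i>))"
    using L by (simp add: linear_sum linear_add linear_cmul)
  also have "\<dots> = (\<Sum>a\<in>UNIV. dz a F z * y $ a + dzbar a F z * cnj (y $ a))"
  proof (intro sum.cong refl)
    fix a
    have "y $ a = of_real (Re (y $ a)) + \<i> * of_real (Im (y $ a))" by (simp add: complex_eq_iff)
    moreover have "cnj (y $ a) = of_real (Re (y $ a)) - \<i> * of_real (Im (y $ a))" by (simp add: complex_eq_iff)
    moreover have "dz a F z * (p + \<i> * q) + dzbar a F z * (p - \<i> * q) = p * ?L (axis a 1) + q * ?L (axis a \<i>)" for p q
      by (simp add: dz_def dzbar_def field_simps)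
    ultimately show "Re (y $ a) *\<^sub>R ?L (axis a 1) + Im (y $ a) *\<^sub>R ?L (axis a \<i>) = dz a F z * y $ a + dzbar a F z * cnj (y $ a)"
      by (metis scaleR_conv_of_real)
  qed
  finally show ?thesis .
qed

lemma complex_linear_component:
  fixes f :: "complex^'n::finite \<Rightarrow> complex"
  assumes f: "(f has_derivative D) (at z)" and D: "\<And>c v. D (c *s v) = c * D v"
  shows "dz j f z = D (axis j 1)" "dzbar j f z = 0" "D v = (\<Sum>j\<in>UNIV. dz j f z * v $ j)" "f differentiable (at z)"
proof -
  have fd: "frechet_derivative f (at z) = D" by (rule frechet_derivative_eqI[OF f])
  show 1: "dz j f z = D (axis j 1)" "dzbar j f z = 0" for j
    by (simp_all add: dz_def dzbar_def fd axis_ii D)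
  show d: "f differentiable (at z)" using f by (auto simp: differentiable_def)
  show "D v = (\<Sum>j\<in>UNIV. dz j f z * v $ j)"
    using real_linear_wirtinger[OF d, of v] by (simp add: fd 1)
qed

lemma holomorphic_map_component:
  fixes h :: "complex^'n::finite \<Rightarrow> complex^'n"
  assumes "holomorphic_map_on V h" "z \<in> V"
  obtains D where "(h has_derivative D) (at z)" "\<And>c v. D (c *s v) = c *s D v"
    "\<And>a. ((\<lambda>x. h x $ a) has_derivative (\<lambda>v. D v $ a)) (at z)"
    "\<And>v. D v = jac h z *v v"
proof -
  obtain D where D: "(h has_derivative D) (at z)" "\<And>c v. D (c *s v) = c *s D v"
    using assms unfolding holomorphic_map_on_def by blast
  have c: "((\<lambda>x. h x $ a) has_derivative (\<lambda>v. D v $ a)) (at z)" for a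
    by (rule bounded_linear.has_derivative[OF bounded_linear_vec_nth D(1)])
  have "D v = jac h z *v v" for v
    unfolding vec_eq_iff
  proof
    fix a
    have "D v $ a = (\<Sum>j\<in>UNIV. dz j (\<lambda>x. h x $ a) z * v $ j)"
      by (rule complex_linear_component(3)[OF c]) (simp add: D)
    then show "D v $ a = (jac h z *v v) $ a" by (simp add: jac_def matrix_vector_mult_def)
  qed
  with that D c show ?thesis by blast
qed

text \<open>The derivative of a holomorphic map is complex linear, so the two types of derivative do
  not mix.\<close>

lemma wirtinger_chain:
  fixes h :: "complex^'n::finite \<Rightarrow> complex^'n" and F :: "complex^'n \<Rightarrow> complex"
  assumes h: "holomorphic_map_on V h" "z \<in> V" and F: "F differentiable (at (h z))"
  shows "dz j (\<lambda>w. F (h w)) z = (\<Sum>a\<in>UNIV. dz a F (h z) * jac h z $ a $ j)"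
    "dzbar j (\<lambda>w. F (h w)) z = (\<Sum>a\<in>UNIV. dzbar a F (h z) * cnj (jac h z $ a $ j))"
    "(\<lambda>w. F (h w)) differentiable (at z)"
proof -
  obtain D where D: "(h has_derivative D) (at z)" "\<And>c v. D (c *s v) = c *s D v" "\<And>v. D v = jac h z *v v"
    using holomorphic_map_component[OF h] by metis
  have c: "((\<lambda>w. F (h w)) has_derivative (\<lambda>v. frechet_derivative F (at (h z)) (D v))) (at z)"
    by (rule has_derivative_compose[OF D(1) frechet_derivative_worksI[OF F]])
  then show "(\<lambda>w. F (h w)) differentiable (at z)" by (auto simp: differentiable_def)
  have fd: "frechet_derivative (\<lambda>w. F (h w)) (at z) v = frechet_derivative F (at (h z)) (D v)" for v
    by (simp add: frechet_derivative_eqI[OF c])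
  have Da: "D (axis j 1) $ a = jac h z $ a $ j" for a
    by (simp add: D(3) matrix_vector_mult_def axis_def mult_delta_right)
  define y where "y a = jac h z $ a $ j" for a
  define A where "A a = dz a F (h z)" for a
  define B where "B a = dzbar a F (h z)" for a
  have e1: "frechet_derivative F (at (h z)) (D (axis j 1)) = (\<Sum>a\<in>UNIV. A a * y a) + (\<Sum>a\<in>UNIV. B a * cnj (y a))"
    unfolding real_linear_wirtinger[OF F] Da by (simp add: y_def sum.distrib A_def B_def)
  have e2: "frechet_derivative F (at (h z)) (D (axis j \<i>)) = \<i> * (\<Sum>a\<in>UNIV. A a * y a) - \<i> * (\<Sum>a\<in>UNIV. B a * cnj (y a))"
    unfolding real_linear_wirtinger[OF F] axis_ii D(2) vector_smult_component Da
    by (simp add: y_def sum.distrib A_def B_def sum_distrib_left sum_negf sum_subtractf mult_ac)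
  have "dz j (\<lambda>w. F (h w)) z = (\<Sum>a\<in>UNIV. A a * y a)"
    unfolding dz_def fd e1 e2 by (simp add: field_simps)
  then show "dz j (\<lambda>w. F (h w)) z = (\<Sum>a\<in>UNIV. dz a F (h z) * jac h z $ a $ j)" by (simp add: A_def y_def)
  have "dzbar j (\<lambda>w. F (h w)) z = (\<Sum>a\<in>UNIV. B a * cnj (y a))"
    unfolding dzbar_def fd e1 e2 by (simp add: field_simps)
  then show "dzbar j (\<lambda>w. F (h w)) z = (\<Sum>a\<in>UNIV. dzbar a F (h z) * cnj (jac h z $ a $ j))" by (simp add: B_def y_def)
qed

text \<open>The Cauchy integral formula in the \<open>j\<close>-th variable, with \<open>e t\<close> running through the unit
  circle.\<close>

lemma partial_cauchy_formula:
  fixes f :: "complex^'n::finite \<Rightarrow> complex"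
  assumes r: "r > 0" and sub: "\<And>c. cmod c \<le> r \<Longrightarrow> x + c *s axis j 1 \<in> V"
    and f: "\<And>z. z \<in> V \<Longrightarrow> \<exists>D. (f has_derivative D) (at z) \<and> (\<forall>c v. D (c *s v) = c * D v)"
  defines "e \<equiv> \<lambda>t::real. exp (2 * of_real pi * \<i> * of_real t)"
  shows "((\<lambda>t. f (x + (of_real r * e t) *s axis j 1) / (of_real r * e t)) has_integral dz j f x) (cbox 0 1)"
proof -
  define g where "g c = f (x + c *s axis j 1)" for c
  have gd: "(g has_field_derivative dz j f (x + c *s axis j 1)) (at c)" if c: "cmod c \<le> r" for c
  proof -
    obtain D where D: "(f has_derivative D) (at (x + c *s axis j 1))" "\<And>c v. D (c *s v) = c * D v"
      using f[OF sub[OF c]] by blast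
    have "linear (\<lambda>c::complex. c *s axis j 1 :: complex^'n)"
      by (intro linearI) (auto simp: vec_eq_iff algebra_simps)
    then have "((\<lambda>c. c *s axis j 1 :: complex^'n) has_derivative (\<lambda>c. c *s axis j 1)) (at c)"
      by (simp add: bounded_linear_imp_has_derivative linear_conv_bounded_linear)
    then have "((\<lambda>c. x + c *s axis j 1) has_derivative (\<lambda>c. c *s axis j 1)) (at c)"
      by (auto intro!: derivative_eq_intros)
    from has_derivative_compose[OF this D(1)] have "(g has_derivative (\<lambda>c. D (c *s axis j 1))) (at c)"
      by (simp add: g_def[abs_def])
    then show ?thesis
      unfolding has_field_derivative_def complex_linear_component(1)[OF D] D(2)
      by (simp add: mult.commute[of _ "D (axis j 1)"])
  qed
  have cont: "continuous_on (cball 0 r) g"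
    by (intro continuous_at_imp_continuous_on ballI DERIV_isCont[OF gd]) simp
  have hol: "g holomorphic_on ball 0 r"
    unfolding holomorphic_on_def field_differentiable_def
    using gd by (meson has_field_derivative_at_within less_imp_le mem_ball_0)
  have "(0::complex) \<in> ball 0 r" using r by simp
  note C = Cauchy_derivative_integral_circlepath[OF cont hol this]
  have "(g has_field_derivative dz j f x) (at 0)" using gd[of 0] r by simp
  from DERIV_unique[OF C(2) this]
  have eq: "contour_integral (circlepath 0 r) (\<lambda>u. g u / (u - 0)\<^sup>2) = 2 * of_real pi * \<i> * dz j f x"
    by (simp add: field_simps)
  from has_contour_integral_integral[OF C(1)]
  have "((\<lambda>u. g u / (u - 0)\<^sup>2) has_contour_integral (2 * of_real pi * \<i> * dz j f x)) (circlepath 0 r)"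
    unfolding eq .
  then have "((\<lambda>t. g (circlepath 0 r t) / (circlepath 0 r t)\<^sup>2 * (2 * pi * \<i> * r * e t)) has_integral
      (2 * of_real pi * \<i> * dz j f x)) (cbox 0 1)"
    unfolding has_contour_integral vector_derivative_circlepath e_def by simp
  from has_integral_mult_right[OF this, of "1 / (2 * of_real pi * \<i>)"]
  have "((\<lambda>t. 1 / (2 * of_real pi * \<i>) * (g (circlepath 0 r t) / (circlepath 0 r t)\<^sup>2 * (2 * pi * \<i> * r * e t))) has_integral dz j f x) (cbox 0 1)"
    by simp
  moreover have "1 / (2 * of_real pi * \<i>) * (g (circlepath 0 r t) / (circlepath 0 r t)\<^sup>2 * (2 * pi * \<i> * r * e t))
     = f (x + (of_real r * e t) *s axis j 1) / (of_real r * e t)" for t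
  proof -
    have "circlepath 0 r t = of_real r * e t" by (simp add: circlepath e_def)
    then show ?thesis using r by (simp add: g_def power2_eq_square e_def)
  qed
  ultimately show ?thesis by simp
qed

text \<open>Transition maps are assumed to be complex differentiable and nothing more, whereas
  transforming a Hessian requires a second derivative. Cauchy's formula writes a partial derivative
  as an integral of \<open>f\<close> over circles of fixed radius; such a parameter integral is
  first continuous and then differentiable, with a complex linear derivative.\<close>

lemma holomorphic_partial_continuous:
  fixes f :: "complex^'n::finite \<Rightarrow> complex"
  assumes V: "open V" and f: "\<And>z. z \<in> V \<Longrightarrow> \<exists>D. (f has_derivative D) (at z) \<and> (\<forall>c v. D (c *s v) = c * D v)"
  shows "continuous_on V (dz j f)"
    and "z \<in> V \<Longrightarrow> \<exists>D. (dz j f has_derivative D) (at z) \<and> (\<forall>c v. D (c *s v) = c * D v)"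
proof -
  define e where "e t = exp (2 * of_real pi * \<i> * of_real t)" for t :: real
  have ne: "cmod (e t) = 1" for t by (simp add: e_def norm_exp_eq_Re)
  have ce: "continuous_on S e" for S unfolding e_def[abs_def] by (intro continuous_intros)
  have cf: "continuous_on V f"
    using f by (intro continuous_at_imp_continuous_on ballI) (metis has_derivative_continuous)
  have loc: "\<exists>r>0. ball z r \<subseteq> V \<and> (\<forall>x\<in>ball z r. \<forall>c. cmod c \<le> r \<longrightarrow> x + c *s axis j 1 \<in> V)" if z: "z \<in> V" for z
  proof -
    obtain R where R: "R > 0" "ball z R \<subseteq> V" using V z openE by blast
    have "x + c *s axis j 1 \<in> V" if "x \<in> ball z (R/2)" "cmod c \<le> R/2" for x c
    proof -
      have "dist z (x + c *s axis j 1) \<le> dist z x + dist x (x + c *s axis j 1)" by (rule dist_triangle)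
      also have "\<dots> < R" using that by (simp add: dist_norm norm_smult_axis)
      finally show ?thesis using R by auto
    qed
    then show ?thesis using R by (intro exI[of _ "R/2"]) auto
  qed
  have cp: "continuous_on (U \<times> cbox 0 1) (\<lambda>(x, t). x + (of_real r * e t) *s axis l (1::complex) :: complex^'n)"
    for r l and U :: "(complex^'n) set"
  proof -
    have "continuous_on (U \<times> cbox 0 1) (\<lambda>y. fst y + (of_real r * e (snd y)) *s axis l (1::complex))"
      unfolding vector_scalar_mult_def e_def by (intro continuous_intros continuous_on_vec_lambda)
    then show ?thesis by (simp add: case_prod_unfold)
  qed
  \<comment> \<open>All partial derivatives, not only the j-th, have to be continuous before the
    Leibniz rule can be applied, because the derivative of the integrand contains all of
    them.\<close>
  have C: "continuous_on V (dz l f)" for l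
  proof -
    have "isCont (dz l f) z" if z: "z \<in> V" for z
    proof -
      obtain R where R: "R > 0" "ball z R \<subseteq> V" using V z openE by blast
      define r where "r = R / 2"
      have r: "r > 0" "ball z r \<subseteq> V" using R by (auto simp: r_def)
      have sub: "x + c *s axis l 1 \<in> V" if "x \<in> ball z r" "cmod c \<le> r" for x c
      proof -
        have "dist z (x + c *s axis l 1) \<le> dist z x + dist x (x + c *s axis l 1)" by (rule dist_triangle)
        also have "\<dots> < R" using that by (simp add: dist_norm norm_smult_axis r_def)
        finally show ?thesis using R by auto
      qed
      define G where "G x t = f (x + (of_real r * e t) *s axis l 1) / (of_real r * e t)" for x t
      have "continuous_on (ball z r \<times> cbox 0 1) (\<lambda>y. G (fst y) (snd y))"
      proof -
        have 1: "continuous_on (ball z r \<times> cbox 0 1) (\<lambda>y. fst y + (of_real r * e (snd y)) *s axis l (1::complex) :: complex^'n)"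
          using cp[of "ball z r" r l] by (simp add: case_prod_unfold)
        have 2: "continuous_on (ball z r \<times> cbox 0 1) (\<lambda>y. f (fst y + (of_real r * e (snd y)) *s axis l (1::complex)))"
          by (rule continuous_on_compose2[OF cf 1]) (use sub r in \<open>auto simp: norm_mult ne\<close>)
        have 3: "continuous_on (ball z r \<times> cbox 0 1) (\<lambda>y. of_real r * e (snd y))"
          unfolding e_def by (intro continuous_intros)
        show ?thesis unfolding G_def
          by (rule continuous_on_divide[OF 2 3]) (use r in \<open>auto simp: e_def\<close>)
      qed
      then have "continuous_on (ball z r) (\<lambda>x. integral (cbox 0 1) (G x))"
        by (intro integral_continuous_on_param) (simp add: case_prod_unfold)
      moreover have "integral (cbox 0 1) (G x) = dz l f x" if "x \<in> ball z r" for x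
        unfolding G_def e_def
        by (rule integral_unique[OF partial_cauchy_formula[OF r(1) _ f]]) (use sub that in auto)
      ultimately have "continuous_on (ball z r) (dz l f)"
        using continuous_on_cong[of "ball z r" "ball z r" "\<lambda>x. integral (cbox 0 1) (G x)" "dz l f"] by blast
      then show ?thesis using r by (simp add: continuous_on_eq_continuous_at)
    qed
    then show ?thesis by (simp add: continuous_at_imp_continuous_on)
  qed
  then show "continuous_on V (dz j f)" .
  have rep: "(f has_derivative (\<lambda>v. \<Sum>l\<in>UNIV. dz l f x * v $ l)) (at x)" if "x \<in> V" for x
  proof -
    obtain D where D: "(f has_derivative D) (at x)" "\<And>c v. D (c *s v) = c * D v" using f[OF \<open>x \<in> V\<close>] by blast
    have "D = (\<lambda>v. \<Sum>l\<in>UNIV. dz l f x * v $ l)" by (rule ext) (rule complex_linear_component(3)[OF D])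
    with D(1) show ?thesis by simp
  qed
  assume z: "z \<in> V"
  obtain r where r: "r > 0" "ball z r \<subseteq> V" and sub: "\<And>x c. x \<in> ball z r \<Longrightarrow> cmod c \<le> r \<Longrightarrow> x + c *s axis j 1 \<in> V"
    using loc[OF z] by blast
  define y where "y x t = x + (of_real r * e t) *s axis j (1::complex)" for x :: "complex^'n" and t
  have yV: "y x t \<in> V" if "x \<in> ball z r" for x t
    unfolding y_def using sub[OF that, of "of_real r * e t"] r by (simp add: norm_mult ne)
  \<comment> \<open>The derivative of the integrand with respect to \<open>x\<close> as a bounded
    linear operator, the form in which the Leibniz rule handles a parameter integral. Its continuity
    rests on \<open>C\<close>.\<close>
  define fx where "fx x t = Blinfun (\<lambda>v. (\<Sum>l\<in>UNIV. dz l f (y x t) * v $ l) / (of_real r * e t))" for x t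
  have bl: "bounded_linear (\<lambda>v::complex^'n. (\<Sum>l\<in>UNIV. c l * v $ l) / d)" for c d
  proof -
    show ?thesis unfolding divide_inverse
      by (intro bounded_linear_mult_const bounded_linear_sum bounded_linear_const_mult bounded_linear_vec_nth)
  qed
  have fxv: "blinfun_apply (fx x t) v = (\<Sum>l\<in>UNIV. dz l f (y x t) * v $ l) / (of_real r * e t)" for x t v
    unfolding fx_def by (simp add: bounded_linear_Blinfun_apply bl)
  have cy: "continuous_on (U \<times> cbox 0 1) (\<lambda>p. y (fst p) (snd p))" for U
    using cp[of U r j] unfolding y_def by (simp add: case_prod_unfold)
  have cfx: "continuous_on (ball z r \<times> cbox 0 1) (\<lambda>(x, t). fx x t)"
  proof (rule continuous_on_blinfun_componentwise)
    fix v :: "complex^'n" assume "v \<in> Basis"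
    have "continuous_on (ball z r \<times> cbox 0 1) (\<lambda>p. (\<Sum>l\<in>UNIV. dz l f (y (fst p) (snd p)) * v $ l) / (of_real r * e (snd p)))"
    proof (intro continuous_intros continuous_on_compose2[OF C cy] continuous_on_compose2[OF ce])
      show "(\<lambda>p. y (fst p) (snd p)) ` (ball z r \<times> cbox 0 1) \<subseteq> V" using yV by auto
      show "\<forall>p\<in>ball z r \<times> cbox 0 1. of_real r * e (snd p) \<noteq> 0" using r by (auto simp: e_def)
    qed auto
    then show "continuous_on (ball z r \<times> cbox 0 1) (\<lambda>p. blinfun_apply (case p of (x, t) \<Rightarrow> fx x t) v)"
      by (simp add: case_prod_unfold fxv)
  qed
  define G where "G x t = f (y x t) / (of_real r * e t)" for x t
  have dG: "((\<lambda>x. G x t) has_derivative blinfun_apply (fx x t)) (at x within ball z r)" if "x \<in> ball z r" for x t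
  proof -
    have "((\<lambda>x. y x t) has_derivative (\<lambda>v. v)) (at x)"
      unfolding y_def by (auto intro!: derivative_eq_intros)
    from has_derivative_compose[OF this rep[OF yV[OF that]]]
    have "((\<lambda>x. f (y x t)) has_derivative (\<lambda>v. \<Sum>l\<in>UNIV. dz l f (y x t) * v $ l)) (at x)" .
    from has_derivative_mult_left[OF this, of "inverse (of_real r * e t)"]
    have "((\<lambda>x. G x t) has_derivative (\<lambda>v. blinfun_apply (fx x t) v)) (at x)"
      unfolding G_def fxv divide_inverse .
    then show ?thesis using has_derivative_at_withinI by blast
  qed
  have GI: "((\<lambda>t. G x t) has_integral dz j f x) (cbox 0 1)" if "x \<in> ball z r" for x
    unfolding G_def e_def y_def by (rule partial_cauchy_formula[OF r(1) _ f]) (use sub that in auto)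
  have zb: "z \<in> ball z r" using r by simp
  have "((\<lambda>x. integral (cbox 0 1) (G x)) has_derivative blinfun_apply (integral (cbox 0 1) (fx z))) (at z within ball z r)"
    by (rule leibniz_rule[OF dG _ cfx zb convex_ball]) (use GI in \<open>auto simp: integrable_on_def\<close>)
  then have "((\<lambda>x. integral (cbox 0 1) (G x)) has_derivative blinfun_apply (integral (cbox 0 1) (fx z))) (at z)"
    using zb by (simp add: at_within_open[OF _ open_ball])
  then have d: "(dz j f has_derivative blinfun_apply (integral (cbox 0 1) (fx z))) (at z)"
    by (rule has_derivative_transform_within_open[OF _ open_ball zb]) (use GI integral_unique in blast)
  have int: "fx z integrable_on cbox 0 1"
  proof (rule integrable_continuous)
    have "continuous_on (cbox 0 1) (\<lambda>t. (\<lambda>(x, t). fx x t) (z, t))"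
      by (rule continuous_on_compose2[OF cfx]) (use zb in \<open>auto intro!: continuous_intros\<close>)
    then show "continuous_on (cbox 0 1) (fx z)" by simp
  qed
  have "blinfun_apply (integral (cbox 0 1) (fx z)) (c *s v) = c * blinfun_apply (integral (cbox 0 1) (fx z)) v" for c v
  proof -
    have "blinfun_apply (fx z t) (c *s v) = c * blinfun_apply (fx z t) v" for t
      by (simp add: fxv sum_distrib_left mult_ac)
    then show ?thesis unfolding blinfun_apply_integral[OF int] by simp
  qed
  with d show "\<exists>D. (dz j f has_derivative D) (at z) \<and> (\<forall>c v. D (c *s v) = c * D v)" by blast
qed

lemma jac_holomorphic:
  fixes h :: "complex^'n::finite \<Rightarrow> complex^'n"
  assumes "open V" "holomorphic_map_on V h" "z \<in> V"
  shows "dzbar k (\<lambda>w. jac h w $ a $ j) z = 0" "(\<lambda>w. jac h w $ a $ j) differentiable (at z)"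
proof -
  have f: "\<exists>D. ((\<lambda>x. h x $ a) has_derivative D) (at z) \<and> (\<forall>c v. D (c *s v) = c * D v)" if z: "z \<in> V" for z
  proof -
    obtain D where "\<And>c v. D (c *s v) = c *s D v" "\<And>a. ((\<lambda>x. h x $ a) has_derivative (\<lambda>v. D v $ a)) (at z)"
      using holomorphic_map_component[OF assms(2) z] by metis
    then show ?thesis by (intro exI[of _ "\<lambda>v. D v $ a"]) auto
  qed
  from holomorphic_partial_continuous(2)[OF assms(1) f assms(3)]
  obtain D where D: "(dz j (\<lambda>x. h x $ a) has_derivative D) (at z)" "\<And>c v. D (c *s v) = c * D v" by blast
  have e: "dz j (\<lambda>x. h x $ a) = (\<lambda>w. jac h w $ a $ j)" by (rule ext) (simp add: jac_def)
  show "dzbar k (\<lambda>w. jac h w $ a $ j) z = 0" "(\<lambda>w. jac h w $ a $ j) differentiable (at z)"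
    using complex_linear_component[OF D] unfolding e by blast+
qed

definition levi :: "(complex^'n::finite \<Rightarrow> complex) \<Rightarrow> complex^'n \<Rightarrow> complex^'n^'n" where
  "levi F z = (\<chi> k j. dzbar k (dz j F) z)"

lemma dz_sum_diff:
  assumes "\<And>i. i \<in> I \<Longrightarrow> F i differentiable (at z)"
  shows "dz j (\<lambda>w. \<Sum>i\<in>I. F i w) z = (\<Sum>i\<in>I. dz j (F i) z)" "dzbar j (\<lambda>w. \<Sum>i\<in>I. F i w) z = (\<Sum>i\<in>I. dzbar j (F i) z)"
  using assms by (induction I rule: infinite_finite_induct) (auto simp: dz_add0 differentiable_sum)

context open_domain
begin

text \<open>The derivatives of pure type pick up second derivatives of \<open>h\<close>. In the
  mixed ones these drop out because the Jacobian is holomorphic, so the complex Hessian transforms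
  like a Hermitian form.\<close>

lemma levi_pullback:
  fixes h :: "complex^'n \<Rightarrow> complex^'n"
  assumes h: "holomorphic_map_on V h" "open V" "\<And>z. z \<in> V \<Longrightarrow> h z \<in> W" and F: "sm F" and z: "z \<in> V"
  shows "dz k (dz j (\<lambda>w. F (h w))) z = (\<Sum>a\<in>UNIV. dz a F (h z) * dz k (\<lambda>w. jac h w $ a $ j) z
      + (\<Sum>b\<in>UNIV. dz b (dz a F) (h z) * jac h z $ b $ k) * jac h z $ a $ j)"
    "levi (\<lambda>w. F (h w)) z = adjoint_mat (jac h z) ** levi F (h z) ** jac h z"
proof -
  interpret V: open_domain V by unfold_locales (rule h)
  have hW: "h w \<in> W" if "w \<in> V" for w using h that by blast
  have d1: "dz j (\<lambda>w. F (h w)) w = (\<Sum>a\<in>UNIV. dz a F (h w) * jac h w $ a $ j)" if "w \<in> V" for w j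
    by (rule wirtinger_chain(1)[OF h(1) that smD[OF F hW[OF that]]])
  have dd: "(\<lambda>w. dz a F (h w)) differentiable (at z)" for a
    by (rule wirtinger_chain(3)[OF h(1) z smD[OF sm_dz[OF F] hW[OF z]]])
  note jd = jac_holomorphic[OF h(2,1) z]
  have pd: "(\<lambda>w. dz a F (h w) * jac h w $ a $ j) differentiable (at z)" for a j
    using dd jd by (intro differentiable_mult)
  have "dz k (dz j (\<lambda>w. F (h w))) z = dz k (\<lambda>w. \<Sum>a\<in>UNIV. dz a F (h w) * jac h w $ a $ j) z"
    by (rule V.dz_cong[OF z d1])
  also have "\<dots> = (\<Sum>a\<in>UNIV. dz a F (h z) * dz k (\<lambda>w. jac h w $ a $ j) z
      + (\<Sum>b\<in>UNIV. dz b (dz a F) (h z) * jac h z $ b $ k) * jac h z $ a $ j)"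
    by (simp add: dz_sum_diff pd dz_mult0 dd jd wirtinger_chain(1)[OF h(1) z smD[OF sm_dz[OF F] hW[OF z]]])
  finally show "dz k (dz j (\<lambda>w. F (h w))) z = (\<Sum>a\<in>UNIV. dz a F (h z) * dz k (\<lambda>w. jac h w $ a $ j) z
      + (\<Sum>b\<in>UNIV. dz b (dz a F) (h z) * jac h z $ b $ k) * jac h z $ a $ j)" .
  have "dzbar k (dz j (\<lambda>w. F (h w))) z = (\<Sum>a\<in>UNIV. (\<Sum>b\<in>UNIV. cnj (jac h z $ b $ k) * dzbar b (dz a F) (h z)) * jac h z $ a $ j)" for k j
  proof -
    have "dzbar k (dz j (\<lambda>w. F (h w))) z = dzbar k (\<lambda>w. \<Sum>a\<in>UNIV. dz a F (h w) * jac h w $ a $ j) z"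
      by (rule V.dzbar_cong[OF z d1])
    also have "\<dots> = (\<Sum>a\<in>UNIV. (\<Sum>b\<in>UNIV. cnj (jac h z $ b $ k) * dzbar b (dz a F) (h z)) * jac h z $ a $ j)"
      by (simp add: dz_sum_diff pd dz_mult0 dd jd wirtinger_chain(2)[OF h(1) z smD[OF sm_dz[OF F] hW[OF z]]] mult.commute)
    finally show ?thesis .
  qed
  then show "levi (\<lambda>w. F (h w)) z = adjoint_mat (jac h z) ** levi F (h z) ** jac h z"
    by (simp add: vec_eq_iff levi_def matrix_matrix_mult_def adjoint_mat_def)
qed

end

section \<open>Behaviour of traces and pairings under a change of frame\<close>

lemma matrix_inv_unique:
  fixes A B :: "complex^'n^'n"
  assumes "A ** B = mat 1" shows "matrix_inv A = B"
proof -
  have BA: "B ** A = mat 1" using assms matrix_left_right_inverse by blast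
  have "invertible A" using assms BA unfolding invertible_def by blast
  then have "matrix_inv A ** A = mat 1"
    using someI_ex[of "\<lambda>A'. A ** A' = mat 1 \<and> A' ** A = mat 1"] unfolding matrix_inv_def invertible_def by blast
  then have "(matrix_inv A ** A) ** B = B" by simp
  then show ?thesis unfolding matrix_mul_assoc[symmetric] assms by simp
qed

lemma matrix_inv_works:
  fixes A :: "complex^'n^'n"
  assumes "invertible A" shows "A ** matrix_inv A = mat 1" "matrix_inv A ** A = mat 1"
  using someI_ex[OF assms[unfolded invertible_def]] by (simp_all add: matrix_inv_def)

lemma invertible_adjoint:
  fixes J :: "complex^'n^'n"
  assumes "invertible J" shows "invertible (adjoint_mat J)" "matrix_inv (adjoint_mat J) = adjoint_mat (matrix_inv J)"
proof -
  have 1: "adjoint_mat J ** adjoint_mat (matrix_inv J) = mat 1"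
    using matrix_inv_works[OF assms] by (metis adjoint_mat_one adjoint_mult)
  show "matrix_inv (adjoint_mat J) = adjoint_mat (matrix_inv J)" by (rule matrix_inv_unique[OF 1])
  show "invertible (adjoint_mat J)" using 1 invertible_right_inverse by blast
qed

lemma matrix_inv_pullback:
  fixes G J :: "complex^'n^'n"
  assumes "invertible G" "invertible J"
  shows "matrix_inv (adjoint_mat J ** G ** J) = matrix_inv J ** matrix_inv G ** adjoint_mat (matrix_inv J)"
proof (rule matrix_inv_unique)
  note i = matrix_inv_works[OF assms(1)] matrix_inv_works[OF assms(2)]
    matrix_inv_works[OF invertible_adjoint(1)[OF assms(2)], unfolded invertible_adjoint(2)[OF assms(2)]]
  have "adjoint_mat J ** G ** J ** (matrix_inv J ** matrix_inv G ** adjoint_mat (matrix_inv J))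
     = adjoint_mat J ** (G ** (J ** matrix_inv J) ** matrix_inv G) ** adjoint_mat (matrix_inv J)"
    by (simp add: matrix_mul_assoc)
  then show "adjoint_mat J ** G ** J ** (matrix_inv J ** matrix_inv G ** adjoint_mat (matrix_inv J)) = mat 1"
    by (simp add: i)
qed

text \<open>The endomorphism associated with two Hermitian forms changes by conjugation; this is the
  source of all invariant traces.\<close>

lemma inv_mult_pullback:
  fixes G H J :: "complex^'n^'n"
  assumes "invertible G" "invertible J"
  shows "matrix_inv (adjoint_mat J ** G ** J) ** (adjoint_mat J ** H ** J) = matrix_inv J ** (matrix_inv G ** H) ** J"
proof -
  have i: "adjoint_mat (matrix_inv J) ** adjoint_mat J = mat 1"
    using matrix_inv_works(1)[OF assms(2)] by (metis adjoint_mat_one adjoint_mult)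
  have "matrix_inv (adjoint_mat J ** G ** J) ** (adjoint_mat J ** H ** J)
    = matrix_inv J ** matrix_inv G ** (adjoint_mat (matrix_inv J) ** adjoint_mat J) ** H ** J"
    unfolding matrix_inv_pullback[OF assms] by (simp only: matrix_mul_assoc)
  then show ?thesis by (simp add: i matrix_mul_assoc)
qed

lemma trace_pullback:
  fixes G H J :: "complex^'n^'n"
  assumes "invertible G" "invertible J"
  defines "G' \<equiv> adjoint_mat J ** G ** J" and "H' \<equiv> adjoint_mat J ** H ** J"
  shows "trace (matrix_inv G' ** H') = trace (matrix_inv G ** H)"
    "trace (matrix_inv G' ** H' ** (matrix_inv G' ** H')) = trace (matrix_inv G ** H ** (matrix_inv G ** H))"
proof -
  have e: "matrix_inv G' ** H' = matrix_inv J ** (matrix_inv G ** H) ** J"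
    unfolding G'_def H'_def by (rule inv_mult_pullback[OF assms(1,2)])
  have t: "trace (matrix_inv J ** M ** J) = trace M" for M :: "complex^'n^'n"
  proof -
    have "trace (matrix_inv J ** M ** J) = trace (J ** (matrix_inv J ** M))" by (rule trace_mult_commute)
    also have "J ** (matrix_inv J ** M) = M" by (simp add: matrix_mul_assoc matrix_inv_works[OF assms(2)])
    finally show ?thesis .
  qed
  show "trace (matrix_inv G' ** H') = trace (matrix_inv G ** H)" unfolding e t ..
  have "matrix_inv G' ** H' ** (matrix_inv G' ** H') = matrix_inv J ** (matrix_inv G ** H ** (J ** matrix_inv J) ** (matrix_inv G ** H)) ** J"
    unfolding e by (simp only: matrix_mul_assoc)
  then show "trace (matrix_inv G' ** H' ** (matrix_inv G' ** H')) = trace (matrix_inv G ** H ** (matrix_inv G ** H))"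
    by (simp add: matrix_inv_works[OF assms(2)] t)
qed

definition pairing :: "complex^'n^'n \<Rightarrow> complex^'n \<Rightarrow> complex^'n \<Rightarrow> complex" where
  "pairing M \<xi> \<eta> = (\<Sum>j\<in>UNIV. \<Sum>k\<in>UNIV. M $ j $ k * \<xi> $ j * \<eta> $ k)"

lemma pairing_vec: "pairing M \<xi> \<eta> = (\<Sum>k\<in>UNIV. (\<xi> v* M) $ k * \<eta> $ k)"
  unfolding pairing_def vector_matrix_mult_def
  by (simp add: sum_distrib_right) (subst sum.swap, simp add: mult_ac)

lemma pairing_pullback:
  fixes G J :: "complex^'n^'n"
  assumes "invertible G" "invertible J"
  shows "pairing (matrix_inv (adjoint_mat J ** G ** J)) (\<xi> v* J) (\<chi> k. \<Sum>a\<in>UNIV. \<eta> $ a * cnj (J $ a $ k))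
     = pairing (matrix_inv G) \<xi> \<eta>"
proof -
  have j: "J ** matrix_inv J = mat 1" by (rule matrix_inv_works[OF assms(2)])
  define M where "M = adjoint_mat (matrix_inv J)"
  have m: "M ** adjoint_mat J = mat 1"
    using matrix_inv_works(1)[OF assms(2)] unfolding M_def by (metis adjoint_mat_one adjoint_mult)
  have "(\<xi> v* J) v* matrix_inv (adjoint_mat J ** G ** J) = (\<xi> v* matrix_inv G) v* M"
    unfolding matrix_inv_pullback[OF assms] M_def[symmetric] vector_matrix_mul_assoc
    by (simp add: matrix_mul_assoc j)
  then have "pairing (matrix_inv (adjoint_mat J ** G ** J)) (\<xi> v* J) (\<chi> k. \<Sum>a\<in>UNIV. \<eta> $ a * cnj (J $ a $ k))
    = (\<Sum>k\<in>UNIV. ((\<xi> v* matrix_inv G) v* M) $ k * (\<Sum>a\<in>UNIV. \<eta> $ a * cnj (J $ a $ k)))"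
    unfolding pairing_vec by simp
  also have "\<dots> = (\<Sum>a\<in>UNIV. (((\<xi> v* matrix_inv G) v* M) v* adjoint_mat J) $ a * \<eta> $ a)"
  proof -
    have "(X v* adjoint_mat J) $ a = (\<Sum>k\<in>UNIV. X $ k * cnj (J $ a $ k))" for X a
      by (simp add: vector_matrix_mult_def adjoint_mat_def mult.commute)
    then show ?thesis
      by (simp add: sum_distrib_left sum_distrib_right) (subst sum.swap, simp add: mult_ac)
  qed
  also have "((\<xi> v* matrix_inv G) v* M) v* adjoint_mat J = \<xi> v* matrix_inv G"
    by (simp add: vector_matrix_mul_assoc matrix_mul_assoc[symmetric] m)
  finally show ?thesis by (simp add: pairing_vec)
qed

section \<open>Holomorphic normal coordinates\<close>

lemma mult_le_bounds:
  fixes x y :: complex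
  assumes "norm x \<le> a" "norm y \<le> b" shows "norm (x * y) \<le> a * b"
  unfolding norm_mult using assms by (intro mult_mono) (auto intro: order_trans[OF norm_ge_zero])

lemma sum_le_bounds:
  fixes F :: "'n::finite \<Rightarrow> complex"
  assumes "\<And>i. norm (F i) \<le> b" shows "norm (\<Sum>i\<in>UNIV. F i) \<le> real CARD('n) * b"
  using sum_norm_bound[of UNIV F b] assms by simp

lemma has_derivative_vecI:
  fixes f :: "'a::real_normed_vector \<Rightarrow> complex^'n::finite"
  assumes "\<And>a. ((\<lambda>w. f w $ a) has_derivative (\<lambda>v. f' v $ a)) F"
  shows "(f has_derivative f') F"
proof -
  have ax: "bounded_linear (axis i :: complex \<Rightarrow> complex^'n)" for i
    by (intro linear_conv_bounded_linear[THEN iffD1] linearI) (auto simp: axis_def vec_eq_iff)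
  have "((\<lambda>w. \<Sum>i\<in>UNIV. axis i (f w $ i)) has_derivative (\<lambda>v. \<Sum>i\<in>UNIV. axis i (f' v $ i))) F"
    by (intro has_derivative_sum bounded_linear.has_derivative[OF ax] assms)
  moreover have "(\<Sum>i\<in>UNIV. axis i (x $ i)) = x" for x :: "complex^'n"
    by (simp add: vec_eq_iff axis_def)
  ultimately show ?thesis by simp
qed

text \<open>A coordinate change of degree two, with frame \<open>T\<close> and second derivatives
  \<open>Qc\<close>; for symmetric \<open>Qc\<close> the factor 1/2 makes the derivative of the
  Jacobian exactly \<open>Qc\<close>.\<close>

definition quad_map :: "complex^'n::finite \<Rightarrow> complex^'n^'n \<Rightarrow> ('n \<Rightarrow> 'n \<Rightarrow> 'n \<Rightarrow> complex) \<Rightarrow> complex^'n \<Rightarrow> complex^'n" where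
  "quad_map z0 T Qc w = (\<chi> a. z0 $ a + (\<Sum>j\<in>UNIV. T $ a $ j * w $ j)
      + (\<Sum>j\<in>UNIV. \<Sum>p\<in>UNIV. (1/2) * Qc a j p * w $ j * w $ p))"

locale quad_coords =
  fixes z0 :: "complex^'n::finite" and T :: "complex^'n^'n" and Qc :: "'n \<Rightarrow> 'n \<Rightarrow> 'n \<Rightarrow> complex"
  assumes Qsym: "Qc a j p = Qc a p j"
begin

abbreviation "h \<equiv> quad_map z0 T Qc"

lemma h_0 [simp]: "h 0 = z0" by (simp add: quad_map_def vec_eq_iff)

lemma has_derivative_h:
  "(h has_derivative (\<lambda>v. \<chi> a. \<Sum>j\<in>UNIV. (T $ a $ j + (\<Sum>p\<in>UNIV. Qc a j p * w $ p)) * v $ j)) (at w)"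
proof -
  have c: "((\<lambda>w. h w $ a) has_derivative (\<lambda>v. \<Sum>j\<in>UNIV. (T $ a $ j + (\<Sum>p\<in>UNIV. Qc a j p * w $ p)) * v $ j)) (at w)" for a
  proof -
    have n: "((\<lambda>w. w $ j) has_derivative (\<lambda>v. v $ j)) (at w)" for j
      by (rule bounded_linear_imp_has_derivative[OF bounded_linear_vec_nth])
    have "((\<lambda>w. z0 $ a + (\<Sum>j\<in>UNIV. T $ a $ j * w $ j)
      + (\<Sum>j\<in>UNIV. \<Sum>p\<in>UNIV. (1/2) * Qc a j p * w $ j * w $ p)) has_derivative
      (\<lambda>v. 0 + (\<Sum>j\<in>UNIV. T $ a $ j * v $ j) + (\<Sum>j\<in>UNIV. \<Sum>p\<in>UNIV. (1/2) * Qc a j p * w $ j * v $ p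
         + ((1/2) * Qc a j p * v $ j) * w $ p))) (at w)"
      by (intro has_derivative_add has_derivative_const has_derivative_sum has_derivative_mult has_derivative_mult_right n)
    moreover have "0 + (\<Sum>j\<in>UNIV. T $ a $ j * v $ j) + (\<Sum>j\<in>UNIV. \<Sum>p\<in>UNIV. (1/2) * Qc a j p * w $ j * v $ p
         + ((1/2) * Qc a j p * v $ j) * w $ p) = (\<Sum>j\<in>UNIV. (T $ a $ j + (\<Sum>p\<in>UNIV. Qc a j p * w $ p)) * v $ j)" for v
    proof -
      have "(\<Sum>j\<in>UNIV. \<Sum>p\<in>UNIV. (1/2) * Qc a j p * w $ j * v $ p) = (\<Sum>p\<in>UNIV. \<Sum>j\<in>UNIV. (1/2) * Qc a j p * w $ j * v $ p)"
        by (rule sum.swap)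
      also have "\<dots> = (\<Sum>j\<in>UNIV. \<Sum>p\<in>UNIV. (1/2) * Qc a j p * v $ j * w $ p)"
        by (intro sum.cong refl) (simp add: Qsym[of a] mult_ac)
      finally have "(\<Sum>j\<in>UNIV. \<Sum>p\<in>UNIV. (1/2) * Qc a j p * w $ j * v $ p + ((1/2) * Qc a j p * v $ j) * w $ p)
          = (\<Sum>j\<in>UNIV. \<Sum>p\<in>UNIV. (1/2) * Qc a j p * v $ j * w $ p) + (\<Sum>j\<in>UNIV. \<Sum>p\<in>UNIV. (1/2) * Qc a j p * v $ j * w $ p)"
        unfolding sum.distrib by simp
      also have "\<dots> = (\<Sum>j\<in>UNIV. \<Sum>p\<in>UNIV. Qc a j p * w $ p * v $ j)"
        unfolding sum.distrib[symmetric] by (intro sum.cong refl) (simp add: mult_ac)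
      finally show ?thesis
        by (simp add: sum.distrib distrib_right sum_distrib_right)
    qed
    ultimately show ?thesis by (simp add: quad_map_def)
  qed
  show ?thesis
    by (rule has_derivative_vecI) (use c in simp)
qed

definition "J a j w = T $ a $ j + (\<Sum>p\<in>UNIV. Qc a j p * w $ p)"

lemma h_deriv: "(h has_derivative (\<lambda>v. \<chi> a. \<Sum>j\<in>UNIV. J a j w * v $ j)) (at w)"
  using has_derivative_h by (simp add: J_def)

lemma holo_h: "holomorphic_map_on UNIV h"
  unfolding holomorphic_map_on_def
  by (intro ballI exI conjI, rule h_deriv) (simp add: vec_eq_iff sum_distrib_left mult_ac)

lemma jac_h: "jac h w $ a $ j = J a j w"
proof -
  have 1: "((\<lambda>x. h x $ a) has_derivative (\<lambda>v. \<Sum>j\<in>UNIV. J a j w * v $ j)) (at w)"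
    using bounded_linear.has_derivative[OF bounded_linear_vec_nth[of a] h_deriv] by simp
  have "dz j (\<lambda>x. h x $ a) w = (\<Sum>l\<in>UNIV. J a l w * axis j 1 $ l)"
    by (rule complex_linear_component(1)[OF 1]) (simp add: sum_distrib_left mult_ac)
  then show ?thesis by (simp add: jac_def axis_def mult_delta_right)
qed

lemma jac_h_0: "jac h 0 = T" by (simp add: vec_eq_iff jac_h J_def)

lemma J_derivs: "dz m (J a j) w = Qc a j m" "dzbar m (J a j) w = 0"
proof -
  have 1: "(J a j has_derivative (\<lambda>v. \<Sum>p\<in>UNIV. Qc a j p * v $ p)) (at w)"
  proof -
    have n: "((\<lambda>w. w $ p) has_derivative (\<lambda>v. v $ p)) (at w)" for p
      by (rule bounded_linear_imp_has_derivative[OF bounded_linear_vec_nth])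
    have "((\<lambda>w. T $ a $ j + (\<Sum>p\<in>UNIV. Qc a j p * w $ p)) has_derivative (\<lambda>v. 0 + (\<Sum>p\<in>UNIV. Qc a j p * v $ p))) (at w)"
      by (intro has_derivative_add has_derivative_const has_derivative_sum has_derivative_mult_right n)
    then show ?thesis by (simp add: J_def[abs_def])
  qed
  have l: "(\<Sum>p\<in>UNIV. Qc a j p * (c *s v) $ p) = c * (\<Sum>p\<in>UNIV. Qc a j p * v $ p)" for c v
    by (simp add: sum_distrib_left mult_ac)
  have "dz m (J a j) w = (\<Sum>p\<in>UNIV. Qc a j p * axis m 1 $ p)" by (rule complex_linear_component(1)[OF 1 l])
  then show "dz m (J a j) w = Qc a j m" by (simp add: axis_def mult_delta_right)
  show "dzbar m (J a j) w = 0" by (rule complex_linear_component(2)[OF 1 l])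
qed

lemma ddbar_J: "ddbar m (J a j) w = 0"
proof -
  have "dzbar m (J a j) = (\<lambda>w. 0)" by (rule ext) (rule J_derivs)
  then show ?thesis by (simp add: ddbar_def)
qed

lemma smooth_J: "open S \<Longrightarrow> smooth_on S (J a j)"
  unfolding J_def[abs_def]
  by (intro smooth_intros smooth_on_const smooth_on_linear[OF _ bounded_linear_vec_nth]) auto

lemma smooth_h: "open S \<Longrightarrow> smooth_on S h"
  unfolding quad_map_def[abs_def]
  by (rule smooth_on_vec, assumption, unfold vec_lambda_beta,
    intro smooth_intros smooth_on_const smooth_on_linear[OF _ bounded_linear_vec_nth]; assumption)

lemma open_det: "open {w. det (jac h w) \<noteq> 0}"
proof -
  have "continuous_on UNIV (\<lambda>w. det (jac h w))"
    unfolding det_def jac_h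
    by (intro continuous_intros smooth_on_continuous[OF smooth_J]) auto
  then show ?thesis by (intro open_Collect_neq) auto
qed

end

text \<open>The quadratic part of the coordinate change is chosen to annihilate the first derivatives
  of the metric at the centre; its symmetry is the Kaehler condition.\<close>

locale quad_metric = quad_coords z0 T Qc for z0 :: "complex^'n::finite" and T Qc +
  fixes V :: "(complex^'n) set" and G :: "complex^'n \<Rightarrow> complex^'n^'n" and lam B Bq t0 :: real
  assumes V: "open V" "z0 \<in> V" and smG: "\<And>k j. smooth_on V (\<lambda>z. G z $ k $ j)"
    and detT: "det T \<noteq> 0" and lam: "lam \<ge> 1"
    and Qc: "\<And>b j m. (\<Sum>a\<in>UNIV. G z0 $ b $ a * Qc a j m) =
        - (\<Sum>c\<in>UNIV. \<Sum>l\<in>UNIV. dz l (\<lambda>z. G z $ b $ c) z0 * T $ l $ m * T $ c $ j)"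
    and bT: "\<And>a j. norm (T $ a $ j) \<le> t0 / sqrt lam"
    and bQ: "\<And>a j m. norm (Qc a j m) \<le> Bq * (t0 / sqrt lam)\<^sup>2"
    and bG: "\<And>k j. norm (G z0 $ k $ j) \<le> B" "\<And>k j l. norm (dz l (\<lambda>z. G z $ k $ j) z0) \<le> B"
      "\<And>k j l. norm (dzbar l (\<lambda>z. G z $ k $ j) z0) \<le> B"
      "\<And>k j l m. norm (dzbar l (dz m (\<lambda>z. G z $ k $ j)) z0) \<le> B"
    and pos: "0 \<le> t0" "0 \<le> B" "0 \<le> Bq"
begin

text \<open>The map serves only to pull functions and the metric back to this set, so it has to land
  in \<open>V\<close> and to keep the pulled back metric nondegenerate.\<close>

definition "W = h -` V \<inter> {w. det (jac h w) \<noteq> 0}"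

lemma open_W': "open W"
proof -
  have "continuous_on UNIV h" by (rule smooth_on_continuous[OF smooth_h]) simp
  then show ?thesis unfolding W_def
    by (intro open_Int open_det open_vimage V)
qed

lemma zero_in_W: "0 \<in> W" using V detT by (simp add: W_def jac_h_0)

lemma W_D: "w \<in> W \<Longrightarrow> h w \<in> V" "w \<in> W \<Longrightarrow> invertible (jac h w)"
  by (auto simp: W_def invertible_det_nz)

sublocale open_domain W by unfold_locales (rule open_W')

definition "gh k j w = complex_of_real lam * (\<Sum>b\<in>UNIV. \<Sum>a\<in>UNIV. (cnj (J b k w) * G (h w) $ b $ a) * J a j w)"

lemma sm_pull: "smooth_on V F \<Longrightarrow> sm (\<lambda>w. F (h w))"
  by (rule smooth_on_compose[OF open_W' V(1)]) (auto simp: W_D intro: smooth_h[OF open_W'])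

lemma sm_J [simp, intro]: "sm (J a j)" by (rule smooth_J[OF open_W'])

lemma sm_G [simp, intro]: "sm (\<lambda>w. G (h w) $ b $ a)" by (rule sm_pull[OF smG])

lemma sm_gh: "sm (gh k j)" unfolding gh_def[abs_def] by auto

lemma gh_matrix: "gh k j w = of_real lam * (adjoint_mat (jac h w) ** G (h w) ** jac h w) $ k $ j"
  unfolding gh_def matrix_matrix_mult_def adjoint_mat_def
  by (simp add: jac_h sum_distrib_right) (subst sum.swap, simp)

lemma pull_derivs:
  assumes F: "smooth_on V F"
  shows "dz m (\<lambda>w. F (h w)) 0 = (\<Sum>l\<in>UNIV. dz l F z0 * T $ l $ m)"
    "dzbar m (\<lambda>w. F (h w)) 0 = (\<Sum>l\<in>UNIV. dzbar l F z0 * cnj (T $ l $ m))"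
    "dz k (dz j (\<lambda>w. F (h w))) 0 = (\<Sum>a\<in>UNIV. dz a F z0 * Qc a j k + (\<Sum>b\<in>UNIV. dz b (dz a F) z0 * T $ b $ k) * T $ a $ j)"
    "dzbar k (dz j (\<lambda>w. F (h w))) 0 = (\<Sum>a\<in>UNIV. (\<Sum>b\<in>UNIV. cnj (T $ b $ k) * dzbar b (dz a F) z0) * T $ a $ j)"
proof -
  interpret Vd: open_domain V by unfold_locales (rule V)
  have hol: "holomorphic_map_on W h" using holo_h unfolding holomorphic_map_on_def by blast
  have F0: "F differentiable (at (h 0))" using smooth_on_differentiable[OF F] V by simp
  show "dz m (\<lambda>w. F (h w)) 0 = (\<Sum>l\<in>UNIV. dz l F z0 * T $ l $ m)"
    "dzbar m (\<lambda>w. F (h w)) 0 = (\<Sum>l\<in>UNIV. dzbar l F z0 * cnj (T $ l $ m))"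
    using wirtinger_chain(1,2)[OF hol zero_in_W F0] by (simp_all add: jac_h_0)
  have hv: "\<And>z. z \<in> W \<Longrightarrow> h z \<in> V" by (rule W_D)
  have Jl: "(\<lambda>w. jac h w $ a $ j) = J a j" for a j by (rule ext) (rule jac_h)
  show "dz k (dz j (\<lambda>w. F (h w))) 0 = (\<Sum>a\<in>UNIV. dz a F z0 * Qc a j k + (\<Sum>b\<in>UNIV. dz b (dz a F) z0 * T $ b $ k) * T $ a $ j)"
    using Vd.levi_pullback(1)[OF hol open_W' hv F zero_in_W, of k j] by (simp add: jac_h_0 Jl J_derivs)
  show "dzbar k (dz j (\<lambda>w. F (h w))) 0 = (\<Sum>a\<in>UNIV. (\<Sum>b\<in>UNIV. cnj (T $ b $ k) * dzbar b (dz a F) z0) * T $ a $ j)"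
  proof -
    have "levi (\<lambda>w. F (h w)) 0 $ k $ j = (adjoint_mat T ** levi F z0 ** T) $ k $ j"
      using Vd.levi_pullback(2)[OF hol open_W' hv F zero_in_W] by (simp add: jac_h_0)
    then show ?thesis by (simp add: levi_def matrix_matrix_mult_def adjoint_mat_def)
  qed
qed

lemma J_0: "J a j 0 = T $ a $ j" by (simp add: J_def)

lemma cnj_J: "sm (\<lambda>w. cnj (J b k w))" "dz m (\<lambda>w. cnj (J b k w)) 0 = 0" "dzbar m (\<lambda>w. cnj (J b k w)) 0 = cnj (Qc b k m)"
  "ddbar m (\<lambda>w. cnj (J b k w)) 0 = 0"
  by (auto simp: d_cnj zero_in_W J_derivs ddbar_cnj ddbar_J)

lemma dz_gh: "dz m (gh k j) 0 = 0"
proof -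
  define D where "D b a = (\<Sum>l\<in>UNIV. dz l (\<lambda>z. G z $ b $ a) z0 * T $ l $ m)" for b a
  have z: "(\<Sum>a\<in>UNIV. G z0 $ b $ a * Qc a j m) + (\<Sum>a\<in>UNIV. D b a * T $ a $ j) = 0" for b
    unfolding Qc by (simp add: sum_distrib_right D_def)
  have "dz m (gh k j) 0 = of_real lam * (\<Sum>b\<in>UNIV. \<Sum>a\<in>UNIV. (cnj (T $ b $ k) * G z0 $ b $ a) * Qc a j m
     + (cnj (T $ b $ k) * D b a) * T $ a $ j)"
    unfolding gh_def[abs_def]
    by (simp add: d_cmult d_sum d_mult zero_in_W cnj_J J_derivs J_0 pull_derivs[OF smG] D_def)
  also have "\<dots> = of_real lam * (\<Sum>b\<in>UNIV. cnj (T $ b $ k) * ((\<Sum>a\<in>UNIV. G z0 $ b $ a * Qc a j m) + (\<Sum>a\<in>UNIV. D b a * T $ a $ j)))"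
    by (simp add: distrib_left sum.distrib sum_distrib_left mult.assoc)
  finally show ?thesis unfolding z by simp
qed

text \<open>Every term carries four factors \<open>t0 / sqrt lam\<close>: one for each entry of
  \<open>T\<close>, two for each \<open>Qc\<close>, and one for each derivative of the metric, by
  the chain rule. Against the factor \<open>lam\<close> of the rescaled metric this leaves
  \<open>1 / lam\<close>, which is how the curvature becomes small.\<close>

lemma ddbar_gh: "norm (ddbar m (gh k j) 0) \<le> (real CARD('n) * (real CARD('n) * (real CARD('n) * B * Bq + (real CARD('n) * real CARD('n)) * B + Bq * B * Bq + Bq * real CARD('n) * B)) * t0 ^ 4) / lam"
proof -
  define \<tau> where "\<tau> = t0 / sqrt lam"
  let ?n = "real CARD('n)"
  have tau: "0 \<le> \<tau>" using pos lam by (simp add: \<tau>_def)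
  define Y where "Y b a w = G (h w) $ b $ a" for b a w
  have smY: "sm (Y b a)" for b a unfolding Y_def[abs_def] by simp
  have T: "norm (T $ a $ j) \<le> \<tau>" "norm (cnj (T $ a $ j)) \<le> \<tau>" for a j using bT by (auto simp: \<tau>_def)
  have Q: "norm (Qc a j m) \<le> Bq * \<tau>\<^sup>2" "norm (cnj (Qc a j m)) \<le> Bq * \<tau>\<^sup>2" for a j m using bQ by (auto simp: \<tau>_def)
  have Y0: "norm (Y b a 0) \<le> B" for b a using bG by (simp add: Y_def)
  have Y1: "norm (dz m (Y b a) 0) \<le> ?n * (B * \<tau>)" "norm (dzbar m (Y b a) 0) \<le> ?n * (B * \<tau>)" for m b a
    unfolding Y_def[abs_def] pull_derivs[OF smG] by (intro sum_le_bounds mult_le_bounds bG T)+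
  have Y2: "norm (ddbar m (Y b a) 0) \<le> ?n * (?n * (\<tau> * B) * \<tau>)" for m b a
    unfolding ddbar_alt[OF smY zero_in_W] unfolding Y_def[abs_def] pull_derivs[OF smG]
    by (intro sum_le_bounds mult_le_bounds bG T)
  define SS where "SS = (\<Sum>b\<in>UNIV. \<Sum>a\<in>UNIV.
      cnj (T $ b $ k) * dzbar m (Y b a) 0 * Qc a j m + cnj (T $ b $ k) * ddbar m (Y b a) 0 * T $ a $ j
      + cnj (Qc b k m) * Y b a 0 * Qc a j m + cnj (Qc b k m) * dz m (Y b a) 0 * T $ a $ j)"
  have eq: "ddbar m (gh k j) 0 = of_real lam * SS"
    unfolding SS_def gh_def[abs_def] Y_def[symmetric]
    by (simp add: ddbar_cmult ddbar_sum ddbar_mult d_mult zero_in_W cnj_J J_derivs J_0 ddbar_J smY algebra_simps)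
  have "norm SS
      \<le> ?n * (?n * (\<tau> * (?n * (B * \<tau>)) * (Bq * \<tau>\<^sup>2) + \<tau> * (?n * (?n * (\<tau> * B) * \<tau>)) * \<tau>
        + Bq * \<tau>\<^sup>2 * B * (Bq * \<tau>\<^sup>2) + Bq * \<tau>\<^sup>2 * (?n * (B * \<tau>)) * \<tau>))"
    unfolding SS_def by (intro sum_le_bounds norm_triangle_mono mult_le_bounds T Q Y0 Y1 Y2)
  also have "\<dots> = (?n * (?n * (?n * B * Bq + (?n * ?n) * B + Bq * B * Bq + Bq * ?n * B))) * \<tau> ^ 4"
    by (simp add: power2_eq_square power4_eq_xxxx algebra_simps)
  also have "\<tau> ^ 4 = t0 ^ 4 / lam\<^sup>2"
  proof -
    have "sqrt lam ^ 4 = (sqrt lam ^ 2) ^ 2" by (simp add: power_mult[symmetric])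
    also have "\<dots> = lam\<^sup>2" using lam by simp
    finally show ?thesis by (simp add: \<tau>_def power_divide)
  qed
  finally have N: "norm SS \<le> (?n * (?n * (?n * B * Bq + (?n * ?n) * B + Bq * B * Bq + Bq * ?n * B))) * (t0 ^ 4 / lam\<^sup>2)" .
  have "norm (ddbar m (gh k j) 0) = lam * norm SS" unfolding eq norm_mult norm_of_real using lam by simp
  then have "norm (ddbar m (gh k j) 0) \<le> lam * ((?n * (?n * (?n * B * Bq + (?n * ?n) * B + Bq * B * Bq + Bq * ?n * B))) * (t0 ^ 4 / lam\<^sup>2))"
    using mult_left_mono[OF N, of lam] lam by linarith
  also have "\<dots> = (?n * (?n * (?n * B * Bq + (?n * ?n) * B + Bq * B * Bq + Bq * ?n * B)) * t0 ^ 4) / lam"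
    using lam by (simp add: power2_eq_square)
  finally show ?thesis .
qed

text \<open>One crude constant for all jets suffices, using only that the frame is bounded by
  \<open>t0\<close>; for f, its Laplacian and \<mu> the smallness comes from the powers of
  \<open>lam\<close> by which they are divided.\<close>

lemma jets_pull:
  assumes F: "smooth_on V F" and b: "norm (F z0) \<le> b" "\<And>a. norm (dz a F z0) \<le> b" "\<And>a k. norm (dz k (dz a F) z0) \<le> b"
    "\<And>a k. norm (dzbar k (dz a F) z0) \<le> b"
  shows "norm (dz j (\<lambda>w. F (h w)) 0) \<le> real CARD('n) * (1 + Bq + real CARD('n)) * (1 + t0)\<^sup>2 * b"
    "norm (dz k (dz j (\<lambda>w. F (h w))) 0) \<le> real CARD('n) * (1 + Bq + real CARD('n)) * (1 + t0)\<^sup>2 * b"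
    "norm (dzbar k (dz j (\<lambda>w. F (h w))) 0) \<le> real CARD('n) * (1 + Bq + real CARD('n)) * (1 + t0)\<^sup>2 * b"
proof -
  let ?n = "real CARD('n)"
  define \<tau> where "\<tau> = t0 / sqrt lam"
  have "\<tau> \<le> t0 / 1" unfolding \<tau>_def using lam pos by (intro divide_left_mono) auto
  then have tau: "0 \<le> \<tau>" "\<tau> \<le> t0" using pos lam by (auto simp: \<tau>_def)
  have T: "norm (T $ a $ j) \<le> t0" "norm (cnj (T $ a $ j)) \<le> t0" for a j using bT[of a j] tau by (auto simp: \<tau>_def)
  have "Bq * \<tau>\<^sup>2 \<le> Bq * t0\<^sup>2" using tau pos by (intro mult_left_mono power_mono) auto
  then have Q: "norm (Qc a j m) \<le> Bq * t0\<^sup>2" for a j m using bQ[of a j m] by (simp add: \<tau>_def)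
  have b0: "0 \<le> b" using b(1) norm_ge_zero order_trans by blast
  have le: "x * b \<le> ?n * (1 + Bq + ?n) * (1 + t0)\<^sup>2 * b" if "x \<le> ?n * (1 + Bq + ?n) * (1 + t0)\<^sup>2" for x
    using that b0 by (rule mult_right_mono)
  have t2: "t0 \<le> (1 + t0)\<^sup>2" "t0\<^sup>2 \<le> (1 + t0)\<^sup>2" using pos by (auto simp: power2_eq_square algebra_simps)
  have n1: "1 \<le> ?n" by simp
  have "norm (dz j (\<lambda>w. F (h w)) 0) \<le> ?n * (b * t0)"
    unfolding pull_derivs[OF F] by (intro sum_le_bounds mult_le_bounds b T)
  also have "\<dots> = (?n * 1 * t0) * b" by simp
  also have "\<dots> \<le> ?n * (1 + Bq + ?n) * (1 + t0)\<^sup>2 * b"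
    by (rule le) (intro mult_mono t2, use pos in auto)
  finally show "norm (dz j (\<lambda>w. F (h w)) 0) \<le> ?n * (1 + Bq + ?n) * (1 + t0)\<^sup>2 * b" .
  have "norm (dz k (dz j (\<lambda>w. F (h w))) 0) \<le> ?n * (b * (Bq * t0\<^sup>2) + (?n * (b * t0)) * t0)"
    unfolding pull_derivs[OF F] by (intro sum_le_bounds norm_triangle_mono mult_le_bounds b T Q)
  also have "\<dots> = (?n * (Bq + ?n) * t0\<^sup>2) * b" by (simp add: power2_eq_square algebra_simps)
  also have "\<dots> \<le> ?n * (1 + Bq + ?n) * (1 + t0)\<^sup>2 * b"
    by (rule le) (intro mult_mono t2, use pos in auto)
  finally show "norm (dz k (dz j (\<lambda>w. F (h w))) 0) \<le> ?n * (1 + Bq + ?n) * (1 + t0)\<^sup>2 * b" .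
  have "norm (dzbar k (dz j (\<lambda>w. F (h w))) 0) \<le> ?n * ((?n * (t0 * b)) * t0)"
    unfolding pull_derivs[OF F] by (intro sum_le_bounds mult_le_bounds b T)
  also have "\<dots> = (?n * ?n * t0\<^sup>2) * b" by (simp add: power2_eq_square algebra_simps)
  also have "\<dots> \<le> ?n * (1 + Bq + ?n) * (1 + t0)\<^sup>2 * b"
    by (rule le) (intro mult_mono t2, use pos in auto)
  finally show "norm (dzbar k (dz j (\<lambda>w. F (h w))) 0) \<le> ?n * (1 + Bq + ?n) * (1 + t0)\<^sup>2 * b" .
qed

end

section \<open>Change of variables for holomorphic maps\<close>

lemma complex_Basis: "(Basis :: (complex^'n::finite) set) = (\<lambda>(i, c). axis i c) ` (UNIV \<times> {1, \<i>})"
  by (auto simp: Basis_vec_def Basis_complex_def)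

text \<open>The index type \<open>'n bit0\<close> has twice as many elements as \<open>'n\<close>
  and carries a well-order, so it indexes the real coordinates in the form in which the theorem on
  changes of variables is stated.\<close>

lemma ex_enum_Basis: "\<exists>b :: 'n::finite bit0 \<Rightarrow> complex^'n. bij_betw b UNIV Basis"
proof -
  have "card (UNIV :: 'n bit0 set) = card (Basis :: (complex^'n) set)" by (simp add: DIM_complex)
  then show ?thesis using finite_same_card_bij[of "UNIV :: 'n bit0 set" "Basis :: (complex^'n) set"] by simp
qed

locale real_coordinates =
  fixes b :: "'n::finite bit0 \<Rightarrow> complex^'n"
  assumes b: "bij_betw b UNIV Basis"
begin

definition "\<Phi> x = (\<Sum>m\<in>UNIV. x $ m *\<^sub>R b m)" for x :: "real^'n bit0"
definition "\<Psi> y = (\<chi> m. y \<bullet> b m)" for y :: "complex^'n"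

lemma b_Basis: "b m \<in> Basis" using b by (auto simp: bij_betw_def)

lemma b_inner: "b m \<bullet> b k = (if m = k then 1 else 0)"
  using b b_Basis by (auto simp: inner_Basis bij_betw_def inj_on_def)

lemma \<Psi>_\<Phi> [simp]: "\<Psi> (\<Phi> x) = x"
  by (simp add: \<Psi>_def \<Phi>_def vec_eq_iff inner_sum_left b_inner mult_delta_right)

lemma \<Phi>_\<Psi> [simp]: "\<Phi> (\<Psi> y) = y"
proof -
  have "\<Phi> (\<Psi> y) = (\<Sum>m\<in>UNIV. (y \<bullet> b m) *\<^sub>R b m)" by (simp add: \<Phi>_def \<Psi>_def)
  also have "\<dots> = (\<Sum>i\<in>Basis. (y \<bullet> i) *\<^sub>R i)"
    using b by (intro sum.reindex_bij_betw)
  finally show ?thesis by (simp add: euclidean_representation)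
qed

lemma linear_\<Phi>: "linear \<Phi>" "bounded_linear \<Phi>"
proof -
  show "linear \<Phi>" by (intro linearI) (auto simp: \<Phi>_def algebra_simps sum.distrib scaleR_sum_right)
  then show "bounded_linear \<Phi>" by (simp add: linear_conv_bounded_linear)
qed

lemma linear_\<Psi>: "linear \<Psi>" "bounded_linear \<Psi>"
proof -
  show "linear \<Psi>" by (intro linearI) (auto simp: \<Psi>_def vec_eq_iff inner_add_left)
  then show "bounded_linear \<Psi>" by (simp add: linear_conv_bounded_linear)
qed

lemma norm_\<Psi>: "norm (\<Psi> y) = norm y"
proof -
  have "(norm (\<Psi> y))\<^sup>2 = (\<Sum>m\<in>UNIV. (y \<bullet> b m)\<^sup>2)"
    by (simp add: norm_vec_def L2_set_def \<Psi>_def sum_nonneg)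
  also have "\<dots> = (\<Sum>i\<in>Basis. (y \<bullet> i)\<^sup>2)" using b by (intro sum.reindex_bij_betw)
  also have "\<dots> = (norm y)\<^sup>2" by (simp only: power2_norm_eq_inner, subst euclidean_inner, simp only: power2_eq_square)
  finally show ?thesis by simp
qed

lemma norm_\<Phi>: "norm (\<Phi> x) = norm x" using norm_\<Psi>[of "\<Phi> x"] by simp

lemma measurable_\<Phi> [measurable]: "\<Phi> \<in> borel_measurable borel"
  by (intro borel_measurable_continuous_onI bounded_linear.continuous_on[OF linear_\<Phi>(2)] continuous_on_id)

text \<open>\<open>\<Phi>\<close> only relabels coordinates, so preimages of boxes are boxes with
  the same side lengths, and the values on boxes determine the measure.\<close>

lemma distr_\<Phi>: "distr lborel borel \<Phi> = (lborel :: (complex^'n) measure)"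
proof (rule lborel_eqI[symmetric])
  fix l u :: "complex^'n" assume lu: "\<And>i. i \<in> Basis \<Longrightarrow> l \<bullet> i \<le> u \<bullet> i"
  have v: "\<Phi> -` box l u = box (\<Psi> l) (\<Psi> u)"
  proof -
    have 1: "x \<bullet> axis m 1 = \<Phi> x \<bullet> b m" for x m
      using \<Psi>_\<Phi>[of x] unfolding \<Psi>_def by (metis inner_axis inner_real_def mult.right_neutral vec_lambda_beta)
    have 2: "\<Psi> y \<bullet> axis m 1 = y \<bullet> b m" for y m by (simp add: \<Psi>_def inner_axis)
    have 3: "(\<forall>i\<in>Basis. P i) \<longleftrightarrow> (\<forall>m. P (b m))" for P
    proof -
      have B: "Basis = range b" using b by (simp add: bij_betw_def)
      show ?thesis unfolding B by blast
    qed
    have 4: "(\<forall>i\<in>(Basis :: (real^'n bit0) set). P i) \<longleftrightarrow> (\<forall>m. P (axis m 1))" for P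
      by (auto simp: Basis_vec_def)
    have "x \<in> \<Phi> -` box l u \<longleftrightarrow> x \<in> box (\<Psi> l) (\<Psi> u)" for x
      unfolding vimage_eq mem_box 3 4 1 2 by (simp add: 1[symmetric] 2[symmetric])
    then show ?thesis by blast
  qed
  have "emeasure (distr lborel borel \<Phi>) (box l u) = emeasure lborel (box (\<Psi> l) (\<Psi> u))"
    by (simp add: emeasure_distr v)
  also have "\<dots> = (\<Prod>i\<in>Basis. (\<Psi> u - \<Psi> l) \<bullet> i)"
    by (rule emeasure_lborel_box) (use lu b_Basis in \<open>auto simp: Basis_vec_def inner_axis \<Psi>_def\<close>)
  also have "(\<Prod>i\<in>Basis. (\<Psi> u - \<Psi> l) \<bullet> i) = (\<Prod>m\<in>UNIV. (u - l) \<bullet> b m)"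
  proof -
    have B: "(Basis :: (real^'n bit0) set) = (\<lambda>m. axis m 1) ` UNIV" by (auto simp: Basis_vec_def)
    show ?thesis unfolding B
      by (subst prod.reindex) (auto simp: inj_on_def axis_eq_axis inner_axis \<Psi>_def inner_diff_left)
  qed
  also have "\<dots> = (\<Prod>i\<in>Basis. (u - l) \<bullet> i)" using b by (intro prod.reindex_bij_betw)
  finally show "emeasure (distr lborel borel \<Phi>) (box l u) = (\<Prod>i\<in>Basis. (u - l) \<bullet> i)" .
qed simp

definition "RM M = matrix (\<lambda>x. \<Psi> (M *v \<Phi> x))" for M :: "complex^'n^'n"

lemma linear_cmat: "linear (\<lambda>x. M *v x)" for M :: "complex^'n^'n"
  by (intro linearI) (auto simp: vec_eq_iff matrix_vector_mult_def algebra_simps sum.distrib scaleR_sum_right)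

lemma linear_RM: "linear (\<lambda>x. \<Psi> (M *v \<Phi> x))" for M :: "complex^'n^'n"
  using linear_compose[OF linear_compose[OF linear_\<Phi>(1) linear_cmat] linear_\<Psi>(1)] by (simp add: o_def)

lemma RM_mult: "RM (A ** B) = RM A ** RM B"
proof -
  have "RM (A ** B) = matrix ((\<lambda>x. \<Psi> (A *v \<Phi> x)) \<circ> (\<lambda>x. \<Psi> (B *v \<Phi> x)))"
    by (simp add: RM_def o_def matrix_vector_mul_assoc)
  then show ?thesis unfolding RM_def by (simp add: matrix_compose linear_RM)
qed

lemma det_RM_unitary:
  assumes "adjoint_mat P ** P = mat 1" shows "\<bar>det (RM P)\<bar> = 1"
proof -
  have hf: "herm_form (mat 1) v = (norm v)\<^sup>2" for v :: "complex^'n"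
    by (simp add: herm_form_def mat_def mult_delta_left norm_vec_def L2_set_def sum_nonneg cmod_def power2_eq_square)
  have "(norm (P *v v))\<^sup>2 = (norm v)\<^sup>2" for v
    using herm_form_mult_vec[of "mat 1" P v] assms by (simp add: hf)
  then have "norm (P *v v) = norm v" for v by simp
  then have "orthogonal_transformation (\<lambda>x. \<Psi> (P *v \<Phi> x))"
    unfolding orthogonal_transformation by (simp add: linear_RM norm_\<Psi> norm_\<Phi>)
  then show ?thesis unfolding RM_def by (rule orthogonal_transformation_det)
qed

text \<open>Every complex coordinate accounts for two real ones, which squares its factor;
  \<open>ix\<close> recovers the complex index from a real basis vector.\<close>

lemma det_RM_diag: "det (RM (diag_mat d)) = (\<Prod>i\<in>UNIV. (d i)\<^sup>2)"
proof -
  define ix where "ix \<beta> = (SOME i. \<exists>c. c \<noteq> (0::complex) \<and> \<beta> = axis i c)" for \<beta> :: "complex^'n"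
  have ix: "ix (axis i c) = i" if "c \<noteq> 0" for i c
    unfolding ix_def by (rule some_equality) (use that in \<open>auto simp: axis_eq_axis\<close>)
  have Dax: "diag_mat d *v axis i c = d i *\<^sub>R axis i c" for i c
    by (simp add: vec_eq_iff diag_mat_def matrix_vector_mult_def axis_def mult_delta_right) (simp add: scaleR_conv_of_real)
  have Db: "diag_mat d *v b m = d (ix (b m)) *\<^sub>R b m" for m
  proof -
    obtain i c where ic: "b m = axis i c" "c \<noteq> 0"
      using b_Basis[of m] unfolding complex_Basis by auto
    then show ?thesis by (simp add: ix Dax)
  qed
  have \<Phi>ax: "\<Phi> (axis m 1) = b m" for m
    unfolding \<Phi>_def axis_def by (simp add: if_distrib[of "\<lambda>c. c *\<^sub>R _"] cong: if_cong)
  have ent: "RM (diag_mat d) $ k $ m = (if k = m then d (ix (b m)) else 0)" for k m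
    unfolding RM_def matrix_def by (simp add: \<Phi>ax Db) (simp add: \<Psi>_def b_inner)
  have "det (RM (diag_mat d)) = (\<Prod>m\<in>UNIV. d (ix (b m)))"
    by (subst det_diagonal) (auto simp: ent)
  also have "\<dots> = (\<Prod>\<beta>\<in>Basis. d (ix \<beta>))" using b by (intro prod.reindex_bij_betw)
  also have "\<dots> = (\<Prod>(i, c)\<in>UNIV \<times> {1, \<i>}. d i)"
    unfolding complex_Basis
    by (subst prod.reindex) (auto simp: inj_on_def axis_eq_axis ix intro!: prod.cong)
  also have "\<dots> = (\<Prod>i\<in>UNIV. (d i)\<^sup>2)"
    by (subst prod.cartesian_product[symmetric]) (simp add: power2_eq_square)
  finally show ?thesis .
qed

lemma det_adjoint: "det (adjoint_mat M) = cnj (det M)" for M :: "complex^'n^'n"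
proof -
  have "det (adjoint_mat M) = det (transpose (\<chi> i j. cnj (M $ i $ j)))"
    by (rule arg_cong[of _ _ det]) (simp add: adjoint_mat_def transpose_def)
  also have "\<dots> = det (\<chi> i j. cnj (M $ i $ j))" by (rule det_transpose)
  also have "\<dots> = cnj (det M)" by (simp add: det_def)
  finally show ?thesis .
qed

text \<open>The proof diagonalizes $M^* M$, that is, it uses the singular value decomposition.\<close>

lemma det_RM:
  fixes M :: "complex^'n^'n"
  assumes "det M \<noteq> 0" shows "\<bar>det (RM M)\<bar> = (cmod (det M))\<^sup>2"
proof -
  define H where "H = adjoint_mat M ** M"
  have hI: "herm_form (mat 1) v = (norm v)\<^sup>2" for v :: "complex^'n"
    by (simp add: herm_form_def mat_def mult_delta_left norm_vec_def L2_set_def sum_nonneg cmod_def power2_eq_square)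
  have "positive_definite (mat 1 :: complex^'n^'n)"
    by (simp add: positive_definite_def hermitian_adjoint hI)
  moreover have "hermitian H" by (simp add: hermitian_adjoint H_def adjoint_mult)
  ultimately obtain P d where D: "diagonalizes P (mat 1) H d" using simultaneous_diagonalization by blast
  then have P: "adjoint_mat P ** P = mat 1" and PH: "adjoint_mat P ** H ** P = diag_mat d"
    by (simp_all add: diagonalizes_def)
  have P': "P ** adjoint_mat P = mat 1" using P matrix_left_right_inverse by blast
  have dp: "d i > 0" for i
  proof -
    have "of_real (d i) = (adjoint_mat P ** H ** P) $ i $ i" by (simp add: PH diag_mat_def)
    also have "\<dots> = sesq (adjoint_mat M ** mat 1 ** M) (column i P) (column i P)"
      by (simp add: sesq_column H_def)
    also have "\<dots> = sesq (mat 1) (M *v column i P) (M *v column i P)" by (rule sesq_mult_vec[symmetric])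
    finally have "d i = (norm (M *v column i P))\<^sup>2"
      by (metis Re_complex_of_real hI herm_form_sesq)
    moreover have "M *v column i P \<noteq> 0"
    proof
      assume "M *v column i P = 0"
      have "invertible M" using assms by (simp add: invertible_det_nz)
      then have "column i P = 0" using \<open>M *v column i P = 0\<close> invertible_left_inverse matrix_left_invertible_ker by blast
      then have "(adjoint_mat P ** P) $ i $ i = 0" using sesq_column[of P "mat 1" i i] by simp
      then show False unfolding P by (simp add: mat_def)
    qed
    ultimately show ?thesis by simp
  qed
  define D1 where "D1 = (diag_mat (\<lambda>i. sqrt (d i)) :: complex^'n^'n)"
  define D2 where "D2 = (diag_mat (\<lambda>i. 1 / sqrt (d i)) :: complex^'n^'n)"
  define V where "V = M ** P ** D2"
  have dm: "diag_mat x ** diag_mat y = (diag_mat (\<lambda>i. x i * y i) :: complex^'n^'n)" for x y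
    by (auto simp: vec_eq_iff diag_mat_def matrix_matrix_mult_def mult_delta_left)
  have one: "diag_mat (\<lambda>i. 1) = (mat 1 :: complex^'n^'n)" by (simp add: vec_eq_iff diag_mat_def mat_def)
  have D21: "D2 ** D1 = mat 1" unfolding D1_def D2_def dm using dp by (simp add: less_imp_neq[symmetric] one)
  have aD2: "adjoint_mat D2 = D2" by (auto simp: D2_def adjoint_mat_def diag_mat_def vec_eq_iff)
  have "adjoint_mat V ** V = D2 ** (adjoint_mat P ** H ** P) ** D2"
    by (simp add: V_def adjoint_mult aD2 H_def matrix_mul_assoc)
  also have "\<dots> = mat 1" unfolding PH D2_def dm using dp
    by (simp add: one[symmetric] real_sqrt_mult_self less_imp_le flip: power2_eq_square)
       (simp add: power2_eq_square less_imp_le less_imp_neq[symmetric])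
  finally have V: "adjoint_mat V ** V = mat 1" .
  have M: "M = V ** D1 ** adjoint_mat P"
  proof -
    have "V ** D1 ** adjoint_mat P = M ** P ** (D2 ** D1) ** adjoint_mat P" by (simp add: V_def matrix_mul_assoc)
    also have "\<dots> = M ** (P ** adjoint_mat P)" by (simp add: D21 matrix_mul_assoc)
    finally show ?thesis by (simp add: P')
  qed
  have cu: "cmod (det Q) = 1" if "adjoint_mat Q ** Q = mat 1" for Q :: "complex^'n^'n"
  proof -
    have "cnj (det Q) * det Q = 1" using that by (metis det_adjoint det_mul det_I)
    then have "cmod (cnj (det Q) * det Q) = 1" by simp
    then have "(cmod (det Q))\<^sup>2 = 1" by (simp add: norm_mult power2_eq_square)
    then show ?thesis by (simp add: power2_eq_1_iff) (metis norm_ge_zero not_one_le_zero neg_0_le_iff_le)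
  qed
  have "\<bar>det (RM M)\<bar> = \<bar>det (RM V)\<bar> * \<bar>det (RM D1)\<bar> * \<bar>det (RM (adjoint_mat P))\<bar>"
    unfolding M RM_mult det_mul abs_mult ..
  also have "\<bar>det (RM V)\<bar> = 1" by (rule det_RM_unitary[OF V])
  also have "\<bar>det (RM (adjoint_mat P))\<bar> = 1" by (rule det_RM_unitary) (simp add: P')
  also have "det (RM D1) = (\<Prod>i\<in>UNIV. d i)" unfolding D1_def det_RM_diag using dp by (simp add: less_imp_le)
  also have "\<bar>\<Prod>i\<in>UNIV. d i\<bar> = (\<Prod>i\<in>UNIV. d i)" using dp by (simp add: prod_nonneg less_imp_le)
  finally have 1: "\<bar>det (RM M)\<bar> = (\<Prod>i\<in>UNIV. d i)" by simp
  have "det D1 = (\<Prod>i\<in>UNIV. complex_of_real (sqrt (d i)))"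
    unfolding D1_def by (subst det_diagonal) (auto simp: diag_mat_def)
  then have "cmod (det D1) = (\<Prod>i\<in>UNIV. sqrt (d i))" using dp by (simp add: prod_norm[symmetric] less_imp_le)
  then have "(cmod (det D1))\<^sup>2 = (\<Prod>i\<in>UNIV. d i)" using dp by (simp add: prod_power_distrib less_imp_le)
  moreover have "cmod (det M) = cmod (det D1)"
    unfolding M det_mul norm_mult using cu[OF V] cu[of "adjoint_mat P"] P' by simp
  ultimately show ?thesis using 1 by simp
qed

end

text \<open>A bridge to the theorem on changes of variables, which concerns absolutely integrable
  functions. A nonnegative integral is infinite exactly when absolute integrability fails, so an
  equivalence of integrability transfers the infinite case too.\<close>

lemma nn_integral_absolutely_integrable:
  fixes f :: "real^'m::{finite,wellorder} \<Rightarrow> real"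
  assumes nn: "\<And>x. x \<in> A \<Longrightarrow> 0 \<le> f x" and meas: "(\<lambda>x. f x * indicator A x) \<in> borel_measurable borel"
  shows "(\<integral>\<^sup>+x\<in>A. ennreal (f x) \<partial>lborel) = (if f absolutely_integrable_on A then ennreal (integral A f) else \<infinity>)"
proof (cases "f absolutely_integrable_on A")
  case True
  then have "(f has_integral integral A f) A"
    by (simp add: absolutely_integrable_on_def integrable_integral)
  from nn_integral_has_integral_lebesgue[OF nn this]
  have "(\<integral>\<^sup>+x. ennreal (indicator A x * f x) \<partial>lborel) = ennreal (integral A f)" by simp
  moreover have "ennreal (indicator A x * f x) = ennreal (f x) * indicator A x" for x
    by (auto simp: indicator_def)
  ultimately show ?thesis using True by simp
next
  case False
  have "(\<integral>\<^sup>+x\<in>A. ennreal (f x) \<partial>lborel) = \<infinity>"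
  proof (rule ccontr)
    assume "\<not> ?thesis"
    then have fin: "(\<integral>\<^sup>+x\<in>A. ennreal (f x) \<partial>lborel) < \<infinity>" by (simp add: less_top)
    have "integrable lebesgue (\<lambda>x. indicator A x *\<^sub>R f x)"
    proof (rule integrableI_bounded)
      have "(\<lambda>x. f x * indicator A x) \<in> borel_measurable lborel" using meas by simp
      then have "(\<lambda>x. f x * indicator A x) \<in> borel_measurable lebesgue" by (rule measurable_completion)
      then show "(\<lambda>x. indicator A x *\<^sub>R f x) \<in> borel_measurable lebesgue" by (simp add: mult.commute)
      have "(\<integral>\<^sup>+x. ennreal (norm (indicator A x *\<^sub>R f x)) \<partial>lebesgue) = (\<integral>\<^sup>+x. ennreal (norm (indicator A x *\<^sub>R f x)) \<partial>lborel)"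
        by (rule nn_integral_completion)
      also have "\<dots> = (\<integral>\<^sup>+x\<in>A. ennreal (f x) \<partial>lborel)"
        by (intro nn_integral_cong) (auto simp: indicator_def nn)
      finally show "(\<integral>\<^sup>+x. ennreal (norm (indicator A x *\<^sub>R f x)) \<partial>lebesgue) < \<infinity>" using fin by simp
    qed
    then show False using False by (simp add: set_integrable_def)
  qed
  then show ?thesis using False by simp
qed

lemma nn_change_of_variables_real:
  fixes f :: "real^'m::{finite,wellorder} \<Rightarrow> real" and g :: "real^'m::_ \<Rightarrow> real^'m::_"
  assumes S: "S \<in> sets borel" and der: "\<And>x. x \<in> S \<Longrightarrow> (g has_derivative g' x) (at x within S)"
    and inj: "inj_on g S" and nn: "\<And>x. x \<in> S \<Longrightarrow> 0 \<le> f (g x)"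
    and m1: "(\<lambda>x. \<bar>det (matrix (g' x))\<bar> * f (g x) * indicator S x) \<in> borel_measurable borel"
    and m2: "(\<lambda>y. f y * indicator (g ` S) y) \<in> borel_measurable borel"
  shows "(\<integral>\<^sup>+y\<in>g ` S. ennreal (f y) \<partial>lborel) = (\<integral>\<^sup>+x\<in>S. ennreal (\<bar>det (matrix (g' x))\<bar> * f (g x)) \<partial>lborel)"
proof -
  have SL: "S \<in> sets lebesgue" using S by simp
  have cov: "((\<lambda>x. \<bar>det (matrix (g' x))\<bar> * f (g x)) absolutely_integrable_on S \<and>
      integral S (\<lambda>x. \<bar>det (matrix (g' x))\<bar> * f (g x)) = c)
     \<longleftrightarrow> (f absolutely_integrable_on (g ` S) \<and> integral (g ` S) f = c)" for c
  proof -
    \<comment> \<open>The theorem concerns vector-valued functions; a scalar function passes through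
      it as a vector with one component.\<close>
    have v: "((\<lambda>x. vec (F x) :: real^1) absolutely_integrable_on A \<and> integral A (\<lambda>x. vec (F x) :: real^1) = vec c)
       \<longleftrightarrow> (F absolutely_integrable_on A \<and> integral A F = c)" for F and A :: "(real^'m::{finite,wellorder}) set"
    proof -
      have i: "(\<lambda>x. vec (F x) :: real^1) absolutely_integrable_on A \<longleftrightarrow> F absolutely_integrable_on A"
        by (simp add: absolutely_integrable_on_1_iff vec_component)
      have "integral A (\<lambda>x. vec (F x) :: real^1) = vec (integral A F)" if "F absolutely_integrable_on A"
      proof -
        have lv: "bounded_linear (vec :: real \<Rightarrow> real^1)"
          by (intro linear_conv_bounded_linear[THEN iffD1] linearI) (auto simp: vec_eq_iff)
        have "(F has_integral integral A F) A" using that by (simp add: absolutely_integrable_on_def integrable_integral)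
        then have "((\<lambda>x. vec (F x) :: real^1) has_integral vec (integral A F)) A"
          using has_integral_linear[of F "integral A F" A "vec :: real \<Rightarrow> real^1"] lv
          by (simp add: o_def)
        then show ?thesis by (rule integral_unique)
      qed
      then show ?thesis using i by (auto simp: vec_eq_iff)
    qed
    have "((\<lambda>x. \<bar>det (matrix (g' x))\<bar> *\<^sub>R (vec (f (g x)) :: real^1)) absolutely_integrable_on S \<and>
           integral S (\<lambda>x. \<bar>det (matrix (g' x))\<bar> *\<^sub>R (vec (f (g x)) :: real^1)) = vec c
       \<longleftrightarrow> (\<lambda>y. vec (f y) :: real^1) absolutely_integrable_on (g ` S) \<and> integral (g ` S) (\<lambda>y. vec (f y) :: real^1) = vec c)"
      by (rule has_absolute_integral_change_of_variables[OF SL der inj])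
    moreover have "\<bar>det (matrix (g' x))\<bar> *\<^sub>R (vec (f (g x)) :: real^1) = vec (\<bar>det (matrix (g' x))\<bar> * f (g x))" for x
      by (simp add: vec_eq_iff)
    ultimately show ?thesis using v by simp
  qed
  have n1: "(\<integral>\<^sup>+y\<in>g ` S. ennreal (f y) \<partial>lborel) = (if f absolutely_integrable_on (g ` S) then ennreal (integral (g ` S) f) else \<infinity>)"
    by (rule nn_integral_absolutely_integrable[OF _ m2]) (use nn in auto)
  have n2: "(\<integral>\<^sup>+x\<in>S. ennreal (\<bar>det (matrix (g' x))\<bar> * f (g x)) \<partial>lborel) =
     (if (\<lambda>x. \<bar>det (matrix (g' x))\<bar> * f (g x)) absolutely_integrable_on S then ennreal (integral S (\<lambda>x. \<bar>det (matrix (g' x))\<bar> * f (g x))) else \<infinity>)"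
    by (rule nn_integral_absolutely_integrable[OF _ m1]) (use nn in auto)
  show ?thesis unfolding n1 n2
    using cov[of "integral (g ` S) f"] cov[of "integral S (\<lambda>x. \<bar>det (matrix (g' x))\<bar> * f (g x))"] by auto
qed

lemma nn_change_of_variables_holomorphic:
  fixes f :: "complex^'n::finite \<Rightarrow> real" and h :: "complex^'n \<Rightarrow> complex^'n" and J :: "complex^'n \<Rightarrow> complex^'n^'n"
  assumes S: "S \<in> sets borel" and der: "\<And>z. z \<in> S \<Longrightarrow> (h has_derivative (\<lambda>v. J z *v v)) (at z)"
    and det: "\<And>z. z \<in> S \<Longrightarrow> det (J z) \<noteq> 0"
    and inj: "inj_on h S" and nn: "\<And>z. z \<in> S \<Longrightarrow> 0 \<le> f (h z)"
    and m1: "(\<lambda>z. (cmod (det (J z)))\<^sup>2 * f (h z) * indicator S z) \<in> borel_measurable borel"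
    and m2: "(\<lambda>y. f y * indicator (h ` S) y) \<in> borel_measurable borel"
  shows "(\<integral>\<^sup>+y\<in>h ` S. ennreal (f y) \<partial>lborel) = (\<integral>\<^sup>+z\<in>S. ennreal ((cmod (det (J z)))\<^sup>2 * f (h z)) \<partial>lborel)"
proof -
  obtain b :: "'n bit0 \<Rightarrow> complex^'n" where b: "bij_betw b UNIV Basis" using ex_enum_Basis by blast
  interpret real_coordinates b by unfold_locales (rule b)
  define S' where "S' = \<Phi> -` S"
  define g where "g x = \<Psi> (h (\<Phi> x))" for x
  define g' where "g' x = (\<lambda>v. \<Psi> (J (\<Phi> x) *v \<Phi> v))" for x
  have S': "S' \<in> sets borel" unfolding S'_def using measurable_sets[OF measurable_\<Phi> S] by simp
  have gS: "g ` S' = \<Phi> -` (h ` S)"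
  proof
    show "g ` S' \<subseteq> \<Phi> -` (h ` S)" by (auto simp: g_def S'_def)
    show "\<Phi> -` (h ` S) \<subseteq> g ` S'"
    proof
      fix x assume "x \<in> \<Phi> -` (h ` S)"
      then obtain z where "z \<in> S" "\<Phi> x = h z" by auto
      then have "x = g (\<Psi> z)" "\<Psi> z \<in> S'" by (auto simp: g_def S'_def) (metis \<Psi>_\<Phi>)
      then show "x \<in> g ` S'" by blast
    qed
  qed
  have dg: "(g has_derivative g' x) (at x within S')" if "x \<in> S'" for x
  proof -
    have "(\<Phi> has_derivative \<Phi>) (at x)" by (rule bounded_linear_imp_has_derivative[OF linear_\<Phi>(2)])
    from has_derivative_compose[OF this der] that
    have "((\<lambda>x. h (\<Phi> x)) has_derivative (\<lambda>v. J (\<Phi> x) *v \<Phi> v)) (at x)" by (simp add: S'_def)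
    from bounded_linear.has_derivative[OF linear_\<Psi>(2) this]
    have "(g has_derivative g' x) (at x)" by (simp add: g_def[abs_def] g'_def)
    then show ?thesis by (rule has_derivative_at_withinI)
  qed
  have ig: "inj_on g S'"
  proof (rule inj_onI)
    fix x y assume xy: "x \<in> S'" "y \<in> S'" "g x = g y"
    then have "h (\<Phi> x) = h (\<Phi> y)" unfolding g_def by (metis \<Phi>_\<Psi>)
    then have "\<Phi> x = \<Phi> y" using inj xy by (auto simp: inj_on_def S'_def)
    then show "x = y" by (metis \<Psi>_\<Phi>)
  qed
  have dt: "\<bar>det (matrix (g' x))\<bar> = (cmod (det (J (\<Phi> x))))\<^sup>2" if "x \<in> S'" for x
    using det_RM[OF det[of "\<Phi> x"]] that by (simp add: g'_def RM_def S'_def)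
  have i1: "indicator S' x = indicator S (\<Phi> x)" for x by (simp add: S'_def indicator_def)
  have i2: "indicator (g ` S') x = indicator (h ` S) (\<Phi> x)" for x by (simp add: gS indicator_def)
  have fg: "f (\<Phi> (g x)) = f (h (\<Phi> x))" for x by (simp add: g_def)
  have cov: "(\<integral>\<^sup>+y\<in>g ` S'. ennreal (f (\<Phi> y)) \<partial>lborel) = (\<integral>\<^sup>+x\<in>S'. ennreal (\<bar>det (matrix (g' x))\<bar> * f (\<Phi> (g x))) \<partial>lborel)"
  proof (rule nn_change_of_variables_real[OF S' dg ig, of "\<lambda>y. f (\<Phi> y)"])
    show "0 \<le> f (\<Phi> (g x))" if "x \<in> S'" for x using nn that by (simp add: fg S'_def)
    have "(\<lambda>x. (\<lambda>z. (cmod (det (J z)))\<^sup>2 * f (h z) * indicator S z) (\<Phi> x)) \<in> borel_measurable borel"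
      by (rule measurable_compose[OF measurable_\<Phi> m1])
    moreover have "\<bar>det (matrix (g' x))\<bar> * f (\<Phi> (g x)) * indicator S' x = (cmod (det (J (\<Phi> x))))\<^sup>2 * f (h (\<Phi> x)) * indicator S (\<Phi> x)" for x
      using dt[of x] by (cases "x \<in> S'") (auto simp: fg i1[symmetric])
    ultimately show "(\<lambda>x. \<bar>det (matrix (g' x))\<bar> * f (\<Phi> (g x)) * indicator S' x) \<in> borel_measurable borel" by simp
    show "(\<lambda>y. f (\<Phi> y) * indicator (g ` S') y) \<in> borel_measurable borel"
      unfolding i2 by (rule measurable_compose[OF measurable_\<Phi> m2])
  qed
  have m1': "(\<lambda>z. ennreal ((cmod (det (J z)))\<^sup>2 * f (h z)) * indicator S z) \<in> borel_measurable borel"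
  proof -
    have "(\<lambda>z. ennreal ((cmod (det (J z)))\<^sup>2 * f (h z) * indicator S z)) \<in> borel_measurable borel" using m1 by measurable
    then show ?thesis by (rule measurable_cong[THEN iffD1, rotated]) (auto simp: indicator_def)
  qed
  have m2': "(\<lambda>y. ennreal (f y) * indicator (h ` S) y) \<in> borel_measurable borel"
  proof -
    have "(\<lambda>y. ennreal (f y * indicator (h ` S) y)) \<in> borel_measurable borel" using m2 by measurable
    then show ?thesis by (rule measurable_cong[THEN iffD1, rotated]) (auto simp: indicator_def)
  qed
  have R: "(\<integral>\<^sup>+z\<in>S. ennreal ((cmod (det (J z)))\<^sup>2 * f (h z)) \<partial>lborel) =
     (\<integral>\<^sup>+x. ennreal ((cmod (det (J (\<Phi> x))))\<^sup>2 * f (h (\<Phi> x))) * indicator S (\<Phi> x) \<partial>lborel)"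
    by (subst distr_\<Phi>[symmetric], subst nn_integral_distr) (use m1' in auto)
  have "(\<integral>\<^sup>+y\<in>h ` S. ennreal (f y) \<partial>lborel) = (\<integral>\<^sup>+y\<in>g ` S'. ennreal (f (\<Phi> y)) \<partial>lborel)"
    unfolding i2 by (subst distr_\<Phi>[symmetric], subst nn_integral_distr) (use m2' in auto)
  also have "\<dots> = (\<integral>\<^sup>+x\<in>S'. ennreal ((cmod (det (J (\<Phi> x))))\<^sup>2 * f (h (\<Phi> x))) \<partial>lborel)"
    unfolding cov by (intro nn_integral_cong) (auto simp: dt fg indicator_def)
  also have "\<dots> = (\<integral>\<^sup>+z\<in>S. ennreal ((cmod (det (J z)))\<^sup>2 * f (h z)) \<partial>lborel)"
    unfolding i1 by (rule R[symmetric])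
  finally show ?thesis .
qed

section \<open>Compact Kaehler manifolds\<close>

locale kaehler_manifold =
  fixes At :: "('a::t2_space, 'n::finite) chart set" and G :: "('a, 'n) metric"
  assumes X: "compact_kaehler_manifold At G"
begin

lemma chart: assumes "c \<in> At"
  shows "open (fst c)" "open (crange c)" "homeomorphism (fst c) (crange c) (snd c) (cinv c)"
  using X assms unfolding compact_kaehler_manifold_def complex_atlas_def is_chart_def by blast+

lemma covers: "\<exists>c\<in>At. x \<in> fst c"
proof -
  have "(\<Union>c\<in>At. fst c) = UNIV" using X unfolding compact_kaehler_manifold_def complex_atlas_def by blast
  then show ?thesis by blast
qed

lemma cinv_simps: assumes "c \<in> At"
  shows "x \<in> fst c \<Longrightarrow> cinv c (snd c x) = x" "z \<in> crange c \<Longrightarrow> snd c (cinv c z) = z"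
    "z \<in> crange c \<Longrightarrow> cinv c z \<in> fst c" "x \<in> fst c \<Longrightarrow> snd c x \<in> crange c"
  using chart(3)[OF assms] unfolding homeomorphism_def by auto

lemma continuous_chart: assumes "c \<in> At"
  shows "continuous_on (fst c) (snd c)" "continuous_on (crange c) (cinv c)"
  using chart(3)[OF assms] unfolding homeomorphism_def by auto

lemma G_pos: "c \<in> At \<Longrightarrow> z \<in> crange c \<Longrightarrow> positive_definite (G c z)"
  and G_smooth: "c \<in> At \<Longrightarrow> smooth_on (crange c) (\<lambda>z. G c z $ k $ j)"
  and G_closed: "c \<in> At \<Longrightarrow> z \<in> crange c \<Longrightarrow> dz l (\<lambda>w. G c w $ k $ j) z = dz j (\<lambda>w. G c w $ k $ l) z"
  using X unfolding compact_kaehler_manifold_def kaehler_metric_def by blast+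

text \<open>In a unitary frame \<open>P\<close> for the form the determinant becomes 1, so the
  original determinant is the inverse square of the modulus of det P.\<close>

lemma positive_definite_facts:
  fixes H :: "complex^'n^'n"
  assumes "positive_definite H" shows "invertible H" "det H \<noteq> 0" "det H = of_real (Re (det H))" "Re (det H) > 0"
proof -
  have "hermitian H" using assms by (simp add: positive_definite_def)
  then obtain P d where D: "diagonalizes P H H d" using simultaneous_diagonalization[OF assms] by blast
  show "invertible H" by (rule diagonalizes_inverse(2)[OF D])
  have P: "det P \<noteq> 0" using diagonalizes_inverse(1)[OF D] by (simp add: invertible_det_nz)
  have "det (adjoint_mat P ** H ** P) = 1" using D by (simp add: diagonalizes_def)
  moreover have "det (adjoint_mat P) = cnj (det P)"
    by (rule real_coordinates.det_adjoint[OF real_coordinates.intro]) (rule someI_ex[OF ex_enum_Basis])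
  ultimately have "cnj (det P) * det H * det P = 1" by (simp add: det_mul)
  then have "det H * (det P * cnj (det P)) = 1" by (simp add: mult_ac)
  then have "det H * of_real ((cmod (det P))\<^sup>2) = 1" by (simp only: complex_norm_square)
  then have e: "det H = of_real (1 / (cmod (det P))\<^sup>2)" using P by (simp add: field_simps)
  show "det H \<noteq> 0" unfolding e using P by simp
  show "det H = of_real (Re (det H))" unfolding e by simp
  show "Re (det H) > 0" unfolding e using P by simp
qed

section \<open>Transition maps and the volume measure\<close>

definition overlap :: "('a, 'n) chart \<Rightarrow> ('a, 'n) chart \<Rightarrow> (complex^'n) set" where
  "overlap c d = snd c ` (fst c \<inter> fst d)"

definition trans_map :: "('a, 'n) chart \<Rightarrow> ('a, 'n) chart \<Rightarrow> complex^'n \<Rightarrow> complex^'n" where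
  "trans_map c d z = snd d (cinv c z)"

lemma overlap_alt: "c \<in> At \<Longrightarrow> overlap c d = {z \<in> crange c. cinv c z \<in> fst d}"
  unfolding overlap_def using cinv_simps[of c] by (auto simp: crange_def)

lemma transition:
  assumes "c \<in> At" "d \<in> At"
  shows "open (overlap c d)" "holomorphic_map_on (overlap c d) (trans_map c d)"
    "z \<in> overlap c d \<Longrightarrow> trans_map c d z \<in> crange d" "z \<in> overlap c d \<Longrightarrow> z \<in> crange c"
    "z \<in> overlap c d \<Longrightarrow> cinv d (trans_map c d z) = cinv c z"
    "z \<in> overlap c d \<Longrightarrow> G c z = adjoint_mat (jac (trans_map c d) z) ** G d (trans_map c d z) ** jac (trans_map c d) z"
    "z \<in> overlap c d \<Longrightarrow> invertible (jac (trans_map c d) z)"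
proof -
  have "openin (top_of_set (crange c)) (crange c \<inter> cinv c -` fst d)"
    using continuous_chart(2)[OF assms(1)] chart(1)[OF assms(2)] by (rule continuous_openin_preimage_gen)
  moreover have "overlap c d = crange c \<inter> cinv c -` fst d" unfolding overlap_alt[OF assms(1)] by blast
  ultimately show "open (overlap c d)" using chart(2)[OF assms(1)] by (metis openin_open_trans)
  have e: "snd d \<circ> cinv c = trans_map c d" by (rule ext) (simp add: trans_map_def)
  have "holomorphic_map_on (snd c ` (fst c \<inter> fst d)) (snd d \<circ> cinv c)"
    using X assms unfolding compact_kaehler_manifold_def complex_atlas_def by blast
  then show "holomorphic_map_on (overlap c d) (trans_map c d)" unfolding overlap_def e .
  assume z: "z \<in> overlap c d"
  then have z': "z \<in> crange c" "cinv c z \<in> fst d" unfolding overlap_alt[OF assms(1)] by auto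
  show "z \<in> crange c" by (rule z')
  show "trans_map c d z \<in> crange d" "cinv d (trans_map c d z) = cinv c z"
    using z' cinv_simps[OF assms(2)] by (auto simp: trans_map_def)
  show Gz: "G c z = adjoint_mat (jac (trans_map c d) z) ** G d (trans_map c d z) ** jac (trans_map c d) z"
    unfolding vec_eq_iff
  proof (intro allI)
    fix k j
    have "G c z $ k $ j = (\<Sum>a\<in>UNIV. \<Sum>b\<in>UNIV. G d (snd d (cinv c z)) $ b $ a
             * dz j (\<lambda>w. snd d (cinv c w) $ a) z * cnj (dz k (\<lambda>w. snd d (cinv c w) $ b) z))"
      using X assms z unfolding compact_kaehler_manifold_def kaehler_metric_def overlap_def by blast
    then show "G c z $ k $ j = (adjoint_mat (jac (trans_map c d) z) ** G d (trans_map c d z) ** jac (trans_map c d) z) $ k $ j"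
      by (simp add: matrix_matrix_mult_def adjoint_mat_def jac_def trans_map_def sum_distrib_right sum_distrib_left mult_ac)
  qed
  have "det (G c z) \<noteq> 0" using positive_definite_facts G_pos assms z' by blast
  then show "invertible (jac (trans_map c d) z)"
    unfolding Gz det_mul invertible_det_nz by auto
qed

definition dens :: "('a, 'n) chart \<Rightarrow> complex^'n \<Rightarrow> real" where
  "dens c z = 2 ^ CARD('n) * Re (det (G c z))"

lemma continuous_dens: assumes "c \<in> At" shows "continuous_on (crange c) (dens c)"
proof -
  interpret open_domain "crange c" by unfold_locales (rule chart(2)[OF assms])
  have "continuous_on (crange c) (\<lambda>z. det (G c z))"
    by (intro smooth_on_continuous sm_det G_smooth assms)
  then show ?thesis unfolding dens_def[abs_def] by (intro continuous_intros)
qed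

lemma dens_pos: "c \<in> At \<Longrightarrow> z \<in> crange c \<Longrightarrow> dens c z > 0"
  unfolding dens_def using positive_definite_facts(4) G_pos by simp

definition chart_measure :: "('a, 'n) chart \<Rightarrow> 'a measure" where
  "chart_measure c = distr (density (restrict_space lborel (crange c)) (\<lambda>z. ennreal (dens c z))) borel (cinv c)"

lemma image_borel:
  assumes "c \<in> At" "E \<in> sets borel" shows "snd c ` (E \<inter> fst c) \<in> sets borel"
    and "snd c ` (E \<inter> fst c) = cinv c -` E \<inter> crange c"
proof -
  show eq: "snd c ` (E \<inter> fst c) = cinv c -` E \<inter> crange c"
    using cinv_simps[OF assms(1)] by (auto simp: crange_def)
  have "cinv c \<in> borel_measurable (restrict_space borel (crange c))"
    by (rule borel_measurable_continuous_on_restrict[OF continuous_chart(2)[OF assms(1)]])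
  from measurable_sets[OF this assms(2)]
  have "cinv c -` E \<inter> crange c \<in> sets (restrict_space borel (crange c))" by (simp add: space_restrict_space)
  then show "snd c ` (E \<inter> fst c) \<in> sets borel"
    using chart(2)[OF assms(1)] unfolding eq by (simp add: sets_restrict_space_iff)
qed

lemma emeasure_chart_measure:
  assumes "c \<in> At" "E \<in> sets borel"
  shows "emeasure (chart_measure c) E = (\<integral>\<^sup>+z\<in>snd c ` (E \<inter> fst c). ennreal (dens c z) \<partial>lborel)"
proof -
  let ?R = "restrict_space lborel (crange c)"
  have sr: "sets ?R = sets (restrict_space borel (crange c))" by (rule sets_restrict_space_cong) simp
  have mc: "cinv c \<in> measurable ?R borel"
    using borel_measurable_continuous_on_restrict[OF continuous_chart(2)[OF assms(1)]]
    by (subst measurable_cong_sets[OF sr refl])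
  have "dens c \<in> borel_measurable (restrict_space borel (crange c))"
    by (rule borel_measurable_continuous_on_restrict[OF continuous_dens[OF assms(1)]])
  then have md: "dens c \<in> borel_measurable ?R"
    by (subst measurable_cong_sets[OF sr refl])
  have "emeasure (chart_measure c) E = emeasure (density ?R (\<lambda>z. ennreal (dens c z))) (cinv c -` E \<inter> crange c)"
    unfolding chart_measure_def using assms mc by (subst emeasure_distr) (auto simp: space_restrict_space)
  also have "\<dots> = (\<integral>\<^sup>+z. ennreal (dens c z) * indicator (cinv c -` E \<inter> crange c) z \<partial>?R)"
    using measurable_sets[OF mc assms(2)] md by (subst emeasure_density) (auto simp: space_restrict_space)
  also have "\<dots> = (\<integral>\<^sup>+z\<in>crange c. ennreal (dens c z) * indicator (cinv c -` E \<inter> crange c) z \<partial>lborel)"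
    using chart(2)[OF assms(1)] by (subst nn_integral_restrict_space) auto
  also have "\<dots> = (\<integral>\<^sup>+z\<in>snd c ` (E \<inter> fst c). ennreal (dens c z) \<partial>lborel)"
    unfolding image_borel(2)[OF assms] by (intro nn_integral_cong) (auto simp: indicator_def)
  finally show ?thesis .
qed

lemma dens_indicator_measurable:
  assumes "c \<in> At" "B \<in> sets borel" "B \<subseteq> crange c"
  shows "(\<lambda>z. dens c z * indicator B z) \<in> borel_measurable borel"
proof -
  have "dens c \<in> borel_measurable (restrict_space borel (crange c))"
    by (rule borel_measurable_continuous_on_restrict[OF continuous_dens[OF assms(1)]])
  then have "(\<lambda>z. indicator (crange c) z *\<^sub>R dens c z) \<in> borel_measurable borel"
    using chart(2)[OF assms(1)] by (subst (asm) borel_measurable_restrict_space_iff) auto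
  then have "(\<lambda>z. (indicator (crange c) z *\<^sub>R dens c z) * indicator B z) \<in> borel_measurable borel"
    using assms(2) by (intro borel_measurable_times borel_measurable_indicator) auto
  moreover have "(\<lambda>z. (indicator (crange c) z *\<^sub>R dens c z) * indicator B z) = (\<lambda>z. dens c z * indicator B z)"
    using assms(3) by (auto simp: fun_eq_iff indicator_def)
  ultimately show ?thesis by simp
qed

text \<open>The determinant of the metric changes by the squared modulus of the complex Jacobian
  determinant, which is the real Jacobian determinant of a holomorphic map in absolute
  value.\<close>

lemma chart_measure_consistent:
  assumes c: "c \<in> At" and d: "d \<in> At" and F: "F \<in> sets borel" "F \<subseteq> fst c" "F \<subseteq> fst d"
  shows "emeasure (chart_measure c) F = emeasure (chart_measure d) F"
proof -
  define S where "S = snd c ` F"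
  define h where "h = trans_map c d"
  have FF: "F \<inter> fst c = F" "F \<inter> fst d = F" using F by auto
  have Sb: "S \<in> sets borel" unfolding S_def using image_borel(1)[OF c F(1)] FF by simp
  have So: "S \<subseteq> overlap c d" unfolding S_def overlap_def using F by auto
  note tr = transition[OF c d, folded h_def]
  have hS: "h ` S = snd d ` F"
    unfolding S_def h_def trans_map_def image_image using F cinv_simps[OF c] by (auto intro!: image_cong)
  have inj: "inj_on h S"
  proof (rule inj_onI)
    fix z w assume "z \<in> S" "w \<in> S" and e: "h z = h w"
    then have "cinv c z = cinv c w" using tr(5) So by (metis subsetD)
    then show "z = w" using cinv_simps(2)[OF c] tr(4) So \<open>z \<in> S\<close> \<open>w \<in> S\<close> by (metis subsetD)
  qed
  have Sc: "S \<subseteq> crange c" using So tr(4) by blast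
  have dd: "dens c z = (cmod (det (jac h z)))\<^sup>2 * dens d (h z)" if "z \<in> S" for z
  proof -
    have z: "z \<in> overlap c d" using that So by blast
    have ad: "det (adjoint_mat J) = cnj (det J)" for J :: "complex^'n^'n"
      by (rule real_coordinates.det_adjoint[OF real_coordinates.intro]) (rule someI_ex[OF ex_enum_Basis])
    have "det (G c z) = (det (jac h z) * cnj (det (jac h z))) * det (G d (h z))"
      using tr(6)[OF z] by (simp add: det_mul ad)
    then have "det (G c z) = of_real ((cmod (det (jac h z)))\<^sup>2) * det (G d (h z))"
      by (simp only: complex_norm_square)
    then show ?thesis by (simp add: dens_def)
  qed
  have "(\<integral>\<^sup>+y\<in>h ` S. ennreal (dens d y) \<partial>lborel) = (\<integral>\<^sup>+z\<in>S. ennreal ((cmod (det (jac h z)))\<^sup>2 * dens d (h z)) \<partial>lborel)"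
  proof (rule nn_change_of_variables_holomorphic[OF Sb _ _ inj])
    fix z assume z: "z \<in> S"
    then have zo: "z \<in> overlap c d" using So by blast
    obtain D where D: "(h has_derivative D) (at z)" "\<And>v. D v = jac h z *v v"
      using holomorphic_map_component[OF tr(2) zo] by metis
    have "D = (\<lambda>v. jac h z *v v)" by (rule ext) (rule D)
    then show "(h has_derivative (\<lambda>v. jac h z *v v)) (at z)" using D(1) by simp
    show "det (jac h z) \<noteq> 0" using tr(7)[OF zo] by (simp add: invertible_det_nz)
    show "0 \<le> dens d (h z)" using dens_pos[OF d tr(3)[OF zo]] by simp
  next
    have "(\<lambda>z. dens c z * indicator S z) \<in> borel_measurable borel" by (rule dens_indicator_measurable[OF c Sb Sc])
    moreover have "(\<lambda>z. dens c z * indicator S z) = (\<lambda>z. (cmod (det (jac h z)))\<^sup>2 * dens d (h z) * indicator S z)"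
      using dd by (auto simp: fun_eq_iff indicator_def)
    ultimately show "(\<lambda>z. (cmod (det (jac h z)))\<^sup>2 * dens d (h z) * indicator S z) \<in> borel_measurable borel" by simp
    show "(\<lambda>y. dens d y * indicator (h ` S) y) \<in> borel_measurable borel"
    proof (rule dens_indicator_measurable[OF d])
      show "h ` S \<in> sets borel" unfolding hS using image_borel(1)[OF d F(1)] FF by simp
      show "h ` S \<subseteq> crange d" using tr(3) So by blast
    qed
  qed
  also have "\<dots> = (\<integral>\<^sup>+z\<in>S. ennreal (dens c z) \<partial>lborel)"
    by (intro nn_integral_cong) (auto simp: dd indicator_def)
  finally show ?thesis
    unfolding hS unfolding emeasure_chart_measure[OF c F(1)] emeasure_chart_measure[OF d F(1)] FF S_def[symmetric]
    by simp
qed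

definition volume_like :: "'a measure \<Rightarrow> bool" where
  "volume_like m \<longleftrightarrow> sets m = sets borel \<and>
     (\<forall>c\<in>At. \<forall>E\<in>sets borel. E \<subseteq> fst c \<longrightarrow>
        emeasure m E = (\<integral>\<^sup>+z\<in>snd c ` E. ennreal (2 ^ CARD('n) * Re (det (G c z))) \<partial>lborel))"

lemma volume_like_chart:
  assumes "volume_like m" "c \<in> At" "E \<in> sets borel" "E \<subseteq> fst c"
  shows "emeasure m E = emeasure (chart_measure c) E"
  using assms unfolding volume_like_def by (simp add: emeasure_chart_measure dens_def Int_absorb2)

lemma finite_chart_cover: "\<exists>C. finite C \<and> C \<subseteq> At \<and> (\<Union>c\<in>C. fst c) = UNIV"
proof -
  have "compact (UNIV :: 'a set)" using X by (simp add: compact_kaehler_manifold_def)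
  moreover have "\<And>c. c \<in> At \<Longrightarrow> open (fst c)" by (rule chart)
  moreover have "UNIV \<subseteq> (\<Union>c\<in>At. fst c)" using covers by blast
  ultimately obtain C where "C \<subseteq> At" "finite C" "UNIV \<subseteq> (\<Union>c\<in>C. fst c)"
    by (rule compactE_image)
  then show ?thesis by blast
qed

text \<open>\<open>volume\<close> is a definite description, so its defining property becomes
  available only through unique existence. A finite cover by chart domains is made disjoint and the
  chart measures are added up over the pieces; consistency on overlaps yields the formula in every
  chart, and the same decomposition proves uniqueness.\<close>

lemma volume_exists: "\<exists>!m. volume_like m"
proof -
  obtain C where C: "finite C" "C \<subseteq> At" "(\<Union>c\<in>C. fst c) = UNIV" using finite_chart_cover by blast
  obtain e :: "nat \<Rightarrow> ('a, 'n) chart" and N where e: "C = e ` {..<N}"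
    using finite_imp_nat_seg_image_inj_on[OF C(1)] by (auto simp: lessThan_def)
  have eAt: "e i \<in> At" if "i < N" for i using e C that by auto
  define B where "B i = fst (e i) - (\<Union>j<i. fst (e j))" for i
  have ef: "fst (e i) \<in> sets borel" if "i < N" for i using chart(1)[OF eAt[OF that]] by simp
  have Bb: "B i \<in> sets borel" if "i < N" for i
    unfolding B_def using ef that by (intro sets.Diff sets.finite_UN) auto
  have Bs: "B i \<subseteq> fst (e i)" for i by (auto simp: B_def)
  have Bd: "disjoint_family_on B {..<N}"
    unfolding disjoint_family_on_def B_def by auto (metis Int_iff Diff_iff UN_I empty_iff lessThan_iff nat_neq_iff)
  have Bu: "(\<Union>i<N. B i) = UNIV"
  proof -
    have "x \<in> (\<Union>i<N. B i)" for x
    proof -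
      have ex: "\<exists>i. i < N \<and> x \<in> fst (e i)" using C(3) e by auto
      define i where "i = (LEAST i. i < N \<and> x \<in> fst (e i))"
      have i: "i < N" "x \<in> fst (e i)" using LeastI_ex[OF ex] by (auto simp: i_def)
      have "x \<notin> fst (e j)" if "j < i" for j using not_less_Least[OF that[unfolded i_def]] that i by auto
      then show ?thesis using i by (auto simp: B_def)
    qed
    then show ?thesis by blast
  qed
  define \<nu> where "\<nu> E = (\<Sum>i<N. emeasure (chart_measure (e i)) (E \<inter> B i))" for E
  have sc: "sets (chart_measure c) = sets borel" for c by (simp add: chart_measure_def)
  have split: "emeasure m E = (\<Sum>i<N. emeasure m (E \<inter> B i))" if "sets m = sets borel" "E \<in> sets borel" for m E
  proof -
    have "E = (\<Union>i<N. E \<inter> B i)" using Bu by blast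
    then have "emeasure m E = emeasure m (\<Union>i<N. E \<inter> B i)" by simp
    also have "\<dots> = (\<Sum>i<N. emeasure m (E \<inter> B i))"
    proof (rule sum_emeasure[symmetric])
      show "disjoint_family_on (\<lambda>i. E \<inter> B i) {..<N}" using Bd unfolding disjoint_family_on_def by blast
    qed (use that Bb in auto)
    finally show ?thesis .
  qed
  define m where "m = measure_of UNIV (sets borel) \<nu>"
  have sm: "sets m = sets borel" unfolding m_def by (simp add: sets.sigma_sets_eq[of borel, simplified])
  have em: "emeasure m E = \<nu> E" if "E \<in> sets borel" for E
  proof (rule emeasure_measure_of[OF m_def])
    show "sets borel \<subseteq> Pow UNIV" by auto
    show "positive (sets m) \<nu>" by (simp add: positive_def \<nu>_def)
    show "countably_additive (sets m) \<nu>"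
    proof (rule countably_additiveI)
      fix A :: "nat \<Rightarrow> 'a set" assume A: "range A \<subseteq> sets m" "disjoint_family A"
      have "(\<Sum>k. \<nu> (A k)) = (\<Sum>i<N. \<Sum>k. emeasure (chart_measure (e i)) (A k \<inter> B i))"
        unfolding \<nu>_def by (rule suminf_sum) simp
      also have "\<dots> = \<nu> (\<Union>k. A k)"
        unfolding \<nu>_def
      proof (intro sum.cong refl)
        fix i assume "i \<in> {..<N}"
        then have "range (\<lambda>k. A k \<inter> B i) \<subseteq> sets (chart_measure (e i))" using A Bb by (auto simp: sc sm)
        moreover have "disjoint_family (\<lambda>k. A k \<inter> B i)" using A(2) by (auto simp: disjoint_family_on_def)
        ultimately have "(\<Sum>k. emeasure (chart_measure (e i)) (A k \<inter> B i)) = emeasure (chart_measure (e i)) (\<Union>k. A k \<inter> B i)"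
          by (rule suminf_emeasure)
        then show "(\<Sum>k. emeasure (chart_measure (e i)) (A k \<inter> B i)) = emeasure (chart_measure (e i)) (\<Union> (range A) \<inter> B i)"
          by (simp add: Int_UN_distrib2[symmetric] UN_extend_simps(4)[symmetric])
      qed
      finally show "(\<Sum>k. \<nu> (A k)) = \<nu> (\<Union> (range A))" .
    qed
    show "E \<in> sets m" using that sm by simp
  qed
  have "volume_like m"
    unfolding volume_like_def
  proof (intro conjI ballI impI sm)
    fix c E assume c: "c \<in> At" and E: "E \<in> sets borel" "E \<subseteq> fst c"
    have "emeasure m E = (\<Sum>i<N. emeasure (chart_measure (e i)) (E \<inter> B i))" using em[OF E(1)] by (simp add: \<nu>_def)
    also have "\<dots> = (\<Sum>i<N. emeasure (chart_measure c) (E \<inter> B i))"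
      using E Bs Bb eAt c by (intro sum.cong refl chart_measure_consistent) auto
    also have "\<dots> = emeasure (chart_measure c) E" using split[OF sc E(1)] by simp
    finally show "emeasure m E = (\<integral>\<^sup>+z\<in>snd c ` E. ennreal (2 ^ CARD('n) * Re (det (G c z))) \<partial>lborel)"
      using E by (simp add: emeasure_chart_measure[OF c E(1)] dens_def Int_absorb2)
  qed
  moreover have "m' = m" if m': "volume_like m'" for m'
  proof (rule measure_eqI)
    have s': "sets m' = sets borel" using m' by (simp add: volume_like_def)
    then show "sets m' = sets m" using sm by simp
    fix E assume "E \<in> sets m'"
    then have E: "E \<in> sets borel" using s' by simp
    have "emeasure m' E = (\<Sum>i<N. emeasure m' (E \<inter> B i))" by (rule split[OF s' E])
    also have "\<dots> = (\<Sum>i<N. emeasure (chart_measure (e i)) (E \<inter> B i))"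
      using E Bs Bb eAt by (intro sum.cong refl volume_like_chart[OF m']) auto
    also have "\<dots> = emeasure m E" using em[OF E] by (simp add: \<nu>_def)
    finally show "emeasure m' E = emeasure m E" .
  qed
  ultimately show ?thesis by blast
qed

lemma volume_like_volume: "volume_like (volume At G)"
proof -
  have "volume At G = (THE m. volume_like m)" unfolding volume_def volume_like_def ..
  then show ?thesis using theI'[OF volume_exists] by simp
qed

end

section \<open>Pullback of Laplacians and gradients, and bounds for jets on compact sets\<close>

context open_domain
begin

lemma trace_levi_pullback:
  fixes h :: "complex^'n \<Rightarrow> complex^'n" and G0 :: "complex^'n^'n"
  assumes h: "holomorphic_map_on V h" "open V" "\<And>z. z \<in> V \<Longrightarrow> h z \<in> W" and F: "sm F" and z: "z \<in> V"
    and inv: "invertible (jac h z)" "invertible G0"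
  shows "trace (matrix_inv (adjoint_mat (jac h z) ** G0 ** jac h z) ** levi (\<lambda>w. F (h w)) z)
    = trace (matrix_inv G0 ** levi F (h z))"
proof -
  have "levi (\<lambda>w. F (h w)) z = adjoint_mat (jac h z) ** levi F (h z) ** jac h z"
    by (rule levi_pullback(2)[OF h F z])
  then show ?thesis using trace_pullback(1)[OF inv(2,1)] by simp
qed

lemma pairing_grad_pullback:
  fixes h :: "complex^'n \<Rightarrow> complex^'n" and G0 :: "complex^'n^'n"
  assumes h: "holomorphic_map_on V h" "open V" "\<And>z. z \<in> V \<Longrightarrow> h z \<in> W" and F: "sm F" "sm F2" and z: "z \<in> V"
    and inv: "invertible (jac h z)" "invertible G0"
  shows "pairing (matrix_inv (adjoint_mat (jac h z) ** G0 ** jac h z))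
      (\<chi> j. dz j (\<lambda>w. F (h w)) z) (\<chi> k. dzbar k (\<lambda>w. F2 (h w)) z)
    = pairing (matrix_inv G0) (\<chi> j. dz j F (h z)) (\<chi> k. dzbar k F2 (h z))"
proof -
  have 1: "(\<chi> j. dz j (\<lambda>w. F (h w)) z) = (\<chi> j. dz j F (h z)) v* jac h z"
    unfolding wirtinger_chain(1)[OF h(1) z smD[OF F(1) h(3)[OF z]]]
    by (simp add: vec_eq_iff vector_matrix_mult_def mult.commute)
  have 2: "(\<chi> k. dzbar k (\<lambda>w. F2 (h w)) z) = (\<chi> k. \<Sum>a\<in>UNIV. (\<chi> k. dzbar k F2 (h z)) $ a * cnj (jac h z $ a $ k))"
    unfolding wirtinger_chain(2)[OF h(1) z smD[OF F(2) h(3)[OF z]]] by simp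
  show ?thesis unfolding 1 2 by (rule pairing_pullback[OF inv(2,1)])
qed

lemma jets_bounded:
  assumes K: "compact K" "K \<subseteq> W" and F: "sm F"
  shows "\<exists>b. \<forall>z\<in>K. norm (F z) \<le> b \<and> (\<forall>a. norm (dz a F z) \<le> b) \<and> (\<forall>a. norm (dzbar a F z) \<le> b)
    \<and> (\<forall>a k. norm (dz k (dz a F) z) \<le> b) \<and> (\<forall>a k. norm (dzbar k (dz a F) z) \<le> b)"
proof -
  have ex: "\<exists>b\<ge>0. \<forall>z\<in>K. norm (E z) \<le> b" if "sm E" for E
  proof -
    have "continuous_on K E" using smooth_on_continuous[OF that] K continuous_on_subset by blast
    then have "compact (E ` K)" using K compact_continuous_image by blast
    then obtain b where "\<And>y. y \<in> E ` K \<Longrightarrow> norm y \<le> b" using compact_imp_bounded bounded_iff by metis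
    then show ?thesis by (intro exI[of _ "max b 0"]) (auto simp: le_max_iff_disj)
  qed
  have fam: "\<exists>b\<ge>0. \<forall>i. \<forall>z\<in>K. norm (E i z) \<le> b" if "\<And>i. sm (E i)" for E :: "'i::finite \<Rightarrow> _"
  proof -
    have "\<forall>i. \<exists>b\<ge>0. \<forall>z\<in>K. norm (E i z) \<le> b" using ex that by blast
    then obtain b where b: "\<And>i. b i \<ge> 0" "\<And>i z. z \<in> K \<Longrightarrow> norm (E i z) \<le> b i" by metis
    have "norm (E i z) \<le> (\<Sum>i\<in>UNIV. b i)" if "z \<in> K" for i z
      using b(2)[OF that, of i] member_le_sum[of i UNIV b] b(1) by fastforce
    then show ?thesis using b(1) by (intro exI[of _ "\<Sum>i\<in>UNIV. b i"]) (auto intro: sum_nonneg)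
  qed
  obtain b0 where b0: "b0 \<ge> 0" "\<And>z. z \<in> K \<Longrightarrow> norm (F z) \<le> b0" using ex[OF F] by blast
  obtain b1 where b1: "b1 \<ge> 0" "\<And>a z. z \<in> K \<Longrightarrow> norm (dz a F z) \<le> b1" using fam[of "\<lambda>a. dz a F"] F by blast
  obtain b2 where b2: "b2 \<ge> 0" "\<And>a z. z \<in> K \<Longrightarrow> norm (dzbar a F z) \<le> b2" using fam[of "\<lambda>a. dzbar a F"] F by blast
  obtain b3 where b3: "b3 \<ge> 0" "\<And>p z. z \<in> K \<Longrightarrow> norm (dz (fst p) (dz (snd p) F) z) \<le> b3"
    using fam[of "\<lambda>p. dz (fst p) (dz (snd p) F)"] F by blast
  obtain b4 where b4: "b4 \<ge> 0" "\<And>p z. z \<in> K \<Longrightarrow> norm (dzbar (fst p) (dz (snd p) F) z) \<le> b4"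
    using fam[of "\<lambda>p. dzbar (fst p) (dz (snd p) F)"] F by blast
  have "norm (dz k (dz a F) z) \<le> b3" "norm (dzbar k (dz a F) z) \<le> b4" if "z \<in> K" for a k z
    using b3(2)[OF that, of "(k, a)"] b4(2)[OF that, of "(k, a)"] by simp_all
  then show ?thesis using b0 b1 b2 b3(1) b4(1)
    by (intro exI[of _ "b0 + b1 + b2 + b3 + b4"]) (smt (verit, ccfv_SIG))
qed

end

section \<open>Global functions defined by local expressions, and finite covers by coordinate
  balls\<close>

context kaehler_manifold
begin

lemma chart_domain: "c \<in> At \<Longrightarrow> open_domain (crange c)"
  by unfold_locales (rule chart(2))

lemma loc_smooth: "smooth_fun At u \<Longrightarrow> c \<in> At \<Longrightarrow> smooth_on (crange c) (loc c u)"
  unfolding smooth_fun_def loc_def[abs_def]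
  using smooth_on_of_real[OF chart(2)] by (auto simp: o_def)

lemma hess_levi: "hess c u z = levi (loc c u) z"
  by (simp add: hess_def levi_def)

lemma laplacian_trace:
  assumes "smooth_fun At u" "c \<in> At" "z \<in> crange c"
  shows "laplacian G c u z = Re (trace (matrix_inv (G c z) ** levi (loc c u) z))"
proof -
  interpret open_domain "crange c" by (rule chart_domain[OF assms(2)])
  show ?thesis
    using d_commute(3)[OF loc_smooth[OF assms(1,2)] assms(3)]
    by (simp add: laplacian_def ginv_def trace_def matrix_matrix_mult_def levi_def)
qed

lemma grad_pair_pairing:
  "grad_pair G c f u z = pairing (matrix_inv (G c z)) (\<chi> j. dz j (loc c f) z) (\<chi> k. dzbar k (loc c u) z)"
  by (simp add: grad_pair_def ginv_def pairing_def)

lemma overlapI: "c \<in> At \<Longrightarrow> z \<in> crange c \<Longrightarrow> cinv c z \<in> fst d \<Longrightarrow> z \<in> overlap c d"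
  by (simp add: overlap_alt)

lemma loc_trans:
  assumes "c \<in> At" "d \<in> At" "z \<in> overlap c d" shows "loc c u z = loc d u (trans_map c d z)"
  using transition(5)[OF assms] by (simp add: loc_def)

lemma chart_invariance:
  assumes u: "smooth_fun At u" and f: "smooth_fun At f" and c: "c \<in> At" "d \<in> At" and z: "z \<in> overlap c d"
  shows "laplacian G c u z = laplacian G d u (trans_map c d z)"
    "grad_pair G c f u z = grad_pair G d f u (trans_map c d z)"
proof -
  interpret D: open_domain "crange d" by (rule chart_domain[OF c(2)])
  note tr = transition[OF c]
  interpret V: open_domain "overlap c d" by unfold_locales (rule tr(1))
  let ?h = "trans_map c d"
  have e: "levi (loc c u) z = levi (\<lambda>w. loc d u (?h w)) z"
  proof -
    have "dzbar k (dz j (loc c u)) z = dzbar k (dz j (\<lambda>w. loc d u (?h w))) z" for k j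
      by (rule V.dzbar_cong[OF z], rule V.dz_cong) (auto simp: loc_trans[OF c])
    then show ?thesis by (simp add: levi_def)
  qed
  have e2: "dz j (loc c f) z = dz j (\<lambda>w. loc d f (?h w)) z" for j
    by (rule V.dz_cong[OF z]) (simp add: loc_trans[OF c])
  have e3: "dzbar j (loc c u) z = dzbar j (\<lambda>w. loc d u (?h w)) z" for j
    by (rule V.dzbar_cong[OF z]) (simp add: loc_trans[OF c])
  have inv: "invertible (jac ?h z)" "invertible (G d (?h z))"
    using tr(7)[OF z] positive_definite_facts(1)[OF G_pos[OF c(2) tr(3)[OF z]]] by auto
  have zc: "z \<in> crange c" by (rule tr(4)[OF z])
  show "laplacian G c u z = laplacian G d u (?h z)"
    unfolding laplacian_trace[OF u c(1) zc] laplacian_trace[OF u c(2) tr(3)[OF z]] e tr(6)[OF z]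
    by (subst D.trace_levi_pullback[OF tr(2,1) tr(3) loc_smooth[OF u c(2)] z inv]) auto
  show "grad_pair G c f u z = grad_pair G d f u (?h z)"
    unfolding grad_pair_pairing e2 e3 tr(6)[OF z]
    by (subst D.pairing_grad_pullback[OF tr(2,1) tr(3) loc_smooth[OF f c(2)] loc_smooth[OF u c(2)] z inv]) auto
qed

text \<open>An arbitrary choice of a chart at each point makes local expressions into functions on
  the manifold; \<open>globalX\<close> removes the dependence on the choice.\<close>

definition chart_at :: "'a \<Rightarrow> ('a, 'n) chart" where
  "chart_at x = (SOME c. c \<in> At \<and> x \<in> fst c)"

lemma chart_at: "chart_at x \<in> At" "x \<in> fst (chart_at x)"
  using someI_ex[of "\<lambda>c. c \<in> At \<and> x \<in> fst c"] covers[of x] unfolding chart_at_def by blast+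

definition lapX :: "('a \<Rightarrow> real) \<Rightarrow> 'a \<Rightarrow> real" where
  "lapX u x = laplacian G (chart_at x) u (snd (chart_at x) x)"

definition gradX :: "('a \<Rightarrow> real) \<Rightarrow> 'a \<Rightarrow> real" where
  "gradX u x = grad_sq G (chart_at x) u (snd (chart_at x) x)"

lemma globalX:
  assumes u: "smooth_fun At u" and c: "c \<in> At" and z: "z \<in> crange c"
  shows "laplacian G c u z = lapX u (cinv c z)" "grad_sq G c u z = gradX u (cinv c z)"
proof -
  let ?x = "cinv c z" and ?d = "chart_at (cinv c z)"
  have zo: "z \<in> overlap c ?d" by (rule overlapI[OF c z chart_at(2)])
  have t: "trans_map c ?d z = snd ?d ?x" by (simp add: trans_map_def)
  show "laplacian G c u z = lapX u (cinv c z)"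
    using chart_invariance(1)[OF u u c chart_at(1) zo] by (simp add: lapX_def t)
  show "grad_sq G c u z = gradX u (cinv c z)"
    using chart_invariance(2)[OF u u c chart_at(1) zo] by (simp add: gradX_def grad_sq_def t)
qed

lemma smooth_matrix_inv: "c \<in> At \<Longrightarrow> smooth_on (crange c) (\<lambda>z. matrix_inv (G c z) $ i $ j)"
proof -
  assume c: "c \<in> At"
  interpret open_domain "crange c" by (rule chart_domain[OF c])
  show ?thesis
    by (rule sm_matrix_inv) (auto intro: G_smooth[OF c] positive_definite_facts(1) G_pos[OF c])
qed

lemma smooth_lap:
  assumes "smooth_fun At u" "c \<in> At"
  shows "smooth_on (crange c) (\<lambda>z. trace (matrix_inv (G c z) ** levi (loc c u) z))"
proof -
  interpret open_domain "crange c" by (rule chart_domain[OF assms(2)])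
  show ?thesis
    unfolding trace_def matrix_matrix_mult_def levi_def vec_lambda_beta
    by (intro sm_intros smooth_matrix_inv assms sm_dz sm_dzbar loc_smooth)
qed

lemma smooth_lapX: assumes "smooth_fun At u" shows "smooth_fun At (lapX u)"
  unfolding smooth_fun_def
proof
  fix c assume c: "c \<in> At"
  interpret open_domain "crange c" by (rule chart_domain[OF c])
  have "smooth_on (crange c) (\<lambda>z. Re (trace (matrix_inv (G c z) ** levi (loc c u) z)))"
    by (rule smooth_on_Re[OF chart(2)[OF c] smooth_lap[OF assms c]])
  moreover have "Re (trace (matrix_inv (G c z) ** levi (loc c u) z)) = (lapX u \<circ> cinv c) z" if "z \<in> crange c" for z
    using globalX(1)[OF assms c that] laplacian_trace[OF assms c that] by simp
  ultimately show "smooth_on (crange c) (lapX u \<circ> cinv c)" by (subst smooth_on_cong[OF open_W, symmetric])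
qed

lemma continuous_grad_sq: assumes "smooth_fun At u" "c \<in> At"
  shows "continuous_on (crange c) (grad_sq G c u)"
proof -
  interpret open_domain "crange c" by (rule chart_domain[OF assms(2)])
  have "sm (\<lambda>z. pairing (matrix_inv (G c z)) (\<chi> j. dz j (loc c u) z) (\<chi> k. dzbar k (loc c u) z))"
    unfolding pairing_def vec_lambda_beta
    by (intro sm_intros smooth_matrix_inv assms sm_dz sm_dzbar loc_smooth)
  from smooth_on_continuous[OF smooth_on_Re[OF open_W this]]
  show ?thesis by (simp add: grad_sq_def[abs_def] grad_pair_pairing)
qed

lemma continuous_global:
  fixes \<phi> :: "'a \<Rightarrow> real"
  assumes "\<And>c. c \<in> At \<Longrightarrow> continuous_on (crange c) (\<lambda>z. \<phi> (cinv c z))"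
  shows "continuous_on UNIV \<phi>"
proof (rule continuous_at_imp_continuous_on, rule ballI)
  fix x
  obtain c where c: "c \<in> At" "x \<in> fst c" using covers by blast
  have "continuous_on (fst c) (\<lambda>y. \<phi> (cinv c (snd c y)))"
    by (rule continuous_on_compose2[OF assms[OF c(1)] continuous_chart(1)[OF c(1)]])
      (use cinv_simps[OF c(1)] in auto)
  then have "continuous_on (fst c) \<phi>"
    by (rule continuous_on_cong[THEN iffD1, rotated -1]) (use cinv_simps[OF c(1)] in auto)
  then show "isCont \<phi> x" using chart(1)[OF c(1)] c(2) by (simp add: continuous_on_eq_continuous_at)
qed

lemma smooth_fun_continuous: "smooth_fun At u \<Longrightarrow> continuous_on UNIV u"
  by (rule continuous_global) (auto simp: smooth_fun_def o_def dest: smooth_on_continuous)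

lemma continuous_gradX: "smooth_fun At u \<Longrightarrow> continuous_on UNIV (gradX u)"
proof (rule continuous_global)
  fix c assume u: "smooth_fun At u" and c: "c \<in> At"
  show "continuous_on (crange c) (\<lambda>z. gradX u (cinv c z))"
    by (rule continuous_on_cong[THEN iffD1, OF refl _ continuous_grad_sq[OF u c]]) (rule globalX(2)[OF u c])
qed

text \<open>The open balls cover, while the closed balls inside the chart ranges are compact and
  give uniform bounds for coefficients and their derivatives. Every later constant is obtained piece
  by piece and combined over this finite family.\<close>

lemma finite_pieces:
  "\<exists>D. finite D \<and> (\<forall>(c, y, r)\<in>D. c \<in> At \<and> r > 0 \<and> cball y r \<subseteq> crange c) \<and>
     (\<forall>x. \<exists>(c, y, r)\<in>D. \<exists>z\<in>ball y r. cinv c z = x)"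
proof -
  define P where "P = {(c, y :: complex^'n, r :: real). c \<in> At \<and> r > 0 \<and> cball y r \<subseteq> crange c}"
  define N where "N p = (case p of (c :: ('a, 'n) chart, y, r) \<Rightarrow> cinv c ` ball y r)" for p
  have op: "open (N p)" if "p \<in> P" for p
  proof -
    obtain c y r where p: "p = (c, y, r)" by (metis prod_cases3)
    have c: "c \<in> At" "cball y r \<subseteq> crange c" using that by (auto simp: P_def p)
    have "N p = {x \<in> fst c. snd c x \<in> ball y r}"
    proof -
      have "x \<in> N p \<longleftrightarrow> x \<in> fst c \<and> snd c x \<in> ball y r" for x
      proof
        assume "x \<in> N p"
        then obtain z where z: "z \<in> ball y r" "x = cinv c z" by (auto simp: N_def p)
        then have "z \<in> crange c" using c(2) ball_subset_cball[of y r] by blast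
        then show "x \<in> fst c \<and> snd c x \<in> ball y r" using z cinv_simps[OF c(1)] by simp
      next
        assume "x \<in> fst c \<and> snd c x \<in> ball y r"
        then show "x \<in> N p" using cinv_simps(1)[OF c(1), of x] unfolding N_def p prod.case by (metis image_eqI)
      qed
      then show ?thesis by blast
    qed
    then have "N p = fst c \<inter> snd c -` ball y r" unfolding vimage_def Int_def mem_Collect_eq .
    then show ?thesis
      using openin_open_trans[OF continuous_openin_preimage_gen[OF continuous_chart(1)[OF c(1)] open_ball[of y r]] chart(1)[OF c(1)]]
      by simp
  qed
  have cov: "UNIV \<subseteq> (\<Union>p\<in>P. N p)"
  proof
    fix x
    obtain c where c: "c \<in> At" "x \<in> fst c" using covers by blast
    then have z: "snd c x \<in> crange c" using cinv_simps by blast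
    obtain r where r: "r > 0" "cball (snd c x) r \<subseteq> crange c" using chart(2)[OF c(1)] z open_contains_cball by blast
    then have "(c, snd c x, r) \<in> P" "x \<in> N (c, snd c x, r)"
      using c cinv_simps(1)[OF c] by (auto simp: P_def N_def image_iff intro!: bexI[of _ "snd c x"])
    then show "x \<in> (\<Union>p\<in>P. N p)" by blast
  qed
  have "compact (UNIV :: 'a set)" using X by (simp add: compact_kaehler_manifold_def)
  then obtain D where D: "D \<subseteq> P" "finite D" "UNIV \<subseteq> (\<Union>p\<in>D. N p)"
    using compactE_image[of UNIV P N] op cov by blast
  have "\<exists>(c, y, r)\<in>D. \<exists>z\<in>ball y r. cinv c z = x" for x
  proof -
    have "x \<in> (\<Union>p\<in>D. N p)" using D(3) by blast
    then obtain c y r where "(c, y, r) \<in> D" "x \<in> cinv c ` ball y r" by (auto simp: N_def)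
    then show ?thesis by (intro bexI[of _ "(c, y, r)"]) auto
  qed
  then show ?thesis using D by (intro exI[of _ D]) (auto simp: P_def)
qed

text \<open>Since $g^{-1} = \lambda T T^*$, a frame \<open>T\<close> that is orthonormal for $\lambda g$ is bounded by the
  entries of $g^{-1}$.\<close>

lemma normal_coordinates:
  assumes c: "c \<in> At" and K: "compact K" "K \<subseteq> crange c"
  shows "\<exists>B Bq t0. \<forall>z0\<in>K. \<forall>lam\<ge>1. \<forall>T. adjoint_mat T ** (\<chi> k j. of_real lam * G c z0 $ k $ j) ** T = mat 1 \<longrightarrow>
     (\<exists>Qc. quad_metric z0 T Qc (crange c) (G c) lam B Bq t0)"
proof -
  interpret open_domain "crange c" by (rule chart_domain[OF c])
  have G1: "\<exists>b. \<forall>z\<in>K. norm (G c z $ fst p $ snd p) \<le> b \<and> (\<forall>a. norm (dz a (\<lambda>z. G c z $ fst p $ snd p) z) \<le> b)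
     \<and> (\<forall>a. norm (dzbar a (\<lambda>z. G c z $ fst p $ snd p) z) \<le> b)
     \<and> (\<forall>a k. norm (dzbar k (dz a (\<lambda>z. G c z $ fst p $ snd p)) z) \<le> b)
     \<and> norm (matrix_inv (G c z) $ fst p $ snd p) \<le> b" for p
  proof -
    obtain b1 where "\<forall>z\<in>K. norm (G c z $ fst p $ snd p) \<le> b1 \<and> (\<forall>a. norm (dz a (\<lambda>z. G c z $ fst p $ snd p) z) \<le> b1)
     \<and> (\<forall>a. norm (dzbar a (\<lambda>z. G c z $ fst p $ snd p) z) \<le> b1) \<and> (\<forall>a k. norm (dz k (dz a (\<lambda>z. G c z $ fst p $ snd p)) z) \<le> b1)
     \<and> (\<forall>a k. norm (dzbar k (dz a (\<lambda>z. G c z $ fst p $ snd p)) z) \<le> b1)"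
      using jets_bounded[OF K G_smooth[OF c, of "fst p" "snd p"]] by blast
    moreover obtain b2 where "\<forall>z\<in>K. norm (matrix_inv (G c z) $ fst p $ snd p) \<le> b2"
      using jets_bounded[OF K smooth_matrix_inv[OF c, of "fst p" "snd p"]] by blast
    ultimately show ?thesis by (intro exI[of _ "max b1 b2"]) (simp add: le_max_iff_disj)
  qed
  then obtain b where b: "\<And>p z. z \<in> K \<Longrightarrow> norm (G c z $ fst p $ snd p) \<le> b p \<and> (\<forall>a. norm (dz a (\<lambda>z. G c z $ fst p $ snd p) z) \<le> b p)
     \<and> (\<forall>a. norm (dzbar a (\<lambda>z. G c z $ fst p $ snd p) z) \<le> b p)
     \<and> (\<forall>a k. norm (dzbar k (dz a (\<lambda>z. G c z $ fst p $ snd p)) z) \<le> b p)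
     \<and> norm (matrix_inv (G c z) $ fst p $ snd p) \<le> b p" by metis
  define B where "B = (\<Sum>p\<in>UNIV. \<bar>b p\<bar>)"
  have B0: "B \<ge> 0" by (simp add: B_def sum_nonneg)
  have bB: "b (k, j) \<le> B" for k j
    using member_le_sum[of "(k, j)" UNIV "\<lambda>p. \<bar>b p\<bar>"] abs_ge_self[of "b (k, j)"] by (simp add: B_def)
  have GB: "norm (G c z $ k $ j) \<le> B" "norm (dz a (\<lambda>z. G c z $ k $ j) z) \<le> B" "norm (dzbar a (\<lambda>z. G c z $ k $ j) z) \<le> B"
     "norm (dzbar l (dz a (\<lambda>z. G c z $ k $ j)) z) \<le> B" "norm (matrix_inv (G c z) $ k $ j) \<le> B" if "z \<in> K" for z k j a l
    using b[OF that, of "(k, j)"] order_trans[OF _ bB[of k j]] by simp_all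
  define n where "n = real CARD('n)"
  define Bq where "Bq = n * (B * (n * (n * B)))"
  define t0 where "t0 = sqrt B"
  show ?thesis
  proof (rule exI[of _ B], rule exI[of _ Bq], rule exI[of _ t0], intro ballI allI impI)
    fix z0 :: "complex^'n" and lam :: real and T :: "complex^'n^'n"
    assume z0: "z0 \<in> K" and lam: "1 \<le> lam" and T: "adjoint_mat T ** (\<chi> k j. of_real lam * G c z0 $ k $ j) ** T = mat 1"
    have z0c: "z0 \<in> crange c" using z0 K by blast
    note pd = positive_definite_facts[OF G_pos[OF c z0c]]
    have GI: "G c z0 ** matrix_inv (G c z0) = mat 1" "matrix_inv (G c z0) ** G c z0 = mat 1"
      by (rule matrix_inv_works[OF pd(1)])+
    have "det (adjoint_mat T) * det (\<chi> k j. of_real lam * G c z0 $ k $ j) * det T = 1"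
      using T by (metis det_mul det_I)
    then have dT: "det T \<noteq> 0" by auto
    have TT: "of_real lam * (\<Sum>j\<in>UNIV. T $ a $ j * cnj (T $ b $ j)) = matrix_inv (G c z0) $ a $ b" for a b
    proof -
      define L where "L = (\<chi> k j. of_real lam * G c z0 $ k $ j)"
      have "T ** (adjoint_mat T ** L) = mat 1" using T matrix_left_right_inverse unfolding L_def by blast
      then have "(\<chi> i j. of_real lam * (T ** adjoint_mat T) $ i $ j) ** G c z0 = mat 1"
        by (simp add: L_def vec_eq_iff matrix_matrix_mult_def sum_distrib_left sum_distrib_right mult_ac)
           (subst sum.swap, simp)
      then have "(\<chi> i j. of_real lam * (T ** adjoint_mat T) $ i $ j) ** G c z0 ** matrix_inv (G c z0) = matrix_inv (G c z0)" by simp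
      then have "(\<chi> i j. of_real lam * (T ** adjoint_mat T) $ i $ j) = matrix_inv (G c z0)"
        by (simp add: matrix_mul_assoc[symmetric] GI)
      from this[symmetric] show ?thesis by (simp add: matrix_matrix_mult_def adjoint_mat_def)
    qed
    have bT: "norm (T $ a $ j) \<le> t0 / sqrt lam" for a j
    proof -
      have e: "matrix_inv (G c z0) $ a $ a = of_real (lam * (\<Sum>j\<in>UNIV. (cmod (T $ a $ j))\<^sup>2))"
        unfolding TT[symmetric] complex_norm_square[symmetric] by simp
      have "lam * (\<Sum>j\<in>UNIV. (cmod (T $ a $ j))\<^sup>2) \<le> B"
        using GB(5)[OF z0, of a a] abs_ge_self[of "lam * (\<Sum>j\<in>UNIV. (cmod (T $ a $ j))\<^sup>2)"]
        unfolding e norm_of_real by linarith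
      moreover have "(cmod (T $ a $ j))\<^sup>2 \<le> (\<Sum>j\<in>UNIV. (cmod (T $ a $ j))\<^sup>2)" by (intro member_le_sum) auto
      ultimately have "lam * (cmod (T $ a $ j))\<^sup>2 \<le> B"
        using mult_left_mono[of "(cmod (T $ a $ j))\<^sup>2" "\<Sum>j\<in>UNIV. (cmod (T $ a $ j))\<^sup>2" lam] lam by linarith
      then have "(cmod (T $ a $ j))\<^sup>2 \<le> B / lam" using lam by (simp add: field_simps)
      also have "B / lam = (t0 / sqrt lam)\<^sup>2" using lam B0 by (simp add: t0_def power_divide)
      finally show ?thesis by (rule power2_le_imp_le) (use B0 lam in \<open>simp add: t0_def\<close>)
    qed
    define Qc where "Qc a j m = - (\<Sum>b\<in>UNIV. matrix_inv (G c z0) $ a $ b * (\<Sum>d\<in>UNIV. \<Sum>l\<in>UNIV. dz l (\<lambda>z. G c z $ b $ d) z0 * T $ l $ m * T $ d $ j))" for a j m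
    have sym: "Qc a j p = Qc a p j" for a j p
    proof -
      have "(\<Sum>d\<in>UNIV. \<Sum>l\<in>UNIV. dz l (\<lambda>z. G c z $ b $ d) z0 * T $ l $ p * T $ d $ j)
         = (\<Sum>d\<in>UNIV. \<Sum>l\<in>UNIV. dz l (\<lambda>z. G c z $ b $ d) z0 * T $ l $ j * T $ d $ p)" for b
        by (subst sum.swap, intro sum.cong refl) (simp add: G_closed[OF c z0c] mult_ac)
      then show ?thesis by (simp add: Qc_def)
    qed
    have Qeq: "(\<Sum>a\<in>UNIV. G c z0 $ b $ a * Qc a j m) = - (\<Sum>d\<in>UNIV. \<Sum>l\<in>UNIV. dz l (\<lambda>z. G c z $ b $ d) z0 * T $ l $ m * T $ d $ j)" for b j m
    proof -
      define y where "y = (\<chi> b. \<Sum>d\<in>UNIV. \<Sum>l\<in>UNIV. dz l (\<lambda>z. G c z $ b $ d) z0 * T $ l $ m * T $ d $ j)"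
      have "(\<Sum>a\<in>UNIV. G c z0 $ b $ a * Qc a j m) = - (G c z0 *v (matrix_inv (G c z0) *v y)) $ b"
        by (simp add: Qc_def matrix_vector_mult_def y_def sum_negf)
      also have "\<dots> = - y $ b" by (simp add: matrix_vector_mul_assoc GI)
      finally show ?thesis by (simp add: y_def)
    qed
    have bQ: "norm (Qc a j m) \<le> Bq * (t0 / sqrt lam)\<^sup>2" for a j m
    proof -
      have "norm (Qc a j m) \<le> n * (B * (n * (n * (B * (t0 / sqrt lam) * (t0 / sqrt lam)))))"
        unfolding Qc_def norm_minus_cancel n_def
        by (intro sum_le_bounds mult_le_bounds GB[OF z0] bT)
      then show ?thesis by (simp add: Bq_def power2_eq_square mult_ac)
    qed
    have "quad_metric z0 T Qc (crange c) (G c) lam B Bq t0"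
    proof unfold_locales
      show "0 \<le> t0" "0 \<le> B" "0 \<le> Bq" using B0 by (auto simp: t0_def Bq_def n_def)
    qed (use sym chart(2)[OF c] z0c G_smooth[OF c] dT lam Qeq bT bQ GB[OF z0] in auto)
    then show "\<exists>Qc. quad_metric z0 T Qc (crange c) (G c) lam B Bq t0" by blast
  qed
qed

end

section \<open>Smallness of $e^{-u}$\<close>

context kaehler_manifold
begin

lemma herm_form_upper:
  fixes H :: "complex^'n^'n"
  assumes "\<And>k j. cmod (H $ k $ j) \<le> b"
  shows "herm_form H v \<le> (real CARD('n))\<^sup>2 * b * (norm v)\<^sup>2"
proof -
  have "herm_form H v \<le> cmod (\<Sum>k\<in>UNIV. \<Sum>j\<in>UNIV. H $ k $ j * (v $ j) * cnj (v $ k))"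
    unfolding herm_form_def by (rule complex_Re_le_cmod)
  also have "\<dots> \<le> real CARD('n) * (real CARD('n) * (b * norm v * norm v))"
    by (intro sum_le_bounds mult_le_bounds assms) (simp_all add: Finite_Cartesian_Product.norm_nth_le)
  finally show ?thesis by (simp add: power2_eq_square mult_ac)
qed

text \<open>The squared differential of e^{-u/2} on a vector is e^{-u} times the squared real part
  of the pairing of the gradient with the vector. By \<open>covector_pairing_bound\<close> it is at
  most e^{-u}|Du|^2 times the metric, so the gradient hypothesis becomes a Lipschitz bound whose
  constant depends on the piece and not on u.\<close>

lemma local_lipschitz:
  assumes c: "c \<in> At" and K: "cball y r \<subseteq> crange c"
  shows "\<exists>L\<ge>0. \<forall>u \<delta>. smooth_fun At u \<and> \<delta> \<ge> 0 \<and>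
      (\<forall>z\<in>crange c. exp (- u (cinv c z)) * grad_sq G c u z \<le> \<delta>) \<longrightarrow>
      (\<forall>z\<in>ball y r. \<forall>z'\<in>ball y r.
         \<bar>exp (- u (cinv c z) / 2) - exp (- u (cinv c z') / 2)\<bar> \<le> L * sqrt \<delta> * norm (z - z'))"
proof -
  interpret open_domain "crange c" by (rule chart_domain[OF c])
  have "\<forall>p. \<exists>b. \<forall>z\<in>cball y r. cmod (G c z $ fst p $ snd p) \<le> b"
  proof
    fix p :: "'n \<times> 'n"
    show "\<exists>b. \<forall>z\<in>cball y r. cmod (G c z $ fst p $ snd p) \<le> b"
      using jets_bounded[OF compact_cball K G_smooth[OF c, of "fst p" "snd p"]] by blast
  qed
  then obtain b where b: "\<And>p z. z \<in> cball y r \<Longrightarrow> cmod (G c z $ fst p $ snd p) \<le> b p" by metis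
  define B where "B = (\<Sum>p\<in>UNIV. \<bar>b p\<bar>)"
  have B0: "B \<ge> 0" by (simp add: B_def sum_nonneg)
  have bB: "cmod (G c z $ k $ j) \<le> B" if "z \<in> cball y r" for z k j
    using b[OF that, of "(k, j)"] member_le_sum[of "(k, j)" UNIV "\<lambda>p. \<bar>b p\<bar>"] abs_ge_self[of "b (k, j)"]
    by (simp add: B_def)
  define M where "M = (real CARD('n))\<^sup>2 * B"
  have M0: "M \<ge> 0" using B0 by (simp add: M_def)
  show ?thesis
  proof (intro exI[of _ "sqrt M"] conjI allI impI ballI)
    show "0 \<le> sqrt M" using M0 by simp
    fix u :: "'a \<Rightarrow> real" and \<delta> z z'
    assume u: "smooth_fun At u \<and> \<delta> \<ge> 0 \<and> (\<forall>z\<in>crange c. exp (- u (cinv c z)) * grad_sq G c u z \<le> \<delta>)"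
      and zz: "z \<in> ball y r" "z' \<in> ball y r"
    define \<rho> where "\<rho> = u \<circ> cinv c"
    have smr: "smooth_on (crange c) \<rho>" using u c by (simp add: smooth_fun_def \<rho>_def)
    define D where "D z = frechet_derivative \<rho> (at z)" for z
    have dr: "(\<rho> has_derivative D z) (at z)" if "z \<in> crange c" for z
      unfolding D_def by (rule frechet_derivative_worksI, rule smooth_on_differentiable[OF smr that])
    have Fsm: "sm (loc c u)" using u c by (intro loc_smooth) auto
    have loc_eq: "loc c u = (\<lambda>z. complex_of_real (\<rho> z))" by (simp add: loc_def[abs_def] \<rho>_def)
    have bound: "\<bar>- exp (- \<rho> z / 2) * D z v / 2\<bar> \<le> sqrt M * sqrt \<delta> * norm v" if z: "z \<in> ball y r" for z v
    proof -
      have zK: "z \<in> cball y r" and zc: "z \<in> crange c" using z K by auto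
      define a where "a = (\<chi> j. dz j (loc c u) z)"
      have db: "dzbar j (loc c u) z = cnj (a $ j)" for j
        unfolding a_def vec_lambda_beta by (rule d_real[OF Fsm _ zc]) (simp add: loc_def)
      have "(loc c u has_derivative (\<lambda>v. complex_of_real (D z v))) (at z)"
        unfolding loc_eq by (rule has_derivative_of_real[OF dr[OF zc]])
      then have "complex_of_real (D z v) = frechet_derivative (loc c u) (at z) v"
        by (simp add: frechet_derivative_eqI)
      also have "\<dots> = (\<Sum>j\<in>UNIV. a $ j * v $ j) + cnj (\<Sum>j\<in>UNIV. a $ j * v $ j)"
        unfolding real_linear_wirtinger[OF smooth_on_differentiable[OF Fsm zc]] db
        by (simp add: a_def sum.distrib)
      finally have Dv: "D z v = 2 * Re (\<Sum>j\<in>UNIV. a $ j * v $ j)" by (simp add: complex_eq_iff)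
      have g: "grad_sq G c u z = Re (\<Sum>j\<in>UNIV. \<Sum>k\<in>UNIV. matrix_inv (G c z) $ j $ k * a $ j * cnj (a $ k))"
        unfolding grad_sq_def grad_pair_def ginv_def db by (simp add: a_def)
      have h: "herm_form (G c z) v \<le> M * (norm v)\<^sup>2" "0 \<le> herm_form (G c z) v"
      proof -
        show "herm_form (G c z) v \<le> M * (norm v)\<^sup>2" unfolding M_def by (rule herm_form_upper) (rule bB[OF zK])
        obtain m where "m > 0" "\<And>v. m * (norm v)\<^sup>2 \<le> herm_form (G c z) v"
          using positive_definite_lower[OF G_pos[OF c zc]] by blast
        then show "0 \<le> herm_form (G c z) v" by (meson mult_nonneg_nonneg less_imp_le order_trans zero_le_power2)
      qed
      have s: "(Re (\<Sum>j\<in>UNIV. a $ j * v $ j))\<^sup>2 \<le> grad_sq G c u z * herm_form (G c z) v"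
        unfolding g by (rule order_trans[OF _ covector_pairing_bound[OF G_pos[OF c zc]]])
          (metis abs_Re_le_cmod abs_ge_zero power2_abs power_mono)
      have "(- exp (- \<rho> z / 2) * D z v / 2)\<^sup>2 = exp (- \<rho> z) * (Re (\<Sum>j\<in>UNIV. a $ j * v $ j))\<^sup>2"
        unfolding Dv by (simp add: power_mult_distrib flip: exp_of_nat_mult)
      also have "\<dots> \<le> exp (- \<rho> z) * (grad_sq G c u z * herm_form (G c z) v)"
        by (rule mult_left_mono[OF s]) simp
      also have "\<dots> \<le> \<delta> * herm_form (G c z) v"
        using u zc mult_right_mono[OF _ h(2), of "exp (- \<rho> z) * grad_sq G c u z" \<delta>] by (simp add: \<rho>_def mult.assoc)
      also have "\<dots> \<le> \<delta> * (M * (norm v)\<^sup>2)" using u h(1) by (intro mult_left_mono) auto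
      also have "\<dots> = (sqrt M * sqrt \<delta> * norm v)\<^sup>2" using M0 u by (simp add: power_mult_distrib)
      finally have sq: "(- exp (- \<rho> z / 2) * D z v / 2)\<^sup>2 \<le> (sqrt M * sqrt \<delta> * norm v)\<^sup>2" .
      have "0 \<le> sqrt M * sqrt \<delta> * norm v" using M0 u by simp
      then show ?thesis using abs_le_square_iff[of "- exp (- \<rho> z / 2) * D z v / 2" "sqrt M * sqrt \<delta> * norm v"] sq by simp
    qed
    have "norm (exp (- \<rho> z / 2) - exp (- \<rho> z' / 2)) \<le> (sqrt M * sqrt \<delta>) * norm (z - z')"
    proof (rule differentiable_bound[OF convex_ball[of y r] _ _ zz])
      fix w assume w: "w \<in> ball y r"
      then have "w \<in> crange c" using K by auto
      from dr[OF this] show "((\<lambda>z. exp (- \<rho> z / 2)) has_derivative (\<lambda>v. - exp (- \<rho> w / 2) * D w v / 2)) (at w within ball y r)"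
      proof -
        assume d: "(\<rho> has_derivative D w) (at w)"
        have "((\<lambda>z. - \<rho> z / 2) has_derivative (\<lambda>v. - D w v / 2)) (at w)"
          by (rule bounded_linear.has_derivative[OF bounded_linear_divide has_derivative_minus[OF d]])
        from has_derivative_exp[OF this] have "((\<lambda>z. exp (- \<rho> z / 2)) has_derivative (\<lambda>v. - D w v / 2 * exp (- \<rho> w / 2))) (at w)"
          by simp
        then have "((\<lambda>z. exp (- \<rho> z / 2)) has_derivative (\<lambda>v. - exp (- \<rho> w / 2) * D w v / 2)) (at w)"
          by (simp add: mult.commute)
        then show ?thesis by (rule has_derivative_at_withinI)
      qed
      show "onorm (\<lambda>v. - exp (- \<rho> w / 2) * D w v / 2) \<le> sqrt M * sqrt \<delta>"
      proof (rule onorm_bound)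
        show "0 \<le> sqrt M * sqrt \<delta>" using M0 conjunct1[OF conjunct2[OF u]] by simp
        show "norm (- exp (- \<rho> w / 2) * D w v / 2) \<le> sqrt M * sqrt \<delta> * norm v" for v
          using bound[OF w, of v] by simp
      qed
    qed
    then show "\<bar>exp (- u (cinv c z) / 2) - exp (- u (cinv c z') / 2)\<bar> \<le> sqrt M * sqrt \<delta> * norm (z - z')"
      by (simp add: \<rho>_def)
  qed
qed

text \<open>The density has a positive minimum on the closed ball, so the volume of the piece is
  bounded below by a multiple of its Lebesgue measure.\<close>

lemma piece_volume:
  assumes c: "c \<in> At" and r: "r > 0" and K: "cball y r \<subseteq> crange c"
  shows "cinv c ` ball y r \<in> sets borel" "\<exists>v>0. ennreal v \<le> emeasure (volume At G) (cinv c ` ball y r)"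
proof -
  let ?E = "cinv c ` ball y r"
  have bc: "ball y r \<subseteq> crange c" using K ball_subset_cball by blast
  have sub: "?E \<subseteq> fst c" using bc cinv_simps(3)[OF c] by blast
  have img: "snd c ` ?E = ball y r" using bc cinv_simps(2)[OF c] by (force simp: image_image)
  have "?E = fst c \<inter> snd c -` ball y r"
  proof (rule set_eqI, rule iffI)
    fix x assume "x \<in> ?E"
    then obtain z where z: "z \<in> ball y r" "x = cinv c z" by blast
    then show "x \<in> fst c \<inter> snd c -` ball y r" using bc cinv_simps[OF c] by auto
  next
    fix x assume "x \<in> fst c \<inter> snd c -` ball y r"
    then show "x \<in> ?E" using cinv_simps(1)[OF c, of x] by (metis IntD1 IntD2 image_eqI vimageD)
  qed
  moreover have "open (fst c \<inter> snd c -` ball y r)"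
    using openin_open_trans[OF continuous_openin_preimage_gen[OF continuous_chart(1)[OF c] open_ball[of y r]] chart(1)[OF c]] .
  ultimately show Eb: "?E \<in> sets borel" by simp
  have "continuous_on (cball y r) (dens c)" using continuous_on_subset[OF continuous_dens[OF c] K] .
  then obtain z0 where z0: "z0 \<in> cball y r" "\<And>z. z \<in> cball y r \<Longrightarrow> dens c z0 \<le> dens c z"
    using continuous_attains_inf[OF compact_cball, of y r "dens c"] r by auto
  define d where "d = dens c z0"
  have d: "d > 0" unfolding d_def using dens_pos[OF c] z0(1) K by blast
  define m where "m = measure lborel (ball y r)"
  have m: "m > 0" unfolding m_def by (rule content_ball_pos[OF r])
  have em: "emeasure lborel (ball y r) = ennreal m" unfolding m_def
    by (rule emeasure_eq_ennreal_measure) (use emeasure_lborel_ball_finite[of y r] in simp)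
  have "ennreal (d * m) = (\<integral>\<^sup>+z. ennreal d * indicator (ball y r) z \<partial>lborel)"
    using d m em by (simp add: nn_integral_cmult_indicator ennreal_mult)
  also have "\<dots> \<le> (\<integral>\<^sup>+z\<in>ball y r. ennreal (dens c z) \<partial>lborel)"
    using z0(2) by (intro nn_integral_mono) (auto simp: indicator_def d_def intro!: ennreal_leI)
  also have "\<dots> = emeasure (volume At G) ?E"
    using volume_like_volume c Eb sub unfolding volume_like_def by (simp add: img dens_def)
  finally show "\<exists>v>0. ennreal v \<le> emeasure (volume At G) ?E" using d m by (intro exI[of _ "d * m"]) simp
qed

text \<open>A Chebyshev argument: if e^{-u} were at least \<eta> on all of \<open>E\<close>, the
  normalization integral would be at least \<open>\<eta> powr \<gamma> * v\<close>.\<close>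

lemma small_somewhere:
  assumes u: "continuous_on UNIV u" and \<gamma>: "\<gamma> > 0" and A: "A > 0"
    and int: "(\<integral>x. exp (- \<gamma> * u x) \<partial>volume At G) powr (1 / \<gamma>) = A"
    and E: "E \<in> sets borel" "ennreal v \<le> emeasure (volume At G) E" and v: "v > 0"
    and \<eta>: "\<eta> > 0" "A < \<eta> * v powr (1 / \<gamma>)"
  shows "\<exists>x\<in>E. exp (- u x) < \<eta>"
proof (rule ccontr)
  let ?V = "volume At G" and ?I = "\<integral>x. exp (- \<gamma> * u x) \<partial>volume At G"
  assume "\<not> ?thesis"
  then have ge: "\<And>x. x \<in> E \<Longrightarrow> \<eta> \<le> exp (- u x)" by (meson not_le)
  have sV: "sets ?V = sets borel" using volume_like_volume by (simp add: volume_like_def)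
  \<comment> \<open>The integral of a function that is not integrable has the default value zero; as
    \<open>A\<close> is positive, the normalization itself supplies integrability.\<close>
  have I0: "?I \<noteq> 0" using int A by auto
  then have integ: "integrable ?V (\<lambda>x. exp (- \<gamma> * u x))" using not_integrable_integral_eq by blast
  have Ige: "?I \<ge> 0" by (rule integral_nonneg_AE) simp
  have IA: "?I = A powr \<gamma>" unfolding int[symmetric] powr_powr using \<gamma> Ige I0 by simp
  have "ennreal (\<eta> powr \<gamma> * v) = ennreal (\<eta> powr \<gamma>) * ennreal v" using v by (simp add: ennreal_mult)
  also have "\<dots> \<le> ennreal (\<eta> powr \<gamma>) * emeasure ?V E" by (intro mult_left_mono E) simp
  also have "\<dots> = (\<integral>\<^sup>+x. ennreal (\<eta> powr \<gamma>) * indicator E x \<partial>?V)"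
    using E sV by (simp add: nn_integral_cmult_indicator)
  also have "\<dots> \<le> (\<integral>\<^sup>+x. ennreal (exp (- \<gamma> * u x)) \<partial>?V)"
  proof (rule nn_integral_mono)
    fix x
    have "\<eta> powr \<gamma> \<le> exp (- \<gamma> * u x)" if "x \<in> E"
    proof -
      have "\<eta> powr \<gamma> \<le> exp (- u x) powr \<gamma>" using ge[OF that] \<eta> \<gamma> by (intro powr_mono2) auto
      then show ?thesis by (simp add: powr_def mult.commute)
    qed
    then show "ennreal (\<eta> powr \<gamma>) * indicator E x \<le> ennreal (exp (- \<gamma> * u x))"
      by (auto simp: indicator_def intro: ennreal_leI)
  qed
  also have "\<dots> = ennreal (A powr \<gamma>)" using nn_integral_eq_integral[OF integ] IA by simp
  finally have "\<eta> powr \<gamma> * v \<le> A powr \<gamma>" by simp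
  moreover have "A powr \<gamma> < (\<eta> * v powr (1 / \<gamma>)) powr \<gamma>" using \<eta> A \<gamma> by (intro powr_less_mono2) auto
  moreover have "(\<eta> * v powr (1 / \<gamma>)) powr \<gamma> = \<eta> powr \<gamma> * v" using \<eta> v \<gamma> by (simp add: powr_mult powr_powr)
  ultimately show False by simp
qed

text \<open>On each piece the normalization provides one point at which e^{-u/2} is at most half of
  the square root of \<epsilon>, and the Lipschitz bound lets it vary by at most the other half over
  the piece. No passage from one piece to another is involved.\<close>

lemma uniform_smallness:
  fixes Sol :: "real \<Rightarrow> ('a \<Rightarrow> real) \<Rightarrow> bool"
  assumes \<gamma>: "\<gamma> > 0"
    and Sol: "\<And>A u. Sol A u \<Longrightarrow> smooth_fun At u"
      "\<And>A u. Sol A u \<Longrightarrow> (\<integral>x. exp (- \<gamma> * u x) \<partial>volume At G) powr (1 / \<gamma>) = A"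
    and H: "\<And>\<delta>. 0 < \<delta> \<Longrightarrow> \<delta> < 1 \<Longrightarrow> \<exists>A\<^sub>\<delta>. 0 < A\<^sub>\<delta> \<and> A\<^sub>\<delta> < 1 \<and> (\<forall>A u. 0 < A \<and> A \<le> A\<^sub>\<delta> \<and> Sol A u \<longrightarrow>
      (\<forall>c\<in>At. \<forall>z\<in>crange c. exp (- u (cinv c z)) * grad_sq G c u z \<le> \<delta>))"
    and \<epsilon>: "\<epsilon> > 0"
  shows "\<exists>A0>0. \<forall>A u. 0 < A \<and> A \<le> A0 \<and> Sol A u \<longrightarrow> (\<forall>x. exp (- u x) \<le> \<epsilon>)"
proof -
  obtain D where D0: "finite D \<and> (\<forall>(c, y, r)\<in>D. c \<in> At \<and> r > 0 \<and> cball y r \<subseteq> crange c) \<and>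
     (\<forall>x. \<exists>(c, y, r)\<in>D. \<exists>z\<in>ball y r. cinv c z = x)" using finite_pieces ..
  have Df: "finite D" using D0 by simp
  have D: "c \<in> At \<and> r > 0 \<and> cball y r \<subseteq> crange c" if "(c, y, r) \<in> D" for c y r
    using D0 that by blast
  have D3: "\<exists>(c, y, r)\<in>D. \<exists>z\<in>ball y r. cinv c z = x" for x using D0 by blast
  have piece: "\<exists>A0>0. \<forall>A u. 0 < A \<and> A \<le> A0 \<and> Sol A u \<longrightarrow> (\<forall>z\<in>ball y r. exp (- u (cinv c z)) \<le> \<epsilon>)"
    if "(c, y, r) \<in> D" for c y r
  proof -
    have c: "c \<in> At" "r > 0" "cball y r \<subseteq> crange c" using D[OF that] by auto
    obtain L where L: "L \<ge> 0" "\<And>u \<delta> z z'. smooth_fun At u \<Longrightarrow> \<delta> \<ge> 0 \<Longrightarrow>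
      (\<And>z. z\<in>crange c \<Longrightarrow> exp (- u (cinv c z)) * grad_sq G c u z \<le> \<delta>) \<Longrightarrow> z\<in>ball y r \<Longrightarrow> z'\<in>ball y r \<Longrightarrow>
         \<bar>exp (- u (cinv c z) / 2) - exp (- u (cinv c z') / 2)\<bar> \<le> L * sqrt \<delta> * norm (z - z')"
      using local_lipschitz[OF c(1,3)] by blast
    obtain v where v: "v > 0" "ennreal v \<le> emeasure (volume At G) (cinv c ` ball y r)" using piece_volume(2)[OF c] by blast
    \<comment> \<open>The largest admissible square root of \<delta>: over the diameter
      \<open>2 * r\<close> it allows a variation of half of \<open>sqrt \<epsilon>\<close>. The
      \<open>+ 1\<close> guards against a vanishing Lipschitz constant.\<close>
    define q where "q = sqrt \<epsilon> / 2 / (L * (2 * r) + 1)"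
    have den: "L * (2 * r) + 1 > 0" using L(1) c(2) by (simp add: add_nonneg_pos)
    have q0: "q > 0" using \<epsilon> den by (simp add: q_def)
    define \<delta> where "\<delta> = min (1/2) (q\<^sup>2)"
    have \<delta>: "0 < \<delta>" "\<delta> < 1" using q0 by (auto simp: \<delta>_def)
    have sd: "sqrt \<delta> \<le> q" using q0 by (intro real_le_lsqrt) (auto simp: \<delta>_def)
    have Lq: "L * sqrt \<delta> * (2 * r) \<le> sqrt \<epsilon> / 2"
    proof -
      have "L * sqrt \<delta> * (2 * r) \<le> (L * (2 * r) + 1) * q"
        using mult_left_mono[OF sd, of "L * (2 * r)"] L(1) c(2) q0 by (simp add: algebra_simps)
      also have "\<dots> = sqrt \<epsilon> / 2" unfolding q_def using den by (metis less_irrefl nonzero_mult_div_cancel_left times_divide_eq_right)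
      finally show ?thesis .
    qed
    obtain A1 where A1: "0 < A1" "\<And>A u z. 0 < A \<Longrightarrow> A \<le> A1 \<Longrightarrow> Sol A u \<Longrightarrow> z \<in> crange c \<Longrightarrow>
        exp (- u (cinv c z)) * grad_sq G c u z \<le> \<delta>"
      using H[OF \<delta>] c(1) by blast
    define A2 where "A2 = \<epsilon> / 4 * v powr (1 / \<gamma>) / 2"
    have A2: "A2 > 0" using \<epsilon> v by (simp add: A2_def)
    show ?thesis
    proof (intro exI[of _ "min A1 A2"] conjI allI impI ballI)
      show "0 < min A1 A2" using A1 A2 by simp
      fix A u z assume "0 < A \<and> A \<le> min A1 A2 \<and> Sol A u" and z: "z \<in> ball y r"
      then have A: "0 < A" "A \<le> A1" "A \<le> A2" and S: "Sol A u" by auto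
      have "\<exists>x\<in>cinv c ` ball y r. exp (- u x) < \<epsilon> / 4"
      proof (rule small_somewhere[OF smooth_fun_continuous[OF Sol(1)[OF S]] \<gamma> A(1) Sol(2)[OF S] piece_volume(1)[OF c] v(2,1)])
        show "0 < \<epsilon> / 4" using \<epsilon> by simp
        show "A < \<epsilon> / 4 * v powr (1 / \<gamma>)" using A(1,3) by (simp add: A2_def)
      qed
      then obtain z' where z': "z' \<in> ball y r" "exp (- u (cinv c z')) < \<epsilon> / 4" by blast
      have "(exp (- u (cinv c z') / 2))\<^sup>2 = exp (- u (cinv c z'))" by (simp flip: exp_of_nat_mult)
      also have "\<dots> \<le> (sqrt \<epsilon> / 2)\<^sup>2" using z'(2) \<epsilon> by (simp add: power_divide)
      finally have e1: "exp (- u (cinv c z') / 2) \<le> sqrt \<epsilon> / 2" by (rule power2_le_imp_le) (use \<epsilon> in simp)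
      have nz: "norm (z - z') \<le> 2 * r" using z z'(1) norm_triangle_ineq4[of "z - y" "z' - y"]
        by (simp add: dist_norm norm_minus_commute)
      have "\<bar>exp (- u (cinv c z) / 2) - exp (- u (cinv c z') / 2)\<bar> \<le> L * sqrt \<delta> * norm (z - z')"
        by (rule L(2)[OF Sol(1)[OF S] _ A1(2)[OF A(1,2) S] z z'(1)]) (use \<delta> in auto)
      also have "\<dots> \<le> L * sqrt \<delta> * (2 * r)" using nz L(1) \<delta> by (intro mult_left_mono) auto
      finally have "exp (- u (cinv c z) / 2) \<le> sqrt \<epsilon>" using e1 Lq by linarith
      then have "(exp (- u (cinv c z) / 2))\<^sup>2 \<le> (sqrt \<epsilon>)\<^sup>2" by (rule power_mono) simp
      then show "exp (- u (cinv c z)) \<le> \<epsilon>" using \<epsilon> by (simp flip: exp_of_nat_mult)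
    qed
  qed
  have "\<forall>d\<in>D. \<exists>A0>0. \<forall>A u. 0 < A \<and> A \<le> A0 \<and> Sol A u \<longrightarrow>
     (\<forall>z\<in>ball (fst (snd d)) (snd (snd d)). exp (- u (cinv (fst d) z)) \<le> \<epsilon>)"
    using piece by auto
  then obtain A0 where A0: "\<And>d. d \<in> D \<Longrightarrow> A0 d > 0" "\<And>d A u z. d \<in> D \<Longrightarrow> 0 < A \<Longrightarrow> A \<le> A0 d \<Longrightarrow> Sol A u \<Longrightarrow>
     z\<in>ball (fst (snd d)) (snd (snd d)) \<Longrightarrow> exp (- u (cinv (fst d) z)) \<le> \<epsilon>"
    unfolding bchoice_iff by blast
  show ?thesis
  proof (intro exI[of _ "Min (insert 1 (A0 ` D))"] conjI allI impI)
    show "0 < Min (insert 1 (A0 ` D))" using Df A0(1) by auto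
    fix A u x assume as: "0 < A \<and> A \<le> Min (insert 1 (A0 ` D)) \<and> Sol A u"
    obtain c y r z where d: "(c, y, r) \<in> D" "z \<in> ball y r" "cinv c z = x" using D3[of x] by auto
    have "A \<le> A0 (c, y, r)" using as Df d(1) by (meson Min_le finite_imageI finite_insert image_eqI insertCI order_trans)
    then show "exp (- u x) \<le> \<epsilon>" using A0(2)[OF d(1), of A u z] as d by simp
  qed
qed

end

section \<open>The forms $g'$ and $\tilde g$ on the manifold\<close>

context kaehler_manifold
begin

text \<open>The trace of $g'$ with respect to the metric, written through the Laplacian and
  therefore a function on the manifold.\<close>

definition traceX :: "real \<Rightarrow> ('a \<Rightarrow> real) \<Rightarrow> ('a \<Rightarrow> real) \<Rightarrow> 'a \<Rightarrow> real" where
  "traceX \<alpha> f u x = real CARD('n) * (exp (u x) + f x * exp (- u x)) + 2 * real CARD('n) * \<alpha> * lapX u x"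

lemma loc_real: "cnj (loc c u z) = loc c u z"
  by (simp add: loc_def)

lemma dzbar_loc: "smooth_fun At u \<Longrightarrow> c \<in> At \<Longrightarrow> z \<in> crange c \<Longrightarrow> dzbar j (loc c u) z = cnj (dz j (loc c u) z)"
  by (rule open_domain.d_real[OF chart_domain loc_smooth]) (auto simp: loc_real)

lemma hermitian_hess:
  assumes u: "smooth_fun At u" and c: "c \<in> At" and z: "z \<in> crange c"
  shows "hermitian (hess c u z)"
proof -
  interpret open_domain "crange c" by (rule chart_domain[OF c])
  have sm: "sm (loc c u)" by (rule loc_smooth[OF u c])
  have "cnj (dzbar j (dz k (loc c u)) z) = dzbar k (dz j (loc c u)) z" for j k
  proof -
    have "cnj (dzbar j (dz k (loc c u)) z) = dz j (\<lambda>w. cnj (dz k (loc c u) w)) z" using sm z by (simp add: d_cnj)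
    also have "\<dots> = dz j (dzbar k (loc c u)) z"
      by (rule dz_cong[OF z]) (simp add: dzbar_loc[OF u c])
    finally show ?thesis using sm z by (simp add: d_commute)
  qed
  then show ?thesis by (simp add: hermitian_def hess_def)
qed

lemma g_prime_nth: "g_prime G \<alpha> f u c z $ k $ j
   = complex_of_real (exp (u (cinv c z)) + f (cinv c z) * exp (- u (cinv c z))) * G c z $ k $ j
     + complex_of_real (2 * real CARD('n) * \<alpha>) * hess c u z $ k $ j"
  by (simp add: g_prime_def Let_def)

lemma hermitian_g_prime:
  assumes u: "smooth_fun At u" and c: "c \<in> At" and z: "z \<in> crange c"
  shows "hermitian (g_prime G \<alpha> f u c z)"
proof -
  have "hermitian (G c z)" using G_pos[OF c z] by (simp add: positive_definite_def)
  with hermitian_hess[OF u c z] show ?thesis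
    unfolding hermitian_def g_prime_nth by (metis complex_cnj_add complex_cnj_mult complex_cnj_complex_of_real)
qed

lemma trace_g_prime:
  assumes u: "smooth_fun At u" and c: "c \<in> At" and z: "z \<in> crange c"
  shows "trace (matrix_inv (G c z) ** g_prime G \<alpha> f u c z) = of_real (traceX \<alpha> f u (cinv c z))"
proof -
  let ?H = "g_prime G \<alpha> f u c z" and ?I = "matrix_inv (G c z)"
  let ?E = "exp (u (cinv c z)) + f (cinv c z) * exp (- u (cinv c z))"
  obtain P d where D: "diagonalizes P (G c z) ?H d"
    using simultaneous_diagonalization[OF G_pos[OF c z] hermitian_g_prime[OF u c z]] by blast
  have "trace (?I ** ?H) = of_real ?E * trace (?I ** G c z) + of_real (2 * real CARD('n) * \<alpha>) * trace (?I ** levi (loc c u) z)"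
    unfolding trace_def matrix_matrix_mult_def vec_lambda_beta g_prime_nth hess_levi
    by (simp add: distrib_left sum.distrib sum_distrib_left mult_ac)
  moreover have "trace (?I ** G c z) = of_real (real CARD('n))"
    using matrix_inv_works(2)[OF positive_definite_facts(1)[OF G_pos[OF c z]]] by (simp add: trace_I)
  ultimately have "Re (trace (?I ** ?H)) = traceX \<alpha> f u (cinv c z)"
    using laplacian_trace[OF u c z] globalX(1)[OF u c z] by (simp add: traceX_def)
  then show ?thesis using diagonalizes_trace(1)[OF D] by simp
qed

lemma g_tilde_nth:
  assumes u: "smooth_fun At u" and c: "c \<in> At" and z: "z \<in> crange c"
  shows "g_tilde G \<alpha> f u c z $ k $ j
    = of_real (traceX \<alpha> f u (cinv c z)) * G c z $ k $ j - g_prime G \<alpha> f u c z $ k $ j"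
  unfolding g_prime_nth
  by (simp add: g_tilde_def Let_def traceX_def globalX(1)[OF u c z] algebra_simps)

lemma grad_pair_frame:
  assumes u: "smooth_fun At u" and c: "c \<in> At" and z: "z \<in> crange c" and D: "diagonalizes P (G c z) H d"
  shows "grad_pair G c f u z = (\<Sum>m\<in>UNIV. (\<Sum>j\<in>UNIV. P $ j $ m * dz j (loc c f) z) * cnj (\<Sum>j\<in>UNIV. P $ j $ m * dz j (loc c u) z))"
proof -
  have "grad_pair G c f u z = (\<Sum>j\<in>UNIV. \<Sum>k\<in>UNIV. \<Sum>m\<in>UNIV.
      P $ j $ m * dz j (loc c f) z * cnj (P $ k $ m * dz k (loc c u) z))"
    unfolding grad_pair_def ginv_def diagonalizes_inverse(3)[OF D] dzbar_loc[OF u c z]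
    by (simp add: matrix_matrix_mult_def adjoint_mat_def sum_distrib_left sum_distrib_right mult_ac)
  also have "\<dots> = (\<Sum>j\<in>UNIV. \<Sum>m\<in>UNIV. \<Sum>k\<in>UNIV.
      P $ j $ m * dz j (loc c f) z * cnj (P $ k $ m * dz k (loc c u) z))"
    by (intro sum.cong refl sum.swap)
  also have "\<dots> = (\<Sum>m\<in>UNIV. \<Sum>j\<in>UNIV. \<Sum>k\<in>UNIV.
      P $ j $ m * dz j (loc c f) z * cnj (P $ k $ m * dz k (loc c u) z))"
    by (rule sum.swap)
  finally show ?thesis by (simp add: cnj_sum sum_product)
qed

lemma grad_bounds:
  assumes u: "smooth_fun At u" and f: "smooth_fun At f" and c: "c \<in> At" and z: "z \<in> crange c"
  shows "grad_sq G c u z \<ge> 0" "cnj (grad_pair G c u u z) = grad_pair G c u u z"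
    "2 * Re (grad_pair G c f u z) \<le> grad_sq G c f z + grad_sq G c u z"
proof -
  have "hermitian (G c z)" using G_pos[OF c z] by (simp add: positive_definite_def)
  then obtain P d where D: "diagonalizes P (G c z) (G c z) d"
    using simultaneous_diagonalization[OF G_pos[OF c z]] by blast
  define X where "X u m = (\<Sum>j\<in>UNIV. P $ j $ m * dz j (loc c u) z)" for u m
  have gp: "grad_pair G c f u z = (\<Sum>m\<in>UNIV. X f m * cnj (X u m))" if "smooth_fun At u" for f u
    using grad_pair_frame[OF that c z D] by (simp add: X_def)
  have gs: "grad_pair G c u u z = of_real (\<Sum>m\<in>UNIV. (cmod (X u m))\<^sup>2)" if "smooth_fun At u" for u
    unfolding gp[OF that] of_real_sum complex_norm_square ..
  show "grad_sq G c u z \<ge> 0" "cnj (grad_pair G c u u z) = grad_pair G c u u z"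
    unfolding grad_sq_def gs[OF u] by (simp_all add: sum_nonneg)
  have "2 * Re (X f m * cnj (X u m)) \<le> (cmod (X f m))\<^sup>2 + (cmod (X u m))\<^sup>2" for m
    using zero_le_power2[of "Re (X f m) - Re (X u m)"] zero_le_power2[of "Im (X f m) - Im (X u m)"]
    unfolding cmod_power2 unfolding power2_eq_square by (simp add: algebra_simps)
  then have "(\<Sum>m\<in>UNIV. 2 * Re (X f m * cnj (X u m))) \<le> (\<Sum>m\<in>UNIV. (cmod (X f m))\<^sup>2 + (cmod (X u m))\<^sup>2)"
    by (intro sum_mono)
  then show "2 * Re (grad_pair G c f u z) \<le> grad_sq G c f z + grad_sq G c u z"
    unfolding grad_sq_def gs[OF u] gs[OF f] unfolding gp[OF u] Re_sum Re_complex_of_real sum_distrib_left sum.distrib .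
qed

text \<open>The eigenvalue $\tau_m = S - \lambda'_m$ of the form $\tilde g$ satisfies
  $2\sigma_2 \le S^2 - \lambda_m'^2 = \tau_m (2S - \tau_m)$.\<close>

lemma tilde_frame:
  assumes u: "smooth_fun At u" and c: "c \<in> At" and z: "z \<in> crange c"
    and D: "diagonalizes P (G c z) (g_prime G \<alpha> f u c z) d"
    and pos: "positive_definite (g_tilde G \<alpha> f u c z)"
  shows "(\<Sum>j\<in>UNIV. d j) = traceX \<alpha> f u (cinv c z)"
    "herm_form (G c z) (P *v v) = (\<Sum>j\<in>UNIV. (cmod (v $ j))\<^sup>2)"
    "herm_form (g_tilde G \<alpha> f u c z) (P *v v) = (\<Sum>j\<in>UNIV. (traceX \<alpha> f u (cinv c z) - d j) * (cmod (v $ j))\<^sup>2)"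
    "traceX \<alpha> f u (cinv c z) - d j > 0"
proof -
  let ?S = "traceX \<alpha> f u (cinv c z)"
  have "complex_of_real (\<Sum>j\<in>UNIV. d j) = of_real ?S"
    using diagonalizes_trace(1)[OF D] trace_g_prime[OF u c z, of \<alpha> f] by simp
  then show s: "(\<Sum>j\<in>UNIV. d j) = ?S" by (simp only: of_real_eq_iff)
  have sq: "Re (a * cnj a) = (cmod a)\<^sup>2" for a by (simp add: complex_norm_square[symmetric])
  have id: "herm_form (mat 1) v = (\<Sum>j\<in>UNIV. (cmod (v $ j))\<^sup>2)" for v :: "complex^'n"
    unfolding herm_form_def mat_def vec_lambda_beta cmod_power2 unfolding power2_eq_square
    by (simp add: if_distrib[of "\<lambda>x. x * _"] sum.delta cong: if_cong)
  have dg: "herm_form (diag_mat d) v = (\<Sum>j\<in>UNIV. d j * (cmod (v $ j))\<^sup>2)" for v :: "complex^'n"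
    unfolding herm_form_def diag_mat_def vec_lambda_beta cmod_power2 unfolding power2_eq_square
    by (simp add: if_distrib[of "\<lambda>x. x * _"] sum.delta cong: if_cong) (simp add: algebra_simps)
  show G1: "herm_form (G c z) (P *v v) = (\<Sum>j\<in>UNIV. (cmod (v $ j))\<^sup>2)" for v
    unfolding herm_form_mult_vec using D id by (simp add: diagonalizes_def)
  have H1: "herm_form (g_prime G \<alpha> f u c z) (P *v v) = (\<Sum>j\<in>UNIV. d j * (cmod (v $ j))\<^sup>2)" for v
    unfolding herm_form_mult_vec using D dg by (simp add: diagonalizes_def)
  have tt: "herm_form (g_tilde G \<alpha> f u c z) v = ?S * herm_form (G c z) v - herm_form (g_prime G \<alpha> f u c z) v" for v
  proof -
    have "(\<Sum>k\<in>UNIV. \<Sum>j\<in>UNIV. g_tilde G \<alpha> f u c z $ k $ j * (v $ j) * cnj (v $ k))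
       = of_real ?S * (\<Sum>k\<in>UNIV. \<Sum>j\<in>UNIV. G c z $ k $ j * (v $ j) * cnj (v $ k))
         - (\<Sum>k\<in>UNIV. \<Sum>j\<in>UNIV. g_prime G \<alpha> f u c z $ k $ j * (v $ j) * cnj (v $ k))"
      unfolding g_tilde_nth[OF u c z]
      by (simp add: left_diff_distrib right_diff_distrib sum_subtractf sum_distrib_left mult_ac)
    then show ?thesis unfolding herm_form_def by simp
  qed
  show T1: "herm_form (g_tilde G \<alpha> f u c z) (P *v v) = (\<Sum>j\<in>UNIV. (?S - d j) * (cmod (v $ j))\<^sup>2)" for v
    unfolding tt G1 H1 by (simp add: left_diff_distrib sum_subtractf sum_distrib_left)
  have "P *v axis j 1 \<noteq> 0"
    using diagonalizes_inverse(1)[OF D] matrix_left_invertible_ker[of P] invertible_left_inverse[of P] axis_eq_0_iff[of j "1::complex"]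
    by (metis zero_neq_one)
  then have "herm_form (g_tilde G \<alpha> f u c z) (P *v axis j 1) > 0" using pos by (simp add: positive_definite_def)
  moreover have "(\<Sum>i\<in>UNIV. (?S - d i) * (cmod (axis j 1 $ i))\<^sup>2) = ?S - d j"
    by (simp add: axis_def if_distrib[of cmod] if_distrib[of "\<lambda>x. x\<^sup>2"] if_distrib[of "\<lambda>x. _ * x"] sum.delta cong: if_cong)
  ultimately show "?S - d j > 0" unfolding T1 by simp
qed

lemma tilde_bounds:
  assumes u: "smooth_fun At u" and c: "c \<in> At" and z: "z \<in> crange c"
    and eq: "sigma2 (G c z) (g_prime G \<alpha> f u c z) = \<psi>" and psi: "\<psi> > 0"
    and pos: "positive_definite (g_tilde G \<alpha> f u c z)"
    and S1: "traceX \<alpha> f u (cinv c z) \<le> S1"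
  shows "\<psi> / S1 * herm_form (G c z) v \<le> herm_form (g_tilde G \<alpha> f u c z) v"
    "herm_form (g_tilde G \<alpha> f u c z) v \<le> real CARD('n) * S1 * herm_form (G c z) v"
proof -
  let ?S = "traceX \<alpha> f u (cinv c z)"
  obtain P d where D: "diagonalizes P (G c z) (g_prime G \<alpha> f u c z) d"
    using simultaneous_diagonalization[OF G_pos[OF c z] hermitian_g_prime[OF u c z]] by blast
  note fr = tilde_frame[OF u c z D pos]
  have psi2: "2 * \<psi> = ?S\<^sup>2 - (\<Sum>j\<in>UNIV. (d j)\<^sup>2)" using sigma2_diagonalizes[OF D] eq fr(1) by simp
  have lower: "2 * \<psi> \<le> (?S - d j) * (?S + d j)" for j
  proof -
    have "(d j)\<^sup>2 \<le> (\<Sum>j\<in>UNIV. (d j)\<^sup>2)" by (rule member_le_sum) auto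
    then show ?thesis using psi2 by (simp add: power2_eq_square algebra_simps)
  qed
  have Spos: "?S > 0"
  proof -
    \<comment> \<open>Any index will do: S - d_j and the product (S - d_j)(S + d_j) are positive,
      hence so is S + d_j, and with it S.\<close>
    obtain j :: 'n where True by blast
    have "0 < (?S - d j) * (?S + d j)" using lower[of j] psi by linarith
    then have "?S + d j > 0" using fr(4)[of j] by (simp add: zero_less_mult_iff)
    then show ?thesis using fr(4)[of j] by linarith
  qed
  have t1: "\<psi> / S1 \<le> ?S - d j" for j
  proof -
    have "2 * \<psi> \<le> (?S - d j) * (2 * S1)"
      using lower[of j] mult_left_mono[of "?S + d j" "2 * S1" "?S - d j"] fr(4)[of j] S1 by linarith
    then show ?thesis using Spos S1 by (simp add: field_simps)
  qed
  have t2: "?S - d j \<le> real CARD('n) * S1" for j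
  proof -
    have "?S - d j \<le> (\<Sum>j\<in>UNIV. ?S - d j)" using fr(4) by (intro member_le_sum) (auto intro: less_imp_le)
    also have "\<dots> \<le> real CARD('n) * ?S" using fr(1) Spos by (simp add: sum_subtractf)
    also have "\<dots> \<le> real CARD('n) * S1" using S1 by (intro mult_left_mono) auto
    finally show ?thesis .
  qed
  obtain y where v: "v = P *v y"
    using diagonalizes_inverse(1)[OF D] matrix_inv_works(1)[of P] by (metis matrix_vector_mul_assoc matrix_vector_mul_lid)
  show "\<psi> / S1 * herm_form (G c z) v \<le> herm_form (g_tilde G \<alpha> f u c z) v"
    unfolding v fr sum_distrib_left by (intro sum_mono mult_right_mono t1) auto
  show "herm_form (g_tilde G \<alpha> f u c z) v \<le> real CARD('n) * S1 * herm_form (G c z) v"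
    unfolding v fr sum_distrib_left by (intro sum_mono mult_right_mono t2) auto
qed

text \<open>The leading term keeps half of e^{2u} because e^{-u}|Du|^2 is small, and the terms in f
  without derivatives are nonnegative. The rest is bounded by a constant, which is at most a quarter
  of e^{2u} once e^{-u} is small.\<close>

lemma rhs_lower:
  assumes u: "smooth_fun At u" and f: "smooth_fun At f" and c: "c \<in> At" and z: "z \<in> crange c"
    and n: "CARD('n) \<ge> 2" and \<alpha>: "\<alpha> > 0" and f0: "f (cinv c z) \<ge> 0"
    and M: "\<bar>\<mu> (cinv c z)\<bar> \<le> M" "\<bar>lapX f (cinv c z)\<bar> \<le> M" "gradX f (cinv c z) \<le> M"
    and small: "exp (- u (cinv c z)) \<le> 1" "exp (- u (cinv c z)) * gradX u (cinv c z) \<le> 1"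
      "4 * \<alpha> * (exp (- u (cinv c z)) * gradX u (cinv c z)) \<le> 1 / 2"
      "exp (- u (cinv c z)) * (2 * real CARD('n) * \<alpha> * (M + real CARD('n) * (2 * M + 1))) \<le> 1 / 4"
  shows "exp (2 * u (cinv c z)) / 4 \<le> equation_rhs G \<alpha> f \<mu> u c z"
proof -
  define x where "x = cinv c z"
  define n where "n = real CARD('n)"
  define e where "e = exp (- u x)"
  define k where "k = 2 * n * \<alpha>"
  have n2: "n \<ge> 2" using n by (simp add: n_def)
  have e: "0 < e" "e \<le> 1" using small by (auto simp: e_def x_def)
  have k0: "k > 0" using n2 \<alpha> by (simp add: k_def)
  have g: "gradX u x \<ge> 0" "gradX f x \<ge> 0" "2 * Re (grad_pair G c f u z) \<le> gradX f x + gradX u x"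
    using grad_bounds[OF u f c z] grad_bounds(1)[OF f f c z] globalX(2)[OF u c z] globalX(2)[OF f c z] by (simp_all add: x_def)
  have M0: "M \<ge> 0" using M(1) by linarith
  have Rb: "e * (lapX f x - 2 * Re (grad_pair G c f u z)) \<ge> - (2 * M + 1)"
  proof -
    have "lapX f x - 2 * Re (grad_pair G c f u z) \<ge> - (2 * M) - gradX u x"
      using g M by (simp add: x_def)
    then have "e * (lapX f x - 2 * Re (grad_pair G c f u z)) \<ge> e * (- (2 * M) - gradX u x)"
      using e by (intro mult_left_mono) auto
    moreover have "e * (2 * M) \<le> 2 * M" using e M0 by (intro mult_left_le_one_le) auto
    moreover have "e * gradX u x \<le> 1" using small(2) by (simp add: e_def x_def)
    ultimately show ?thesis by (simp add: algebra_simps)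
  qed
  have rhs: "equation_rhs G \<alpha> f \<mu> u c z = n * (n - 1) / 2 * exp (2 * u x) * (1 - 4 * \<alpha> * (e * gradX u x))
     + (2 * \<alpha> * n * (n - 1) * f x * (e * gradX u x) + n * (n - 1) * f x + n * (n - 1) / 2 * exp (- 2 * u x) * (f x)\<^sup>2)
     - k * \<mu> x + k * (n - 1) * (e * (lapX f x - 2 * Re (grad_pair G c f u z)))"
    unfolding equation_rhs_def Let_def x_def[symmetric] n_def[symmetric] globalX(1)[OF f c z, folded x_def]
      globalX(2)[OF u c z, folded x_def] by (simp add: e_def k_def mult_ac)
  have eu: "exp (2 * u x) * (e * e) = 1" by (simp add: e_def flip: exp_add)
  have nn: "n * (n - 1) \<ge> 2 * 1" using n2 by (intro mult_mono) auto
  have t1: "n * (n - 1) / 2 * exp (2 * u x) * (1 - 4 * \<alpha> * (e * gradX u x)) \<ge> exp (2 * u x) / 2"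
  proof -
    have "n * (n - 1) / 2 * exp (2 * u x) \<ge> 1 * exp (2 * u x)" using nn by (intro mult_right_mono) auto
    moreover have "1 - 4 * \<alpha> * (e * gradX u x) \<ge> 1 / 2" using small(3) by (simp add: e_def x_def)
    ultimately have "n * (n - 1) / 2 * exp (2 * u x) * (1 - 4 * \<alpha> * (e * gradX u x)) \<ge> (1 * exp (2 * u x)) * (1 / 2)"
      using nn by (intro mult_mono) auto
    then show ?thesis by simp
  qed
  have t2: "2 * \<alpha> * n * (n - 1) * f x * (e * gradX u x) + n * (n - 1) * f x + n * (n - 1) / 2 * exp (- 2 * u x) * (f x)\<^sup>2 \<ge> 0"
    using n2 \<alpha> f0 e g by (intro add_nonneg_nonneg mult_nonneg_nonneg) (auto simp: x_def)
  have t3: "k * \<mu> x \<le> k * M" using M(1) k0 by (intro mult_left_mono) (auto simp: x_def)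
  have t4: "k * (n - 1) * (e * (lapX f x - 2 * Re (grad_pair G c f u z))) \<ge> - (k * n * (2 * M + 1))"
  proof -
    have "k * (n - 1) * (e * (lapX f x - 2 * Re (grad_pair G c f u z))) \<ge> k * (n - 1) * (- (2 * M + 1))"
      using Rb k0 n2 by (intro mult_left_mono) auto
    moreover have "k * (n - 1) * (2 * M + 1) \<le> k * n * (2 * M + 1)" using k0 n2 M0 by (intro mult_right_mono mult_left_mono) auto
    ultimately show ?thesis by linarith
  qed
  have t5: "k * (M + n * (2 * M + 1)) \<le> exp (2 * u x) / 4"
  proof -
    have "e * (k * (M + n * (2 * M + 1))) \<le> 1 / 4" using small(4) by (simp add: e_def x_def k_def n_def)
    then have "e * (e * (k * (M + n * (2 * M + 1)))) \<le> 1 * (1 / 4)"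
      using e k0 M0 n2 by (intro mult_mono) auto
    then have "exp (2 * u x) * (e * (e * (k * (M + n * (2 * M + 1))))) \<le> exp (2 * u x) * (1 / 4)"
      by (intro mult_left_mono) auto
    moreover have "exp (2 * u x) * (e * (e * (k * (M + n * (2 * M + 1))))) = k * (M + n * (2 * M + 1))"
      using eu by (simp add: mult.assoc[symmetric])
    ultimately show ?thesis by simp
  qed
  have "k * (M + n * (2 * M + 1)) = k * M + k * n * (2 * M + 1)" by (simp add: algebra_simps)
  then show ?thesis using t1 t2 t3 t4 t5 unfolding rhs x_def[symmetric] by linarith
qed

end

section \<open>Rescaling at a maximum point\<close>

lemma sandwich_linear:
  fixes A M J :: "complex^'n^'n"
  shows "(adjoint_mat J ** (\<chi> k j. x * A $ k $ j + y * M $ k $ j) ** J) $ k $ j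
    = x * (adjoint_mat J ** A ** J) $ k $ j + y * (adjoint_mat J ** M ** J) $ k $ j"
  by (simp add: matrix_matrix_mult_def distrib_left distrib_right sum.distrib sum_distrib_left sum_distrib_right mult_ac)

lemma sandwich_scale:
  fixes A J :: "complex^'n^'n"
  shows "(adjoint_mat J ** (\<chi> k j. x * A $ k $ j) ** J) $ k $ j = x * (adjoint_mat J ** A ** J) $ k $ j"
  using sandwich_linear[of J x A 0 A k j] by simp

text \<open>Rescaling the metric by $\lambda = e^{u(x_0)}$ turns the equation at a maximum point $x_0$ into
  the equation for $u - u(x_0)$, $f/\lambda^2$ and $\mu/\lambda^2$, whose data are small.\<close>

locale blown_up = kaehler_manifold At G + Q: quad_metric z0 T Qc "crange c" "G c" lam B Bq t0
  for At :: "('a::t2_space, 'n::finite) chart set" and G and c and z0 T Qc lam B Bq t0 +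
  fixes \<alpha> K :: real and f \<mu> u :: "'a \<Rightarrow> real" and a :: "'n \<Rightarrow> real"
  assumes cAt: "c \<in> At" and smu: "smooth_fun At u" and smf: "smooth_fun At f" and smmu: "smooth_fun At \<mu>"
    and alpha: "\<alpha> > 0" and Kpos: "K > 0" and lam_eq: "lam = exp (u (cinv c z0))"
    and T1: "adjoint_mat T ** (\<chi> k j. of_real lam * G c z0 $ k $ j) ** T = mat 1"
    and T2: "adjoint_mat T ** g_prime G \<alpha> f u c z0 ** T = diag_mat a"
    and eqn: "\<And>z. z \<in> crange c \<Longrightarrow> sigma2 (G c z) (g_prime G \<alpha> f u c z) = equation_rhs G \<alpha> f \<mu> u c z"
begin

abbreviation "h \<equiv> quad_map z0 T Qc"
definition "Gl z = (\<chi> k j. complex_of_real lam * G c z $ k $ j)"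
definition "gm w = adjoint_mat (jac h w) ** Gl (h w) ** jac h w"
definition "gi j k w = matrix_inv (gm w) $ j $ k"
text \<open>The exponent 2 is used for f and \<mu>, as the equation scales with the square of
  \<open>lam\<close>. The Laplacian of f takes the exponent 3 because the metric, too, is multiplied
  by \<open>lam\<close>.\<close>

definition "rescaled k \<phi> w = complex_of_real (1 / lam ^ k) * loc c \<phi> (h w)"
definition "u' w = loc c u (h w) - complex_of_real (u (cinv c z0))"
abbreviation "f' \<equiv> rescaled 2 f"
abbreviation "q' \<equiv> rescaled 3 (lapX f)"
abbreviation "mu' \<equiv> rescaled 2 \<mu>"

lemma lam0: "lam > 0" "lam \<noteq> 0" using Q.lam by auto

lemma hW: "w \<in> Q.W \<Longrightarrow> h w \<in> crange c" by (rule Q.W_D)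

lemma gm_nth: "gm w $ k $ j = Q.gh k j w"
  by (simp add: gm_def Gl_def sandwich_scale Q.gh_matrix)

lemma matrix_inv_Gl:
  assumes "z \<in> crange c"
  shows "invertible (Gl z)" "matrix_inv (Gl z) = (\<chi> j k. of_real (1 / lam) * matrix_inv (G c z) $ j $ k)"
proof -
  have "Gl z ** (\<chi> j k. of_real (1 / lam) * matrix_inv (G c z) $ j $ k) = G c z ** matrix_inv (G c z)"
    using lam0 by (simp add: Gl_def vec_eq_iff matrix_matrix_mult_def)
  also have "\<dots> = mat 1" by (rule matrix_inv_works[OF positive_definite_facts(1)[OF G_pos[OF cAt assms]]])
  finally have e: "Gl z ** (\<chi> j k. of_real (1 / lam) * matrix_inv (G c z) $ j $ k) = mat 1" .
  show "matrix_inv (Gl z) = (\<chi> j k. of_real (1 / lam) * matrix_inv (G c z) $ j $ k)" by (rule matrix_inv_unique[OF e])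
  show "invertible (Gl z)" using e matrix_left_right_inverse invertible_right_inverse by blast
qed

lemma inv_gm: "w \<in> Q.W \<Longrightarrow> invertible (gm w)"
  unfolding gm_def by (intro invertible_mult invertible_adjoint Q.W_D matrix_inv_Gl hW)

lemma holo: "holomorphic_map_on Q.W h"
  using Q.holo_h unfolding holomorphic_map_on_def by blast

lemma pull_sm: "smooth_fun At \<phi> \<Longrightarrow> Q.sm (\<lambda>w. loc c \<phi> (h w))"
  by (rule Q.sm_pull[OF loc_smooth[OF _ cAt]])

lemma sm_u': "Q.sm u'" and sm_rescaled: "smooth_fun At \<phi> \<Longrightarrow> Q.sm (rescaled k \<phi>)"
  unfolding u'_def[abs_def] rescaled_def[abs_def] using pull_sm smu by (intro Q.sm_intros; auto)+

lemma u'_derivs: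
  assumes "w \<in> Q.W"
  shows "dz j u' w = dz j (\<lambda>w. loc c u (h w)) w" "dzbar j u' w = dzbar j (\<lambda>w. loc c u (h w)) w"
    "dzbar k (dz j u') w = dzbar k (dz j (\<lambda>w. loc c u (h w))) w"
proof -
  have 1: "dz j u' v = dz j (\<lambda>w. loc c u (h w)) v" if "v \<in> Q.W" for v
    unfolding u'_def[abs_def] using that pull_sm[OF smu] by (subst Q.d_diff) auto
  then show "dz j u' w = dz j (\<lambda>w. loc c u (h w)) w" using assms .
  show "dzbar j u' w = dzbar j (\<lambda>w. loc c u (h w)) w"
    unfolding u'_def[abs_def] using assms pull_sm[OF smu] by (subst Q.d_diff) auto
  show "dzbar k (dz j u') w = dzbar k (dz j (\<lambda>w. loc c u (h w))) w"
    by (rule Q.dzbar_cong[OF assms 1])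
qed

lemma rescaled_derivs:
  assumes "w \<in> Q.W" "smooth_fun At \<phi>"
  shows "dz j (rescaled i \<phi>) w = of_real (1 / lam ^ i) * dz j (\<lambda>w. loc c \<phi> (h w)) w"
    "dzbar j (rescaled i \<phi>) w = of_real (1 / lam ^ i) * dzbar j (\<lambda>w. loc c \<phi> (h w)) w"
    "dz k (dz j (rescaled i \<phi>)) w = of_real (1 / lam ^ i) * dz k (dz j (\<lambda>w. loc c \<phi> (h w))) w"
    "dzbar k (dz j (rescaled i \<phi>)) w = of_real (1 / lam ^ i) * dzbar k (dz j (\<lambda>w. loc c \<phi> (h w))) w"
proof -
  note s = pull_sm[OF assms(2)]
  have 1: "dz j (rescaled i \<phi>) v = of_real (1 / lam ^ i) * dz j (\<lambda>w. loc c \<phi> (h w)) v" if "v \<in> Q.W" for v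
    unfolding rescaled_def[abs_def] by (rule Q.d_cmult[OF s that])
  then show "dz j (rescaled i \<phi>) w = of_real (1 / lam ^ i) * dz j (\<lambda>w. loc c \<phi> (h w)) w" using assms(1) .
  show "dzbar j (rescaled i \<phi>) w = of_real (1 / lam ^ i) * dzbar j (\<lambda>w. loc c \<phi> (h w)) w"
    unfolding rescaled_def[abs_def] by (rule Q.d_cmult[OF s assms(1)])
  show "dz k (dz j (rescaled i \<phi>)) w = of_real (1 / lam ^ i) * dz k (dz j (\<lambda>w. loc c \<phi> (h w))) w"
    by (subst Q.dz_cong[OF assms(1) 1], assumption, rule Q.d_cmult[OF Q.sm_dz[OF s] assms(1)])
  show "dzbar k (dz j (rescaled i \<phi>)) w = of_real (1 / lam ^ i) * dzbar k (dz j (\<lambda>w. loc c \<phi> (h w))) w"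
    by (subst Q.dzbar_cong[OF assms(1) 1], assumption, rule Q.d_cmult[OF Q.sm_dz[OF s] assms(1)])
qed

lemma pairing_gm:
  assumes w: "w \<in> Q.W" and F: "smooth_fun At \<phi>" "smooth_fun At \<phi>2"
  shows "pairing (matrix_inv (gm w)) (\<chi> j. dz j (\<lambda>w. loc c \<phi> (h w)) w) (\<chi> k. dzbar k (\<lambda>w. loc c \<phi>2 (h w)) w)
    = of_real (1 / lam) * grad_pair G c \<phi> \<phi>2 (h w)"
proof -
  interpret D: open_domain "crange c" by (rule chart_domain[OF cAt])
  have "pairing (matrix_inv (gm w)) (\<chi> j. dz j (\<lambda>w. loc c \<phi> (h w)) w) (\<chi> k. dzbar k (\<lambda>w. loc c \<phi>2 (h w)) w)
     = pairing (matrix_inv (Gl (h w))) (\<chi> j. dz j (loc c \<phi>) (h w)) (\<chi> k. dzbar k (loc c \<phi>2) (h w))"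
    unfolding gm_def
    by (rule D.pairing_grad_pullback[OF holo Q.open_W' hW loc_smooth[OF F(1) cAt] loc_smooth[OF F(2) cAt] w
      Q.W_D(2)[OF w] matrix_inv_Gl(1)[OF hW[OF w]]])
  then show ?thesis
    unfolding matrix_inv_Gl(2)[OF hW[OF w]] grad_pair_pairing
    by (simp add: pairing_def sum_distrib_left mult.assoc)
qed

lemma trace_levi_gm:
  assumes w: "w \<in> Q.W" and F: "smooth_fun At \<phi>"
  shows "trace (matrix_inv (gm w) ** levi (\<lambda>w. loc c \<phi> (h w)) w)
    = of_real (1 / lam) * trace (matrix_inv (G c (h w)) ** levi (loc c \<phi>) (h w))"
proof -
  interpret D: open_domain "crange c" by (rule chart_domain[OF cAt])
  have "trace (matrix_inv (gm w) ** levi (\<lambda>w. loc c \<phi> (h w)) w) = trace (matrix_inv (Gl (h w)) ** levi (loc c \<phi>) (h w))"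
    unfolding gm_def
    by (rule D.trace_levi_pullback[OF holo Q.open_W' hW loc_smooth[OF F(1) cAt] w
      Q.W_D(2)[OF w] matrix_inv_Gl(1)[OF hW[OF w]]])
  then show ?thesis
    unfolding matrix_inv_Gl(2)[OF hW[OF w]]
    by (simp add: trace_def matrix_matrix_mult_def sum_distrib_left mult.assoc)
qed

lemma exp_u': "exp (u' w) = of_real (exp (u (cinv c (h w))) / lam)" "exp (- u' w) = of_real (exp (- u (cinv c (h w))) * lam)"
proof -
  have "u' w = complex_of_real (u (cinv c (h w)) - u (cinv c z0))" by (simp add: u'_def loc_def)
  then show "exp (u' w) = of_real (exp (u (cinv c (h w))) / lam)" "exp (- u' w) = of_real (exp (- u (cinv c (h w))) * lam)"
    by (simp_all add: exp_of_real[symmetric] lam_eq exp_diff exp_minus field_simps flip: of_real_minus exp_add)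
qed

lemma g_prime_pullback:
  assumes w: "w \<in> Q.W"
  shows "(exp (u' w) + f' w * exp (- u' w)) * Q.gh k j w + of_real (2 * real CARD('n) * \<alpha>) * dzbar k (dz j u') w
    = (adjoint_mat (jac h w) ** g_prime G \<alpha> f u c (h w) ** jac h w) $ k $ j"
proof -
  interpret D: open_domain "crange c" by (rule chart_domain[OF cAt])
  let ?x = "cinv c (h w)"
  have L: "dzbar k (dz j u') w = (adjoint_mat (jac h w) ** hess c u (h w) ** jac h w) $ k $ j"
    using D.levi_pullback(2)[OF holo Q.open_W' hW loc_smooth[OF smu cAt] w]
    unfolding u'_derivs[OF w] hess_levi by (simp add: levi_def vec_eq_iff)
  have E: "(exp (u' w) + f' w * exp (- u' w)) * of_real lam = of_real (exp (u ?x) + f ?x * exp (- u ?x))"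
    using lam0 unfolding exp_u' by (simp add: rescaled_def loc_def field_simps power2_eq_square)
  have gp: "g_prime G \<alpha> f u c (h w) = (\<chi> k j. of_real (exp (u ?x) + f ?x * exp (- u ?x)) * G c (h w) $ k $ j
      + of_real (2 * real CARD('n) * \<alpha>) * hess c u (h w) $ k $ j)"
    by (simp add: vec_eq_iff g_prime_nth)
  show ?thesis unfolding gp sandwich_linear L Q.gh_matrix E[symmetric] by (simp add: mult.assoc)
qed

lemma trace_levi_lapX:
  assumes "smooth_fun At \<phi>" "z \<in> crange c"
  shows "trace (matrix_inv (G c z) ** levi (loc c \<phi>) z) = of_real (lapX \<phi> (cinv c z))"
proof -
  obtain P d where D: "diagonalizes P (G c z) (hess c \<phi> z) d"
    using simultaneous_diagonalization[OF G_pos[OF cAt assms(2)] hermitian_hess[OF assms(1) cAt assms(2)]] by blast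
  from diagonalizes_trace(1)[OF D, unfolded hess_levi] show ?thesis
    using laplacian_trace[OF assms(1) cAt assms(2)] globalX(1)[OF assms(1) cAt assms(2)] by simp
qed

lemma gm_0: "gm 0 = mat 1"
  unfolding gm_def Q.jac_h_0 Q.h_0 Gl_def by (rule T1)

sublocale N: normal_coords Q.W 0 Q.gh gi u' f' q' mu' "2 * real CARD('n) * \<alpha>" K a
proof (unfold_locales, goal_cases)
  case 1 show ?case by (rule Q.zero_in_W)
next
  case (2 k j) show ?case by (rule Q.sm_gh)
next
  case (3 k j)
  have "Q.sm (\<lambda>w. gm w $ i $ l)" for i l
    unfolding gm_nth using Q.sm_gh by (simp add: eta_contract_eq)
  then show ?case unfolding gi_def[abs_def] by (rule Q.sm_matrix_inv) (rule inv_gm)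
next
  case 4 show ?case by (rule sm_u')
next
  case 5 show ?case by (rule sm_rescaled[OF smf])
next
  case 6 show ?case by (rule sm_rescaled[OF smooth_lapX[OF smf]])
next
  case 7 show ?case by (rule sm_rescaled[OF smmu])
next
  case (8 w j l)
  have "(matrix_inv (gm w) ** gm w) $ j $ l = (mat 1 :: complex^'n^'n) $ j $ l"
    using matrix_inv_works(2)[OF inv_gm[OF 8]] by simp
  then show ?case by (simp add: matrix_matrix_mult_def gi_def gm_nth mat_def)
next
  case (9 w k j)
  have "hermitian (G c (h w))" using G_pos[OF cAt hW[OF 9]] by (simp add: positive_definite_def)
  then have herm: "cnj (G c (h w) $ b $ a) = G c (h w) $ a $ b" for a b
    unfolding hermitian_def by metis
  have "cnj (\<Sum>b\<in>UNIV. \<Sum>a\<in>UNIV. cnj (jac h w $ b $ k) * G c (h w) $ b $ a * jac h w $ a $ j)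
    = (\<Sum>b\<in>UNIV. \<Sum>a\<in>UNIV. cnj (jac h w $ a $ j) * G c (h w) $ a $ b * jac h w $ b $ k)"
    by (simp add: herm mult_ac)
  also have "\<dots> = (\<Sum>b\<in>UNIV. \<Sum>a\<in>UNIV. cnj (jac h w $ b $ j) * G c (h w) $ b $ a * jac h w $ a $ k)"
    by (rule sum.swap)
  finally show ?case unfolding Q.gh_def Q.jac_h[symmetric] by simp
next
  case (10 k j)
  show ?case unfolding gm_nth[symmetric] gm_0 by (simp add: mat_def)
next
  case (11 m k j) show ?case by (rule Q.dz_gh)
next
  case (12 w) show ?case by (simp add: u'_def loc_real)
next
  case (13 w) show ?case by (simp add: rescaled_def loc_real)
next
  case (14 w) show ?case by (simp add: rescaled_def loc_real)
next
  case (15 w) show ?case by (simp add: rescaled_def loc_real)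
next
  case 16 show ?case by (simp add: u'_def loc_def)
next
  case (17 w)
  have "(\<Sum>j\<in>UNIV. \<Sum>k\<in>UNIV. gi j k w * dz j (dzbar k f') w)
     = of_real (1 / lam ^ 2) * trace (matrix_inv (gm w) ** levi (\<lambda>w. loc c f (h w)) w)"
    unfolding Q.d_commute(3)[OF sm_rescaled[OF smf] 17, symmetric] rescaled_derivs(4)[OF 17 smf]
    by (simp add: trace_def matrix_matrix_mult_def levi_def gi_def sum_distrib_left mult_ac)
  then show ?case unfolding trace_levi_gm[OF 17 smf] trace_levi_lapX[OF smf hW[OF 17]]
    by (simp add: rescaled_def loc_def power2_eq_square power3_eq_cube)
next
  case 18 show ?case using alpha by simp
next
  case 19 show ?case by (rule Kpos)
next
  case (20 k j)
  show ?case unfolding g_prime_pullback[OF Q.zero_in_W] Q.jac_h_0 Q.h_0 T2 by (simp add: diag_mat_def)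
qed

lemma rescaled_A: assumes "w \<in> Q.W"
  shows "(\<chi> k j. N.A k j w) = adjoint_mat (jac h w) ** g_prime G \<alpha> f u c (h w) ** jac h w"
  using g_prime_pullback[OF assms] by (simp add: vec_eq_iff N.A_def N.E_def)

lemma rescaled_S:
  assumes w: "w \<in> Q.W"
  shows "N.S w = of_real (traceX \<alpha> f u (cinv c (h w)) / lam)"
    "N.S w * N.S w - N.N w = of_real (2 * equation_rhs G \<alpha> f \<mu> u c (h w) / lam\<^sup>2)"
proof -
  let ?g = "g_prime G \<alpha> f u c (h w)"
  note zc = hW[OF w]
  define C where "C = matrix_inv (gm w) ** (\<chi> k j. N.A k j w)"
  have CC: "N.Cm j l w = C $ j $ l" for j l
    by (simp add: N.Cm_def C_def matrix_matrix_mult_def gi_def)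
  have sS: "N.S w = trace C" by (simp add: N.S_def CC trace_def)
  have sN: "N.N w = trace (C ** C)" by (simp add: N.N_def CC trace_def matrix_matrix_mult_def)
  have inv: "matrix_inv (Gl (h w)) ** ?g = (\<chi> i j. of_real (1 / lam) * (matrix_inv (G c (h w)) ** ?g) $ i $ j)"
    unfolding matrix_inv_Gl(2)[OF zc] by (simp add: vec_eq_iff matrix_matrix_mult_def sum_distrib_left mult.assoc)
  have tC: "trace C = of_real (1 / lam) * trace (matrix_inv (G c (h w)) ** ?g)"
    unfolding C_def rescaled_A[OF w] gm_def trace_pullback(1)[OF matrix_inv_Gl(1)[OF zc] Q.W_D(2)[OF w]] inv
    by (simp add: trace_def sum_distrib_left)
  have tCC: "trace (C ** C) = of_real (1 / lam\<^sup>2) * trace (matrix_inv (G c (h w)) ** ?g ** (matrix_inv (G c (h w)) ** ?g))"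
    unfolding C_def rescaled_A[OF w] gm_def trace_pullback(2)[OF matrix_inv_Gl(1)[OF zc] Q.W_D(2)[OF w]] inv
    by (simp add: trace_def matrix_matrix_mult_def[of "vec_lambda _"] matrix_matrix_mult_def[of "matrix_inv (G c (h w)) ** ?g"] sum_distrib_left power2_eq_square)
  show "N.S w = of_real (traceX \<alpha> f u (cinv c (h w)) / lam)"
    unfolding sS tC trace_g_prime[OF smu cAt zc] by simp
  have "N.S w * N.S w - N.N w = of_real (1 / lam\<^sup>2) * ((trace (matrix_inv (G c (h w)) ** ?g))\<^sup>2
     - trace (matrix_inv (G c (h w)) ** ?g ** (matrix_inv (G c (h w)) ** ?g)))"
    unfolding sS sN tC tCC by (simp add: power2_eq_square diff_divide_distrib)
  also have "\<dots> = of_real (1 / lam\<^sup>2) * of_real (2 * equation_rhs G \<alpha> f \<mu> u c (h w))"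
    using sigma2_trace[OF G_pos[OF cAt zc] hermitian_g_prime[OF smu cAt zc, of \<alpha> f]] eqn[OF zc] by simp
  finally show "N.S w * N.S w - N.N w = of_real (2 * equation_rhs G \<alpha> f \<mu> u c (h w) / lam\<^sup>2)" by simp
qed

text \<open>The quantity w is invariant: |Du|^2 is divided by \<open>lam\<close> while e^{-u} is
  multiplied by it. So the gradient hypothesis carries over unchanged, and the test function changes
  only by the constant factor coming from the trace.\<close>

lemma rescaled_gradients:
  assumes w: "w \<in> Q.W"
  shows "N.P w = of_real (gradX u (cinv c (h w)) / lam)"
    "N.Q w = of_real (1 / lam ^ 3) * grad_pair G c f u (h w)"
    "N.ww w = of_real (exp (- u (cinv c (h w))) * gradX u (cinv c (h w)))"
proof -
  note zc = hW[OF w]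
  have "N.P w = of_real (1 / lam) * grad_pair G c u u (h w)"
    unfolding pairing_gm[OF w smu smu, symmetric]
    by (simp add: N.P_def pairing_def u'_derivs[OF w] gi_def)
  moreover have "grad_pair G c u u (h w) = of_real (gradX u (cinv c (h w)))"
    using grad_bounds(2)[OF smu smu cAt zc] globalX(2)[OF smu cAt zc]
    by (simp add: grad_sq_def complex_eq_iff)
  ultimately show P: "N.P w = of_real (gradX u (cinv c (h w)) / lam)" by simp
  have "N.Q w = of_real (1 / lam ^ 2) * pairing (matrix_inv (gm w)) (\<chi> j. dz j (\<lambda>w. loc c f (h w)) w) (\<chi> k. dzbar k (\<lambda>w. loc c u (h w)) w)"
    by (simp add: N.Q_def pairing_def u'_derivs[OF w] rescaled_derivs[OF w smf] gi_def sum_distrib_left mult_ac)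
  then show "N.Q w = of_real (1 / lam ^ 3) * grad_pair G c f u (h w)"
    unfolding pairing_gm[OF w smf smu] by (simp add: power2_eq_square power3_eq_cube)
  show "N.ww w = of_real (exp (- u (cinv c (h w))) * gradX u (cinv c (h w)))"
    unfolding N.ww_def P exp_u' using lam0 by simp
qed

lemma rescaled_psi:
  assumes w: "w \<in> Q.W"
  shows "N.psi w = of_real (equation_rhs G \<alpha> f \<mu> u c (h w) / lam\<^sup>2)"
proof -
  define x where "x = cinv c (h w)"
  define X Y where "X = exp (u x)" and "Y = exp (- u x)"
  define n where "n = real CARD('n)"
  define g r where "g = gradX u x" and "r = 2 * Re (grad_pair G c f u (h w))"
  note zc = hW[OF w]
  have XY: "X * Y = 1" by (simp add: X_def Y_def flip: exp_add)
  have E: "N.E w = of_real ((X + f x * Y) / lam)" "N.E' w = of_real ((X - f x * Y) / lam)"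
    unfolding N.E_def N.E'_def exp_u' using lam0
    by (simp_all add: X_def Y_def x_def rescaled_def loc_def power2_eq_square field_simps)
  have "N.Q w + cnj (N.Q w) = of_real (r / lam ^ 3)"
    unfolding rescaled_gradients(2)[OF w] r_def by (simp add: complex_eq_iff)
  then have R: "N.R w = of_real ((r - lapX f x) / lam ^ 3)"
    by (simp add: N.R_def rescaled_def loc_def x_def diff_divide_distrib)
  have "N.psi w = of_real (n * (n - 1) / 2 * (((X + f x * Y) / lam) * ((X + f x * Y) / lam))
      - (2 * n * \<alpha>) * (n - 1) * ((X - f x * Y) / lam * (g / lam) + Y * lam * ((r - lapX f x) / lam ^ 3)) - (2 * n * \<alpha>) * (\<mu> x / lam\<^sup>2))"
    unfolding N.psi_def E R rescaled_gradients(1)[OF w] exp_u' N.n1_def N.nn_def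
    by (simp add: n_def g_def x_def Y_def rescaled_def loc_def)
  also have "n * (n - 1) / 2 * (((X + f x * Y) / lam) * ((X + f x * Y) / lam))
      - (2 * n * \<alpha>) * (n - 1) * ((X - f x * Y) / lam * (g / lam) + Y * lam * ((r - lapX f x) / lam ^ 3)) - (2 * n * \<alpha>) * (\<mu> x / lam\<^sup>2)
    = (n * (n - 1) / 2 * ((X + f x * Y) * (X + f x * Y)) - (2 * n * \<alpha>) * (n - 1) * ((X - f x * Y) * g + Y * (r - lapX f x)) - (2 * n * \<alpha>) * \<mu> x) / lam\<^sup>2"
    using lam0 by (simp add: field_simps power2_eq_square power3_eq_cube)
  also have "(X + f x * Y) * (X + f x * Y) = X\<^sup>2 + 2 * f x * (X * Y) + (f x)\<^sup>2 * Y\<^sup>2"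
    by (simp add: power2_eq_square algebra_simps)
  finally have psi: "N.psi w = of_real ((n * (n - 1) / 2 * (X\<^sup>2 + 2 * f x + (f x)\<^sup>2 * Y\<^sup>2)
      - (2 * n * \<alpha>) * (n - 1) * ((X - f x * Y) * g + Y * (r - lapX f x)) - (2 * n * \<alpha>) * \<mu> x) / lam\<^sup>2)"
    unfolding XY by simp
  have XXY: "X\<^sup>2 * Y = X" using XY by (simp add: power2_eq_square mult.assoc)
  have e2: "exp (2 * u x) = X\<^sup>2" "exp (- 2 * u x) = Y\<^sup>2"
    by (simp_all add: X_def Y_def power2_eq_square flip: exp_add)
  have "equation_rhs G \<alpha> f \<mu> u c (h w) = n * (n - 1) / 2 * (X\<^sup>2 + 2 * f x + (f x)\<^sup>2 * Y\<^sup>2)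
      - (2 * n * \<alpha>) * (n - 1) * ((X\<^sup>2 * Y - f x * Y) * g + Y * (r - lapX f x)) - (2 * n * \<alpha>) * \<mu> x"
    unfolding equation_rhs_def Let_def x_def[symmetric] globalX(1)[OF smf cAt zc, folded x_def]
      globalX(2)[OF smu cAt zc, folded x_def] e2 Y_def[symmetric] n_def[symmetric] g_def[symmetric] r_def[symmetric]
    by (simp add: field_simps power2_eq_square)
  with psi show ?thesis unfolding XXY by simp
qed

sublocale N: normal_equation Q.W 0 Q.gh gi u' f' q' mu' "2 * real CARD('n) * \<alpha>" K a
proof (unfold_locales)
  fix w assume "w \<in> Q.W"
  then show "N.S w * N.S w - N.N w = 2 * N.psi w" using rescaled_S(2) rescaled_psi by simp
qed

end

text \<open>The requirements of \<open>trace_bound\<close> and of \<open>rhs_lower\<close> on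
  \<open>K\<close> and \<theta>. The equation for \<open>K\<close> does not contain \<theta>, so
  \<open>K\<close> can be fixed first and \<theta> made small in terms of it.\<close>

definition maximum_constants :: "real \<Rightarrow> real \<Rightarrow> real \<Rightarrow> real \<Rightarrow> bool" where
  "maximum_constants n \<alpha> K \<theta> \<longleftrightarrow> K > 0 \<and> 0 < \<theta> \<and> \<theta> \<le> 1 / 8
     \<and> \<theta> * (2 * n * \<alpha> * n * (3 * n + 2)) \<le> 1 / 2 \<and> K * c_10 n * \<theta> \<le> 1 / 4
     \<and> \<theta> * (2 * c_6 n (2 * n * \<alpha>) * K + K * c_9 n (2 * n * \<alpha>) + K\<^sup>2 * c_10 n) \<le> 1 / 2
     \<and> K * min (1 / 2) (1 / (4 * (2 * n * \<alpha>)\<^sup>2)) = 2 * (c_7 n (2 * n * \<alpha>) + c_6 n (2 * n * \<alpha>) + 1)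
     \<and> 4 * \<alpha> * \<theta>\<^sup>2 \<le> 1 / 2"

lemma maximum_constantsD:
  assumes "maximum_constants n \<alpha> K \<theta>"
  shows "K > 0" "0 < \<theta>" "\<theta> \<le> 1 / 8"
    "\<theta> * (2 * n * \<alpha> * n * (3 * n + 2)) \<le> 1 / 2" "K * c_10 n * \<theta> \<le> 1 / 4"
    "\<theta> * (2 * c_6 n (2 * n * \<alpha>) * K + K * c_9 n (2 * n * \<alpha>) + K\<^sup>2 * c_10 n) \<le> 1 / 2"
    "K * min (1 / 2) (1 / (4 * (2 * n * \<alpha>)\<^sup>2)) = 2 * (c_7 n (2 * n * \<alpha>) + c_6 n (2 * n * \<alpha>) + 1)"
    "4 * \<alpha> * \<theta>\<^sup>2 \<le> 1 / 2"
  using assms unfolding maximum_constants_def by simp_all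

section \<open>The maximum principle applied to the rescaled equation\<close>

context blown_up
begin

lemma rescaled_jets:
  assumes \<phi>: "smooth_fun At \<phi>" and i: "i \<ge> 1"
    and b: "norm (loc c \<phi> z0) \<le> b" "\<And>a. norm (dz a (loc c \<phi>) z0) \<le> b"
      "\<And>a k. norm (dz k (dz a (loc c \<phi>)) z0) \<le> b" "\<And>a k. norm (dzbar k (dz a (loc c \<phi>)) z0) \<le> b"
    and \<theta>: "real CARD('n) * (1 + Bq + real CARD('n)) * (1 + t0)\<^sup>2 * b / lam \<le> \<theta>"
  shows "cmod (rescaled i \<phi> 0) \<le> \<theta>" "cmod (dz j (rescaled i \<phi>) 0) \<le> \<theta>"
    "cmod (dz k (dz j (rescaled i \<phi>)) 0) \<le> \<theta>" "cmod (dzbar k (dz j (rescaled i \<phi>)) 0) \<le> \<theta>"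
    "cmod (ddbar k (rescaled i \<phi>) 0) \<le> \<theta>"
proof -
  let ?C = "real CARD('n) * (1 + Bq + real CARD('n)) * (1 + t0)\<^sup>2"
  note jets = Q.jets_pull[OF loc_smooth[OF \<phi> cAt] b]
  have b0: "b \<ge> 0" using b(1) norm_ge_zero order_trans by blast
  have "1 * 1 * 1 \<le> ?C" using Q.pos by (intro mult_mono) auto
  then have bC: "b \<le> ?C * b" using b0 mult_right_mono[of 1 ?C b] by simp
  have pw: "cmod (of_real (1 / lam ^ i) * y) \<le> \<theta>" if y: "cmod y \<le> ?C * b" for y
  proof -
    have "lam ^ 1 \<le> lam ^ i" using Q.lam i by (intro power_increasing) auto
    then have "1 / lam ^ i \<le> 1 / lam" using lam0 by (simp add: field_simps)
    then have "1 / lam ^ i * cmod y \<le> 1 / lam * (?C * b)"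
      using y b0 lam0 Q.pos by (intro mult_mono) auto
    moreover have "cmod (of_real (1 / lam ^ i) * y) = 1 / lam ^ i * cmod y"
      unfolding norm_mult norm_of_real using lam0 by simp
    ultimately show ?thesis using \<theta> by simp
  qed
  show "cmod (rescaled i \<phi> 0) \<le> \<theta>" unfolding rescaled_def Q.h_0 by (rule pw) (use b(1) bC in linarith)
  show "cmod (dz j (rescaled i \<phi>) 0) \<le> \<theta>" unfolding rescaled_derivs[OF Q.zero_in_W \<phi>] by (rule pw[OF jets(1)])
  show "cmod (dz k (dz j (rescaled i \<phi>)) 0) \<le> \<theta>" unfolding rescaled_derivs[OF Q.zero_in_W \<phi>] by (rule pw[OF jets(2)])
  show t: "cmod (dzbar k (dz j (rescaled i \<phi>)) 0) \<le> \<theta>" for k j unfolding rescaled_derivs[OF Q.zero_in_W \<phi>] by (rule pw[OF jets(3)])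
  show "cmod (ddbar k (rescaled i \<phi>) 0) \<le> \<theta>" unfolding Q.ddbar_alt[OF sm_rescaled[OF \<phi>] Q.zero_in_W] by (rule t)
qed

lemma scaled_trace_bound:
  assumes n2: "CARD('n) \<ge> 2" and f0: "f (cinv c z0) \<ge> 0"
    and mc: "maximum_constants (real CARD('n)) \<alpha> K \<theta>"
    and b: "\<And>\<phi>. \<phi> \<in> {f, lapX f, \<mu>} \<Longrightarrow> norm (loc c \<phi> z0) \<le> b"
      "\<And>\<phi> a. \<phi> \<in> {f, lapX f, \<mu>} \<Longrightarrow> norm (dz a (loc c \<phi>) z0) \<le> b"
      "\<And>\<phi> a k. \<phi> \<in> {f, lapX f, \<mu>} \<Longrightarrow> norm (dz k (dz a (loc c \<phi>)) z0) \<le> b"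
      "\<And>\<phi> a k. \<phi> \<in> {f, lapX f, \<mu>} \<Longrightarrow> norm (dzbar k (dz a (loc c \<phi>)) z0) \<le> b"
    and small: "real CARD('n) * (1 + Bq + real CARD('n)) * (1 + t0)\<^sup>2 * b / lam \<le> \<theta>"
      "(real CARD('n) * (real CARD('n) * (real CARD('n) * B * Bq + (real CARD('n) * real CARD('n)) * B + Bq * B * Bq + Bq * real CARD('n) * B)) * t0^4) / lam \<le> \<theta>"
    and w: "exp (- u (cinv c z0)) * gradX u (cinv c z0) \<le> \<theta>\<^sup>2"
    and tau: "\<And>m. (\<Sum>j\<in>UNIV. a j) - a m > 0"
    and max: "\<And>x. traceX \<alpha> f u x * exp (K * (exp (- u x) * gradX u x))
       \<le> traceX \<alpha> f u (cinv c z0) * exp (K * (exp (- u (cinv c z0)) * gradX u (cinv c z0)))"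
  shows "traceX \<alpha> f u (cinv c z0) \<le> max 1 (4 * c_8 (real CARD('n)) (2 * real CARD('n) * \<alpha>)) * lam"
proof -
  note theta = maximum_constantsD(2-6)[OF mc] and Kc = maximum_constantsD(7)[OF mc]
  have "complex_of_real (traceX \<alpha> f u (cinv c z0) / lam) = of_real N.s"
    using N.S_p rescaled_S(1)[OF Q.zero_in_W] by simp
  then have "traceX \<alpha> f u (cinv c z0) / lam = N.s" by (simp only: of_real_eq_iff)
  then have tr: "traceX \<alpha> f u (cinv c z0) = N.s * lam" using lam0 by (simp add: field_simps)
  show ?thesis
  proof (cases "1 \<le> N.s")
    case False
    then show ?thesis unfolding tr using lam0 by (intro mult_right_mono) auto
  next
    case True
  note jf = rescaled_jets[OF smf _ b(1)[of f] b(2)[of f] b(3)[of f] b(4)[of f] small(1)]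
  note jq = rescaled_jets[OF smooth_lapX[OF smf] _ b(1)[of "lapX f"] b(2)[of "lapX f"] b(3)[of "lapX f"] b(4)[of "lapX f"] small(1)]
  note jm = rescaled_jets[OF smmu _ b(1)[of \<mu>] b(2)[of \<mu>] b(3)[of \<mu>] b(4)[of \<mu>] small(1)]
  have SS: "N.S w = of_real (traceX \<alpha> f u (cinv c (h w)) / lam)" if "w \<in> Q.W" for w by (rule rescaled_S(1)[OF that])
  have WW: "N.ww w = of_real (exp (- u (cinv c (h w))) * gradX u (cinv c (h w)))" if "w \<in> Q.W" for w by (rule rescaled_gradients(3)[OF that])
  have SE: "Re (N.S w * exp (of_real K * N.ww w)) = traceX \<alpha> f u (cinv c (h w)) * exp (K * (exp (- u (cinv c (h w))) * gradX u (cinv c (h w)))) / lam"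
    if "w \<in> Q.W" for w
    unfolding SS[OF that] WW[OF that] of_real_mult[symmetric] exp_of_real Re_complex_of_real by simp
  interpret NB: normal_bounds Q.W 0 Q.gh gi u' f' q' mu' "2 * real CARD('n) * \<alpha>" K a \<theta> "real CARD('n)"
  proof (unfold_locales, goal_cases)
    case 1 show ?case ..
  next
    case 2 show ?case by (rule theta(1))
  next
    case 3 show ?case using theta(2) by linarith
  next
    case 4 show ?case by (rule theta(3))
  next
    case 5 show ?case by (rule n2)
  next
    case (6 j)
    \<comment> \<open>At the centre w is the sum of the squares of the first derivatives of u; this
      is why the hypothesis bounds w by the square of \<theta>.\<close>
    have "N.ww 0 = N.P 0" by (simp add: N.ww_def N.u_p)
    then have "complex_of_real (exp (- u (cinv c z0)) * gradX u (cinv c z0)) = of_real (\<Sum>j\<in>UNIV. (cmod (N.U j))\<^sup>2)"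
      using WW[OF Q.zero_in_W] N.P_p by (simp only: Q.h_0)
    then have "exp (- u (cinv c z0)) * gradX u (cinv c z0) = (\<Sum>j\<in>UNIV. (cmod (N.U j))\<^sup>2)"
      by (simp only: of_real_eq_iff)
    moreover have "(cmod (N.U j))\<^sup>2 \<le> (\<Sum>j\<in>UNIV. (cmod (N.U j))\<^sup>2)" by (intro member_le_sum) auto
    ultimately have "(cmod (N.U j))\<^sup>2 \<le> \<theta>\<^sup>2" using w by linarith
    then show ?case by (rule power2_le_imp_le) (use theta(1) in simp)
  next
    case 7
    have "N.f0 = f (cinv c z0) / lam\<^sup>2" by (simp add: N.f0_def rescaled_def loc_def)
    then show ?case using f0 by simp
  next
    case 8
    show ?case unfolding N.f0_def using jf(1)[of 2] complex_Re_le_cmod[of "f' 0"] by simp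
  next
    case (9 j) show ?case unfolding N.Fj_def by (rule jf(2)) auto
  next
    case (10 j m) show ?case unfolding N.FF_def by (rule jf(3)) auto
  next
    case (11 j m) show ?case unfolding N.FH_def by (rule jf(4)) auto
  next
    case (12 m) show ?case by (rule jf(5)) auto
  next
    case 13 show ?case by (rule jq(1)) auto
  next
    case (14 m) show ?case by (rule jq(2)) auto
  next
    case (15 m) show ?case by (rule jq(5)) auto
  next
    case 16 show ?case by (rule jm(1)) auto
  next
    case (17 m) show ?case by (rule jm(2)) auto
  next
    case (18 m) show ?case by (rule jm(5)) auto
  next
    case (19 m j k)
    have "cmod (N.rho m j k) = cmod (ddbar m (Q.gh j k) 0)" unfolding N.rho_g by simp
    then show ?case using Q.ddbar_gh[of m j k] small(2) by linarith
  next
    case (20 m) show ?case unfolding N.tau_def N.s_def by (rule tau)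
  next
    case (21 w)
    show ?case unfolding SE[OF 21] SE[OF Q.zero_in_W] Q.h_0
      by (intro divide_right_mono max) (use lam0 in auto)
  next
    case (22 w) show ?case unfolding SS[OF 22] by simp
  next
    case (23 w) show ?case unfolding WW[OF 23] by simp
  next
    case 24 show ?case by (rule True)
  qed
  have "N.s < 4 * c_8 (real CARD('n)) (2 * real CARD('n) * \<alpha>)"
    by (rule NB.trace_bound[OF Kc theta(2,4,5)])
  then show ?thesis unfolding tr using lam0 by (intro mult_right_mono) auto
  qed
qed

end

lemma maximum_principle_constants:
  fixes n \<alpha> :: real
  assumes n: "n \<ge> 1" and \<alpha>: "\<alpha> > 0"
  obtains K \<theta> where "maximum_constants n \<alpha> K \<theta>"
proof -
  define \<kappa> where "\<kappa> = 2 * n * \<alpha>"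
  have \<kappa>: "\<kappa> > 0" using n \<alpha> by (simp add: \<kappa>_def)
  have ch: "c_h n \<kappa> \<ge> 0" using n \<kappa> by (simp add: c_h_def)
  have c1: "c_1 n \<kappa> \<ge> 0" using n \<kappa> ch by (simp add: c_1_def c_w_def)
  have c34: "c_3 n \<kappa> \<ge> 0" "c_4 n \<kappa> \<ge> 0" using n \<kappa> ch c1 by (simp_all add: c_3_def c_4_def)
  have c6: "c_6 n \<kappa> \<ge> 0" unfolding c_6_def using n \<kappa> ch c34 by (intro add_nonneg_nonneg mult_nonneg_nonneg) auto
  have c7: "c_7 n \<kappa> \<ge> 0" using n \<kappa> ch by (simp add: c_7_def)
  define m where "m = min (1 / 2) (1 / (4 * \<kappa>\<^sup>2))"
  have m: "m > 0" using \<kappa> by (simp add: m_def)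
  define K where "K = 2 * (c_7 n \<kappa> + c_6 n \<kappa> + 1) / m"
  have K: "K > 0" using c6 c7 m by (simp add: K_def)
  define x1 x2 x3 where "x1 = \<kappa> * n * (3 * n + 2)" and "x2 = K * c_10 n"
    and "x3 = 2 * c_6 n \<kappa> * K + K * c_9 n \<kappa> + K\<^sup>2 * c_10 n"
  \<comment> \<open>With \<theta> = 1 / D every coefficient among \<open>x1\<close>,
    \<open>x2\<close>, \<open>x3\<close> and \<open>4 * \<alpha>\<close> contributes at most 1/8,
    which is below each of the required bounds.\<close>
  define D where "D = 8 * (1 + \<bar>x1\<bar> + \<bar>x2\<bar> + \<bar>x3\<bar> + 4 * \<alpha>)"
  have D: "D \<ge> 8" using \<alpha> by (simp add: D_def)
  have le: "x / D \<le> 1 / 8" if "8 * x \<le> D" for x using that D by (simp add: divide_simps)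
  have t1: "1 / D \<le> 1" using D by (simp add: divide_simps)
  have t2: "(1 / D)\<^sup>2 \<le> 1 / D" using mult_right_mono[OF t1, of "1 / D"] D by (simp add: power2_eq_square)
  show ?thesis
  proof (rule that[of K "1 / D"], unfold maximum_constants_def, intro conjI)
    show "0 < K" by (rule K)
    show "0 < 1 / D" using D by simp
    show "1 / D \<le> 1 / 8" using D by (simp add: divide_simps)
    show "1 / D * (2 * n * \<alpha> * n * (3 * n + 2)) \<le> 1 / 2"
      using le[of x1] \<alpha> by (simp add: D_def x1_def \<kappa>_def)
    show "K * c_10 n * (1 / D) \<le> 1 / 4"
      using le[of x2] \<alpha> by (simp add: D_def x2_def)
    show "1 / D * (2 * c_6 n (2 * n * \<alpha>) * K + K * c_9 n (2 * n * \<alpha>) + K\<^sup>2 * c_10 n) \<le> 1 / 2"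
    proof -
      have "x3 / D \<le> 1 / 8" by (rule le) (use \<alpha> in \<open>simp add: D_def\<close>)
      moreover have "1 / D * x3 = x3 / D" by simp
      ultimately show ?thesis unfolding x3_def[unfolded \<kappa>_def, symmetric] by linarith
    qed
    show "K * min (1 / 2) (1 / (4 * (2 * n * \<alpha>)\<^sup>2)) = 2 * (c_7 n (2 * n * \<alpha>) + c_6 n (2 * n * \<alpha>) + 1)"
      using m unfolding m_def[unfolded \<kappa>_def, symmetric] by (simp add: K_def \<kappa>_def)
    have "4 * \<alpha> * (1 / D)\<^sup>2 \<le> 4 * \<alpha> * (1 / D)" using t2 \<alpha> by (intro mult_left_mono) auto
    moreover have "4 * \<alpha> / D \<le> 1 / 8" by (rule le) (simp add: D_def)
    ultimately show "4 * \<alpha> * (1 / D)\<^sup>2 \<le> 1 / 2" by simp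
  qed
qed

context kaehler_manifold
begin

definition solves_on :: "('a, 'n) chart \<Rightarrow> real \<Rightarrow> ('a \<Rightarrow> real) \<Rightarrow> ('a \<Rightarrow> real) \<Rightarrow> ('a \<Rightarrow> real) \<Rightarrow> bool" where
  "solves_on c \<alpha> f \<mu> u \<longleftrightarrow> (\<forall>z\<in>crange c.
     sigma2 (G c z) (g_prime G \<alpha> f u c z) = equation_rhs G \<alpha> f \<mu> u c z \<and>
     positive_definite (g_tilde G \<alpha> f u c z))"

text \<open>The threshold \<epsilon> depends on the piece, on f and on \<mu>, but the resulting
  bound only on the dimension and \<alpha>. A small value of e^{-u} at the maximum means a large
  \<open>lam\<close>, which makes the rescaled jets and the curvature at most \<theta>.\<close>

lemma trace_at_max_local:
  assumes c: "c \<in> At" and ball: "cball y r \<subseteq> crange c"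
    and n2: "CARD('n) \<ge> 2" and \<alpha>: "\<alpha> > 0"
    and mc: "maximum_constants (real CARD('n)) \<alpha> K \<theta>"
    and f: "smooth_fun At f" "\<And>x. 0 \<le> f x" and \<mu>: "smooth_fun At \<mu>"
  shows "\<exists>\<epsilon>>0. \<forall>u z0. smooth_fun At u \<longrightarrow> z0 \<in> ball y r \<longrightarrow>
     solves_on c \<alpha> f \<mu> u \<longrightarrow>
     exp (- u (cinv c z0)) \<le> \<epsilon> \<longrightarrow> exp (- u (cinv c z0)) * gradX u (cinv c z0) \<le> \<theta>\<^sup>2 \<longrightarrow>
     (\<forall>x. traceX \<alpha> f u x * exp (K * (exp (- u x) * gradX u x))
       \<le> traceX \<alpha> f u (cinv c z0) * exp (K * (exp (- u (cinv c z0)) * gradX u (cinv c z0)))) \<longrightarrow>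
     traceX \<alpha> f u (cinv c z0) \<le> max 1 (4 * c_8 (real CARD('n)) (2 * real CARD('n) * \<alpha>)) * exp (u (cinv c z0))"
proof -
  note theta = maximum_constantsD(2-6)[OF mc] and Kc = maximum_constantsD(7)[OF mc] and Kpos = maximum_constantsD(1)[OF mc]
  interpret D: open_domain "crange c" by (rule chart_domain[OF c])
  obtain B Bq t0 where coords: "\<And>z0 lam T. z0 \<in> cball y r \<Longrightarrow> lam \<ge> 1 \<Longrightarrow>
      adjoint_mat T ** (\<chi> k j. of_real lam * G c z0 $ k $ j) ** T = mat 1 \<Longrightarrow>
      \<exists>Qc. quad_metric z0 T Qc (crange c) (G c) lam B Bq t0"
    using normal_coordinates[OF c compact_cball ball] by blast
  have "\<exists>b\<ge>0. \<forall>z\<in>cball y r. norm (loc c \<phi> z) \<le> b \<and> (\<forall>a. norm (dz a (loc c \<phi>) z) \<le> b)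
    \<and> (\<forall>a k. norm (dz k (dz a (loc c \<phi>)) z) \<le> b) \<and> (\<forall>a k. norm (dzbar k (dz a (loc c \<phi>)) z) \<le> b)"
    if sm: "smooth_fun At \<phi>" for \<phi>
  proof -
    obtain b where b: "\<forall>z\<in>cball y r. norm (loc c \<phi> z) \<le> b \<and> (\<forall>a. norm (dz a (loc c \<phi>) z) \<le> b) \<and> (\<forall>a. norm (dzbar a (loc c \<phi>) z) \<le> b)
      \<and> (\<forall>a k. norm (dz k (dz a (loc c \<phi>)) z) \<le> b) \<and> (\<forall>a k. norm (dzbar k (dz a (loc c \<phi>)) z) \<le> b)"
      using D.jets_bounded[OF compact_cball ball loc_smooth[OF sm c]] by blast
    then show ?thesis by (intro exI[of _ "max b 0"]) (auto simp: le_max_iff_disj)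
  qed
  then obtain bb where bb: "\<And>\<phi>. smooth_fun At \<phi> \<Longrightarrow> bb \<phi> \<ge> 0" "\<And>\<phi> z a k. smooth_fun At \<phi> \<Longrightarrow> z \<in> cball y r \<Longrightarrow>
      norm (loc c \<phi> z) \<le> bb \<phi> \<and> norm (dz a (loc c \<phi>) z) \<le> bb \<phi> \<and> norm (dz k (dz a (loc c \<phi>)) z) \<le> bb \<phi>
      \<and> norm (dzbar k (dz a (loc c \<phi>)) z) \<le> bb \<phi>"
    by metis
  define b where "b = bb f + bb (lapX f) + bb \<mu>"
  have smF: "smooth_fun At \<phi>" if "\<phi> \<in> {f, lapX f, \<mu>}" for \<phi> using that f \<mu> smooth_lapX by auto
  have bbb: "bb \<phi> \<le> b" if "\<phi> \<in> {f, lapX f, \<mu>}" for \<phi>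
    using that bb(1)[of f] bb(1)[of "lapX f"] bb(1)[of \<mu>] smF unfolding b_def by fastforce
  define C1 where "C1 = real CARD('n) * (1 + Bq + real CARD('n)) * (1 + t0)\<^sup>2 * b"
  define C2 where "C2 = real CARD('n) * (real CARD('n) * (real CARD('n) * B * Bq + (real CARD('n) * real CARD('n)) * B + Bq * B * Bq + Bq * real CARD('n) * B)) * t0^4"
  \<comment> \<open>\<open>C1\<close> bounds the jets of the data and \<open>C2\<close> the
    curvature, each before division by \<open>lam\<close>; the bound 1 ensures that
    \<open>lam\<close> is at least 1, as \<open>quad_metric\<close> demands.\<close>
  define \<epsilon> where "\<epsilon> = min 1 (\<theta> / (\<bar>C1\<bar> + \<bar>C2\<bar> + 1))"
  have eps: "\<epsilon> > 0" "\<epsilon> \<le> 1" using theta(1) by (auto simp: \<epsilon>_def)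
  have epsC: "C * \<epsilon> \<le> \<theta>" if "0 \<le> C" "C \<le> \<bar>C1\<bar> + \<bar>C2\<bar> + 1" for C
  proof -
    have "C * \<epsilon> \<le> (\<bar>C1\<bar> + \<bar>C2\<bar> + 1) * (\<theta> / (\<bar>C1\<bar> + \<bar>C2\<bar> + 1))"
      using that eps by (intro mult_mono) (auto simp: \<epsilon>_def)
    also have "\<dots> = \<theta>" by (simp add: add_nonneg_eq_0_iff)
    finally show ?thesis .
  qed
  show ?thesis
  proof (intro exI[of _ \<epsilon>] conjI allI impI)
    show "0 < \<epsilon>" by (rule eps)
    fix u z0
    assume u: "smooth_fun At u" and z0b: "z0 \<in> ball y r"
      and sol: "solves_on c \<alpha> f \<mu> u"
      and eu: "exp (- u (cinv c z0)) \<le> \<epsilon>" and w: "exp (- u (cinv c z0)) * gradX u (cinv c z0) \<le> \<theta>\<^sup>2"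
      and max: "\<forall>x. traceX \<alpha> f u x * exp (K * (exp (- u x) * gradX u x))
       \<le> traceX \<alpha> f u (cinv c z0) * exp (K * (exp (- u (cinv c z0)) * gradX u (cinv c z0)))"
    have z0: "z0 \<in> cball y r" "z0 \<in> crange c" using z0b ball by auto
    define lam where "lam = exp (u (cinv c z0))"
    have lam_inv: "1 / lam \<le> \<epsilon>" using eu by (simp add: lam_def exp_minus inverse_eq_divide)
    have lam0: "lam > 0" by (simp add: lam_def)
    have "1 / lam \<le> 1" using lam_inv eps by linarith
    then have lam1: "lam \<ge> 1" using lam0 by simp
    have small: "C / lam \<le> \<theta>" if "C \<le> \<bar>C1\<bar> + \<bar>C2\<bar>" for C
    proof -
      have "C / lam \<le> (\<bar>C1\<bar> + \<bar>C2\<bar>) * (1 / lam)" using that lam0 by (simp add: divide_right_mono)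
      also have "\<dots> \<le> (\<bar>C1\<bar> + \<bar>C2\<bar>) * \<epsilon>" using lam_inv by (intro mult_left_mono) auto
      also have "\<dots> \<le> \<theta>" by (rule epsC) auto
      finally show ?thesis .
    qed
    obtain P d where D: "diagonalizes P (G c z0) (g_prime G \<alpha> f u c z0) d"
      using simultaneous_diagonalization[OF G_pos[OF c z0(2)] hermitian_g_prime[OF u c z0(2)]] by blast
    \<comment> \<open>A frame orthonormal for the metric, scaled to be orthonormal for
      \<open>lam\<close> times the metric; the eigenvalues of $g'$ are divided by \<open>lam\<close>
      accordingly.\<close>
    define T where "T = (\<chi> i j. complex_of_real (1 / sqrt lam) * P $ i $ j)"
    define a where "a j = d j / lam" for j
    have sq: "complex_of_real (1 / sqrt lam) * complex_of_real (1 / sqrt lam) = of_real (1 / lam)"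
      using lam0 by (simp flip: of_real_mult)
    have TM: "(adjoint_mat T ** M ** T) $ k $ j = of_real (1 / lam) * (adjoint_mat P ** M ** P) $ k $ j" for M k j
      unfolding sq[symmetric] by (simp add: T_def adjoint_mat_def matrix_matrix_mult_def sum_distrib_left sum_distrib_right mult_ac)
    have T1: "adjoint_mat T ** (\<chi> k j. of_real lam * G c z0 $ k $ j) ** T = mat 1"
      unfolding vec_eq_iff TM sandwich_scale using D lam0 by (simp add: diagonalizes_def)
    have T2: "adjoint_mat T ** g_prime G \<alpha> f u c z0 ** T = diag_mat a"
      unfolding vec_eq_iff TM using D lam0 by (simp add: diagonalizes_def diag_mat_def a_def)
    obtain Qc where Q: "quad_metric z0 T Qc (crange c) (G c) lam B Bq t0" using coords[OF z0(1) lam1 T1] by blast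
    interpret QQ: quad_metric z0 T Qc "crange c" "G c" lam B Bq t0 by (rule Q)
    interpret BU: blown_up At G c z0 T Qc lam B Bq t0 \<alpha> K f \<mu> u a
      by unfold_locales (use c u f \<mu> \<alpha> Kpos T1 T2 sol in \<open>simp_all add: lam_def solves_on_def\<close>)
    note fr = tilde_frame[OF u c z0(2) D sol[unfolded solves_on_def, rule_format, OF z0(2), THEN conjunct2]]
    have tau: "(\<Sum>j\<in>UNIV. a j) - a m > 0" for m
    proof -
      have "(\<Sum>j\<in>UNIV. a j) - a m = (traceX \<alpha> f u (cinv c z0) - d m) / lam"
        using fr(1) by (simp add: a_def sum_divide_distrib[symmetric] diff_divide_distrib)
      then show ?thesis using fr(4)[of m] lam0 by simp
    qed
    have jb: "norm (loc c \<phi> z0) \<le> b \<and> norm (dz i (loc c \<phi>) z0) \<le> b \<and> norm (dz k (dz i (loc c \<phi>)) z0) \<le> b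
      \<and> norm (dzbar k (dz i (loc c \<phi>)) z0) \<le> b" if "\<phi> \<in> {f, lapX f, \<mu>}" for \<phi> i k
      using bb(2)[OF smF[OF that] z0(1), of i k] bbb[OF that] by linarith
    have "traceX \<alpha> f u (cinv c z0) \<le> max 1 (4 * c_8 (real CARD('n)) (2 * real CARD('n) * \<alpha>)) * lam"
    proof (rule BU.scaled_trace_bound[where b = b and \<theta> = \<theta>, OF n2 f(2) mc])
      show "real CARD('n) * (1 + Bq + real CARD('n)) * (1 + t0)\<^sup>2 * b / lam \<le> \<theta>"
        unfolding C1_def[symmetric] by (rule small) linarith
      show "(real CARD('n) * (real CARD('n) * (real CARD('n) * B * Bq + (real CARD('n) * real CARD('n)) * B + Bq * B * Bq + Bq * real CARD('n) * B)) * t0^4) / lam \<le> \<theta>"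
        unfolding C2_def[symmetric] by (rule small) linarith
      show "exp (- u (cinv c z0)) * gradX u (cinv c z0) \<le> \<theta>\<^sup>2" by (rule w)
    qed (use jb tau max in blast)+
    then show "traceX \<alpha> f u (cinv c z0) \<le> max 1 (4 * c_8 (real CARD('n)) (2 * real CARD('n) * \<alpha>)) * exp (u (cinv c z0))"
      by (simp only: lam_def)
  qed
qed

end

section \<open>From the maximum point to the whole manifold\<close>

context kaehler_manifold
begin

lemma compact_X: "compact (UNIV :: 'a set)"
  using X by (simp add: compact_kaehler_manifold_def)

lemma bounded_continuous:
  fixes \<phi> :: "'a \<Rightarrow> real"
  assumes "continuous_on UNIV \<phi>"
  shows "\<exists>M. \<forall>x. \<bar>\<phi> x\<bar> \<le> M" "\<bar>\<phi> x\<bar> \<le> sup_norm \<phi>"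
proof -
  have "compact (range \<phi>)" using compact_continuous_image[OF assms compact_X] .
  then obtain M where M: "\<And>y. y \<in> range \<phi> \<Longrightarrow> norm y \<le> M" using compact_imp_bounded bounded_iff by metis
  then have M': "\<And>x. \<bar>\<phi> x\<bar> \<le> M" by simp
  then show "\<exists>M. \<forall>x. \<bar>\<phi> x\<bar> \<le> M" by blast
  show "\<bar>\<phi> x\<bar> \<le> sup_norm \<phi>" unfolding sup_norm_def
    by (rule cSUP_upper) (auto intro!: bdd_aboveI2[where M = M] M')
qed

lemma continuous_traceX:
  assumes "smooth_fun At u" "smooth_fun At f"
  shows "continuous_on UNIV (traceX \<alpha> f u)"
  unfolding traceX_def[abs_def] using assms
  by (intro continuous_intros smooth_fun_continuous smooth_lapX)

text \<open>The order of the quantifiers matters: \<open>K\<close>, \<theta> and \<open>M\<close>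
  are fixed before f and \<mu>, and only \<epsilon> may depend on these. The factor e^{u(x_0)} from
  the maximum point is estimated by the sup norm of u, and the weight of the test function stays
  between 1 and e^K.\<close>

lemma trace_bound_global:
  assumes n2: "CARD('n) \<ge> 2" and \<alpha>: "\<alpha> > 0"
  obtains K \<theta> M where "K > 0" "0 < \<theta>" "\<theta> \<le> 1 / 8" "4 * \<alpha> * \<theta>\<^sup>2 \<le> 1 / 2" "M > 0"
    "\<And>f \<mu>. smooth_fun At f \<Longrightarrow> (\<And>x. 0 \<le> f x) \<Longrightarrow> smooth_fun At \<mu> \<Longrightarrow>
      \<exists>\<epsilon>>0. \<forall>u. smooth_fun At u \<longrightarrow>
        (\<forall>c\<in>At. solves_on c \<alpha> f \<mu> u) \<longrightarrow>
        (\<forall>x. exp (- u x) \<le> \<epsilon>) \<longrightarrow> (\<forall>x. exp (- u x) * gradX u x \<le> \<theta>\<^sup>2) \<longrightarrow>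
        (\<forall>x. traceX \<alpha> f u x \<le> M * exp (sup_norm u + K))"
proof -
  have n1: "real CARD('n) \<ge> 1" by simp
  obtain K \<theta> where mc: "maximum_constants (real CARD('n)) \<alpha> K \<theta>"
    using maximum_principle_constants[OF n1 \<alpha>] by blast
  note K = maximum_constantsD(1)[OF mc] and th = maximum_constantsD(2-3)[OF mc] and th2 = maximum_constantsD(8)[OF mc]
  define M where "M = max 1 (4 * c_8 (real CARD('n)) (2 * real CARD('n) * \<alpha>))"
  have M: "M > 0" by (simp add: M_def)
  obtain D where D0: "finite D \<and> (\<forall>(c, y, r)\<in>D. c \<in> At \<and> r > 0 \<and> cball y r \<subseteq> crange c) \<and>
     (\<forall>x. \<exists>(c, y, r)\<in>D. \<exists>z\<in>ball y r. cinv c z = x)" using finite_pieces ..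
  have Df: "finite D" and D3: "\<And>x. \<exists>(c, y, r)\<in>D. \<exists>z\<in>ball y r. cinv c z = x" using D0 by blast+
  have D: "c \<in> At \<and> r > 0 \<and> cball y r \<subseteq> crange c" if "(c, y, r) \<in> D" for c y r
    using D0 that by blast
  have main: "\<exists>\<epsilon>>0. \<forall>u. smooth_fun At u \<longrightarrow>
        (\<forall>c\<in>At. solves_on c \<alpha> f \<mu> u) \<longrightarrow>
        (\<forall>x. exp (- u x) \<le> \<epsilon>) \<longrightarrow> (\<forall>x. exp (- u x) * gradX u x \<le> \<theta>\<^sup>2) \<longrightarrow>
        (\<forall>x. traceX \<alpha> f u x \<le> M * exp (sup_norm u + K))"
    if f: "smooth_fun At f" "\<And>x. 0 \<le> f x" and \<mu>: "smooth_fun At \<mu>" for f \<mu>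
  proof -
    define good where "good d \<epsilon> \<longleftrightarrow> (\<forall>u. \<forall>z0\<in>ball (fst (snd d)) (snd (snd d)). smooth_fun At u \<longrightarrow>
     solves_on (fst d) \<alpha> f \<mu> u \<longrightarrow>
     exp (- u (cinv (fst d) z0)) \<le> \<epsilon> \<longrightarrow> exp (- u (cinv (fst d) z0)) * gradX u (cinv (fst d) z0) \<le> \<theta>\<^sup>2 \<longrightarrow>
     (\<forall>x. traceX \<alpha> f u x * exp (K * (exp (- u x) * gradX u x))
       \<le> traceX \<alpha> f u (cinv (fst d) z0) * exp (K * (exp (- u (cinv (fst d) z0)) * gradX u (cinv (fst d) z0)))) \<longrightarrow>
     traceX \<alpha> f u (cinv (fst d) z0) \<le> M * exp (u (cinv (fst d) z0)))" for d :: "('a, 'n) chart \<times> (complex^'n) \<times> real" and \<epsilon>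
    have "\<exists>\<epsilon>>0. good d \<epsilon>" if d: "d \<in> D" for d
    proof -
      obtain c y r where dd: "d = (c, y, r)" by (metis prod_cases3)
      have c: "c \<in> At" "cball y r \<subseteq> crange c" using D[OF d[unfolded dd]] by auto
      show ?thesis
        using trace_at_max_local[OF c n2 \<alpha> mc f \<mu>, folded M_def] unfolding good_def dd fst_conv snd_conv by blast
    qed
    then obtain e where e: "\<And>d. d \<in> D \<Longrightarrow> e d > 0 \<and> good d (e d)" by metis
    show ?thesis
    proof (intro exI[of _ "Min (insert 1 (e ` D))"] conjI allI impI)
      show "0 < Min (insert 1 (e ` D))" using Df e by auto
      fix u x
      assume u: "smooth_fun At u"
        and sol: "\<forall>c\<in>At. solves_on c \<alpha> f \<mu> u"
        and eu: "\<forall>x. exp (- u x) \<le> Min (insert 1 (e ` D))" and w: "\<forall>x. exp (- u x) * gradX u x \<le> \<theta>\<^sup>2"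
      define \<Phi> where "\<Phi> x = traceX \<alpha> f u x * exp (K * (exp (- u x) * gradX u x))" for x
      have "continuous_on UNIV \<Phi>" unfolding \<Phi>_def[abs_def]
        by (intro continuous_intros continuous_traceX[OF u f(1)] continuous_gradX[OF u] smooth_fun_continuous[OF u])
      then obtain x0 where mx: "\<And>x. \<Phi> x \<le> \<Phi> x0"
        using continuous_attains_sup[OF compact_X] by auto
      obtain c y r z0 where d: "(c, y, r) \<in> D" "z0 \<in> ball y r" "cinv c z0 = x0" using D3[of x0] by auto
      have "e (c, y, r) \<in> insert 1 (e ` D)" using d(1) by blast
      then have "Min (insert 1 (e ` D)) \<le> e (c, y, r)" using Df by (intro Min_le) auto
      then have e0: "exp (- u x0) \<le> e (c, y, r)" using eu order_trans by blast
      have t0: "traceX \<alpha> f u x0 \<le> M * exp (u x0)"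
        using e[OF d(1)] u sol D[OF d(1)] d(2) e0 w mx unfolding good_def fst_conv snd_conv d(3)[symmetric] \<Phi>_def by blast
      have g0: "gradX u x \<ge> 0" for x
        using grad_bounds(1)[OF u u chart_at(1) cinv_simps(4)[OF chart_at]] by (simp add: gradX_def)
      have th1: "\<theta>\<^sup>2 \<le> 1" using th(1,2) by (simp add: power_le_one)
      have ux: "u x0 \<le> sup_norm u" using bounded_continuous(2)[OF smooth_fun_continuous[OF u], of x0] by linarith
      \<comment> \<open>Multiplication by an exponential that is at least 1 increases nonnegative
        values only, hence the maximum with zero.\<close>
      have "traceX \<alpha> f u x \<le> max 0 (\<Phi> x)"
      proof (cases "traceX \<alpha> f u x \<ge> 0")
        case True
        have "traceX \<alpha> f u x * 1 \<le> \<Phi> x" unfolding \<Phi>_def using True K g0[of x] by (intro mult_left_mono) auto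
        then show ?thesis by simp
      qed simp
      also have "\<dots> \<le> max 0 (\<Phi> x0)" using mx[of x] by simp
      also have "\<Phi> x0 \<le> (M * exp (u x0)) * exp (K * (exp (- u x0) * gradX u x0))"
        unfolding \<Phi>_def by (intro mult_right_mono t0) auto
      also have "\<dots> \<le> (M * exp (sup_norm u)) * exp (K * 1)"
        using M ux K order_trans[OF w[rule_format, of x0] th1] by (intro mult_mono mult_left_mono) auto
      also have "\<dots> = M * exp (sup_norm u + K)" by (simp add: exp_add)
      finally show "traceX \<alpha> f u x \<le> M * exp (sup_norm u + K)" using M by (simp add: max_def)
    qed
  qed
  show ?thesis by (rule that[OF K th th2 M main])
qed

end

theorem theorem3:
  fixes At :: "('a::t2_space, 'n::finite) chart set"
    and G :: "('a, 'n) metric"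
    and \<alpha> :: real
  assumes X: "compact_kaehler_manifold At G"
    and n: "CARD('n) \<ge> 2"
    and \<alpha>: "\<alpha> > 0"
  shows "\<exists>C :: real \<Rightarrow> real \<Rightarrow> real \<Rightarrow> real \<Rightarrow> real \<Rightarrow> real.
    (\<forall>r s p q A. 0 < C r s p q A) \<and>
    (\<forall>f \<mu>. smooth_fun At f \<longrightarrow> (\<forall>x. 0 \<le> f x) \<longrightarrow>
       smooth_fun At \<mu> \<longrightarrow> (\<integral>x. \<mu> x \<partial>volume At G) = 0 \<longrightarrow>
       (\<forall>\<delta>. 0 < \<delta> \<and> \<delta> < 1 \<longrightarrow>
          (\<exists>A\<^sub>\<delta>. 0 < A\<^sub>\<delta> \<and> A\<^sub>\<delta> < 1 \<and>
            (\<forall>A u. 0 < A \<and> A \<le> A\<^sub>\<delta> \<and> A_solution At G \<alpha> f \<mu> A u \<longrightarrow>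
              (\<forall>c\<in>At. \<forall>z\<in>crange c. exp (- u (cinv c z)) * grad_sq G c u z \<le> \<delta>)))) \<longrightarrow>
       (\<exists>A\<^sub>0. 0 < A\<^sub>0 \<and> A\<^sub>0 < 1 \<and>
         (\<forall>A u. 0 < A \<and> A \<le> A\<^sub>0 \<and> A_solution At G \<alpha> f \<mu> A u \<longrightarrow>
           (let K = C (sup_norm u) (grad_sup_norm At G u) (C2_norm At G f) (C2_norm At G \<mu>) A in
             \<forall>c\<in>At. \<forall>z\<in>crange c. \<forall>v.
               1 / K * herm_form (G c z) v \<le> herm_form (g_tilde G \<alpha> f u c z) v \<and>
               herm_form (g_tilde G \<alpha> f u c z) v \<le> K * herm_form (G c z) v))))"
proof -
  interpret kaehler_manifold At G by unfold_locales (rule X)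
  define n where "n = real CARD('n)"
  obtain K \<theta> M where K: "K > 0" and th: "0 < \<theta>" "\<theta> \<le> 1 / 8" "4 * \<alpha> * \<theta>\<^sup>2 \<le> 1 / 2" and M: "M > 0"
    and tr: "\<And>f \<mu>. smooth_fun At f \<Longrightarrow> (\<And>x. 0 \<le> f x) \<Longrightarrow> smooth_fun At \<mu> \<Longrightarrow>
      \<exists>\<epsilon>>0. \<forall>u. smooth_fun At u \<longrightarrow>
        (\<forall>c\<in>At. solves_on c \<alpha> f \<mu> u) \<longrightarrow>
        (\<forall>x. exp (- u x) \<le> \<epsilon>) \<longrightarrow> (\<forall>x. exp (- u x) * gradX u x \<le> \<theta>\<^sup>2) \<longrightarrow>
        (\<forall>x. traceX \<alpha> f u x \<le> M * exp (sup_norm u + K))"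
    using trace_bound_global[OF assms(2) \<alpha>] by metis
  have th1: "\<theta>\<^sup>2 < 1" "\<theta>\<^sup>2 > 0" using th(1,2) by (auto simp: power_less_one_iff)
  define S1 where "S1 r = M * exp (r + K)" for r
  have S1: "S1 r > 0" for r using M by (simp add: S1_def)
  \<comment> \<open>\<open>S1\<close> bounds the trace. The summand \<open>n\<close> serves the
    upper bound of \<open>tilde_bounds\<close>; the summand with the exponential serves the lower
    one, where the right-hand side of the equation is at least a quarter of
    \<open>exp (- 2 * r)\<close>.\<close>
  define C where "C r = (n + 4 * exp (2 * r)) * S1 r" for r
  have n0: "n \<ge> 0" by (simp add: n_def)
  have C: "C r > 0" for r unfolding C_def using S1[of r] n0 by (intro mult_pos_pos add_nonneg_pos) auto
  have C1: "1 / C r \<le> exp (- 2 * r) / 4 / S1 r" for r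
  proof -
    have "(4 * exp (2 * r)) * S1 r \<le> C r" unfolding C_def using S1[of r] n0 by (intro mult_right_mono) auto
    then have "1 / C r \<le> 1 / (4 * exp (2 * r) * S1 r)" using S1[of r] by (intro divide_left_mono mult_pos_pos C) auto
    also have "\<dots> = exp (- 2 * r) / 4 / S1 r" by (simp add: exp_minus field_simps)
    finally show ?thesis .
  qed
  have C2: "n * S1 r \<le> C r" for r unfolding C_def using S1[of r] by (intro mult_right_mono) auto
  show ?thesis
  proof (intro exI[of _ "\<lambda>r s p q A. C r"] conjI allI impI, goal_cases)
    case 1 show ?case by (rule C)
  next
    case (2 f \<mu>)
    then have f: "smooth_fun At f" "\<And>x. 0 \<le> f x" and \<mu>: "smooth_fun At \<mu>" and
      H: "\<And>\<delta>. 0 < \<delta> \<Longrightarrow> \<delta> < 1 \<Longrightarrow> \<exists>A\<^sub>\<delta>. 0 < A\<^sub>\<delta> \<and> A\<^sub>\<delta> < 1 \<and>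
            (\<forall>A u. 0 < A \<and> A \<le> A\<^sub>\<delta> \<and> A_solution At G \<alpha> f \<mu> A u \<longrightarrow>
              (\<forall>c\<in>At. \<forall>z\<in>crange c. exp (- u (cinv c z)) * grad_sq G c u z \<le> \<delta>))"
      by blast+
    obtain m1 where m1: "\<And>x. \<bar>\<mu> x\<bar> \<le> m1" using bounded_continuous(1)[OF smooth_fun_continuous[OF \<mu>]] by blast
    obtain m2 where m2: "\<And>x. \<bar>lapX f x\<bar> \<le> m2" using bounded_continuous(1)[OF smooth_fun_continuous[OF smooth_lapX[OF f(1)]]] by blast
    obtain m3 where m3: "\<And>x. \<bar>gradX f x\<bar> \<le> m3" using bounded_continuous(1)[OF continuous_gradX[OF f(1)]] by blast
    define m where "m = max m1 (max m2 m3)"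
    have m: "\<bar>\<mu> x\<bar> \<le> m" "\<bar>lapX f x\<bar> \<le> m" "gradX f x \<le> m" for x
      using m1[of x] m2[of x] m3[of x] by (auto simp: m_def le_max_iff_disj)
    have m0: "m \<ge> 0" using m(1)[of undefined] by linarith
    obtain \<epsilon>1 where e1: "\<epsilon>1 > 0" "\<And>u x. smooth_fun At u \<Longrightarrow>
        (\<forall>c\<in>At. solves_on c \<alpha> f \<mu> u) \<Longrightarrow>
        (\<forall>x. exp (- u x) \<le> \<epsilon>1) \<Longrightarrow> (\<forall>x. exp (- u x) * gradX u x \<le> \<theta>\<^sup>2) \<Longrightarrow>
        traceX \<alpha> f u x \<le> S1 (sup_norm u)"
      using tr[OF f \<mu>] unfolding S1_def by blast
    \<comment> \<open>The part of the right-hand side that \<open>rhs_lower\<close> has to absorb;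
      it depends on f and \<mu> and therefore influences only \<epsilon> and, through it, the
      threshold for \<open>A\<close>.\<close>
    define R where "R = 2 * real CARD('n) * \<alpha> * (m + real CARD('n) * (2 * m + 1))"
    have R: "R \<ge> 0" using m0 \<alpha> by (simp add: R_def)
    define \<epsilon> where "\<epsilon> = min \<epsilon>1 (min 1 (1 / (4 * (R + 1))))"
    have e: "\<epsilon> > 0" "\<epsilon> \<le> \<epsilon>1" "\<epsilon> \<le> 1" "\<epsilon> \<le> 1 / (4 * (R + 1))" using e1(1) R by (simp_all add: \<epsilon>_def min.coboundedI2)
    have eR: "\<epsilon> * R \<le> 1 / 4"
    proof -
      have "\<epsilon> * R \<le> 1 / (4 * (R + 1)) * (R + 1)" using e R by (intro mult_mono) auto
      also have "\<dots> = 1 / 4" using R by (simp add: field_simps)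
      finally show ?thesis .
    qed
    have sol: "smooth_fun At u" "(\<integral>x. exp (- (4 * (real CARD('n) - 1)) * u x) \<partial>volume At G) powr (1 / (4 * (real CARD('n) - 1))) = A"
      "\<forall>c\<in>At. solves_on c \<alpha> f \<mu> u" if "A_solution At G \<alpha> f \<mu> A u" for A u
      using that unfolding A_solution_def Let_def solves_on_def by blast+
    have g0: "4 * (real CARD('n) - 1) > 0" using assms(2) by simp
    have "\<exists>A0>0. \<forall>A u. 0 < A \<and> A \<le> A0 \<and> A_solution At G \<alpha> f \<mu> A u \<longrightarrow> (\<forall>x. exp (- u x) \<le> \<epsilon>)"
    proof (rule uniform_smallness[OF g0 _ _ _ e(1)])
      show "smooth_fun At u" if "A_solution At G \<alpha> f \<mu> A u" for A u by (rule sol(1)[OF that])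
      show "(\<integral>x. exp (- (4 * (real CARD('n) - 1)) * u x) \<partial>volume At G) powr (1 / (4 * (real CARD('n) - 1))) = A"
        if "A_solution At G \<alpha> f \<mu> A u" for A u by (rule sol(2)[OF that])
    qed (rule H)
    then obtain A1 where A1: "A1 > 0" "\<And>A u x. 0 < A \<Longrightarrow> A \<le> A1 \<Longrightarrow> A_solution At G \<alpha> f \<mu> A u \<Longrightarrow> exp (- u x) \<le> \<epsilon>"
      by blast
    \<comment> \<open>The gradient hypothesis is used once more, with the square of the \<theta>
      fixed above as \<delta>.\<close>
    obtain A2 where A2: "0 < A2" "A2 < 1" "\<And>A u c z. 0 < A \<Longrightarrow> A \<le> A2 \<Longrightarrow> A_solution At G \<alpha> f \<mu> A u \<Longrightarrow> c \<in> At \<Longrightarrow> z \<in> crange c \<Longrightarrow>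
       exp (- u (cinv c z)) * grad_sq G c u z \<le> \<theta>\<^sup>2"
      using H[OF th1(2,1)] by blast
    show ?case
    proof (intro exI[of _ "min A1 A2"] conjI allI impI)
      show "0 < min A1 A2" "min A1 A2 < 1" using A1 A2 by auto
      fix A u assume "0 < A \<and> A \<le> min A1 A2 \<and> A_solution At G \<alpha> f \<mu> A u"
      then have A: "0 < A" "A \<le> A1" "A \<le> A2" and as: "A_solution At G \<alpha> f \<mu> A u" by auto
      note u = sol(1)[OF as]
      have small: "exp (- u x) \<le> \<epsilon>" for x by (rule A1(2)[OF A(1,2) as])
      have w: "exp (- u x) * gradX u x \<le> \<theta>\<^sup>2" for x
        using A2(3)[OF A(1,3) as chart_at(1) cinv_simps(4)[OF chart_at], of x]
        by (simp add: gradX_def cinv_simps(1)[OF chart_at])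
      have T: "traceX \<alpha> f u x \<le> S1 (sup_norm u)" for x
        by (rule e1(2)[OF u sol(3)[OF as]]) (use small e(2) order_trans w in blast)+
      show "let K = C (sup_norm u) in \<forall>c\<in>At. \<forall>z\<in>crange c. \<forall>v.
               1 / K * herm_form (G c z) v \<le> herm_form (g_tilde G \<alpha> f u c z) v \<and>
               herm_form (g_tilde G \<alpha> f u c z) v \<le> K * herm_form (G c z) v"
        unfolding Let_def
      proof (intro ballI allI)
        fix c z v assume c: "c \<in> At" and z: "z \<in> crange c"
        let ?x = "cinv c z" and ?r = "sup_norm u"
        define \<psi> where "\<psi> = equation_rhs G \<alpha> f \<mu> u c z"
        have "exp (2 * u ?x) / 4 \<le> \<psi>" unfolding \<psi>_def
        proof (rule rhs_lower[OF u f(1) c z assms(2) \<alpha> f(2) m])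
          show "exp (- u ?x) \<le> 1" using small[of ?x] e(3) by linarith
          show "exp (- u ?x) * gradX u ?x \<le> 1" using w[of ?x] th1 by linarith
          have "4 * \<alpha> * (exp (- u ?x) * gradX u ?x) \<le> 4 * \<alpha> * \<theta>\<^sup>2" using w[of ?x] \<alpha> by (intro mult_left_mono) auto
          then show "4 * \<alpha> * (exp (- u ?x) * gradX u ?x) \<le> 1 / 2" using th(3) by linarith
          have "exp (- u ?x) * R \<le> \<epsilon> * R" using small R by (intro mult_right_mono) auto
          then show "exp (- u ?x) * (2 * real CARD('n) * \<alpha> * (m + real CARD('n) * (2 * m + 1))) \<le> 1 / 4"
            unfolding R_def[symmetric] using eR by linarith
        qed
        moreover have "- 2 * ?r \<le> 2 * u ?x"
          using bounded_continuous(2)[OF smooth_fun_continuous[OF u], of ?x] by linarith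
        ultimately have psi: "exp (- 2 * ?r) / 4 \<le> \<psi>" by (meson divide_right_mono exp_le_cancel_iff order_trans zero_le_numeral)
        then have psi0: "\<psi> > 0" using exp_gt_zero[of "- 2 * ?r"] by linarith
        have eq: "sigma2 (G c z) (g_prime G \<alpha> f u c z) = \<psi>" and pd: "positive_definite (g_tilde G \<alpha> f u c z)"
          using sol(3)[OF as] c z by (auto simp: \<psi>_def solves_on_def)
        note tb = tilde_bounds[OF u c z eq psi0 pd T, of v]
        have h0: "herm_form (G c z) v \<ge> 0"
          using G_pos[OF c z] by (cases "v = 0") (auto simp: positive_definite_def herm_form_def less_imp_le)
        have "1 / C ?r \<le> \<psi> / S1 ?r"
          using C1[of ?r] divide_right_mono[OF psi, of "S1 ?r"] S1[of ?r] by linarith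
        then have "1 / C ?r * herm_form (G c z) v \<le> \<psi> / S1 ?r * herm_form (G c z) v" by (rule mult_right_mono[OF _ h0])
        moreover have "real CARD('n) * S1 ?r * herm_form (G c z) v \<le> C ?r * herm_form (G c z) v"
          by (rule mult_right_mono[OF C2[of ?r, unfolded n_def] h0])
        ultimately show "1 / C ?r * herm_form (G c z) v \<le> herm_form (g_tilde G \<alpha> f u c z) v \<and>
               herm_form (g_tilde G \<alpha> f u c z) v \<le> C ?r * herm_form (G c z) v"
          using tb by linarith
      qed
    qed
  qed
qed

end
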